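(* Let $(S,d_S)$ be a compact metric space, $b>0$, and let $E=[0,1]\times S\times[0,b]$ with metric $d_E((u,y,r),(u',y',r'))=\max\{|u-u'|^{1/2},d_S(y,y')^{1/2},|r-r'|^{1/2}\}$. Let $(X_{t,T})$ be an $S$-valued locally stationary process with auxiliary process $(X_t(u))$, admitting the representations described in the context, with $\delta_0(m)\to0$ as $m\to\infty$ for both processes. Suppose that, for $f_{y,r}\in\Gamma_\varphi$, $$\sup_T\sum_{j=0}^\infty\sup_{t\in[T]}\theta^{X}_t(j)<\infty\quad\text{and}\quad \sup_u\sum_{j=0}^\infty\sup_{t\in\mathbb Z}\theta_t^{X(u)}(j)<\infty,\qquad \theta^W_t(j)=\sup_{m\ge1}\|P_{t-j}(f_{y,r}(W_{m,t}))\|_{\mathbb R,2},$$ and that one of the following holds: (a) $N(E,d_E,\epsilon)\sim\epsilon^{-\alpha}$ and, for some $p>\alpha$ and all $T\ge1$, $y\in S$, $r\in[0,b]$, $\sum_{j=0}^\infty j\sup_{t\in[T]}\|P_{t-j}(f_{y,r}(X_{t,T}))\|_{\mathbb R,p}<\infty$; or (b) $N(E,d_E,\epsilon)\sim e^{\epsilon^{-\alpha}}$ for some $\alpha<2$ and, for all $T\ge1$, $y\in S$, $r\in[0,b]$, $\sum_{j=0}^\infty j\sup_{t\in[T]}\operatorname{ess\,sup}\|P_{t-j}(f_{y,r}(X_{t,T}))\mid\mathcal G_{t-j-1}\|_\psi<\infty$ with $\psi(x)=e^{x^2}-1$. Let $\zeta$ be the zero-mean Gaussian process on $E$ with almost surely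 continuous sample paths and covariance $\mathrm{cov}(\zeta(u_1,y_1,r_1),\zeta(u_2,y_2,r_2))=\int_0^{u_1\wedge u_2}\sigma_\eta(y_1,r_1,y_2,r_2)d\eta$, where $\sigma_\eta(y_1,r_1,y_2,r_2)=\sum_{h\in\mathbb Z}\mathrm{cov}(f_{y_1,r_1}(X_0(\eta)),f_{y_2,r_2}(X_h(\eta)))$. Then $\zeta$ can be represented (in law) as $$\zeta(u,y,r)=\sum_{\ell=1}^\infty\int_0^u\tilde g_\ell(\eta,y,r)\,d\mathbb B_\ell(\eta),$$ where $\{\mathbb B_\ell\}_{\ell\in\mathbb N}$ is a sequence of independent standard Brownian motions and the functions $\tilde g_\ell$ are such that $$\sigma_\eta(y_1,r_1,y_2,r_2)=\sum_{\ell=1}^\infty\tilde g_\ell(\eta,y_1,r_1)\,\tilde g_\ell(\eta,y_2,r_2).$$ Under stationarity this reduces to $\zeta(u,y,r)=\sum_{\ell=1}^\infty\tilde g_\ell(y,r)\,\mathbb B_\ell(u)$.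
   Context: Local stationarity: $(X_{t,T})$ is a triangular array (sample $t=1,\dots,T$, extended by $X_{t,T}=X_{1,T}$ for $t\le0$ and $X_{t,T}=X_{T,T}$ for $t\ge T$) of $S$-valued random variables, and it is locally stationary if there is an $S$-valued process $(X_t(u):t\in\mathbb Z,u\in[0,1])$ (the auxiliary process), stationary in $t$ for each fixed $u$, such that $\mathbb E[d_S(X_{t,T},X_t(t/T))\wedge1]=O(T^{-1})$ and $\mathbb E[d_S(X_t(u),X_t(v))\wedge1]=O(|u-v|)$, uniformly in $t=1,\dots,T$ and $u,v\in[0,1]$. "Under stationarity" means that $X_{t,T}=X_t$ for a stationary process $(X_t)$ for all $t,T$, so that $X_t(u)=X_t$ for all $u$. Representations: $X_{t,T}=F(t,T,\mathfrak g_t)$ and $X_t(u)=\ddot F(u,\mathfrak g_t)$, where $\mathfrak g_t=(\varepsilon_t,\varepsilon_{t-1},\dots)$ for an iid sequence $(\varepsilon_t)_{t\in\mathbb Z}$ of random elements of a measurable space $\mathfrak G$, and $F:\mathbb Z\times\mathbb N\times\mathfrak G^\infty\to S$, $\ddot F:[0,1]\times\mathfrak G^\infty\to S$ are measurable. Coupling: let $(\varepsilon'_t)$ be an independent copy of $(\varepsilon_t)$. For $W$ either $(X_{t,T})$ or $(X_t(u))$, $W_{m,t}$ is obtained by replacing $\mathfrak g_t$ by $(\varepsilon_t,\dots,\varepsilon_{t-m+1},\varepsilon'_{t-m},\varepsilon'_{t-m-1},\dots)$. $\delta_0(m)=\sup\mathbb E[d_S(W_t,W_{m,t})\wedge1]$,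 supremum over $t$ (and over $T$, respectively $u$). $\mathcal G_t=\sigma(\varepsilon_s:s\le t)$, $P_j(Y)=\mathbb E[Y|\mathcal G_j]-\mathbb E[Y|\mathcal G_{j-1}]$, $\|Y\|_{\mathbb R,p}=(\mathbb E|Y|^p)^{1/p}$, $[T]=\{1,\dots,T\}$. In $\theta^X_t(j)$, $W_{m,t}$ is the coupled version of $X_{t,T}$; in $\theta^{X(u)}_t(j)$ that of $X_t(u)$. $\Gamma_\varphi=\{f_{y,r}:y\in S,r>0\}$, $f_{y,r}(x)=e^{-r d_S(x,y)}$ (same formula for $r=0$). $N(E,d_E,\epsilon)$ is the smallest number of open $d_E$-balls of radius $\epsilon$ covering $E$; $\sim$ describes its order of growth as $\epsilon\downarrow0$. For a $\sigma$-algebra $\tilde{\mathcal F}$, $\|Y\mid\tilde{\mathcal F}\|_\psi=\inf\{k\in L^0(\tilde{\mathcal F}),k>0\text{ a.s.}:\mathbb E[\psi(|Y|/k)\mid\tilde{\mathcal F}]\le1\}$, and $\operatorname{ess\,sup}(Y)=\inf\{M:\mathbb P(Y>M)=0\}$. *)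

theory Defs
  imports "HOL-Probability.Probability" "HOL-Library.Landau_Symbols"
begin

section \<open>Processes driven by an iid sequence\<close>

definition stationary_process :: "'w measure \<Rightarrow> (int \<Rightarrow> 'w \<Rightarrow> 's::topological_space) \<Rightarrow> bool" where
  "stationary_process M X \<longleftrightarrow>
     (\<forall>t. X t \<in> M \<rightarrow>\<^sub>M borel) \<and>
     (\<forall>h. distr M (Pi\<^sub>M UNIV (\<lambda>_. borel)) (\<lambda>\<omega> t. X (t + h) \<omega>) =
          distr M (Pi\<^sub>M UNIV (\<lambda>_. borel)) (\<lambda>\<omega> t. X t \<omega>))"

text \<open>\<open>X t T\<close> is the array, with sample \<open>t = 1, \<dots>, T\<close> for \<open>T \<ge> 1\<close>, and \<open>Y u t\<close> is the
  auxiliary process at rescaled time \<open>u\<close> (rescaled time is the first argument). The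
  \<open>O\<close>-terms are uniform: \<open>C\<close> does not depend on \<open>t, T, u, v\<close>.\<close>

definition locally_stationary ::
    "'w measure \<Rightarrow> (int \<Rightarrow> nat \<Rightarrow> 'w \<Rightarrow> 's::metric_space) \<Rightarrow> (real \<Rightarrow> int \<Rightarrow> 'w \<Rightarrow> 's) \<Rightarrow> bool" where
  "locally_stationary M X Y \<longleftrightarrow>
     (\<forall>T\<ge>1. \<forall>t. X t T \<in> M \<rightarrow>\<^sub>M borel) \<and>
     (\<forall>T\<ge>1. (\<forall>t\<le>0. X t T = X 1 T) \<and> (\<forall>t\<ge>int T. X t T = X (int T) T)) \<and>
     (\<forall>u\<in>{0..1}. stationary_process M (Y u)) \<and>
     (\<exists>C. \<forall>T\<ge>1. \<forall>t\<in>{1..int T}.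
        (\<integral>\<omega>. min (dist (X t T \<omega>) (Y (of_int t / real T) t \<omega>)) 1 \<partial>M) \<le> C / real T) \<and>
     (\<exists>C. \<forall>T\<ge>1. \<forall>t\<in>{1..int T}. \<forall>u\<in>{0..1}. \<forall>v\<in>{0..1}.
        (\<integral>\<omega>. min (dist (Y u t \<omega>) (Y v t \<omega>)) 1 \<partial>M) \<le> C * \<bar>u - v\<bar>)"

definition under_stationarity ::
    "'w measure \<Rightarrow> (int \<Rightarrow> nat \<Rightarrow> 'w \<Rightarrow> 's::metric_space) \<Rightarrow> (real \<Rightarrow> int \<Rightarrow> 'w \<Rightarrow> 's) \<Rightarrow> bool" where
  "under_stationarity M X Y \<longleftrightarrow> (\<exists>X0. stationary_process M X0 \<and>
     (\<forall>T\<ge>1. \<forall>t\<in>{1..int T}. AE \<omega> in M. X t T \<omega> = X0 t \<omega>) \<and>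
     (\<forall>u\<in>{0..1}. \<forall>t. AE \<omega> in M. Y u t \<omega> = X0 t \<omega>))"

definition iid_with_independent_copy ::
    "'w measure \<Rightarrow> 'g measure \<Rightarrow> (int \<Rightarrow> 'w \<Rightarrow> 'g) \<Rightarrow> (int \<Rightarrow> 'w \<Rightarrow> 'g) \<Rightarrow> bool" where
  "iid_with_independent_copy M G \<epsilon> \<epsilon>' \<longleftrightarrow>
     prob_space.indep_vars M (\<lambda>_. G) \<epsilon> UNIV \<and>
     (\<forall>t. distr M G (\<epsilon> t) = distr M G (\<epsilon> 0)) \<and>
     prob_space.indep_var M
       (Pi\<^sub>M UNIV (\<lambda>_. G)) (\<lambda>\<omega> t. \<epsilon> t \<omega>) (Pi\<^sub>M UNIV (\<lambda>_. G)) (\<lambda>\<omega> t. \<epsilon>' t \<omega>) \<and>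
     distr M (Pi\<^sub>M UNIV (\<lambda>_. G)) (\<lambda>\<omega> t. \<epsilon>' t \<omega>) =
       distr M (Pi\<^sub>M UNIV (\<lambda>_. G)) (\<lambda>\<omega> t. \<epsilon> t \<omega>)"

definition past :: "(int \<Rightarrow> 'w \<Rightarrow> 'g) \<Rightarrow> int \<Rightarrow> 'w \<Rightarrow> (nat \<Rightarrow> 'g)" where
  "past \<epsilon> t \<omega> = (\<lambda>k. \<epsilon> (t - int k) \<omega>)"

definition coupled_past ::
    "(int \<Rightarrow> 'w \<Rightarrow> 'g) \<Rightarrow> (int \<Rightarrow> 'w \<Rightarrow> 'g) \<Rightarrow> nat \<Rightarrow> int \<Rightarrow> 'w \<Rightarrow> (nat \<Rightarrow> 'g)" where
  "coupled_past \<epsilon> \<epsilon>' m t \<omega> = (\<lambda>k. if k < m then \<epsilon> (t - int k) \<omega> else \<epsilon>' (t - int k) \<omega>)"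

text \<open>The representation of the array is required for \<open>t \<in> [T]\<close> only, since it is incompatible
  with the constant extension of the array outside \<open>[T]\<close>.\<close>

definition has_representations ::
    "'w measure \<Rightarrow> 'g measure \<Rightarrow> (int \<Rightarrow> 'w \<Rightarrow> 'g) \<Rightarrow>
     (int \<Rightarrow> nat \<Rightarrow> 'w \<Rightarrow> 's::metric_space) \<Rightarrow> (int \<Rightarrow> nat \<Rightarrow> (nat \<Rightarrow> 'g) \<Rightarrow> 's) \<Rightarrow>
     (real \<Rightarrow> int \<Rightarrow> 'w \<Rightarrow> 's) \<Rightarrow> (real \<Rightarrow> (nat \<Rightarrow> 'g) \<Rightarrow> 's) \<Rightarrow> bool" where
  "has_representations M G \<epsilon> X F Y F' \<longleftrightarrow>
     (\<lambda>(t, T, x). F t T x) \<in>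
       (count_space UNIV \<Otimes>\<^sub>M count_space UNIV \<Otimes>\<^sub>M Pi\<^sub>M UNIV (\<lambda>_. G)) \<rightarrow>\<^sub>M borel \<and>
     (\<lambda>(u, x). F' u x) \<in> (restrict_space borel {0..1} \<Otimes>\<^sub>M Pi\<^sub>M UNIV (\<lambda>_. G)) \<rightarrow>\<^sub>M borel \<and>
     (\<forall>T\<ge>1. \<forall>t\<in>{1..int T}. AE \<omega> in M. X t T \<omega> = F t T (past \<epsilon> t \<omega>)) \<and>
     (\<forall>u\<in>{0..1}. \<forall>t. AE \<omega> in M. Y u t \<omega> = F' u (past \<epsilon> t \<omega>))"

definition delta0_array ::
    "'w measure \<Rightarrow> (int \<Rightarrow> 'w \<Rightarrow> 'g) \<Rightarrow> (int \<Rightarrow> 'w \<Rightarrow> 'g) \<Rightarrow>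
     (int \<Rightarrow> nat \<Rightarrow> 'w \<Rightarrow> 's::metric_space) \<Rightarrow> (int \<Rightarrow> nat \<Rightarrow> (nat \<Rightarrow> 'g) \<Rightarrow> 's) \<Rightarrow> nat \<Rightarrow> real" where
  "delta0_array M \<epsilon> \<epsilon>' X F m =
     (SUP (t, T)\<in>{(t, T). 1 \<le> T \<and> t \<in> {1..int T}}.
        \<integral>\<omega>. min (dist (X t T \<omega>) (F t T (coupled_past \<epsilon> \<epsilon>' m t \<omega>))) 1 \<partial>M)"

definition delta0_aux ::
    "'w measure \<Rightarrow> (int \<Rightarrow> 'w \<Rightarrow> 'g) \<Rightarrow> (int \<Rightarrow> 'w \<Rightarrow> 'g) \<Rightarrow>
     (real \<Rightarrow> int \<Rightarrow> 'w \<Rightarrow> 's::metric_space) \<Rightarrow> (real \<Rightarrow> (nat \<Rightarrow> 'g) \<Rightarrow> 's) \<Rightarrow> nat \<Rightarrow> real" where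
  "delta0_aux M \<epsilon> \<epsilon>' Y F' m =
     (SUP (t, u)\<in>UNIV \<times> {0..1}.
        \<integral>\<omega>. min (dist (Y u t \<omega>) (F' u (coupled_past \<epsilon> \<epsilon>' m t \<omega>))) 1 \<partial>M)"


section \<open>Projections and norms\<close>

definition history :: "'w measure \<Rightarrow> 'g measure \<Rightarrow> (int \<Rightarrow> 'w \<Rightarrow> 'g) \<Rightarrow> int \<Rightarrow> 'w measure" where
  "history M G \<epsilon> t = sigma (space M) {\<epsilon> s -` A \<inter> space M | s A. s \<le> t \<and> A \<in> sets G}"

definition proj :: "'w measure \<Rightarrow> 'g measure \<Rightarrow> (int \<Rightarrow> 'w \<Rightarrow> 'g) \<Rightarrow> int \<Rightarrow> ('w \<Rightarrow> real) \<Rightarrow> 'w \<Rightarrow> real" where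
  "proj M G \<epsilon> j V = (\<lambda>\<omega>. real_cond_exp M (history M G \<epsilon> j) V \<omega> -
                        real_cond_exp M (history M G \<epsilon> (j - 1)) V \<omega>)"

text \<open>Only applied to projections of bounded variables, for which the integral is finite.\<close>

definition Lp_norm :: "'w measure \<Rightarrow> real \<Rightarrow> ('w \<Rightarrow> real) \<Rightarrow> real" where
  "Lp_norm M p V = (\<integral>\<omega>. \<bar>V \<omega>\<bar> powr p \<partial>M) powr (1 / p)"

definition fyr :: "'s::metric_space \<Rightarrow> real \<Rightarrow> 's \<Rightarrow> real" where
  "fyr y r x = exp (- r * dist x y)"

text \<open>\<open>W m\<close> is the coupled version \<open>W\<^sub>m\<^sub>,\<^sub>t\<close> of the process at the fixed time \<open>t\<close>.\<close>

definition theta ::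
    "'w measure \<Rightarrow> 'g measure \<Rightarrow> (int \<Rightarrow> 'w \<Rightarrow> 'g) \<Rightarrow> 's::metric_space \<Rightarrow> real \<Rightarrow>
     int \<Rightarrow> (nat \<Rightarrow> 'w \<Rightarrow> 's) \<Rightarrow> nat \<Rightarrow> ennreal" where
  "theta M G \<epsilon> y r t W j =
     (SUP m\<in>{1..}. ennreal (Lp_norm M 2 (proj M G \<epsilon> (t - int j) (\<lambda>\<omega>. fyr y r (W m \<omega>)))))"

text \<open>The infimum of a family of random variables is taken in the lattice of \<open>F\<close>-measurable
  functions modulo null sets, i.e. it is an essential infimum. It is unique up to null sets,
  so that its essential supremum does not depend on the chosen version.\<close>

definition is_ess_inf :: "'w measure \<Rightarrow> 'w measure \<Rightarrow> ('w \<Rightarrow> ennreal) set \<Rightarrow> ('w \<Rightarrow> ennreal) \<Rightarrow> bool" where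
  "is_ess_inf M F K n \<longleftrightarrow>
     n \<in> borel_measurable F \<and> (\<forall>k\<in>K. AE \<omega> in M. n \<omega> \<le> k \<omega>) \<and>
     (\<forall>n'\<in>borel_measurable F. (\<forall>k\<in>K. AE \<omega> in M. n' \<omega> \<le> k \<omega>) \<longrightarrow> (AE \<omega> in M. n' \<omega> \<le> n \<omega>))"

definition cond_orlicz_norm ::
    "'w measure \<Rightarrow> 'w measure \<Rightarrow> (real \<Rightarrow> real) \<Rightarrow> ('w \<Rightarrow> real) \<Rightarrow> 'w \<Rightarrow> ennreal" where
  "cond_orlicz_norm M F \<psi> V = (SOME n. is_ess_inf M F
     {\<lambda>\<omega>. ennreal (k \<omega>) | k. k \<in> borel_measurable F \<and> (AE \<omega> in M. 0 < k \<omega>) \<and>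
        (AE \<omega> in M. nn_cond_exp M F (\<lambda>\<omega>. ennreal (\<psi> (\<bar>V \<omega>\<bar> / k \<omega>))) \<omega> \<le> 1)} n)"


section \<open>The index space\<close>

definition index_set :: "real \<Rightarrow> (real \<times> 's \<times> real) set" where
  "index_set b = {0..1} \<times> UNIV \<times> {0..b}"

definition index_dist :: "real \<times> 's::metric_space \<times> real \<Rightarrow> real \<times> 's \<times> real \<Rightarrow> real" where
  "index_dist = (\<lambda>(u, y, r) (u', y', r').
     max (sqrt \<bar>u - u'\<bar>) (max (sqrt (dist y y')) (sqrt \<bar>r - r'\<bar>)))"

definition covering_number :: "'e set \<Rightarrow> ('e \<Rightarrow> 'e \<Rightarrow> real) \<Rightarrow> real \<Rightarrow> nat" where
  "covering_number E d \<epsilon> =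
     (LEAST n. \<exists>C\<subseteq>E. finite C \<and> card C = n \<and> E \<subseteq> (\<Union>c\<in>C. Metric_space.mball E d c \<epsilon>))"


section \<open>Gaussian processes, Brownian motion and Wiener integrals\<close>

definition cov :: "'w measure \<Rightarrow> ('w \<Rightarrow> real) \<Rightarrow> ('w \<Rightarrow> real) \<Rightarrow> real" where
  "cov M V W = (\<integral>\<omega>. (V \<omega> - (\<integral>\<omega>'. V \<omega>' \<partial>M)) * (W \<omega> - (\<integral>\<omega>'. W \<omega>' \<partial>M)) \<partial>M)"

definition long_run_cov ::
    "'w measure \<Rightarrow> (real \<Rightarrow> int \<Rightarrow> 'w \<Rightarrow> 's::metric_space) \<Rightarrow> real \<Rightarrow> 's \<Rightarrow> real \<Rightarrow> 's \<Rightarrow> real \<Rightarrow> real" where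
  "long_run_cov M Y \<eta> y1 r1 y2 r2 =
     (\<Sum>\<^sub>\<infinity>h::int. cov M (\<lambda>\<omega>. fyr y1 r1 (Y \<eta> 0 \<omega>)) (\<lambda>\<omega>. fyr y2 r2 (Y \<eta> h \<omega>)))"

text \<open>Degenerate normal laws (\<open>s = 0\<close>) are included.\<close>

definition normal_rv :: "'w measure \<Rightarrow> ('w \<Rightarrow> real) \<Rightarrow> bool" where
  "normal_rv M V \<longleftrightarrow> V \<in> borel_measurable M \<and>
     (\<exists>\<mu> s. (s = 0 \<and> (AE \<omega> in M. V \<omega> = \<mu>)) \<or>
            (s > 0 \<and> distributed M lborel V (\<lambda>x. ennreal (normal_density \<mu> s x))))"

definition centred_gaussian_process :: "'w measure \<Rightarrow> 'e set \<Rightarrow> ('e \<Rightarrow> 'w \<Rightarrow> real) \<Rightarrow> bool" where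
  "centred_gaussian_process M E Z \<longleftrightarrow>
     (\<forall>e\<in>E. Z e \<in> borel_measurable M \<and> (\<integral>\<omega>. Z e \<omega> \<partial>M) = 0) \<and>
     (\<forall>J c. finite J \<longrightarrow> J \<subseteq> E \<longrightarrow> normal_rv M (\<lambda>\<omega>. \<Sum>e\<in>J. c e * Z e \<omega>))"

definition standard_brownian_motion :: "'w measure \<Rightarrow> (real \<Rightarrow> 'w \<Rightarrow> real) \<Rightarrow> bool" where
  "standard_brownian_motion M B \<longleftrightarrow>
     (\<forall>t\<ge>0. B t \<in> borel_measurable M) \<and>
     (AE \<omega> in M. B 0 \<omega> = 0) \<and>
     (\<forall>s t. 0 \<le> s \<longrightarrow> s < t \<longrightarrow>
        distributed M lborel (\<lambda>\<omega>. B t \<omega> - B s \<omega>)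
          (\<lambda>x. ennreal (normal_density 0 (sqrt (t - s)) x))) \<and>
     (\<forall>(n::nat) \<tau>. 0 \<le> \<tau> 0 \<longrightarrow> mono \<tau> \<longrightarrow>
        prob_space.indep_vars M (\<lambda>_. borel) (\<lambda>i \<omega>. B (\<tau> (Suc i)) \<omega> - B (\<tau> i) \<omega>) {..<n}) \<and>
     (AE \<omega> in M. continuous_on {0..} (\<lambda>t. B t \<omega>))"

definition independent_brownian_motions :: "'w measure \<Rightarrow> (nat \<Rightarrow> real \<Rightarrow> 'w \<Rightarrow> real) \<Rightarrow> bool" where
  "independent_brownian_motions M B \<longleftrightarrow>
     (\<forall>l. standard_brownian_motion M (B l)) \<and>
     prob_space.indep_vars M (\<lambda>_. Pi\<^sub>M {0..} (\<lambda>_. borel)) (\<lambda>l \<omega>. \<lambda>t\<in>{0..}. B l t \<omega>) UNIV"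

text \<open>A step function \<open>\<Sum>\<^sub>i c\<^sub>i 1\<^bsub>(a\<^sub>i,b\<^sub>i]\<^esub>\<close> is encoded as a list of triples
  \<open>(c\<^sub>i, a\<^sub>i, b\<^sub>i)\<close>; the intervals may overlap. The Wiener integral over \<open>[0,u]\<close> of a
  deterministic square-integrable function is the \<open>L\<^sup>2\<close>-limit of the integrals of step
  functions approximating it in \<open>L\<^sup>2[0,u]\<close>; the property below determines it up to null sets.\<close>

definition steps_in :: "real \<Rightarrow> (real \<times> real \<times> real) list \<Rightarrow> bool" where
  "steps_in u \<phi> \<longleftrightarrow> (\<forall>(c, a, b)\<in>set \<phi>. 0 \<le> a \<and> a \<le> b \<and> b \<le> u)"

definition step_fun :: "(real \<times> real \<times> real) list \<Rightarrow> real \<Rightarrow> real" where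
  "step_fun \<phi> x = (\<Sum>(c, a, b)\<leftarrow>\<phi>. c * indicator {a<..b} x)"

definition step_integral :: "(real \<Rightarrow> 'w \<Rightarrow> real) \<Rightarrow> (real \<times> real \<times> real) list \<Rightarrow> 'w \<Rightarrow> real" where
  "step_integral B \<phi> \<omega> = (\<Sum>(c, a, b)\<leftarrow>\<phi>. c * (B b \<omega> - B a \<omega>))"

definition has_wiener_integral ::
    "'w measure \<Rightarrow> (real \<Rightarrow> 'w \<Rightarrow> real) \<Rightarrow> real \<Rightarrow> (real \<Rightarrow> real) \<Rightarrow> ('w \<Rightarrow> real) \<Rightarrow> bool" where
  "has_wiener_integral M B u g I \<longleftrightarrow>
     set_borel_measurable lborel {0..u} g \<and>
     set_integrable lborel {0..u} (\<lambda>\<eta>. (g \<eta>)\<^sup>2) \<and>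
     I \<in> borel_measurable M \<and>
     (\<exists>\<phi>. (\<forall>n. steps_in u (\<phi> n)) \<and>
        (\<lambda>n. \<integral>\<^sup>+\<eta>\<in>{0..u}. ennreal ((step_fun (\<phi> n) \<eta> - g \<eta>)\<^sup>2) \<partial>lborel) \<longlonglongrightarrow> 0 \<and>
        (\<lambda>n. \<integral>\<^sup>+\<omega>. ennreal ((step_integral B (\<phi> n) \<omega> - I \<omega>)\<^sup>2) \<partial>M) \<longlonglongrightarrow> 0)"

text \<open>Convergence of a random series in mean square. For independent centred Gaussian summands,
  as below, this is equivalent to almost sure convergence and to convergence in law.\<close>

definition sums_L2 :: "'w measure \<Rightarrow> (nat \<Rightarrow> 'w \<Rightarrow> real) \<Rightarrow> ('w \<Rightarrow> real) \<Rightarrow> bool" where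
  "sums_L2 M V W \<longleftrightarrow>
     (\<forall>l. V l \<in> borel_measurable M) \<and> W \<in> borel_measurable M \<and>
     (\<lambda>n. \<integral>\<^sup>+\<omega>. ennreal (((\<Sum>l<n. V l \<omega>) - W \<omega>)\<^sup>2) \<partial>M) \<longlonglongrightarrow> 0"

text \<open>Continuity on the index set refers to the product topology, which is the one induced by
  \<^const>\<open>index_dist\<close>. For processes with continuous paths on a compact set, equality of the laws
  on the product \<open>\<sigma>\<close>-algebra is equality of the laws on the space of continuous functions.\<close>

definition as_continuous :: "'w measure \<Rightarrow> 'e::topological_space set \<Rightarrow> ('e \<Rightarrow> 'w \<Rightarrow> real) \<Rightarrow> bool" where
  "as_continuous M E Z \<longleftrightarrow> (AE \<omega> in M. continuous_on E (\<lambda>e. Z e \<omega>))"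

definition equal_in_law ::
    "'w measure \<Rightarrow> 'v measure \<Rightarrow> 'e set \<Rightarrow> ('e \<Rightarrow> 'w \<Rightarrow> real) \<Rightarrow> ('e \<Rightarrow> 'v \<Rightarrow> real) \<Rightarrow> bool" where
  "equal_in_law M N E Z Z' \<longleftrightarrow>
     distr M (Pi\<^sub>M E (\<lambda>_. borel)) (\<lambda>\<omega>. \<lambda>e\<in>E. Z e \<omega>) =
     distr N (Pi\<^sub>M E (\<lambda>_. borel)) (\<lambda>\<omega>. \<lambda>e\<in>E. Z' e \<omega>)"

definition limit_process ::
    "'w measure \<Rightarrow> (real \<Rightarrow> int \<Rightarrow> 'w \<Rightarrow> 's::metric_space) \<Rightarrow> real \<Rightarrow>
     'z measure \<Rightarrow> (real \<times> 's \<times> real \<Rightarrow> 'z \<Rightarrow> real) \<Rightarrow> bool" where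
  "limit_process M Y b N \<zeta> \<longleftrightarrow>
     centred_gaussian_process N (index_set b) \<zeta> \<and>
     as_continuous N (index_set b) \<zeta> \<and>
     (\<forall>(u1, y1, r1)\<in>index_set b. \<forall>(u2, y2, r2)\<in>index_set b.
        cov N (\<zeta> (u1, y1, r1)) (\<zeta> (u2, y2, r2)) =
        (LBINT \<eta>:{0..min u1 u2}. long_run_cov M Y \<eta> y1 r1 y2 r2))"

text \<open>\<open>Z\<close> is a version, with continuous paths, of
  \<open>\<Sum>\<^sub>\<ell> \<integral>\<^sub>0\<^sup>u g\<^sub>\<ell>(\<eta>,y,r) dB\<^sub>\<ell>(\<eta>)\<close>.\<close>

definition series_of_wiener_integrals ::
    "'v measure \<Rightarrow> real \<Rightarrow> (nat \<Rightarrow> real \<Rightarrow> 'v \<Rightarrow> real) \<Rightarrow> (nat \<Rightarrow> real \<Rightarrow> 's::metric_space \<Rightarrow> real \<Rightarrow> real) \<Rightarrow>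
     (real \<times> 's \<times> real \<Rightarrow> 'v \<Rightarrow> real) \<Rightarrow> bool" where
  "series_of_wiener_integrals P b B g Z \<longleftrightarrow>
     as_continuous P (index_set b) Z \<and>
     (\<forall>(u, y, r)\<in>index_set b. \<exists>I.
        (\<forall>l. has_wiener_integral P (B l) u (\<lambda>\<eta>. g l \<eta> y r) (I l)) \<and>
        sums_L2 P I (Z (u, y, r)))"

end

theory Submission
  imports Defs
begin

text \<open>
  For \<open>p = (y, r)\<close> and rescaled time \<open>\<eta>\<close> let \<open>V\<^sub>t = f\<^sub>p(X\<^sub>t(\<eta>))\<close>. The projective bounds make the series
  of martingale differences \<open>D\<^sub>p(\<eta>) = \<Sum>\<^sub>t P\<^sub>1(V\<^sub>t)\<close>, \<open>t \<ge> 1\<close>, converge in \<open>L\<^sup>2\<close>, and the long-run covariance is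
  a Gram kernel, \<open>\<sigma>\<^sub>\<eta>(p, q) = \<langle>D\<^sub>p(\<eta>), D\<^sub>q(\<eta>)\<rangle>\<close> (\<open>long_run_cov_eq_inner\<close>). The partial sums of \<open>D\<^sub>p(\<eta>)\<close>
  depend continuously on \<open>p\<close>, so that one sequence of them approximates all \<open>D\<^sub>p(\<eta>)\<close>, at every
  \<open>\<eta>\<close> (\<open>dense_truncations\<close>). Orthonormalising this sequence by the Gram--Schmidt procedure and
  letting \<open>g\<^sub>l(\<eta>, p)\<close> be the \<open>l\<close>-th coordinate of \<open>D\<^sub>p(\<eta>)\<close>, Parseval's identity reads
  \<open>\<sigma>\<^sub>\<eta>(p, q) = \<Sum>\<^sub>l g\<^sub>l(\<eta>, p) g\<^sub>l(\<eta>, q)\<close> (\<open>kernel_expansion\<close>). The coordinates are arithmetic expressions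
  in the Gram kernel, whose entries are limits of continuous functions of \<open>\<eta>\<close>; hence they are
  measurable in \<open>\<eta>\<close> (\<open>long_run_cov_diagonalisation\<close>).

  The Brownian motions \<open>B\<^sub>l\<close> are built from a sequence of independent standard normal variables,
  and all variables formed from them lie in the closed linear span of this sequence. Elements of
  this Gaussian Hilbert space have joint laws determined by their inner products
  (\<open>char_gaussian_span\<close>). By the isometry of the Wiener integral the series
  \<open>\<Sum>\<^sub>l \<integral>\<^sub>0\<^sup>u g\<^sub>l(\<eta>, p) dB\<^sub>l(\<eta>)\<close> converges in mean square, and its covariances are the integrals
  of \<open>\<Sum>\<^sub>l g\<^sub>l(\<eta>, p) g\<^sub>l(\<eta>, q)\<close> over \<open>[0, u \<and> v]\<close>, which are the covariances of \<open>\<zeta>\<close>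
  (\<open>wiener_series\<close>). Both processes being centred Gaussian, they have the same law, and the
  continuity of \<open>\<zeta>\<close> passes to a version of the series (\<open>continuous_version\<close>).

  Under stationarity \<open>\<sigma>\<^sub>\<eta>\<close> does not depend on \<open>\<eta>\<close>. The coordinates at \<open>\<eta> = 0\<close> then serve for all \<open>\<eta>\<close>, and
  the Wiener integral of a constant is a multiple of the Brownian motion.
\<close>

section \<open>Square-integrable functions\<close>

definition square_integrable :: "'a measure \<Rightarrow> ('a \<Rightarrow> real) \<Rightarrow> bool" where
  "square_integrable M f \<longleftrightarrow> f \<in> borel_measurable M \<and> integrable M (\<lambda>x. (f x)\<^sup>2)"

definition L2_inner :: "'a measure \<Rightarrow> ('a \<Rightarrow> real) \<Rightarrow> ('a \<Rightarrow> real) \<Rightarrow> real" where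
  "L2_inner M f g = (\<integral>x. f x * g x \<partial>M)"

definition L2_norm :: "'a measure \<Rightarrow> ('a \<Rightarrow> real) \<Rightarrow> real" where
  "L2_norm M f = sqrt (\<integral>x. (f x)\<^sup>2 \<partial>M)"

lemma square_integrable_measurable [measurable_dest]:
  "square_integrable M f \<Longrightarrow> f \<in> borel_measurable M"
  by (simp add: square_integrable_def)

lemma square_integrable_mult:
  assumes "square_integrable M f" "square_integrable M g"
  shows "integrable M (\<lambda>x. f x * g x)"
proof (rule Bochner_Integration.integrable_bound)
  show "integrable M (\<lambda>x. (f x)\<^sup>2 + (g x)\<^sup>2)"
    using assms by (auto simp: square_integrable_def)
  show "AE x in M. norm (f x * g x) \<le> norm ((f x)\<^sup>2 + (g x)\<^sup>2)"
  proof (rule AE_I2)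
    fix x
    have "2 * (\<bar>f x\<bar> * \<bar>g x\<bar>) \<le> (f x)\<^sup>2 + (g x)\<^sup>2"
      using sum_squares_bound[of "\<bar>f x\<bar>" "\<bar>g x\<bar>"] by (simp add: algebra_simps)
    moreover have "0 \<le> \<bar>f x\<bar> * \<bar>g x\<bar>" by simp
    ultimately show "norm (f x * g x) \<le> norm ((f x)\<^sup>2 + (g x)\<^sup>2)"
      unfolding real_norm_def abs_mult by linarith
  qed
qed (use assms in \<open>auto simp: square_integrable_def\<close>)

lemma square_integrable_cmult:
  "square_integrable M f \<Longrightarrow> square_integrable M (\<lambda>x. c * f x)"
  by (auto simp: square_integrable_def power_mult_distrib)

lemma square_integrable_add:
  assumes "square_integrable M f" "square_integrable M g"
  shows "square_integrable M (\<lambda>x. f x + g x)"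
  using assms square_integrable_mult[OF assms]
  by (auto simp: square_integrable_def power2_sum mult.assoc)

lemma square_integrable_diff:
  assumes "square_integrable M f" "square_integrable M g"
  shows "square_integrable M (\<lambda>x. f x - g x)"
  using square_integrable_add[OF assms(1) square_integrable_cmult[OF assms(2), of "-1"]] by simp

lemma square_integrable_abs: "square_integrable M f \<Longrightarrow> square_integrable M (\<lambda>x. \<bar>f x\<bar>)"
  by (auto simp: square_integrable_def)

lemma square_integrable_zero [simp]: "square_integrable M (\<lambda>x. 0)"
  by (simp add: square_integrable_def)

lemma square_integrable_sum:
  "(\<And>i. i \<in> I \<Longrightarrow> square_integrable M (f i)) \<Longrightarrow> square_integrable M (\<lambda>x. \<Sum>i\<in>I. f i x)"
  by (induction I rule: infinite_finite_induct) (auto intro: square_integrable_add)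

lemma (in finite_measure) square_integrable_bounded:
  assumes "f \<in> borel_measurable M" "\<And>x. x \<in> space M \<Longrightarrow> \<bar>f x\<bar> \<le> C"
  shows "square_integrable M f"
proof -
  have "integrable M (\<lambda>x. (f x)\<^sup>2)"
  proof (rule integrable_const_bound[where B = "C\<^sup>2"])
    show "AE x in M. norm ((f x)\<^sup>2) \<le> C\<^sup>2"
      using assms(2) by (intro AE_I2) (simp add: abs_le_square_iff[symmetric], smt (verit))
  qed (use assms in auto)
  thus ?thesis using assms by (simp add: square_integrable_def)
qed

lemma (in finite_measure) L2_imp_integrable:
  assumes "square_integrable M f" shows "integrable M f"
  using square_integrable_mult[OF assms square_integrable_bounded[of "\<lambda>_. 1" 1]] by simp

lemma L2_norm_nonneg [simp]: "0 \<le> L2_norm M f"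
  by (simp add: L2_norm_def)

lemma L2_norm_power2: "(L2_norm M f)\<^sup>2 = L2_inner M f f"
  by (simp add: L2_norm_def L2_inner_def power2_eq_square)

lemma L2_inner_commute: "L2_inner M f g = L2_inner M g f"
  by (simp add: L2_inner_def mult.commute)

lemma L2_inner_add_left:
  assumes "square_integrable M f" "square_integrable M g" "square_integrable M h"
  shows "L2_inner M (\<lambda>x. f x + g x) h = L2_inner M f h + L2_inner M g h"
  using square_integrable_mult[OF assms(1,3)] square_integrable_mult[OF assms(2,3)]
  by (simp add: L2_inner_def algebra_simps)

lemma L2_inner_cmult_left: "L2_inner M (\<lambda>x. c * f x) h = c * L2_inner M f h"
  by (simp add: L2_inner_def mult.assoc)

lemma L2_inner_diff_left:
  assumes "square_integrable M f" "square_integrable M g" "square_integrable M h"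
  shows "L2_inner M (\<lambda>x. f x - g x) h = L2_inner M f h - L2_inner M g h"
  using square_integrable_mult[OF assms(1,3)] square_integrable_mult[OF assms(2,3)]
  by (simp add: L2_inner_def algebra_simps)

lemma L2_inner_diff_right:
  assumes "square_integrable M f" "square_integrable M g" "square_integrable M h"
  shows "L2_inner M h (\<lambda>x. f x - g x) = L2_inner M h f - L2_inner M h g"
  using L2_inner_diff_left[OF assms] by (simp add: L2_inner_commute)

lemma L2_inner_sum_left:
  assumes "\<And>i. i \<in> I \<Longrightarrow> square_integrable M (f i)" "square_integrable M h"
  shows "L2_inner M (\<lambda>x. \<Sum>i\<in>I. f i x) h = (\<Sum>i\<in>I. L2_inner M (f i) h)"
  unfolding L2_inner_def sum_distrib_right
  by (rule Bochner_Integration.integral_sum) (auto intro: square_integrable_mult assms)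

lemma L2_inner_sum_right:
  assumes "\<And>i. i \<in> I \<Longrightarrow> square_integrable M (f i)" "square_integrable M h"
  shows "L2_inner M h (\<lambda>x. \<Sum>i\<in>I. f i x) = (\<Sum>i\<in>I. L2_inner M h (f i))"
  using L2_inner_sum_left[OF assms] by (simp add: L2_inner_commute)

lemma L2_inner_combination:
  assumes "\<And>i. i \<in> I \<Longrightarrow> square_integrable M (f i)"
  shows "L2_inner M (\<lambda>x. \<Sum>i\<in>I. c i * f i x) (\<lambda>x. \<Sum>i\<in>I. c i * f i x)
    = (\<Sum>i\<in>I. \<Sum>j\<in>I. c i * c j * L2_inner M (f i) (f j))"
proof -
  have "L2_inner M (\<lambda>x. \<Sum>i\<in>I. c i * f i x) (\<lambda>x. \<Sum>i\<in>I. c i * f i x)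
    = (\<Sum>i\<in>I. \<Sum>j\<in>I. L2_inner M (\<lambda>x. c i * f i x) (\<lambda>x. c j * f j x))"
    using assms by (simp add: L2_inner_sum_left L2_inner_sum_right square_integrable_cmult
        square_integrable_sum)
  also have "\<dots> = (\<Sum>i\<in>I. \<Sum>j\<in>I. c i * c j * L2_inner M (f i) (f j))"
    by (simp add: L2_inner_def ac_simps flip: Bochner_Integration.integral_mult_right_zero)
  finally show ?thesis .
qed

lemma L2_inner_cong_AE:
  assumes "AE x in M. f x = f' x" "AE x in M. g x = g' x"
    and "f \<in> borel_measurable M" "f' \<in> borel_measurable M"
        "g \<in> borel_measurable M" "g' \<in> borel_measurable M"
  shows "L2_inner M f g = L2_inner M f' g'"
  unfolding L2_inner_def by (rule integral_cong_AE) (use assms in auto)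

lemma L2_Cauchy_Schwarz:
  assumes "square_integrable M f" "square_integrable M g"
  shows "\<bar>L2_inner M f g\<bar> \<le> L2_norm M f * L2_norm M g"
proof -
  define a b c where "a = L2_inner M f f" and "b = L2_inner M f g" and "c = L2_inner M g g"
  have q: "0 \<le> a * s\<^sup>2 + 2 * b * s * t + c * t\<^sup>2" for s t
  proof -
    have "0 \<le> L2_inner M (\<lambda>x. s * f x + t * g x) (\<lambda>x. s * f x + t * g x)"
      unfolding L2_inner_def by (intro Bochner_Integration.integral_nonneg) auto
    also have "\<dots> = (\<integral>x. s\<^sup>2 * (f x * f x) + (2 * s * t) * (f x * g x) + t\<^sup>2 * (g x * g x) \<partial>M)"
      unfolding L2_inner_def by (simp add: algebra_simps power2_eq_square)
    also have "\<dots> = a * s\<^sup>2 + 2 * b * s * t + c * t\<^sup>2"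
      unfolding a_def b_def c_def L2_inner_def
      using assms by (simp add: square_integrable_mult)
    finally show ?thesis .
  qed
  have "a \<ge> 0" "c \<ge> 0" using q[of 1 0] q[of 0 1] by auto
  have "b\<^sup>2 \<le> a * c"
  proof (cases "a = 0")
    case True
    have "b = 0"
    proof (rule ccontr)
      assume "b \<noteq> 0"
      have "0 \<le> 2 * b * (- (c + 1) / (2 * b)) + c" using q[of "- (c + 1) / (2 * b)" 1] True by simp
      also have "\<dots> = -1" using \<open>b \<noteq> 0\<close> by simp
      finally show False by simp
    qed
    thus ?thesis using True by simp
  next
    case False
    with \<open>a \<ge> 0\<close> have "a > 0" by simp
    have "0 \<le> a * (- b)\<^sup>2 + 2 * b * (- b) * a + c * a\<^sup>2" using q[of "- b" a] .
    hence "0 \<le> a * (a * c - b\<^sup>2)" by (simp add: algebra_simps power2_eq_square)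
    thus ?thesis using \<open>a > 0\<close> by (simp add: zero_le_mult_iff)
  qed
  hence "sqrt (b\<^sup>2) \<le> sqrt (a * c)" by (rule real_sqrt_le_mono)
  thus ?thesis
    unfolding a_def b_def c_def by (simp add: L2_norm_def L2_inner_def power2_eq_square real_sqrt_mult)
qed

lemma L2_norm_triangle:
  assumes "square_integrable M f" "square_integrable M g"
  shows "L2_norm M (\<lambda>x. f x + g x) \<le> L2_norm M f + L2_norm M g"
proof (rule power2_le_imp_le)
  have e: "(L2_norm M (\<lambda>x. f x + g x))\<^sup>2 = L2_inner M f f + 2 * L2_inner M f g + L2_inner M g g"
    unfolding L2_norm_power2 L2_inner_def
  proof -
    have "(\<integral>x. (f x + g x) * (f x + g x) \<partial>M) = (\<integral>x. f x * f x + 2 * (f x * g x) + g x * g x \<partial>M)"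
      by (simp add: algebra_simps)
    thus "(\<integral>x. (f x + g x) * (f x + g x) \<partial>M)
        = (\<integral>x. f x * f x \<partial>M) + 2 * (\<integral>x. f x * g x \<partial>M) + (\<integral>x. g x * g x \<partial>M)"
      using assms by (simp add: square_integrable_mult)
  qed
  also have "\<dots> \<le> (L2_norm M f + L2_norm M g)\<^sup>2"
    using L2_Cauchy_Schwarz[OF assms] by (simp add: power2_sum L2_norm_power2)
  finally show "(L2_norm M (\<lambda>x. f x + g x))\<^sup>2 \<le> (L2_norm M f + L2_norm M g)\<^sup>2" .
qed simp

lemma L2_norm_cmult: "L2_norm M (\<lambda>x. c * f x) = \<bar>c\<bar> * L2_norm M f"
  by (simp add: L2_norm_def power_mult_distrib real_sqrt_mult)

lemma L2_norm_uminus: "L2_norm M (\<lambda>x. - f x) = L2_norm M f"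
  by (simp add: L2_norm_def)

lemma L2_norm_minus_commute: "L2_norm M (\<lambda>x. f x - g x) = L2_norm M (\<lambda>x. g x - f x)"
  by (simp add: L2_norm_def power2_commute)

lemma L2_norm_triangle_diff:
  assumes "square_integrable M f" "square_integrable M g" "square_integrable M h"
  shows "L2_norm M (\<lambda>x. f x - h x) \<le> L2_norm M (\<lambda>x. f x - g x) + L2_norm M (\<lambda>x. g x - h x)"
  using L2_norm_triangle[of M "\<lambda>x. f x - g x" "\<lambda>x. g x - h x"] assms
  by (simp add: square_integrable_diff)

lemma L2_norm_cong_AE:
  assumes "AE x in M. f x = g x" "f \<in> borel_measurable M" "g \<in> borel_measurable M"
  shows "L2_norm M f = L2_norm M g"
proof -
  have "(\<integral>x. (f x)\<^sup>2 \<partial>M) = (\<integral>x. (g x)\<^sup>2 \<partial>M)"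
    by (rule integral_cong_AE) (use assms in auto)
  thus ?thesis by (simp add: L2_norm_def)
qed

lemma square_integrable_cong_AE:
  assumes "square_integrable M f" "AE x in M. f x = g x" "g \<in> borel_measurable M"
  shows "square_integrable M g"
  unfolding square_integrable_def
proof
  show "integrable M (\<lambda>x. (g x)\<^sup>2)"
  proof (rule Bochner_Integration.integrable_cong_AE_imp[of M "\<lambda>x. (f x)\<^sup>2"])
    show "AE x in M. (f x)\<^sup>2 = (g x)\<^sup>2" using assms(2) by eventually_elim simp
  qed (use assms(1,3) in \<open>simp_all add: square_integrable_def\<close>)
qed (rule assms)

lemma L2_norm_sum_le:
  assumes "finite I" "\<And>i. i \<in> I \<Longrightarrow> square_integrable M (f i)"
  shows "L2_norm M (\<lambda>x. \<Sum>i\<in>I. f i x) \<le> (\<Sum>i\<in>I. L2_norm M (f i))"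
  using assms
proof (induction I)
  case empty
  then show ?case by (simp add: L2_norm_def)
next
  case (insert j I)
  hence "L2_norm M (\<lambda>x. f j x + (\<Sum>i\<in>I. f i x)) \<le> L2_norm M (f j) + L2_norm M (\<lambda>x. \<Sum>i\<in>I. f i x)"
    by (intro L2_norm_triangle square_integrable_sum) auto
  with insert show ?case by auto
qed

lemma nn_integral_square:
  assumes "square_integrable M f"
  shows "(\<integral>\<^sup>+x. ennreal ((f x)\<^sup>2) \<partial>M) = ennreal ((L2_norm M f)\<^sup>2)"
  using assms by (simp add: nn_integral_eq_integral square_integrable_def L2_norm_def)

lemma square_integrableI_nn:
  assumes "f \<in> borel_measurable M" "(\<integral>\<^sup>+x. ennreal ((f x)\<^sup>2) \<partial>M) < \<infinity>"
  shows "square_integrable M f"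
  unfolding square_integrable_def using assms
  by (auto intro!: integrableI_nonneg)

definition L2_tendsto :: "'a measure \<Rightarrow> (nat \<Rightarrow> 'a \<Rightarrow> real) \<Rightarrow> ('a \<Rightarrow> real) \<Rightarrow> bool" where
  "L2_tendsto M V W \<longleftrightarrow> (\<forall>n. square_integrable M (V n)) \<and> square_integrable M W \<and>
     (\<lambda>n. L2_norm M (\<lambda>x. V n x - W x)) \<longlonglongrightarrow> 0"

lemma L2_tendstoD:
  assumes "L2_tendsto M V W"
  shows "square_integrable M (V n)" "square_integrable M W"
    "(\<lambda>n. L2_norm M (\<lambda>x. V n x - W x)) \<longlonglongrightarrow> 0"
  using assms by (auto simp: L2_tendsto_def)

lemma L2_tendsto_inner:
  assumes V: "L2_tendsto M V W" and V': "L2_tendsto M V' W'"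
  shows "(\<lambda>n. L2_inner M (V n) (V' n)) \<longlonglongrightarrow> L2_inner M W W'"
proof -
  note s = L2_tendstoD[OF V] L2_tendstoD[OF V']
  have "\<bar>L2_inner M (V n) (V' n) - L2_inner M W W'\<bar> \<le>
      L2_norm M (\<lambda>x. V n x - W x) * (L2_norm M (\<lambda>x. V' n x - W' x) + L2_norm M W')
      + L2_norm M W * L2_norm M (\<lambda>x. V' n x - W' x)" (is "_ \<le> ?b n") for n
  proof -
    have "L2_inner M (V n) (V' n) - L2_inner M W W' =
        L2_inner M (\<lambda>x. V n x - W x) (V' n) + L2_inner M W (\<lambda>x. V' n x - W' x)"
      using s by (simp add: L2_inner_diff_left L2_inner_diff_right)
    moreover have "\<bar>L2_inner M (\<lambda>x. V n x - W x) (V' n)\<bar> \<le> L2_norm M (\<lambda>x. V n x - W x) * L2_norm M (V' n)"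
      by (intro L2_Cauchy_Schwarz square_integrable_diff s)
    moreover have "\<bar>L2_inner M W (\<lambda>x. V' n x - W' x)\<bar> \<le> L2_norm M W * L2_norm M (\<lambda>x. V' n x - W' x)"
      by (intro L2_Cauchy_Schwarz square_integrable_diff s)
    moreover have "L2_norm M (V' n) \<le> L2_norm M (\<lambda>x. V' n x - W' x) + L2_norm M W'"
      using L2_norm_triangle[OF square_integrable_diff[OF s(4) s(5)] s(5), of n] by simp
    hence "L2_norm M (\<lambda>x. V n x - W x) * L2_norm M (V' n)
      \<le> L2_norm M (\<lambda>x. V n x - W x) * (L2_norm M (\<lambda>x. V' n x - W' x) + L2_norm M W')"
      by (intro mult_left_mono) auto
    ultimately show ?thesis by linarith
  qed
  hence ev: "eventually (\<lambda>n. norm (L2_inner M (V n) (V' n) - L2_inner M W W') \<le> ?b n) sequentially"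
    by (intro always_eventually allI) (simp only: real_norm_def)
  have "?b \<longlonglongrightarrow> 0 * (0 + L2_norm M W') + L2_norm M W * 0"
    by (intro tendsto_intros s)
  hence lim: "?b \<longlonglongrightarrow> 0" by (simp only: mult_zero_left mult_zero_right add_0_left)
  show ?thesis by (rule LIM_zero_cancel[OF Lim_null_comparison[OF ev lim]])
qed

lemma L2_tendsto_const: "square_integrable M W \<Longrightarrow> L2_tendsto M (\<lambda>_. W) W"
  by (simp add: L2_tendsto_def L2_norm_def)

lemma L2_tendsto_add:
  assumes V: "L2_tendsto M V W" and V': "L2_tendsto M V' W'"
  shows "L2_tendsto M (\<lambda>n x. V n x + V' n x) (\<lambda>x. W x + W' x)"
proof -
  note s = L2_tendstoD[OF V] L2_tendstoD[OF V']
  have "(\<lambda>n. L2_norm M (\<lambda>x. (V n x + V' n x) - (W x + W' x))) \<longlonglongrightarrow> 0"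
  proof (rule tendsto_sandwich[OF _ _ tendsto_const])
    show "eventually (\<lambda>n. L2_norm M (\<lambda>x. (V n x + V' n x) - (W x + W' x)) \<le>
        L2_norm M (\<lambda>x. V n x - W x) + L2_norm M (\<lambda>x. V' n x - W' x)) sequentially"
      using L2_norm_triangle[OF square_integrable_diff[OF s(1,2)] square_integrable_diff[OF s(4,5)]]
      by (intro always_eventually allI) (simp add: algebra_simps)
    show "(\<lambda>n. L2_norm M (\<lambda>x. V n x - W x) + L2_norm M (\<lambda>x. V' n x - W' x)) \<longlonglongrightarrow> 0"
      using tendsto_add[OF s(3,6)] by simp
  qed auto
  thus ?thesis using s by (simp add: L2_tendsto_def square_integrable_add)
qed

lemma L2_tendsto_cmult:
  assumes V: "L2_tendsto M V W"
  shows "L2_tendsto M (\<lambda>n x. c * V n x) (\<lambda>x. c * W x)"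
proof -
  note s = L2_tendstoD[OF V]
  have "(\<lambda>n. L2_norm M (\<lambda>x. c * V n x - c * W x)) = (\<lambda>n. \<bar>c\<bar> * L2_norm M (\<lambda>x. V n x - W x))"
    by (simp add: L2_norm_cmult flip: right_diff_distrib)
  thus ?thesis using s tendsto_mult_right_zero[OF s(3), of "\<bar>c\<bar>"]
    by (simp add: L2_tendsto_def square_integrable_cmult)
qed

lemma L2_tendsto_unique:
  assumes V: "L2_tendsto M V W" and V': "L2_tendsto M V W'"
  shows "AE x in M. W x = W' x"
proof -
  note s = L2_tendstoD[OF V] L2_tendstoD[OF V']
  have "L2_tendsto M (\<lambda>n x. V n x + (-1) * V n x) (\<lambda>x. W x + (-1) * W' x)"
    by (intro L2_tendsto_add L2_tendsto_cmult assms)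
  hence "(\<lambda>n. L2_norm M (\<lambda>x. 0 - (W x - W' x))) \<longlonglongrightarrow> 0"
    by (auto dest!: L2_tendstoD(3))
  hence "L2_norm M (\<lambda>x. W x - W' x) = 0"
    using L2_norm_minus_commute[of M W W'] by (simp add: LIMSEQ_const_iff)
  hence "(\<integral>\<^sup>+x. ennreal ((W x - W' x)\<^sup>2) \<partial>M) = 0"
    using nn_integral_square[OF square_integrable_diff[OF s(2,5)]] by simp
  hence "AE x in M. ennreal ((W x - W' x)\<^sup>2) = 0"
    using s by (subst (asm) nn_integral_0_iff_AE) auto
  thus ?thesis by eventually_elim (simp add: ennreal_eq_0_iff)
qed

lemma L2_tendsto_cong_AE:
  assumes V: "L2_tendsto M V W" and "AE x in M. W x = W' x" "W' \<in> borel_measurable M"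
  shows "L2_tendsto M V W'"
proof -
  note s = L2_tendstoD[OF V]
  have s': "square_integrable M W'" by (rule square_integrable_cong_AE[OF s(2) assms(2,3)])
  have "L2_norm M (\<lambda>x. V n x - W x) = L2_norm M (\<lambda>x. V n x - W' x)" for n
  proof (rule L2_norm_cong_AE)
    show "AE x in M. V n x - W x = V n x - W' x" using assms(2) by eventually_elim simp
  qed (use square_integrable_measurable[OF s(1)[of n]] square_integrable_measurable[OF s(2)] assms(3) in simp_all)
  thus ?thesis using s s' by (simp add: L2_tendsto_def)
qed

lemma L2_tendsto_iff_nn:
  assumes "\<And>n. square_integrable M (V n)" "W \<in> borel_measurable M"
  shows "L2_tendsto M V W \<longleftrightarrow> (\<lambda>n. \<integral>\<^sup>+x. ennreal ((V n x - W x)\<^sup>2) \<partial>M) \<longlonglongrightarrow> 0"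
proof
  assume l: "L2_tendsto M V W"
  have "(\<lambda>n. ennreal ((L2_norm M (\<lambda>x. V n x - W x))\<^sup>2)) \<longlonglongrightarrow> ennreal (0\<^sup>2)"
    by (intro tendsto_ennrealI tendsto_power L2_tendstoD(3)[OF l])
  thus "(\<lambda>n. \<integral>\<^sup>+x. ennreal ((V n x - W x)\<^sup>2) \<partial>M) \<longlonglongrightarrow> 0"
    using L2_tendstoD[OF l] by (simp add: nn_integral_square square_integrable_diff)
next
  assume l: "(\<lambda>n. \<integral>\<^sup>+x. ennreal ((V n x - W x)\<^sup>2) \<partial>M) \<longlonglongrightarrow> 0"
  have "eventually (\<lambda>n. (\<integral>\<^sup>+x. ennreal ((V n x - W x)\<^sup>2) \<partial>M) < 1) sequentially"
    using order_tendstoD(2)[OF l, of 1] by simp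
  then obtain n where "(\<integral>\<^sup>+x. ennreal ((V n x - W x)\<^sup>2) \<partial>M) < 1"
    by (auto simp: eventually_sequentially)
  hence d: "square_integrable M (\<lambda>x. V n x - W x)"
    using assms by (intro square_integrableI_nn) (auto intro: less_trans)
  hence W: "square_integrable M W"
    using square_integrable_diff[OF assms(1)[of n] d] by simp
  have "(\<lambda>n. sqrt (enn2real (\<integral>\<^sup>+x. ennreal ((V n x - W x)\<^sup>2) \<partial>M))) \<longlonglongrightarrow> sqrt 0"
    using l by (intro tendsto_real_sqrt tendsto_enn2real) simp_all
  thus "L2_tendsto M V W"
    using W assms(1) by (simp add: L2_tendsto_def nn_integral_square square_integrable_diff)
qed

lemma ennreal_tendsto_0I:
  fixes f :: "nat \<Rightarrow> ennreal"
  assumes "\<And>e. e > 0 \<Longrightarrow> eventually (\<lambda>n. f n \<le> ennreal e) sequentially"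
  shows "f \<longlonglongrightarrow> 0"
proof (rule order_tendstoI)
  fix a :: ennreal assume "0 < a"
  then obtain e where e: "0 < e" "ennreal e < a"
    by (metis dense ennreal_less_zero_iff ennreal_cases order_less_imp_not_less top.not_eq_extremum less_top_ennreal)
  show "eventually (\<lambda>n. f n < a) sequentially"
    using assms[OF e(1)] by eventually_elim (use e in auto)
qed simp

text \<open>Riesz--Fischer: along a subsequence with summable increments the partial sums converge
  absolutely almost everywhere, and Fatou's lemma bounds the distance to the pointwise limit.\<close>

lemma L2_complete:
  assumes V: "\<And>n. square_integrable M (V n)"
    and C: "\<And>e. e > 0 \<Longrightarrow> \<exists>N. \<forall>m\<ge>N. \<forall>n\<ge>N. L2_norm M (\<lambda>x. V m x - V n x) < e"
  shows "\<exists>W. L2_tendsto M V W"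
proof -
  have [measurable]: "V n \<in> borel_measurable M" for n using V by (simp add: square_integrable_def)
  define D where "D m n = L2_norm M (\<lambda>x. V m x - V n x)" for m n
  have "\<exists>N. \<forall>k. (\<forall>m\<ge>N k. \<forall>n\<ge>N k. D m n < (1/2)^k) \<and> True"
    unfolding D_def by (intro choice allI) (use C in auto)
  then obtain N where N: "\<And>k m n. m \<ge> N k \<Longrightarrow> n \<ge> N k \<Longrightarrow> D m n < (1/2)^k" by blast
  \<comment> \<open>a nondecreasing majorant of \<open>N\<close>\<close>
  define s where "s k = (\<Sum>i\<le>k. N i)" for k
  have sN: "s k \<ge> N k" for k unfolding s_def by (rule member_le_sum) auto
  have smono: "s k \<le> s (Suc k)" for k unfolding s_def by simp
  have inc: "D (s (Suc k)) (s k) < (1/2)^k" for k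
    by (rule N) (use sN smono order_trans in blast)+
  define A where "A k x = (\<Sum>i<k. \<bar>V (s (Suc i)) x - V (s i) x\<bar>)" for k x
  have Asq: "square_integrable M (A k)" for k
    unfolding A_def using V
    by (intro square_integrable_sum square_integrable_abs square_integrable_diff)
  have [measurable]: "A k \<in> borel_measurable M" for k
    using Asq by (rule square_integrable_measurable)
  have An: "L2_norm M (A k) \<le> 2" for k
  proof -
    have "L2_norm M (A k) \<le> (\<Sum>i<k. L2_norm M (\<lambda>x. \<bar>V (s (Suc i)) x - V (s i) x\<bar>))"
      unfolding A_def using square_integrable_diff[OF V V]
      by (intro L2_norm_sum_le) (auto simp: square_integrable_def)
    also have "\<dots> = (\<Sum>i<k. D (s (Suc i)) (s i))" by (simp add: D_def L2_norm_def)
    also have "\<dots> \<le> (\<Sum>i<k. (1/2)^i)" by (intro sum_mono less_imp_le inc)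
    also have "\<dots> = 2 - 2 * (1/2)^k" by (induction k) simp_all
    also have "\<dots> \<le> 2" by simp
    finally show ?thesis .
  qed
  have Amono: "incseq (\<lambda>k. ennreal ((A k x)\<^sup>2))" for x
    unfolding A_def by (intro incseq_SucI ennreal_leI power_mono sum_nonneg) auto
  have "(\<integral>\<^sup>+x. (SUP k. ennreal ((A k x)\<^sup>2)) \<partial>M) = (SUP k. \<integral>\<^sup>+x. ennreal ((A k x)\<^sup>2) \<partial>M)"
    by (rule nn_integral_monotone_convergence_SUP)
      (use Asq Amono in \<open>auto simp: square_integrable_def incseq_def le_fun_def\<close>)
  also have "\<dots> \<le> ennreal 4"
  proof (rule SUP_least)
    fix k
    have "(L2_norm M (A k))\<^sup>2 \<le> 2\<^sup>2" by (rule power_mono[OF An]) simp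
    thus "(\<integral>\<^sup>+x. ennreal ((A k x)\<^sup>2) \<partial>M) \<le> ennreal 4"
      unfolding nn_integral_square[OF Asq] by (intro ennreal_leI) simp
  qed
  finally have "(\<integral>\<^sup>+x. (SUP k. ennreal ((A k x)\<^sup>2)) \<partial>M) < \<infinity>" by (simp add: le_less_trans)
  hence "AE x in M. (SUP k. ennreal ((A k x)\<^sup>2)) \<noteq> \<infinity>"
    by (intro nn_integral_noteq_infinite) (simp_all add: less_top[symmetric])
  hence conv: "AE x in M. convergent (\<lambda>k. V (s k) x)"
  proof eventually_elim
    case (elim x)
    then obtain c where c: "(SUP k. ennreal ((A k x)\<^sup>2)) = ennreal c" "0 \<le> c"
      by (cases "SUP k. ennreal ((A k x)\<^sup>2)") auto
    have "A k x \<le> sqrt c" for k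
    proof -
      have "ennreal ((A k x)\<^sup>2) \<le> ennreal c" using c(1) by (metis SUP_upper UNIV_I)
      thus ?thesis using c(2) by (simp add: real_le_rsqrt)
    qed
    hence "summable (\<lambda>i. \<bar>V (s (Suc i)) x - V (s i) x\<bar>)"
      by (intro summableI_nonneg_bounded[where x = "sqrt c"]) (auto simp: A_def)
    hence "summable (\<lambda>i. V (s (Suc i)) x - V (s i) x)" by (rule summable_rabs_cancel)
    hence "convergent (\<lambda>n. \<Sum>i<n. V (s (Suc i)) x - V (s i) x)" by (simp add: summable_iff_convergent)
    hence "convergent (\<lambda>n. V (s n) x - V (s 0) x)"
      by (simp only: sum_lessThan_telescope[where f = "\<lambda>n. V (s n) x"])
    from convergent_add[OF this convergent_const[of "V (s 0) x"]]
    have "convergent (\<lambda>n. (V (s n) x - V (s 0) x) + V (s 0) x)" .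
    thus ?case by simp
  qed
  define W where "W x = lim (\<lambda>k. V (s k) x)" for x
  have [measurable]: "W \<in> borel_measurable M" unfolding W_def by measurable
  have lim: "AE x in M. (\<lambda>k. V (s k) x) \<longlonglongrightarrow> W x"
    using conv by eventually_elim (simp add: W_def convergent_LIMSEQ_iff)
  have bnd: "(\<integral>\<^sup>+x. ennreal ((V n x - W x)\<^sup>2) \<partial>M) \<le> ennreal (((1/2)^k)\<^sup>2)" if "n \<ge> s k" for n k
  proof -
    have "(\<integral>\<^sup>+x. ennreal ((V n x - W x)\<^sup>2) \<partial>M) = (\<integral>\<^sup>+x. liminf (\<lambda>i. ennreal ((V n x - V (s i) x)\<^sup>2)) \<partial>M)"
    proof (rule nn_integral_cong_AE)
      show "AE x in M. ennreal ((V n x - W x)\<^sup>2) = liminf (\<lambda>i. ennreal ((V n x - V (s i) x)\<^sup>2))"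
        using lim
      proof eventually_elim
        case (elim x)
        have "(\<lambda>i. ennreal ((V n x - V (s i) x)\<^sup>2)) \<longlonglongrightarrow> ennreal ((V n x - W x)\<^sup>2)"
          by (intro tendsto_intros elim tendsto_ennrealI)
        thus ?case using lim_imp_Liminf by (metis trivial_limit_sequentially)
      qed
    qed
    also have "\<dots> \<le> liminf (\<lambda>i. \<integral>\<^sup>+x. ennreal ((V n x - V (s i) x)\<^sup>2) \<partial>M)"
      by (rule nn_integral_liminf) simp
    also have "\<dots> = liminf (\<lambda>i. ennreal ((D n (s i))\<^sup>2))"
      by (simp add: D_def nn_integral_square square_integrable_diff V)
    also have "\<dots> \<le> limsup (\<lambda>i. ennreal ((D n (s i))\<^sup>2))" by (rule Liminf_le_Limsup) simp
    also have "\<dots> \<le> ennreal (((1/2)^k)\<^sup>2)"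
    proof (rule Limsup_bounded, rule eventually_sequentiallyI[of k])
      fix i assume "i \<ge> k"
      have "s i \<ge> s k" by (rule lift_Suc_mono_le[of s, OF smono]) fact
      hence "D n (s i) < (1/2)^k" using N that sN[of k] by simp
      thus "ennreal ((D n (s i))\<^sup>2) \<le> ennreal (((1/2)^k)\<^sup>2)"
        by (intro ennreal_leI power_mono) (auto simp: D_def)
    qed
    finally show ?thesis .
  qed
  have "(\<lambda>n. \<integral>\<^sup>+x. ennreal ((V n x - W x)\<^sup>2) \<partial>M) \<longlonglongrightarrow> 0"
  proof (rule ennreal_tendsto_0I)
    fix e :: real assume "e > 0"
    obtain k where k: "((1/2::real)^2)^k < e" using \<open>e > 0\<close> real_arch_pow_inv[of e "(1/2)^2"]
      by (auto simp: power2_eq_square)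
    show "eventually (\<lambda>n. (\<integral>\<^sup>+x. ennreal ((V n x - W x)\<^sup>2) \<partial>M) \<le> ennreal e) sequentially"
    proof (rule eventually_sequentiallyI[of "s k"])
      fix n assume "n \<ge> s k"
      from bnd[OF this] have "(\<integral>\<^sup>+x. ennreal ((V n x - W x)\<^sup>2) \<partial>M) \<le> ennreal (((1/2)^k)\<^sup>2)" .
      also have "\<dots> \<le> ennreal e" using k by (intro ennreal_leI) (simp add: power_mult[symmetric] mult.commute)
      finally show "(\<integral>\<^sup>+x. ennreal ((V n x - W x)\<^sup>2) \<partial>M) \<le> ennreal e" .
    qed
  qed
  hence "L2_tendsto M V W" by (subst L2_tendsto_iff_nn) (simp_all add: V)
  thus ?thesis by blast
qed

lemma L2_norm_diff_power2:
  assumes "square_integrable M f" "square_integrable M g"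
  shows "(L2_norm M (\<lambda>x. f x - g x))\<^sup>2 = L2_inner M f f - 2 * L2_inner M f g + L2_inner M g g"
  using assms L2_inner_commute[of M f g]
  by (simp add: L2_norm_power2 L2_inner_diff_left L2_inner_diff_right square_integrable_diff)

lemma L2_norm_combination_power2:
  assumes "\<And>i. i \<in> I \<Longrightarrow> square_integrable M (f i)"
    and "\<And>i j. i \<in> I \<Longrightarrow> j \<in> I \<Longrightarrow> i \<noteq> j \<Longrightarrow> L2_inner M (f i) (f j) = 0" and "finite I"
  shows "(L2_norm M (\<lambda>x. \<Sum>i\<in>I. f i x))\<^sup>2 = (\<Sum>i\<in>I. (L2_norm M (f i))\<^sup>2)"
proof -
  have "(L2_norm M (\<lambda>x. \<Sum>i\<in>I. f i x))\<^sup>2 = (\<Sum>i\<in>I. \<Sum>j\<in>I. L2_inner M (f i) (f j))"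
    using L2_inner_combination[of I M f "\<lambda>_. 1"] assms(1) by (simp add: L2_norm_power2)
  also have "\<dots> = (\<Sum>i\<in>I. \<Sum>j\<in>I. if j = i then L2_inner M (f i) (f i) else 0)"
    using assms(2) by (intro sum.cong refl) auto
  also have "\<dots> = (\<Sum>i\<in>I. L2_inner M (f i) (f i))"
    using \<open>finite I\<close> by (intro sum.cong refl) simp
  finally show ?thesis by (simp add: L2_norm_power2)
qed

lemma orthogonal_series_converges:
  fixes f :: "nat \<Rightarrow> 'a \<Rightarrow> real"
  assumes f: "\<And>i. square_integrable M (f i)"
    and orth: "\<And>i j. i \<noteq> j \<Longrightarrow> L2_inner M (f i) (f j) = 0"
    and sum: "summable (\<lambda>i. (L2_norm M (f i))\<^sup>2)"
  shows "\<exists>W. L2_tendsto M (\<lambda>n x. \<Sum>i<n. f i x) W"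
proof (rule L2_complete)
  show "square_integrable M (\<lambda>x. \<Sum>i<n. f i x)" for n by (intro square_integrable_sum f)
  have d: "L2_norm M (\<lambda>x. (\<Sum>i<m. f i x) - (\<Sum>i<n. f i x)) = sqrt (\<Sum>i=n..<m. (L2_norm M (f i))\<^sup>2)" if "n \<le> m" for m n
  proof -
    have "(\<lambda>x. (\<Sum>i<m. f i x) - (\<Sum>i<n. f i x)) = (\<lambda>x. \<Sum>i=n..<m. f i x)"
      using sum_diff_nat_ivl[of 0 n m] that by (auto simp: lessThan_atLeast0)
    moreover have "(L2_norm M (\<lambda>x. \<Sum>i=n..<m. f i x))\<^sup>2 = (\<Sum>i=n..<m. (L2_norm M (f i))\<^sup>2)"
      by (rule L2_norm_combination_power2) (simp_all add: f orth)
    ultimately show ?thesis by (simp add: real_sqrt_unique)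
  qed
  fix e :: real assume "e > 0"
  hence "e\<^sup>2 > 0" by simp
  then obtain N where N: "\<And>m n. m \<ge> N \<Longrightarrow> norm (\<Sum>i=m..<n. (L2_norm M (f i))\<^sup>2) < e\<^sup>2"
    using sum unfolding summable_Cauchy by blast
  have le: "L2_norm M (\<lambda>x. (\<Sum>i<m. f i x) - (\<Sum>i<n. f i x)) < e" if "n \<ge> N" "n \<le> m" for m n
  proof -
    have "(\<Sum>i=n..<m. (L2_norm M (f i))\<^sup>2) < e\<^sup>2" using N[OF that(1), of m] by simp
    hence "sqrt (\<Sum>i=n..<m. (L2_norm M (f i))\<^sup>2) < sqrt (e\<^sup>2)" by (rule real_sqrt_less_mono)
    thus ?thesis unfolding d[OF that(2)] using \<open>e > 0\<close> by simp
  qed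
  show "\<exists>N. \<forall>m\<ge>N. \<forall>n\<ge>N. L2_norm M (\<lambda>x. (\<Sum>i<m. f i x) - (\<Sum>i<n. f i x)) < e"
  proof (intro exI[of _ N] allI impI)
    fix m n assume mn: "m \<ge> N" "n \<ge> N"
    show "L2_norm M (\<lambda>x. (\<Sum>i<m. f i x) - (\<Sum>i<n. f i x)) < e"
    proof (cases "n \<le> m")
      case True thus ?thesis by (rule le[OF mn(2)])
    next
      case False
      hence "L2_norm M (\<lambda>x. (\<Sum>i<n. f i x) - (\<Sum>i<m. f i x)) < e" by (intro le mn) simp
      thus ?thesis using L2_norm_minus_commute[of M "\<lambda>x. \<Sum>i<m. f i x" "\<lambda>x. \<Sum>i<n. f i x"] by simp
    qed
  qed
qed

lemma L2_tendsto_AE_unique: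
  assumes lim: "L2_tendsto M V W" and ae: "AE x in M. (\<lambda>n. V n x) \<longlonglongrightarrow> W' x"
    and [measurable]: "W' \<in> borel_measurable M"
  shows "AE x in M. W' x = W x"
proof -
  have [measurable]: "V n \<in> borel_measurable M" "W \<in> borel_measurable M" for n
    using L2_tendstoD(1,2)[OF lim] by (auto intro: square_integrable_measurable)
  have "(\<integral>\<^sup>+x. ennreal ((W' x - W x)\<^sup>2) \<partial>M) = (\<integral>\<^sup>+x. liminf (\<lambda>n. ennreal ((V n x - W x)\<^sup>2)) \<partial>M)"
  proof (rule nn_integral_cong_AE)
    show "AE x in M. ennreal ((W' x - W x)\<^sup>2) = liminf (\<lambda>n. ennreal ((V n x - W x)\<^sup>2))"
      using ae
    proof eventually_elim
      case (elim x)
      have "(\<lambda>n. ennreal ((V n x - W x)\<^sup>2)) \<longlonglongrightarrow> ennreal ((W' x - W x)\<^sup>2)"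
        by (intro tendsto_intros elim tendsto_ennrealI)
      thus ?case using lim_imp_Liminf by (metis trivial_limit_sequentially)
    qed
  qed
  also have "\<dots> \<le> liminf (\<lambda>n. \<integral>\<^sup>+x. ennreal ((V n x - W x)\<^sup>2) \<partial>M)"
    by (rule nn_integral_liminf) simp
  also have "\<dots> = 0"
    using lim by (intro lim_imp_Liminf) (simp_all add: L2_tendsto_iff_nn L2_tendstoD[OF lim])
  finally have "(\<integral>\<^sup>+x. ennreal ((W' x - W x)\<^sup>2) \<partial>M) = 0" by simp
  hence "AE x in M. ennreal ((W' x - W x)\<^sup>2) = 0"
    by (subst (asm) nn_integral_0_iff_AE) simp_all
  thus ?thesis by eventually_elim simp
qed

lemma L2_tendsto_dominated:
  assumes f: "\<And>n. f n \<in> borel_measurable M" and g: "g \<in> borel_measurable M"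
    and h: "square_integrable M h"
    and b: "\<And>n x. x \<in> space M \<Longrightarrow> \<bar>f n x\<bar> \<le> h x"
    and lim: "\<And>x. x \<in> space M \<Longrightarrow> (\<lambda>n. f n x) \<longlonglongrightarrow> g x"
  shows "L2_tendsto M f g"
proof -
  have gb: "\<bar>g x\<bar> \<le> h x" if "x \<in> space M" for x
    by (rule LIMSEQ_le_const2[OF tendsto_rabs[OF lim[OF that]]]) (use b[OF that] in auto)
  have dom: "square_integrable M k" if k: "k \<in> borel_measurable M" "\<And>x. x \<in> space M \<Longrightarrow> \<bar>k x\<bar> \<le> h x" for k
  proof -
    have "integrable M (\<lambda>x. (k x)\<^sup>2)"
    proof (rule Bochner_Integration.integrable_bound)
      show "integrable M (\<lambda>x. (h x)\<^sup>2)" using h by (simp add: square_integrable_def)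
      show "AE x in M. norm ((k x)\<^sup>2) \<le> norm ((h x)\<^sup>2)"
      proof (rule AE_I2)
        fix x assume "x \<in> space M"
        from power_mono[OF k(2)[OF this], of 2] show "norm ((k x)\<^sup>2) \<le> norm ((h x)\<^sup>2)" by simp
      qed
    qed (use k in simp)
    thus ?thesis using k by (simp add: square_integrable_def)
  qed
  have sf: "square_integrable M (f n)" for n by (rule dom[OF f b])
  have sg: "square_integrable M g" by (rule dom[OF g gb])
  have "(\<lambda>n. \<integral>x. (f n x - g x)\<^sup>2 \<partial>M) \<longlonglongrightarrow> (\<integral>x. 0 \<partial>M)"
  proof (rule integral_dominated_convergence[where w = "\<lambda>x. 4 * (h x)\<^sup>2"])
    show "integrable M (\<lambda>x. 4 * (h x)\<^sup>2)" using h by (simp add: square_integrable_def)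
    show "AE x in M. (\<lambda>n. (f n x - g x)\<^sup>2) \<longlonglongrightarrow> 0"
    proof (rule AE_I2)
      fix x assume "x \<in> space M"
      from tendsto_power[OF tendsto_diff[OF lim[OF this] tendsto_const[of "g x"]], of 2]
      show "(\<lambda>n. (f n x - g x)\<^sup>2) \<longlonglongrightarrow> 0" by simp
    qed
    show "AE x in M. norm ((f n x - g x)\<^sup>2) \<le> 4 * (h x)\<^sup>2" for n
    proof (rule AE_I2)
      fix x assume x: "x \<in> space M"
      have "\<bar>f n x - g x\<bar> \<le> 2 * h x" using b[OF x, of n] gb[OF x] by linarith
      from power_mono[OF this, of 2] show "norm ((f n x - g x)\<^sup>2) \<le> 4 * (h x)\<^sup>2"
        by (simp add: power_mult_distrib)
    qed
  qed (use f g in simp_all)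
  hence "(\<lambda>n. sqrt (\<integral>x. (f n x - g x)\<^sup>2 \<partial>M)) \<longlonglongrightarrow> sqrt 0" by (intro tendsto_real_sqrt) simp
  hence "(\<lambda>n. L2_norm M (\<lambda>x. f n x - g x)) \<longlonglongrightarrow> 0" by (simp add: L2_norm_def)
  thus ?thesis using sf sg by (simp add: L2_tendsto_def)
qed

lemma (in prob_space) integral_abs_le_L2_norm:
  assumes "square_integrable M f" shows "(\<integral>x. \<bar>f x\<bar> \<partial>M) \<le> L2_norm M f"
proof -
  have "\<bar>L2_inner M (\<lambda>x. \<bar>f x\<bar>) (\<lambda>_. 1)\<bar> \<le> L2_norm M (\<lambda>x. \<bar>f x\<bar>) * L2_norm M (\<lambda>_. 1)"
    by (intro L2_Cauchy_Schwarz square_integrable_abs assms square_integrable_bounded[where C = 1]) auto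
  thus ?thesis by (simp add: L2_inner_def L2_norm_def prob_space)
qed

lemma (in prob_space) square_integrable_AE_bounded:
  assumes "f \<in> borel_measurable M" "AE x in M. \<bar>f x\<bar> \<le> C"
  shows "square_integrable M f"
proof -
  have "integrable M (\<lambda>x. (f x)\<^sup>2)"
  proof (rule integrable_const_bound[where B = "C\<^sup>2"])
    show "AE x in M. norm ((f x)\<^sup>2) \<le> C\<^sup>2"
      using assms(2)
    proof eventually_elim
      case (elim x)
      from power_mono[OF this, of 2] show ?case by simp
    qed
  qed (use assms in simp)
  thus ?thesis using assms by (simp add: square_integrable_def)
qed

section \<open>Laws determined by characteristic functions\<close>

text \<open>Levy's uniqueness theorem for the laws of \<open>X\<close> and \<open>X'\<close> under the probability measures with
  densities proportional to \<open>w\<close> and \<open>w'\<close>; the hypothesis at \<open>t = 0\<close> says that the total masses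
  agree.\<close>

lemma integral_weighted_indicator_eqI:
  fixes w :: "'a \<Rightarrow> real" and w' :: "'b \<Rightarrow> real"
  assumes "prob_space M" "prob_space N"
    and [measurable]: "w \<in> borel_measurable M" "X \<in> borel_measurable M"
      "w' \<in> borel_measurable N" "X' \<in> borel_measurable N"
    and w: "\<And>x. 0 \<le> w x" "\<And>x. w x \<le> C" and w': "\<And>x. 0 \<le> w' x" "\<And>x. w' x \<le> C"
    and eq: "\<And>t. (\<integral>x. w x *\<^sub>R iexp (t * X x) \<partial>M) = (\<integral>x. w' x *\<^sub>R iexp (t * X' x) \<partial>N)"
    and [measurable]: "A \<in> sets borel"
  shows "(\<integral>x. w x * indicator A (X x) \<partial>M) = (\<integral>x. w' x * indicator A (X' x) \<partial>N)"
proof -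
  interpret M: prob_space M by fact
  interpret N: prob_space N by fact
  have iw: "integrable M w" by (rule M.integrable_const_bound[where B = C]) (use w in auto)
  have iw': "integrable N w'" by (rule N.integrable_const_bound[where B = C]) (use w' in auto)
  define m where "m = (\<integral>x. w x \<partial>M)"
  have "(\<integral>x. complex_of_real (w x) \<partial>M) = (\<integral>x. complex_of_real (w' x) \<partial>N)"
    using eq[of 0] by (simp add: scaleR_conv_of_real)
  hence m': "m = (\<integral>x. w' x \<partial>N)" unfolding m_def by (simp add: of_real_eq_iff)
  have m0: "m \<ge> 0" unfolding m_def using w by (simp add: Bochner_Integration.integral_nonneg)
  show ?thesis
  proof (cases "m = 0")
    case True
    have "AE x in M. w x = 0" using iw True w unfolding m_def by (subst integral_nonneg_eq_0_iff_AE[symmetric]) auto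
    hence "(\<integral>x. w x * indicator A (X x) \<partial>M) = (\<integral>x. 0 \<partial>M)" by (intro integral_cong_AE) auto
    moreover have "AE x in N. w' x = 0" using iw' True w' unfolding m' by (subst integral_nonneg_eq_0_iff_AE[symmetric]) auto
    hence "(\<integral>x. w' x * indicator A (X' x) \<partial>N) = (\<integral>x. 0 \<partial>N)" by (intro integral_cong_AE) auto
    ultimately show ?thesis by simp
  next
    case False
    with m0 have mpos: "m > 0" by simp
    define \<rho> where "\<rho> = distr (density M (\<lambda>x. ennreal (w x / m))) borel X"
    define \<rho>' where "\<rho>' = distr (density N (\<lambda>x. ennreal (w' x / m))) borel X'"
    have "prob_space (density M (\<lambda>x. ennreal (w x / m)))"
    proof (rule prob_spaceI)
      show "emeasure (density M (\<lambda>x. ennreal (w x / m))) (space (density M (\<lambda>x. ennreal (w x / m)))) = 1"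
        using mpos w iw by (simp add: emeasure_density nn_integral_eq_integral flip: m_def cong: nn_integral_cong)
    qed
    hence "real_distribution \<rho>" unfolding \<rho>_def by (intro prob_space.real_distribution_distr) auto
    moreover have "prob_space (density N (\<lambda>x. ennreal (w' x / m)))"
    proof (rule prob_spaceI)
      show "emeasure (density N (\<lambda>x. ennreal (w' x / m))) (space (density N (\<lambda>x. ennreal (w' x / m)))) = 1"
        using mpos w' iw' by (simp add: emeasure_density nn_integral_eq_integral flip: m' cong: nn_integral_cong)
    qed
    hence "real_distribution \<rho>'" unfolding \<rho>'_def by (intro prob_space.real_distribution_distr) auto
    moreover have "char \<rho> = char \<rho>'"
    proof
      fix t
      have "char \<rho> t = (\<integral>x. (w x / m) *\<^sub>R iexp (t * X x) \<partial>M)"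
        unfolding char_def \<rho>_def using w mpos by (subst integral_distr) (auto simp: integral_density)
      also have "\<dots> = (1 / m) *\<^sub>R (\<integral>x. w x *\<^sub>R iexp (t * X x) \<partial>M)"
        by (simp flip: integral_scaleR_right)
      also have "\<dots> = (1 / m) *\<^sub>R (\<integral>x. w' x *\<^sub>R iexp (t * X' x) \<partial>N)" by (simp only: eq)
      also have "\<dots> = (\<integral>x. (w' x / m) *\<^sub>R iexp (t * X' x) \<partial>N)"
        by (simp flip: integral_scaleR_right)
      also have "\<dots> = char \<rho>' t"
        unfolding char_def \<rho>'_def using w' mpos by (subst integral_distr) (auto simp: integral_density)
      finally show "char \<rho> t = char \<rho>' t" .
    qed
    ultimately have "\<rho> = \<rho>'" by (rule Levy_uniqueness)
    hence "(\<integral>x. indicator A x \<partial>\<rho>) = (\<integral>x. indicator A x \<partial>\<rho>' :: real)" by simp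
    also have "(\<integral>x. indicator A x \<partial>\<rho>) = (\<integral>x. (w x / m) *\<^sub>R (indicator A (X x) :: real) \<partial>M)"
      unfolding \<rho>_def using w mpos by (subst integral_distr) (auto simp: integral_density)
    also have "(\<integral>x. indicator A x \<partial>\<rho>') = (\<integral>x. (w' x / m) *\<^sub>R (indicator A (X' x) :: real) \<partial>N)"
      unfolding \<rho>'_def using w' mpos by (subst integral_distr) (auto simp: integral_density)
    finally show ?thesis using mpos by (simp add: divide_simps)
  qed
qed

lemma iexp_add: "iexp (x + y) = iexp x * iexp y"
  by (simp add: exp_add ring_distribs)

lemma integral_combination3:
  fixes f g h :: "'a \<Rightarrow> complex"
  assumes "integrable M f" "integrable M g" "integrable M h"
  shows "(\<integral>x. f x + a * g x + b * h x \<partial>M) = (\<integral>x. f x \<partial>M) + a * (\<integral>x. g x \<partial>M) + b * (\<integral>x. h x \<partial>M)"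
  using assms by simp

lemma integral_Complex:
  fixes f g :: "'a \<Rightarrow> real"
  assumes "integrable M f" "integrable M g"
  shows "(\<integral>x. complex_of_real (f x) + \<i> * complex_of_real (g x) \<partial>M)
    = complex_of_real (\<integral>x. f x \<partial>M) + \<i> * complex_of_real (\<integral>x. g x \<partial>M)"
  using assms by simp

lemma iexp_eq_Complex: "iexp s = Complex (cos s) (sin s)"
  by (simp add: cis_conv_exp[symmetric] complex_eq_iff)

lemma cos_sin_via_iexp:
  "complex_of_real (1 + cos s) = 1 + (iexp s + iexp (- s)) / 2"
  "complex_of_real (1 + sin s) = 1 + (iexp s - iexp (- s)) / (2 * \<i>)"
  unfolding iexp_eq_Complex by (simp_all add: complex_eq_iff)

text \<open>Multivariate version of Levy's uniqueness theorem, obtained from the univariate one by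
  treating the coordinates one after the other: the exponentials in the coordinates of \<open>K\<close> have
  already been replaced by indicators. In the step the remaining exponentials, which are complex,
  are removed with the help of the nonnegative weights \<open>1 + cos\<close> and \<open>1 + sin\<close>.\<close>

lemma iexp_combination_eq_imp_indicator_eq:
  fixes X :: "'i \<Rightarrow> 'a \<Rightarrow> real" and X' :: "'i \<Rightarrow> 'b \<Rightarrow> real"
  assumes M: "prob_space M" and N: "prob_space N" and J: "finite J"
    and X: "\<And>i. i \<in> J \<Longrightarrow> X i \<in> borel_measurable M"
    and X': "\<And>i. i \<in> J \<Longrightarrow> X' i \<in> borel_measurable N"
    and eq: "\<And>c. (\<integral>x. iexp (\<Sum>i\<in>J. c i * X i x) \<partial>M) = (\<integral>x. iexp (\<Sum>i\<in>J. c i * X' i x) \<partial>N)"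
    and K: "K \<subseteq> J" and A: "\<And>i. A i \<in> sets borel"
  shows "(\<integral>x. (\<Prod>i\<in>K. indicator (A i) (X i x)) *\<^sub>R iexp (\<Sum>i\<in>J-K. c i * X i x) \<partial>M)
    = (\<integral>x. (\<Prod>i\<in>K. indicator (A i) (X' i x)) *\<^sub>R iexp (\<Sum>i\<in>J-K. c i * X' i x) \<partial>N)"
proof -
  have "finite K" using J K finite_subset by blast
  thus ?thesis using K
  proof (induction K arbitrary: c)
    case empty
    then show ?case using eq[of c] by simp
  next
    case (insert j K)
    interpret M: prob_space M by fact
    interpret N: prob_space N by fact
    have j: "j \<in> J" "j \<notin> K" "J - K = insert j (J - insert j K)" "j \<notin> J - insert j K"
      and KJ: "K \<subseteq> J" using insert by auto
    define h where "h x = (\<Prod>i\<in>K. indicator (A i) (X i x) :: real)" for x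
    define h' where "h' x = (\<Prod>i\<in>K. indicator (A i) (X' i x) :: real)" for x
    define s where "s x = (\<Sum>i\<in>J - insert j K. c i * X i x)" for x
    define s' where "s' x = (\<Sum>i\<in>J - insert j K. c i * X' i x)" for x
    have "(\<lambda>x. indicator (A i) (X i x) :: real) \<in> borel_measurable M" if "i \<in> K" for i
      by (rule measurable_compose[OF X borel_measurable_indicator]) (use that KJ A in auto)
    hence mh [measurable]: "h \<in> borel_measurable M"
      unfolding h_def by (rule borel_measurable_prod)
    have "(\<lambda>x. c i * X i x) \<in> borel_measurable M" if "i \<in> J - insert j K" for i
      using that by (intro borel_measurable_times borel_measurable_const X) simp
    hence ms [measurable]: "s \<in> borel_measurable M"
      unfolding s_def by (rule borel_measurable_sum)
    have mX [measurable]: "X j \<in> borel_measurable M" by (rule X[OF j(1)])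
    have "(\<lambda>x. indicator (A i) (X' i x) :: real) \<in> borel_measurable N" if "i \<in> K" for i
      by (rule measurable_compose[OF X' borel_measurable_indicator]) (use that KJ A in auto)
    hence mh' [measurable]: "h' \<in> borel_measurable N"
      unfolding h'_def by (rule borel_measurable_prod)
    have "(\<lambda>x. c i * X' i x) \<in> borel_measurable N" if "i \<in> J - insert j K" for i
      using that by (intro borel_measurable_times borel_measurable_const X') simp
    hence ms' [measurable]: "s' \<in> borel_measurable N"
      unfolding s'_def by (rule borel_measurable_sum)
    have mX' [measurable]: "X' j \<in> borel_measurable N" by (rule X'[OF j(1)])
    have h01: "0 \<le> h x" "h x \<le> 1" for x
      unfolding h_def by (auto intro!: prod_nonneg prod_le_1 simp: indicator_def)
    have h01': "0 \<le> h' x" "h' x \<le> 1" for x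
      unfolding h'_def by (auto intro!: prod_nonneg prod_le_1 simp: indicator_def)
    have IH: "(\<integral>x. h x *\<^sub>R iexp (t * X j x + a * s x) \<partial>M) = (\<integral>x. h' x *\<^sub>R iexp (t * X' j x + a * s' x) \<partial>N)" for t a
    proof -
      let ?c = "(\<lambda>i. a * c i)(j := t)"
      have "(\<Sum>i\<in>J - K. ?c i * Y i) = t * Y j + a * (\<Sum>i\<in>J - insert j K. c i * Y i)" for Y :: "'i \<Rightarrow> real"
      proof -
        have "(\<Sum>i\<in>J - K. ?c i * Y i) = ?c j * Y j + (\<Sum>i\<in>J - insert j K. ?c i * Y i)"
          unfolding j(3) by (rule sum.insert) (use J in auto)
        also have "(\<Sum>i\<in>J - insert j K. ?c i * Y i) = (\<Sum>i\<in>J - insert j K. a * (c i * Y i))"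
          by (intro sum.cong) auto
        finally show ?thesis by (simp add: sum_distrib_left)
      qed
      thus ?thesis using insert.IH[OF KJ, of ?c] unfolding h_def h'_def s_def s'_def by simp
    qed
    have intM: "integrable M (\<lambda>x. h x *\<^sub>R iexp (f x))" if [measurable]: "f \<in> borel_measurable M" for f
      by (rule M.integrable_const_bound[where B = 1]) (use h01 in \<open>auto simp: norm_mult\<close>)
    have intN: "integrable N (\<lambda>x. h' x *\<^sub>R iexp (f x))" if [measurable]: "f \<in> borel_measurable N" for f
      by (rule N.integrable_const_bound[where B = 1]) (use h01' in \<open>auto simp: norm_mult\<close>)
    have expand: "(h0 * (1 + cos s0)) *\<^sub>R iexp (t * x0) = h0 *\<^sub>R iexp (t * x0 + 0 * s0)
        + (1/2) * (h0 *\<^sub>R iexp (t * x0 + 1 * s0)) + (1/2) * (h0 *\<^sub>R iexp (t * x0 + (-1) * s0))"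
      "(h0 * (1 + sin s0)) *\<^sub>R iexp (t * x0) = h0 *\<^sub>R iexp (t * x0 + 0 * s0)
        + (1/(2*\<i>)) * (h0 *\<^sub>R iexp (t * x0 + 1 * s0)) + (- 1/(2*\<i>)) * (h0 *\<^sub>R iexp (t * x0 + (-1) * s0))"
      for h0 s0 t x0 :: real
    proof -
      show "(h0 * (1 + cos s0)) *\<^sub>R iexp (t * x0) = h0 *\<^sub>R iexp (t * x0 + 0 * s0)
        + (1/2) * (h0 *\<^sub>R iexp (t * x0 + 1 * s0)) + (1/2) * (h0 *\<^sub>R iexp (t * x0 + (-1) * s0))"
        unfolding scaleR_conv_of_real of_real_mult cos_sin_via_iexp iexp_add
        by (simp add: algebra_simps add_divide_distrib)
      show "(h0 * (1 + sin s0)) *\<^sub>R iexp (t * x0) = h0 *\<^sub>R iexp (t * x0 + 0 * s0)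
        + (1/(2*\<i>)) * (h0 *\<^sub>R iexp (t * x0 + 1 * s0)) + (- 1/(2*\<i>)) * (h0 *\<^sub>R iexp (t * x0 + (-1) * s0))"
        unfolding scaleR_conv_of_real of_real_mult cos_sin_via_iexp iexp_add
        by (simp add: algebra_simps add_divide_distrib diff_divide_distrib)
    qed
    let ?I = "indicator (A j) :: real \<Rightarrow> real"
    have Am [measurable]: "A j \<in> sets borel" by (rule A)
    have bnd: "a * b \<le> 2" if "0 \<le> a" "a \<le> 1" "0 \<le> b" "b \<le> 2" for a b :: real
      using mult_mono[of a 1 b 2] that by simp
    have w0: "(\<integral>x. h x * ?I (X j x) \<partial>M) = (\<integral>x. h' x * ?I (X' j x) \<partial>N)"
    proof (rule integral_weighted_indicator_eqI[OF M N, where C = 1])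
      show "(\<integral>x. h x *\<^sub>R iexp (t * X j x) \<partial>M) = (\<integral>x. h' x *\<^sub>R iexp (t * X' j x) \<partial>N)" for t
        using IH[of t 0] by (simp only: mult_zero_left add_0_right)
    qed (fact mh mh' mX mX' h01 h01' A)+
    have w1: "(\<integral>x. (h x * (1 + cos (s x))) * ?I (X j x) \<partial>M) = (\<integral>x. (h' x * (1 + cos (s' x))) * ?I (X' j x) \<partial>N)"
    proof (rule integral_weighted_indicator_eqI[OF M N, where C = 2])
      show "(\<integral>x. (h x * (1 + cos (s x))) *\<^sub>R iexp (t * X j x) \<partial>M) = (\<integral>x. (h' x * (1 + cos (s' x))) *\<^sub>R iexp (t * X' j x) \<partial>N)" for t
        unfolding expand by (subst integral_combination3, (rule intM; measurable)+,
            subst integral_combination3, (rule intN; measurable)+) (simp only: IH)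
      show "h x * (1 + cos (s x)) \<le> 2" for x by (rule bnd) (use h01[of x] cos_le_one[of "s x"] cos_ge_minus_one[of "s x"] in linarith)+
      show "h' x * (1 + cos (s' x)) \<le> 2" for x by (rule bnd) (use h01'[of x] cos_le_one[of "s' x"] cos_ge_minus_one[of "s' x"] in linarith)+
      show "0 \<le> h x * (1 + cos (s x))" for x using h01(1)[of x] cos_ge_minus_one[of "s x"] by (intro mult_nonneg_nonneg) linarith+
      show "0 \<le> h' x * (1 + cos (s' x))" for x using h01'(1)[of x] cos_ge_minus_one[of "s' x"] by (intro mult_nonneg_nonneg) linarith+
    qed measurable
    have w2: "(\<integral>x. (h x * (1 + sin (s x))) * ?I (X j x) \<partial>M) = (\<integral>x. (h' x * (1 + sin (s' x))) * ?I (X' j x) \<partial>N)"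
    proof (rule integral_weighted_indicator_eqI[OF M N, where C = 2])
      show "(\<integral>x. (h x * (1 + sin (s x))) *\<^sub>R iexp (t * X j x) \<partial>M) = (\<integral>x. (h' x * (1 + sin (s' x))) *\<^sub>R iexp (t * X' j x) \<partial>N)" for t
        unfolding expand by (subst integral_combination3, (rule intM; measurable)+,
            subst integral_combination3, (rule intN; measurable)+) (simp only: IH)
      show "h x * (1 + sin (s x)) \<le> 2" for x by (rule bnd) (use h01[of x] sin_le_one[of "s x"] sin_ge_minus_one[of "s x"] in linarith)+
      show "h' x * (1 + sin (s' x)) \<le> 2" for x by (rule bnd) (use h01'[of x] sin_le_one[of "s' x"] sin_ge_minus_one[of "s' x"] in linarith)+
      show "0 \<le> h x * (1 + sin (s x))" for x using h01(1)[of x] sin_ge_minus_one[of "s x"] by (intro mult_nonneg_nonneg) linarith+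
      show "0 \<le> h' x * (1 + sin (s' x))" for x using h01'(1)[of x] sin_ge_minus_one[of "s' x"] by (intro mult_nonneg_nonneg) linarith+
    qed measurable
    have bM: "integrable M (\<lambda>x. h x * f (s x) * ?I (X j x))" if "\<And>y. \<bar>f y\<bar> \<le> 1" and [measurable]: "f \<in> borel_measurable borel" for f
    proof (rule M.integrable_const_bound[where B = 1])
      show "AE x in M. norm (h x * f (s x) * ?I (X j x)) \<le> 1"
      proof (rule AE_I2)
        fix x have "\<bar>h x\<bar> * \<bar>f (s x)\<bar> \<le> 1 * 1" using h01[of x] that(1)[of "s x"] by (intro mult_mono) auto
        thus "norm (h x * f (s x) * ?I (X j x)) \<le> 1" by (auto simp: abs_mult indicator_def)
      qed
    qed auto
    have bN: "integrable N (\<lambda>x. h' x * f (s' x) * ?I (X' j x))" if "\<And>y. \<bar>f y\<bar> \<le> 1" and [measurable]: "f \<in> borel_measurable borel" for f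
    proof (rule N.integrable_const_bound[where B = 1])
      show "AE x in N. norm (h' x * f (s' x) * ?I (X' j x)) \<le> 1"
      proof (rule AE_I2)
        fix x have "\<bar>h' x\<bar> * \<bar>f (s' x)\<bar> \<le> 1 * 1" using h01'[of x] that(1)[of "s' x"] by (intro mult_mono) auto
        thus "norm (h' x * f (s' x) * ?I (X' j x)) \<le> 1" by (auto simp: abs_mult indicator_def)
      qed
    qed auto
    have c: "(\<integral>x. h x * cos (s x) * ?I (X j x) \<partial>M) = (\<integral>x. h' x * cos (s' x) * ?I (X' j x) \<partial>N)"
    proof -
      have "(\<integral>x. (h x * (1 + cos (s x))) * ?I (X j x) \<partial>M) = (\<integral>x. h x * ?I (X j x) \<partial>M) + (\<integral>x. h x * cos (s x) * ?I (X j x) \<partial>M)"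
        using bM[of cos] bM[of "\<lambda>_. 1"] by (subst Bochner_Integration.integral_add[symmetric]) (simp_all add: algebra_simps)
      moreover have "(\<integral>x. (h' x * (1 + cos (s' x))) * ?I (X' j x) \<partial>N) = (\<integral>x. h' x * ?I (X' j x) \<partial>N) + (\<integral>x. h' x * cos (s' x) * ?I (X' j x) \<partial>N)"
        using bN[of cos] bN[of "\<lambda>_. 1"] by (subst Bochner_Integration.integral_add[symmetric]) (simp_all add: algebra_simps)
      ultimately show ?thesis using w0 w1 by linarith
    qed
    have d: "(\<integral>x. h x * sin (s x) * ?I (X j x) \<partial>M) = (\<integral>x. h' x * sin (s' x) * ?I (X' j x) \<partial>N)"
    proof -
      have "(\<integral>x. (h x * (1 + sin (s x))) * ?I (X j x) \<partial>M) = (\<integral>x. h x * ?I (X j x) \<partial>M) + (\<integral>x. h x * sin (s x) * ?I (X j x) \<partial>M)"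
        using bM[of sin] bM[of "\<lambda>_. 1"] by (subst Bochner_Integration.integral_add[symmetric]) (simp_all add: algebra_simps)
      moreover have "(\<integral>x. (h' x * (1 + sin (s' x))) * ?I (X' j x) \<partial>N) = (\<integral>x. h' x * ?I (X' j x) \<partial>N) + (\<integral>x. h' x * sin (s' x) * ?I (X' j x) \<partial>N)"
        using bN[of sin] bN[of "\<lambda>_. 1"] by (subst Bochner_Integration.integral_add[symmetric]) (simp_all add: algebra_simps)
      ultimately show ?thesis using w0 w2 by linarith
    qed
    have split: "(h0 * i0) *\<^sub>R iexp s0 = complex_of_real (h0 * cos s0 * i0) + \<i> * complex_of_real (h0 * sin s0 * i0)"
      for h0 i0 s0 :: real unfolding iexp_eq_Complex by (simp add: complex_eq_iff)
    have "(\<integral>x. (h x * ?I (X j x)) *\<^sub>R iexp (s x) \<partial>M) = (\<integral>x. (h' x * ?I (X' j x)) *\<^sub>R iexp (s' x) \<partial>N)"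
      unfolding split
      by (subst integral_Complex, (rule bM; simp)+, subst integral_Complex, (rule bN; simp)+) (simp only: c d)
    thus ?case using insert.hyps by (simp add: h_def h'_def s_def s'_def mult.commute)
  qed
qed

text \<open>Cylinder sets determine a measure on the product, and the case \<open>K = J\<close> of the preceding lemma
  compares them.\<close>

theorem equal_in_law_iexpI:
  fixes Z :: "'e \<Rightarrow> 'a \<Rightarrow> real" and Z' :: "'e \<Rightarrow> 'b \<Rightarrow> real"
  assumes M: "prob_space M" and N: "prob_space N"
    and Z: "\<And>e. e \<in> E \<Longrightarrow> Z e \<in> borel_measurable M"
    and Z': "\<And>e. e \<in> E \<Longrightarrow> Z' e \<in> borel_measurable N"
    and eq: "\<And>J c. finite J \<Longrightarrow> J \<subseteq> E \<Longrightarrow>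
       (\<integral>x. iexp (\<Sum>i\<in>J. c i * Z i x) \<partial>M) = (\<integral>x. iexp (\<Sum>i\<in>J. c i * Z' i x) \<partial>N)"
  shows "equal_in_law M N E Z Z'"
  unfolding equal_in_law_def
proof (rule measure_eqI_PiM_infinite)
  interpret M: prob_space M by fact
  interpret N: prob_space N by fact
  have mZ [measurable]: "(\<lambda>\<omega>. \<lambda>e\<in>E. Z e \<omega>) \<in> M \<rightarrow>\<^sub>M Pi\<^sub>M E (\<lambda>_. borel)"
    using Z by (intro measurable_restrict)
  have mZ' [measurable]: "(\<lambda>\<omega>. \<lambda>e\<in>E. Z' e \<omega>) \<in> N \<rightarrow>\<^sub>M Pi\<^sub>M E (\<lambda>_. borel)"
    using Z' by (intro measurable_restrict)
  show "finite_measure (distr M (Pi\<^sub>M E (\<lambda>_. borel)) (\<lambda>\<omega>. \<lambda>e\<in>E. Z e \<omega>))"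
    by (intro prob_space.finite_measure M.prob_space_distr mZ)
  fix J and A :: "'e \<Rightarrow> real set"
  assume J: "finite J" "J \<subseteq> E" and A: "\<And>i. i \<in> J \<Longrightarrow> A i \<in> sets borel"
  define B where "B i = (if i \<in> J then A i else {})" for i
  have B: "B i \<in> sets borel" for i using A by (auto simp: B_def)
  have ind: "(\<Prod>i\<in>J. indicator (B i) (Y i)) = (indicator {y. \<forall>i\<in>J. y i \<in> A i} Y :: real)" for Y
    using J(1) by (auto simp: indicator_def B_def prod_zero_iff intro!: prod.neutral split: if_splits)
  have *: "(\<integral>x. (\<Prod>i\<in>J. indicator (B i) (Z i x)) *\<^sub>R iexp (\<Sum>i\<in>J-J. 0 * Z i x) \<partial>M)
    = (\<integral>x. (\<Prod>i\<in>J. indicator (B i) (Z' i x)) *\<^sub>R iexp (\<Sum>i\<in>J-J. 0 * Z' i x) \<partial>N)"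
    by (rule iexp_combination_eq_imp_indicator_eq[OF M N J(1)]) (use J Z Z' eq B in auto)
  have e: "(\<integral>x. indicator {y. \<forall>i\<in>J. y i \<in> A i} (\<lambda>i. Z i x) \<partial>M)
      = (\<integral>x. indicator {y. \<forall>i\<in>J. y i \<in> A i} (\<lambda>i. Z' i x) \<partial>N :: real)"
  proof -
    have "complex_of_real (\<integral>x. indicator {y. \<forall>i\<in>J. y i \<in> A i} (\<lambda>i. Z i x) \<partial>M)
        = complex_of_real (\<integral>x. indicator {y. \<forall>i\<in>J. y i \<in> A i} (\<lambda>i. Z' i x) \<partial>N)"
      using * unfolding ind scaleR_conv_of_real Diff_cancel sum.empty
      by (simp only: of_real_0 mult_zero_right exp_zero mult_1_right integral_complex_of_real)
    thus ?thesis by (simp only: of_real_eq_iff)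
  qed
  have cyl: "measure L {x\<in>space L. \<forall>i\<in>J. Y i x \<in> A i} = (\<integral>x. indicator {y. \<forall>i\<in>J. y i \<in> A i} (\<lambda>i. Y i x) \<partial>L)"
    for L :: "'c measure" and Y
  proof -
    have "(\<integral>x. indicator {y. \<forall>i\<in>J. y i \<in> A i} (\<lambda>i. Y i x) \<partial>L)
        = (\<integral>x. indicator {x\<in>space L. \<forall>i\<in>J. Y i x \<in> A i} x \<partial>L :: real)"
      by (rule Bochner_Integration.integral_cong) (simp_all add: indicator_def)
    also have "\<dots> = measure L ({x\<in>space L. \<forall>i\<in>J. Y i x \<in> A i} \<inter> space L)" by simp
    finally show ?thesis by (simp add: Int_absorb2)
  qed
  have pre: "(\<lambda>\<omega>. \<lambda>e\<in>E. Y e \<omega>) -` prod_emb E (\<lambda>_. borel) J (Pi\<^sub>E J A) \<inter> space L = {x\<in>space L. \<forall>i\<in>J. Y i x \<in> A i}"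
    for L :: "'c measure" and Y
  proof (intro set_eqI)
    fix x
    have "(\<forall>i\<in>J. (\<lambda>e\<in>E. Y e x) i \<in> A i) \<longleftrightarrow> (\<forall>i\<in>J. Y i x \<in> A i)"
      using J(2) by (intro ball_cong refl) (simp add: subsetD)
    thus "x \<in> (\<lambda>\<omega>. \<lambda>e\<in>E. Y e \<omega>) -` prod_emb E (\<lambda>_. borel) J (Pi\<^sub>E J A) \<inter> space L
        \<longleftrightarrow> x \<in> {x\<in>space L. \<forall>i\<in>J. Y i x \<in> A i}"
      by (simp add: prod_emb_iff restrict_PiE_iff Pi_iff conj_commute del: restrict_restrict)
  qed
  have sets: "prod_emb E (\<lambda>_. borel) J (Pi\<^sub>E J A) \<in> sets (Pi\<^sub>M E (\<lambda>_. borel))"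
    using J A by (intro sets_PiM_I) auto
  show "emeasure (distr M (Pi\<^sub>M E (\<lambda>_. borel)) (\<lambda>\<omega>. \<lambda>e\<in>E. Z e \<omega>)) (prod_emb E (\<lambda>_. borel) J (Pi\<^sub>E J A)) =
    emeasure (distr N (Pi\<^sub>M E (\<lambda>_. borel)) (\<lambda>\<omega>. \<lambda>e\<in>E. Z' e \<omega>)) (prod_emb E (\<lambda>_. borel) J (Pi\<^sub>E J A))"
    by (simp add: emeasure_distr[OF mZ sets] emeasure_distr[OF mZ' sets] pre M.emeasure_eq_measure
        N.emeasure_eq_measure cyl e)
qed auto

section \<open>Diagonalising a separable kernel\<close>

definition psd_kernel :: "('x \<Rightarrow> 'x \<Rightarrow> real) \<Rightarrow> bool" where
  "psd_kernel Q \<longleftrightarrow> (\<forall>p q. Q p q = Q q p) \<and>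
     (\<forall>(n::nat) c p. 0 \<le> (\<Sum>i<n. \<Sum>j<n. c i * c j * Q (p i) (p j)))"

text \<open>Gram--Schmidt orthogonalisation of the points \<open>x 0, x 1, \<dots>\<close> in the Hilbert space
  with reproducing kernel \<open>Q\<close>, written in terms of the kernel: the \<open>l\<close>-th residual is the kernel
  of the component orthogonal to the first \<open>l\<close> points. Because \<open>a / 0 = 0\<close>, a point that depends
  linearly on its predecessors is skipped. Every quantity is obtained from values of \<open>Q\<close> by
  arithmetic operations, so that it depends measurably on any parameter on which \<open>Q\<close> does.\<close>

fun kernel_residual :: "('x \<Rightarrow> 'x \<Rightarrow> real) \<Rightarrow> (nat \<Rightarrow> 'x) \<Rightarrow> nat \<Rightarrow> 'x \<Rightarrow> 'x \<Rightarrow> real" where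
  "kernel_residual Q x 0 p q = Q p q"
| "kernel_residual Q x (Suc l) p q = kernel_residual Q x l p q -
     kernel_residual Q x l (x l) p * kernel_residual Q x l (x l) q / kernel_residual Q x l (x l) (x l)"

definition kernel_coord :: "('x \<Rightarrow> 'x \<Rightarrow> real) \<Rightarrow> (nat \<Rightarrow> 'x) \<Rightarrow> nat \<Rightarrow> 'x \<Rightarrow> real" where
  "kernel_coord Q x l p = kernel_residual Q x l (x l) p / sqrt (kernel_residual Q x l (x l) (x l))"

lemma measurable_kernel_residual:
  assumes "\<And>p q. (\<lambda>\<eta>. Q \<eta> p q) \<in> borel_measurable N"
  shows "(\<lambda>\<eta>. kernel_residual (Q \<eta>) x l p q) \<in> borel_measurable N"
proof (induction l arbitrary: p q)
  case 0
  show ?case using assms by simp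
next
  case (Suc l)
  show ?case unfolding kernel_residual.simps
    by (intro borel_measurable_diff borel_measurable_divide borel_measurable_times Suc)
qed

lemma measurable_kernel_coord:
  assumes "\<And>p q. (\<lambda>\<eta>. Q \<eta> p q) \<in> borel_measurable N"
  shows "(\<lambda>\<eta>. kernel_coord (Q \<eta>) x l p) \<in> borel_measurable N"
  unfolding kernel_coord_def
  by (intro borel_measurable_divide measurable_compose[OF _ borel_measurable_sqrt] measurable_kernel_residual assms)

lemma psd_kernel_nonneg:
  assumes "psd_kernel Q"
  shows "0 \<le> Q p p"
proof -
  have "0 \<le> (\<Sum>i<1::nat. \<Sum>j<1::nat. 1 * 1 * Q p p)"
    using assms unfolding psd_kernel_def by (elim conjE allE[of _ 1] allE[of _ "\<lambda>_. 1"] allE[of _ "\<lambda>_. p"]) auto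
  thus ?thesis by simp
qed

lemma psd_kernel_L2_inner:
  assumes "\<And>p. square_integrable M (U p)"
  shows "psd_kernel (\<lambda>p q. L2_inner M (U p) (U q))"
  unfolding psd_kernel_def
proof (intro conjI allI)
  show "L2_inner M (U p) (U q) = L2_inner M (U q) (U p)" for p q by (rule L2_inner_commute)
  fix n :: nat and c p
  have "(\<Sum>i<n. \<Sum>j<n. c i * c j * L2_inner M (U (p i)) (U (p j))) = (L2_norm M (\<lambda>x. \<Sum>i<n. c i * U (p i) x))\<^sup>2"
    unfolding L2_norm_power2 by (rule L2_inner_combination[symmetric]) (rule assms)
  thus "0 \<le> (\<Sum>i<n. \<Sum>j<n. c i * c j * L2_inner M (U (p i)) (U (p j)))" by simp
qed

lemma psd_kernel_quadratic:
  assumes "psd_kernel Q"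
  shows "0 \<le> s\<^sup>2 * Q p p + 2 * s * t * Q p q + t\<^sup>2 * Q q q"
proof -
  define c where "c = (\<lambda>i::nat. if i = 0 then s else t)"
  define r where "r = (\<lambda>i::nat. if i = 0 then p else q)"
  have "0 \<le> (\<Sum>i<2. \<Sum>j<2. c i * c j * Q (r i) (r j))"
    using assms unfolding psd_kernel_def by blast
  moreover have "Q q p = Q p q" using assms unfolding psd_kernel_def by blast
  ultimately show ?thesis
    by (simp add: c_def r_def numeral_2_eq_2 power2_eq_square algebra_simps)
qed

lemma psd_kernel_Cauchy_Schwarz:
  assumes "psd_kernel Q"
  shows "(Q p q)\<^sup>2 \<le> Q p p * Q q q"
proof (cases "Q p p = 0")
  case True
  have "Q p q = 0"
  proof (rule ccontr)
    assume ne: "Q p q \<noteq> 0"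
    have "0 \<le> 2 * (- (Q q q + 1) / (2 * Q p q)) * Q p q + Q q q"
      using psd_kernel_quadratic[OF assms, of "- (Q q q + 1) / (2 * Q p q)" p 1 q] True by simp
    also have "\<dots> = -1" using ne by (simp add: field_simps)
    finally show False by simp
  qed
  thus ?thesis using True by simp
next
  case False
  hence pos: "Q p p > 0" using psd_kernel_nonneg[OF assms, of p] by simp
  have "0 \<le> (- Q p q)\<^sup>2 * Q p p + 2 * (- Q p q) * Q p p * Q p q + (Q p p)\<^sup>2 * Q q q"
    using psd_kernel_quadratic[OF assms, of "- Q p q" p "Q p p" q] .
  hence "0 \<le> Q p p * (Q p p * Q q q - (Q p q)\<^sup>2)" by (simp add: algebra_simps power2_eq_square)
  thus ?thesis using pos by (simp add: zero_le_mult_iff)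
qed

text \<open>The quadratic form of the difference at a combination of points is the one of \<open>R\<close> at the
  same combination with its projection onto \<open>x\<close> subtracted.\<close>

lemma psd_kernel_Schur_complement:
  assumes "psd_kernel R"
  shows "psd_kernel (\<lambda>p q. R p q - R x p * R x q / R x x)"
  unfolding psd_kernel_def
proof (intro conjI allI)
  have sym: "R p q = R q p" for p q using assms unfolding psd_kernel_def by blast
  fix p q show "R p q - R x p * R x q / R x x = R q p - R x q * R x p / R x x"
    using sym[of p q] by simp
next
  have sym: "R p q = R q p" for p q using assms unfolding psd_kernel_def by blast
  fix n :: nat and c p
  define A B q where "A = R x x" and "B = (\<Sum>i<n. c i * R x (p i))"
    and "q = (\<Sum>i<n. \<Sum>j<n. c i * c j * R (p i) (p j))"
  have "(\<Sum>i<n. \<Sum>j<n. c i * c j * (R (p i) (p j) - R x (p i) * R x (p j) / R x x))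
    = q - (\<Sum>i<n. \<Sum>j<n. (c i * R x (p i)) * (c j * R x (p j)) / A)"
    unfolding q_def A_def by (simp add: algebra_simps sum_subtractf)
  also have "(\<Sum>i<n. \<Sum>j<n. (c i * R x (p i)) * (c j * R x (p j)) / A) = B * B / A"
    unfolding B_def by (simp only: sum_product sum_divide_distrib)
  finally have e: "(\<Sum>i<n. \<Sum>j<n. c i * c j * (R (p i) (p j) - R x (p i) * R x (p j) / R x x)) = q - B * B / A" .
  have "0 \<le> q - B * B / A"
  proof (cases "A = 0")
    case True
    have "0 \<le> q" using assms unfolding q_def psd_kernel_def by blast
    thus ?thesis using True by simp
  next
    case False
    define t where "t = - B / A"
    define c' p' where "c' = c(n := t)" and "p' = p(n := x)"
    have "0 \<le> (\<Sum>i<Suc n. \<Sum>j<Suc n. c' i * c' j * R (p' i) (p' j))"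
      using assms unfolding psd_kernel_def by blast
    also have "\<dots> = q + t * B + t * B + t * t * A"
      by (simp add: c'_def p'_def sum.distrib q_def A_def B_def sum_distrib_left ac_simps sym[of "p _" x])
    also have "\<dots> = q - B * B / A"
      unfolding t_def using False by (simp add: field_simps)
    finally show ?thesis .
  qed
  thus "0 \<le> (\<Sum>i<n. \<Sum>j<n. c i * c j * (R (p i) (p j) - R x (p i) * R x (p j) / R x x))"
    using e by simp
qed

lemma psd_kernel_residual:
  assumes "psd_kernel Q"
  shows "psd_kernel (kernel_residual Q x l)"
proof (induction l)
  case 0
  have "kernel_residual Q x 0 = Q" by (intro ext) simp
  thus ?case using assms by simp
next
  case (Suc l)
  have "kernel_residual Q x (Suc l) = (\<lambda>p q. kernel_residual Q x l p q -
     kernel_residual Q x l (x l) p * kernel_residual Q x l (x l) q / kernel_residual Q x l (x l) (x l))"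
    by (intro ext) simp
  thus ?case using psd_kernel_Schur_complement[OF Suc, of "x l"] by simp
qed

lemma kernel_eq_coords_plus_residual:
  assumes "psd_kernel Q"
  shows "Q p q = (\<Sum>i<l. kernel_coord Q x i p * kernel_coord Q x i q) + kernel_residual Q x l p q"
proof (induction l)
  case (Suc l)
  have "0 \<le> kernel_residual Q x l (x l) (x l)"
    by (rule psd_kernel_nonneg[OF psd_kernel_residual[OF assms]])
  hence "kernel_coord Q x l p * kernel_coord Q x l q
    = kernel_residual Q x l (x l) p * kernel_residual Q x l (x l) q / kernel_residual Q x l (x l) (x l)"
    by (simp add: kernel_coord_def)
  thus ?case using Suc by simp
qed simp

text \<open>Step \<open>n\<close> removes the point \<open>x n\<close>. If the residual of this point already vanishes on the
  diagonal, it is zero by the Cauchy--Schwarz inequality.\<close>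

lemma kernel_residual_eq_0:
  assumes "psd_kernel Q" "n < l"
  shows "kernel_residual Q x l (x n) p = 0"
proof -
  have "kernel_residual Q x (Suc n + k) (x n) p = 0" for k p
  proof (induction k arbitrary: p)
    case 0
    have "kernel_residual Q x n (x n) p = 0" if "kernel_residual Q x n (x n) (x n) = 0"
      using psd_kernel_Cauchy_Schwarz[OF psd_kernel_residual[OF assms(1), of x n], of "x n" p] that by simp
    thus ?case by (cases "kernel_residual Q x n (x n) (x n) = 0") simp_all
  next
    case (Suc k)
    have "kernel_residual Q x (Suc n + k) (x (Suc n + k)) (x n)
        = kernel_residual Q x (Suc n + k) (x n) (x (Suc n + k))"
      using psd_kernel_residual[OF assms(1)] unfolding psd_kernel_def by blast
    moreover have "kernel_residual Q x (Suc n + Suc k) (x n) p = kernel_residual Q x (Suc n + k) (x n) p -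
     kernel_residual Q x (Suc n + k) (x (Suc n + k)) (x n) * kernel_residual Q x (Suc n + k) (x (Suc n + k)) p
       / kernel_residual Q x (Suc n + k) (x (Suc n + k)) (x (Suc n + k))"
      by (simp only: add_Suc_right kernel_residual.simps)
    ultimately show ?case by (simp only: Suc)
  qed
  from this[of "l - Suc n"] show ?thesis using assms(2) by simp
qed

text \<open>The residual at \<open>p\<close> is the squared distance of \<open>p\<close> from the span of the first \<open>l\<close> points, one of
  which is \<open>x n\<close>.\<close>

lemma kernel_residual_le_dist:
  assumes "psd_kernel Q" "n < l"
  shows "kernel_residual Q x l p p \<le> Q p p - 2 * Q p (x n) + Q (x n) (x n)"
proof -
  let ?g = "kernel_coord Q x" and ?R = "kernel_residual Q x l"
  have sym: "?R (x n) p = ?R p (x n)"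
    using psd_kernel_residual[OF assms(1)] unfolding psd_kernel_def by blast
  note e = kernel_eq_coords_plus_residual[OF assms(1), where l = l and x = x]
  have z: "?R (x n) (x n) = 0" "?R p (x n) = 0"
    using kernel_residual_eq_0[OF assms, of x "x n"] kernel_residual_eq_0[OF assms, of x p] sym by simp_all
  have "(\<Sum>i<l. (?g i p - ?g i (x n))\<^sup>2)
      = (\<Sum>i<l. ?g i p * ?g i p - 2 * (?g i p * ?g i (x n)) + ?g i (x n) * ?g i (x n))"
    by (intro sum.cong refl) (simp add: power2_eq_square algebra_simps)
  also have "\<dots> = (\<Sum>i<l. ?g i p * ?g i p) - 2 * (\<Sum>i<l. ?g i p * ?g i (x n)) + (\<Sum>i<l. ?g i (x n) * ?g i (x n))"
    by (simp only: sum.distrib sum_subtractf sum_distrib_left)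
  finally have s: "(\<Sum>i<l. (?g i p - ?g i (x n))\<^sup>2) = \<dots>" .
  have "0 \<le> (\<Sum>i<l. (?g i p - ?g i (x n))\<^sup>2)" by (intro sum_nonneg) simp
  thus ?thesis using e[of p p] e[of p "x n"] e[of "x n" "x n"] z unfolding s by linarith
qed

lemma kernel_residual_tendsto_0:
  assumes Q: "psd_kernel Q"
    and dense: "\<And>e. e > 0 \<Longrightarrow> \<exists>n. Q p p - 2 * Q p (x n) + Q (x n) (x n) < e"
  shows "(\<lambda>l. kernel_residual Q x l p p) \<longlonglongrightarrow> 0"
proof (rule LIMSEQ_I)
  fix e :: real assume "e > 0"
  then obtain n where n: "Q p p - 2 * Q p (x n) + Q (x n) (x n) < e" using dense by blast
  show "\<exists>no. \<forall>l\<ge>no. norm (kernel_residual Q x l p p - 0) < e"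
  proof (intro exI[of _ "Suc n"] allI impI)
    fix l assume "l \<ge> Suc n"
    hence "kernel_residual Q x l p p < e"
      using kernel_residual_le_dist[OF Q, of n l x p] n by simp
    thus "norm (kernel_residual Q x l p p - 0) < e"
      using psd_kernel_nonneg[OF psd_kernel_residual[OF Q], of x l p] by simp
  qed
qed

text \<open>Parseval's identity for the orthonormalised points, which is where their density is used.\<close>

theorem kernel_expansion:
  assumes Q: "psd_kernel Q"
    and p: "\<And>e. e > 0 \<Longrightarrow> \<exists>n. Q p p - 2 * Q p (x n) + Q (x n) (x n) < e"
    and q: "\<And>e. e > 0 \<Longrightarrow> \<exists>n. Q q q - 2 * Q q (x n) + Q (x n) (x n) < e"
  shows "(\<lambda>l. kernel_coord Q x l p * kernel_coord Q x l q) sums Q p q"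
proof -
  let ?R = "kernel_residual Q x"
  have "(\<lambda>l. sqrt (?R l p p * ?R l q q)) \<longlonglongrightarrow> sqrt (0 * 0)"
    by (intro tendsto_intros kernel_residual_tendsto_0 Q p q)
  hence lim: "(\<lambda>l. sqrt (?R l p p * ?R l q q)) \<longlonglongrightarrow> 0" by simp
  have "norm (?R l p q) \<le> sqrt (?R l p p * ?R l q q)" for l
    using real_sqrt_le_mono[OF psd_kernel_Cauchy_Schwarz[OF psd_kernel_residual[OF Q, of x l], of p q]]
    by simp
  hence "(\<lambda>l. ?R l p q) \<longlonglongrightarrow> 0"
    by (rule Lim_null_comparison[OF always_eventually[OF allI] lim])
  from tendsto_diff[OF tendsto_const[of "Q p q"] this]
  have "(\<lambda>l. Q p q - ?R l p q) \<longlonglongrightarrow> Q p q" by simp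
  moreover have "Q p q - ?R l p q = (\<Sum>i<l. kernel_coord Q x i p * kernel_coord Q x i q)" for l
    using kernel_eq_coords_plus_residual[OF Q, of p q, where l = l and x = x] by simp
  ultimately show ?thesis unfolding sums_def by simp
qed

section \<open>White noise and its Gaussian Hilbert space\<close>

definition white_noise :: "(nat \<Rightarrow> real) measure" where
  "white_noise = Pi\<^sub>M UNIV (\<lambda>_. std_normal_distribution)"

lemma prob_space_std_normal: "prob_space std_normal_distribution"
  by (rule prob_space_normal_density) simp

lemma prob_space_white_noise: "prob_space white_noise"
  unfolding white_noise_def by (intro prob_space_PiM prob_space_std_normal)

interpretation white_noise: prob_space white_noise
  by (rule prob_space_white_noise)

lemma measurable_white_noise_coord [measurable]: "(\<lambda>\<omega>. \<omega> i) \<in> borel_measurable white_noise"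
proof -
  have "(\<lambda>\<omega>. \<omega> i) \<in> white_noise \<rightarrow>\<^sub>M std_normal_distribution"
    unfolding white_noise_def by (rule measurable_component_singleton) simp
  thus ?thesis by simp
qed

lemma distr_white_noise_coord: "distr white_noise borel (\<lambda>\<omega>. \<omega> i) = std_normal_distribution"
proof -
  have "distr white_noise borel (\<lambda>\<omega>. \<omega> i) = distr white_noise std_normal_distribution (\<lambda>\<omega>. \<omega> i)"
    by (rule distr_cong) auto
  also have "\<dots> = std_normal_distribution"
    unfolding white_noise_def by (rule distr_PiM_component) (auto intro: prob_space_std_normal)
  finally show ?thesis .
qed

lemma indep_white_noise_coords: "white_noise.indep_vars (\<lambda>_. borel) (\<lambda>i \<omega>. \<omega> i) UNIV"
proof (subst white_noise.indep_vars_iff_distr_eq_PiM)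
  have "distr white_noise (Pi\<^sub>M UNIV (\<lambda>_. borel)) (\<lambda>\<omega>. \<lambda>i\<in>UNIV. \<omega> i) = distr white_noise white_noise (\<lambda>\<omega>. \<omega>)"
    by (rule distr_cong) (auto simp: white_noise_def intro!: sets_PiM_cong)
  also have "\<dots> = white_noise" by (rule distr_id)
  also have "\<dots> = Pi\<^sub>M UNIV (\<lambda>i. distr white_noise borel (\<lambda>\<omega>. \<omega> i))"
    by (simp only: distr_white_noise_coord) (simp add: white_noise_def)
  finally show "distr white_noise (Pi\<^sub>M UNIV (\<lambda>_. borel)) (\<lambda>\<omega>. \<lambda>i\<in>UNIV. \<omega> i)
    = Pi\<^sub>M UNIV (\<lambda>i. distr white_noise borel (\<lambda>\<omega>. \<omega> i))" .
qed auto

lemma integral_white_noise_coord: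
  fixes f :: "real \<Rightarrow> 'b::{banach, second_countable_topology}"
  assumes [measurable]: "f \<in> borel_measurable borel"
  shows "(\<integral>\<omega>. f (\<omega> i) \<partial>white_noise) = (\<integral>x. f x \<partial>std_normal_distribution)"
  using integral_distr[of "\<lambda>\<omega>. \<omega> i" white_noise borel f] by (simp add: distr_white_noise_coord)

lemma white_noise_coord_square_integrable: "square_integrable white_noise (\<lambda>\<omega>. \<omega> i)"
proof -
  have "integrable (distr white_noise borel (\<lambda>\<omega>. \<omega> i)) (\<lambda>x. x\<^sup>2)"
    unfolding distr_white_noise_coord by (rule integrable_std_normal_distribution_moment)
  thus ?thesis by (simp add: square_integrable_def integrable_distr_eq)
qed

lemma white_noise_coord_mean: "(\<integral>\<omega>. \<omega> i \<partial>white_noise) = 0"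
proof -
  have "(\<integral>\<omega>. \<omega> i \<partial>white_noise) = (\<integral>x. x^1 \<partial>std_normal_distribution)"
    using integral_white_noise_coord[of "\<lambda>x. x" i] by simp
  also have "\<dots> = 0" by (rule integral_std_normal_distribution_moment_odd) simp
  finally show ?thesis .
qed

lemma white_noise_coord_orthonormal: "L2_inner white_noise (\<lambda>\<omega>. \<omega> i) (\<lambda>\<omega>. \<omega> j) = (if i = j then 1 else 0)"
proof (cases "i = j")
  case True
  have "(\<integral>x. x^(2 * 1) \<partial>std_normal_distribution) = fact (2 * 1) / (2 ^ 1 * fact 1)"
    using std_normal_distribution_even_moments(1)[of 1] .
  thus ?thesis using True integral_white_noise_coord[of "\<lambda>x. x * x" j]
    by (simp add: L2_inner_def power2_eq_square)
next
  case False
  have "(\<integral>\<omega>. (\<Prod>k\<in>{i, j}. \<omega> k) \<partial>white_noise) = (\<Prod>k\<in>{i, j}. \<integral>\<omega>. \<omega> k \<partial>white_noise)"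
  proof (rule white_noise.indep_vars_lebesgue_integral)
    show "white_noise.indep_vars (\<lambda>_. borel) (\<lambda>k \<omega>. \<omega> k) {i, j}"
      by (rule white_noise.indep_vars_subset[OF indep_white_noise_coords]) simp
    show "integrable white_noise (\<lambda>\<omega>. \<omega> k)" for k
      by (rule white_noise.L2_imp_integrable[OF white_noise_coord_square_integrable])
  qed simp
  hence "(\<integral>\<omega>. \<omega> i * \<omega> j \<partial>white_noise) = (\<integral>\<omega>. \<omega> i \<partial>white_noise) * (\<integral>\<omega>. \<omega> j \<partial>white_noise)"
    using False by simp
  moreover have "(\<integral>\<omega>. \<omega> i \<partial>white_noise) = 0"
    by (rule white_noise_coord_mean)
  ultimately show ?thesis using False by (simp add: L2_inner_def)
qed

lemma char_white_noise_combination: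
  "(\<integral>\<omega>. iexp (\<Sum>i<n. c i * \<omega> i) \<partial>white_noise) = complex_of_real (exp (- (\<Sum>i<n. (c i)\<^sup>2) / 2))"
proof -
  have ind: "white_noise.indep_vars (\<lambda>i. borel) (\<lambda>i \<omega>. c i * \<omega> i) {..<n}"
    by (rule white_noise.indep_vars_subset[OF white_noise.indep_vars_compose2[OF indep_white_noise_coords,
            where Y = "\<lambda>i x. c i * x" and N = "\<lambda>_. borel"]]) simp_all
  have "(\<integral>\<omega>. iexp (\<Sum>i<n. c i * \<omega> i) \<partial>white_noise) = char (distr white_noise borel (\<lambda>\<omega>. \<Sum>i<n. c i * \<omega> i)) 1"
    unfolding char_def by (subst integral_distr) auto
  also have "\<dots> = (\<Prod>i<n. char (distr white_noise borel (\<lambda>\<omega>. c i * \<omega> i)) 1)"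
    by (rule white_noise.char_distr_sum[OF ind])
  also have "\<dots> = (\<Prod>i<n. complex_of_real (exp (- (c i)\<^sup>2 / 2)))"
  proof (rule prod.cong)
    fix i
    have "char (distr white_noise borel (\<lambda>\<omega>. c i * \<omega> i)) 1 = (\<integral>\<omega>. iexp (c i * \<omega> i) \<partial>white_noise)"
      unfolding char_def by (subst integral_distr) auto
    also have "\<dots> = char std_normal_distribution (c i)"
      unfolding char_def by (rule integral_white_noise_coord[of "\<lambda>x. iexp (c i * x)"]) simp
    finally show "char (distr white_noise borel (\<lambda>\<omega>. c i * \<omega> i)) 1 = complex_of_real (exp (- (c i)\<^sup>2 / 2))"
      by (simp only: char_std_normal_distribution)
  qed simp
  also have "\<dots> = complex_of_real (exp (\<Sum>i<n. - (c i)\<^sup>2 / 2))"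
    by (simp only: exp_sum[OF finite_lessThan] of_real_prod)
  finally show ?thesis by (simp add: sum_divide_distrib sum_negf)
qed

text \<open>Membership in the closed linear span of the coordinates in \<open>L\<^sup>2\<close>.\<close>

definition gaussian_span :: "((nat \<Rightarrow> real) \<Rightarrow> real) \<Rightarrow> bool" where
  "gaussian_span V \<longleftrightarrow> square_integrable white_noise V \<and>
     (\<forall>e>0. \<exists>n c. L2_norm white_noise (\<lambda>\<omega>. V \<omega> - (\<Sum>i<n. c i * \<omega> i)) < e)"

lemma gaussian_span_square_integrable: "gaussian_span V \<Longrightarrow> square_integrable white_noise V"
  by (simp add: gaussian_span_def)

lemma gaussian_span_measurable [measurable_dest]: "gaussian_span V \<Longrightarrow> V \<in> borel_measurable white_noise"
  by (simp add: gaussian_span_def square_integrable_def)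

lemma square_integrable_white_noise_combination:
  "square_integrable white_noise (\<lambda>\<omega>. \<Sum>i\<in>I. c i * \<omega> i)"
  by (intro square_integrable_sum square_integrable_cmult white_noise_coord_square_integrable)

lemma gaussian_span_combination: "gaussian_span (\<lambda>\<omega>. \<Sum>i<n. c i * \<omega> i)"
  unfolding gaussian_span_def
proof (intro conjI allI impI)
  fix e :: real assume "e > 0"
  thus "\<exists>m d. L2_norm white_noise (\<lambda>\<omega>. (\<Sum>i<n. c i * \<omega> i) - (\<Sum>i<m. d i * \<omega> i)) < e"
    by (intro exI[of _ n] exI[of _ c]) (simp add: L2_norm_def)
qed (rule square_integrable_white_noise_combination)

lemma gaussian_span_cmult:
  assumes "gaussian_span V" shows "gaussian_span (\<lambda>\<omega>. a * V \<omega>)"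
  unfolding gaussian_span_def
proof (intro conjI allI impI)
  fix e :: real assume "e > 0"
  hence "e / (\<bar>a\<bar> + 1) > 0" by (simp add: add_nonneg_pos)
  then obtain n c where c: "L2_norm white_noise (\<lambda>\<omega>. V \<omega> - (\<Sum>i<n. c i * \<omega> i)) < e / (\<bar>a\<bar> + 1)"
    using assms unfolding gaussian_span_def by blast
  have "L2_norm white_noise (\<lambda>\<omega>. a * V \<omega> - (\<Sum>i<n. (a * c i) * \<omega> i))
    = L2_norm white_noise (\<lambda>\<omega>. a * (V \<omega> - (\<Sum>i<n. c i * \<omega> i)))"
    by (simp add: right_diff_distrib sum_distrib_left mult.assoc)
  also have "\<dots> \<le> (\<bar>a\<bar> + 1) * L2_norm white_noise (\<lambda>\<omega>. V \<omega> - (\<Sum>i<n. c i * \<omega> i))"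
    unfolding L2_norm_cmult by (intro mult_right_mono) auto
  also have "\<dots> < e" using c by (simp add: pos_less_divide_eq add_nonneg_pos mult.commute)
  finally show "\<exists>m d. L2_norm white_noise (\<lambda>\<omega>. a * V \<omega> - (\<Sum>i<m. d i * \<omega> i)) < e"
    by (intro exI[of _ n] exI[of _ "\<lambda>i. a * c i"])
qed (use assms in \<open>auto intro: square_integrable_cmult gaussian_span_square_integrable\<close>)

lemma gaussian_span_add:
  assumes "gaussian_span V" "gaussian_span W" shows "gaussian_span (\<lambda>\<omega>. V \<omega> + W \<omega>)"
  unfolding gaussian_span_def
proof (intro conjI allI impI)
  note sV = assms(1)[THEN gaussian_span_square_integrable]
  note sW = assms(2)[THEN gaussian_span_square_integrable]
  show "square_integrable white_noise (\<lambda>\<omega>. V \<omega> + W \<omega>)" by (rule square_integrable_add[OF sV sW])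
  fix e :: real assume "e > 0"
  hence e2: "e / 2 > 0" by simp
  obtain n c where c: "L2_norm white_noise (\<lambda>\<omega>. V \<omega> - (\<Sum>i<n. c i * \<omega> i)) < e / 2"
    using assms(1) e2 unfolding gaussian_span_def by blast
  obtain m d where d: "L2_norm white_noise (\<lambda>\<omega>. W \<omega> - (\<Sum>i<m. d i * \<omega> i)) < e / 2"
    using assms(2) e2 unfolding gaussian_span_def by blast
  define a where "a i = (if i < n then c i else 0) + (if i < m then d i else 0)" for i
  have a: "(\<Sum>i<n + m. a i * \<omega> i) = (\<Sum>i<n. c i * \<omega> i) + (\<Sum>i<m. d i * \<omega> i)" for \<omega> :: "nat \<Rightarrow> real"
  proof -
    have "(\<Sum>i<n + m. a i * \<omega> i) = (\<Sum>i<n + m. if i < n then c i * \<omega> i else 0) + (\<Sum>i<n + m. if i < m then d i * \<omega> i else 0)"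
      unfolding sum.distrib[symmetric] by (intro sum.cong) (auto simp: a_def algebra_simps)
    also have "(\<Sum>i<n + m. if i < n then c i * \<omega> i else 0) = (\<Sum>i<n. c i * \<omega> i)"
      by (rule sum.mono_neutral_cong_right) auto
    also have "(\<Sum>i<n + m. if i < m then d i * \<omega> i else 0) = (\<Sum>i<m. d i * \<omega> i)"
      by (rule sum.mono_neutral_cong_right) auto
    finally show ?thesis .
  qed
  have "L2_norm white_noise (\<lambda>\<omega>. V \<omega> + W \<omega> - (\<Sum>i<n + m. a i * \<omega> i)) =
    L2_norm white_noise (\<lambda>\<omega>. (V \<omega> - (\<Sum>i<n. c i * \<omega> i)) + (W \<omega> - (\<Sum>i<m. d i * \<omega> i)))"
    unfolding a by (simp add: algebra_simps)
  also have "\<dots> \<le> L2_norm white_noise (\<lambda>\<omega>. V \<omega> - (\<Sum>i<n. c i * \<omega> i)) + L2_norm white_noise (\<lambda>\<omega>. W \<omega> - (\<Sum>i<m. d i * \<omega> i))"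
    by (intro L2_norm_triangle square_integrable_diff sV sW square_integrable_white_noise_combination)
  also have "\<dots> < e" using c d by simp
  finally show "\<exists>n a. L2_norm white_noise (\<lambda>\<omega>. V \<omega> + W \<omega> - (\<Sum>i<n. a i * \<omega> i)) < e" by blast
qed

lemma gaussian_span_zero: "gaussian_span (\<lambda>\<omega>. 0)"
  using gaussian_span_combination[where n = 0] by simp

lemma gaussian_span_sum: "(\<And>i. i \<in> I \<Longrightarrow> gaussian_span (V i)) \<Longrightarrow> gaussian_span (\<lambda>\<omega>. \<Sum>i\<in>I. V i \<omega>)"
  by (induction I rule: infinite_finite_induct) (auto intro: gaussian_span_add gaussian_span_zero)

lemma gaussian_span_diff:
  assumes "gaussian_span V" "gaussian_span W" shows "gaussian_span (\<lambda>\<omega>. V \<omega> - W \<omega>)"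
  using gaussian_span_add[OF assms(1) gaussian_span_cmult[OF assms(2), of "-1"]] by simp

lemma gaussian_span_coord: "gaussian_span (\<lambda>\<omega>. \<omega> i)"
proof -
  have "(\<Sum>j<Suc i. (if j = i then 1 else 0) * \<omega> j) = \<omega> i" for \<omega> :: "nat \<Rightarrow> real"
    by (simp add: if_distrib[of "\<lambda>x. x * _"] cong: if_cong)
  thus ?thesis using gaussian_span_combination[of "\<lambda>j. if j = i then 1 else 0" "Suc i"] by simp
qed

lemma gaussian_span_limit:
  assumes V: "\<And>n. gaussian_span (V n)" and lim: "L2_tendsto white_noise V W"
  shows "gaussian_span W"
  unfolding gaussian_span_def
proof (intro conjI allI impI)
  note sW = L2_tendstoD(2)[OF lim]
  show "square_integrable white_noise W" by (rule sW)
  fix e :: real assume "e > 0"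
  hence e2: "e / 2 > 0" by simp
  from order_tendstoD(2)[OF L2_tendstoD(3)[OF lim] e2]
  obtain n where n: "L2_norm white_noise (\<lambda>x. V n x - W x) < e / 2" by (auto simp: eventually_sequentially)
  obtain m c where c: "L2_norm white_noise (\<lambda>\<omega>. V n \<omega> - (\<Sum>i<m. c i * \<omega> i)) < e / 2"
    using V[of n] e2 unfolding gaussian_span_def by blast
  have "L2_norm white_noise (\<lambda>\<omega>. W \<omega> - (\<Sum>i<m. c i * \<omega> i))
      \<le> L2_norm white_noise (\<lambda>\<omega>. W \<omega> - V n \<omega>) + L2_norm white_noise (\<lambda>\<omega>. V n \<omega> - (\<Sum>i<m. c i * \<omega> i))"
    by (intro L2_norm_triangle_diff sW gaussian_span_square_integrable V square_integrable_white_noise_combination)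
  also have "\<dots> < e" using n c by (simp add: L2_norm_minus_commute[of _ W])
  finally show "\<exists>m c. L2_norm white_noise (\<lambda>\<omega>. W \<omega> - (\<Sum>i<m. c i * \<omega> i)) < e" by blast
qed

lemma gaussian_span_approx_seq:
  assumes "gaussian_span V"
  obtains n c where "L2_tendsto white_noise (\<lambda>k \<omega>. \<Sum>i<n k. c k i * \<omega> i) V"
proof -
  have "\<exists>n c. L2_norm white_noise (\<lambda>\<omega>. V \<omega> - (\<Sum>i<n. c i * \<omega> i)) < inverse (real (Suc k))" for k
    using assms unfolding gaussian_span_def by simp
  then obtain n c where nc: "\<And>k. L2_norm white_noise (\<lambda>\<omega>. V \<omega> - (\<Sum>i<n k. c k i * \<omega> i)) < inverse (real (Suc k))"
    by metis
  have "(\<lambda>k. L2_norm white_noise (\<lambda>\<omega>. (\<Sum>i<n k. c k i * \<omega> i) - V \<omega>)) \<longlonglongrightarrow> 0"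
  proof (rule Lim_null_comparison[OF always_eventually[OF allI] LIMSEQ_inverse_real_of_nat])
    fix k show "norm (L2_norm white_noise (\<lambda>\<omega>. (\<Sum>i<n k. c k i * \<omega> i) - V \<omega>)) \<le> inverse (real (Suc k))"
      using nc[of k] by (simp add: L2_norm_minus_commute[of _ V])
  qed
  hence "L2_tendsto white_noise (\<lambda>k \<omega>. \<Sum>i<n k. c k i * \<omega> i) V"
    unfolding L2_tendsto_def
    by (intro conjI allI square_integrable_white_noise_combination gaussian_span_square_integrable assms)
  thus ?thesis by (rule that)
qed

lemma norm_iexp_diff_le: "norm (iexp x - iexp y) \<le> \<bar>x - y\<bar>"
proof -
  have "norm (iexp x - iexp y) = norm (iexp y * (iexp (x - y) - 1))"
    by (simp add: right_diff_distrib exp_add[symmetric] ring_distribs)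
  also have "\<dots> = norm (iexp (x - y) - 1)" by (simp add: norm_mult)
  also have "\<dots> \<le> \<bar>x - y\<bar>" using iexp_approx1[of "x - y" 0] by simp
  finally show ?thesis .
qed

text \<open>Both sides are continuous with respect to convergence in \<open>L\<^sup>2\<close> and agree for finite
  combinations of coordinates.\<close>

lemma char_gaussian_span:
  assumes V: "gaussian_span V"
  shows "(\<integral>\<omega>. iexp (V \<omega>) \<partial>white_noise) = complex_of_real (exp (- L2_inner white_noise V V / 2))"
proof -
  obtain n c where lim: "L2_tendsto white_noise (\<lambda>k \<omega>. \<Sum>i<n k. c k i * \<omega> i) V"
    using gaussian_span_approx_seq[OF V] by blast
  define W where "W k \<omega> = (\<Sum>i<n k. c k i * \<omega> i)" for k and \<omega> :: "nat \<Rightarrow> real"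
  have lim: "L2_tendsto white_noise W V" using lim unfolding W_def .
  have sW: "square_integrable white_noise (W k)" for k by (rule L2_tendstoD(1)[OF lim])
  have sV: "square_integrable white_noise V" by (rule L2_tendstoD(2)[OF lim])
  have [measurable]: "W k \<in> borel_measurable white_noise" for k using sW by (rule square_integrable_measurable)
  have [measurable]: "V \<in> borel_measurable white_noise" using sV by (rule square_integrable_measurable)
  have "L2_inner white_noise (W k) (W k) = (\<Sum>i<n k. (c k i)\<^sup>2)" for k
  proof -
    have "L2_inner white_noise (W k) (W k) = (\<Sum>i<n k. \<Sum>j<n k. c k i * c k j * (if i = j then 1 else 0))"
      unfolding W_def white_noise_coord_orthonormal[symmetric]
      by (rule L2_inner_combination) (rule white_noise_coord_square_integrable)
    also have "\<dots> = (\<Sum>i<n k. (c k i)\<^sup>2)"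
      by (intro sum.cong refl) (simp add: power2_eq_square if_distrib[of "\<lambda>x. _ * x"] cong: if_cong)
    finally show ?thesis .
  qed
  hence ch: "(\<integral>\<omega>. iexp (W k \<omega>) \<partial>white_noise) = complex_of_real (exp (- L2_inner white_noise (W k) (W k) / 2))" for k
    unfolding W_def by (simp only: char_white_noise_combination)
  have "(\<lambda>k. complex_of_real (exp (- L2_inner white_noise (W k) (W k) / 2)))
      \<longlonglongrightarrow> complex_of_real (exp (- L2_inner white_noise V V / 2))"
    by (intro tendsto_intros L2_tendsto_inner lim) simp
  hence A: "(\<lambda>k. (\<integral>\<omega>. iexp (W k \<omega>) \<partial>white_noise)) \<longlonglongrightarrow> complex_of_real (exp (- L2_inner white_noise V V / 2))"
    by (simp only: ch)
  have "(\<lambda>k. (\<integral>\<omega>. iexp (W k \<omega>) \<partial>white_noise) - (\<integral>\<omega>. iexp (V \<omega>) \<partial>white_noise)) \<longlonglongrightarrow> 0"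
  proof (rule Lim_null_comparison[OF always_eventually[OF allI] L2_tendstoD(3)[OF lim]])
    fix k
    have iW: "integrable white_noise (\<lambda>\<omega>. iexp (W k \<omega>))" by (rule white_noise.integrable_iexp) auto
    have iV: "integrable white_noise (\<lambda>\<omega>. iexp (V \<omega>))" by (rule white_noise.integrable_iexp) auto
    have "norm ((\<integral>\<omega>. iexp (W k \<omega>) \<partial>white_noise) - (\<integral>\<omega>. iexp (V \<omega>) \<partial>white_noise))
      = norm (\<integral>\<omega>. iexp (W k \<omega>) - iexp (V \<omega>) \<partial>white_noise)"
      by (subst Bochner_Integration.integral_diff[OF iW iV]) simp
    also have "\<dots> \<le> (\<integral>\<omega>. norm (iexp (W k \<omega>) - iexp (V \<omega>)) \<partial>white_noise)"
      by (rule integral_norm_bound)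
    also have "\<dots> \<le> (\<integral>\<omega>. \<bar>W k \<omega> - V \<omega>\<bar> \<partial>white_noise)"
    proof (rule integral_mono)
      show "integrable white_noise (\<lambda>\<omega>. norm (iexp (W k \<omega>) - iexp (V \<omega>)))"
        by (intro integrable_norm Bochner_Integration.integrable_diff iW iV)
      show "integrable white_noise (\<lambda>\<omega>. \<bar>W k \<omega> - V \<omega>\<bar>)"
        by (intro white_noise.L2_imp_integrable square_integrable_abs square_integrable_diff sW sV)
    qed (rule norm_iexp_diff_le)
    also have "\<dots> \<le> L2_norm white_noise (\<lambda>x. W k x - V x)"
      by (intro white_noise.integral_abs_le_L2_norm square_integrable_diff sW sV)
    finally show "norm ((\<integral>\<omega>. iexp (W k \<omega>) \<partial>white_noise) - (\<integral>\<omega>. iexp (V \<omega>) \<partial>white_noise))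
        \<le> L2_norm white_noise (\<lambda>x. W k x - V x)" .
  qed
  from LIMSEQ_unique[OF A LIM_zero_cancel[OF this]] show ?thesis by simp
qed

lemma distributed_normal_iff_distr:
  assumes "prob_space M" "X \<in> borel_measurable M"
  shows "distributed M lborel X (\<lambda>x. ennreal (normal_density \<mu> \<sigma> x)) \<longleftrightarrow>
    distr M borel X = density lborel (\<lambda>x. ennreal (normal_density \<mu> \<sigma> x))"
proof -
  have "distr M lborel X = distr M borel X" by (rule distr_cong) simp_all
  thus ?thesis using assms(2) by (simp add: distributed_def)
qed

lemma gaussian_span_normal:
  assumes V: "gaussian_span V" and v: "L2_inner white_noise V V > 0"
  shows "distributed white_noise lborel V (\<lambda>x. ennreal (normal_density 0 (sqrt (L2_inner white_noise V V)) x))"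
proof -
  define s where "s = sqrt (L2_inner white_noise V V)"
  have s: "s > 0" "s\<^sup>2 = L2_inner white_noise V V" using v by (simp_all add: s_def)
  have [measurable]: "V \<in> borel_measurable white_noise" using V by (rule gaussian_span_measurable)
  have cV: "char (distr white_noise borel V) t = complex_of_real (exp (- (t\<^sup>2 * s\<^sup>2) / 2))" for t
  proof -
    have "char (distr white_noise borel V) t = (\<integral>\<omega>. iexp (t * V \<omega>) \<partial>white_noise)"
      unfolding char_def by (subst integral_distr) auto
    also have "\<dots> = complex_of_real (exp (- L2_inner white_noise (\<lambda>\<omega>. t * V \<omega>) (\<lambda>\<omega>. t * V \<omega>) / 2))"
      by (rule char_gaussian_span[OF gaussian_span_cmult[OF V]])
    also have "L2_inner white_noise (\<lambda>\<omega>. t * V \<omega>) (\<lambda>\<omega>. t * V \<omega>) = t\<^sup>2 * s\<^sup>2"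
      unfolding s(2) by (simp add: L2_norm_power2[symmetric] L2_norm_cmult power_mult_distrib)
    finally show ?thesis .
  qed
  have cs: "char (distr white_noise borel (\<lambda>\<omega>. s * \<omega> 0)) t = complex_of_real (exp (- (t\<^sup>2 * s\<^sup>2) / 2))" for t
  proof -
    have "char (distr white_noise borel (\<lambda>\<omega>. s * \<omega> 0)) t = (\<integral>\<omega>. iexp (t * (s * \<omega> 0)) \<partial>white_noise)"
      unfolding char_def by (subst integral_distr) auto
    also have "\<dots> = (\<integral>\<omega>. iexp (\<Sum>i<1. (t * s) * \<omega> i) \<partial>white_noise)" by (simp add: mult.assoc)
    also have "\<dots> = complex_of_real (exp (- (\<Sum>i<1::nat. (t * s)\<^sup>2) / 2))"
      by (rule char_white_noise_combination)
    finally show ?thesis by (simp add: power_mult_distrib)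
  qed
  have "distr white_noise borel V = distr white_noise borel (\<lambda>\<omega>. s * \<omega> 0)"
    by (rule Levy_uniqueness) (auto intro!: white_noise.real_distribution_distr simp: cV cs fun_eq_iff)
  also have "\<dots> = density lborel (\<lambda>x. ennreal (normal_density 0 s x))"
  proof -
    have "distributed white_noise lborel (\<lambda>\<omega>. \<omega> 0) (\<lambda>x. ennreal (normal_density 0 1 x))"
      by (subst distributed_normal_iff_distr) (auto simp: distr_white_noise_coord white_noise.prob_space_axioms)
    hence "distributed white_noise lborel (\<lambda>\<omega>. (s * \<omega> 0 - 0) / s) (\<lambda>x. ennreal (normal_density 0 1 x))"
      using s(1) by simp
    hence "distributed white_noise lborel (\<lambda>\<omega>. s * \<omega> 0) (\<lambda>x. ennreal (normal_density 0 s x))"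
      using white_noise.normal_standard_normal_convert[OF s(1), of "\<lambda>\<omega>. s * \<omega> 0" 0] by simp
    thus ?thesis
      by (subst (asm) distributed_normal_iff_distr) (auto simp: white_noise.prob_space_axioms)
  qed
  finally show ?thesis
    by (subst distributed_normal_iff_distr) (auto simp: white_noise.prob_space_axioms s_def)
qed

lemma gaussian_span_4th_moment:
  assumes V: "gaussian_span V"
  shows "(\<integral>\<^sup>+\<omega>. ennreal ((V \<omega>)^4) \<partial>white_noise) = ennreal (3 * (L2_inner white_noise V V)\<^sup>2)"
proof (cases "L2_inner white_noise V V = 0")
  case True
  have "AE \<omega> in white_noise. V \<omega> = 0"
  proof -
    have "(\<integral>\<^sup>+x. ennreal ((V x)\<^sup>2) \<partial>white_noise) = 0"
      using nn_integral_square[OF gaussian_span_square_integrable[OF V]] True by (simp add: L2_norm_power2)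
    hence "AE x in white_noise. ennreal ((V x)\<^sup>2) = 0"
      using gaussian_span_measurable[OF V] by (subst (asm) nn_integral_0_iff_AE) auto
    thus ?thesis by eventually_elim simp
  qed
  hence "(\<integral>\<^sup>+\<omega>. ennreal ((V \<omega>)^4) \<partial>white_noise) = (\<integral>\<^sup>+\<omega>. 0 \<partial>white_noise)"
    by (intro nn_integral_cong_AE) auto
  thus ?thesis using True by simp
next
  case False
  moreover have "L2_inner white_noise V V \<ge> 0" by (simp add: L2_norm_power2[symmetric])
  ultimately have v: "L2_inner white_noise V V > 0" by simp
  define s where "s = sqrt (L2_inner white_noise V V)"
  have s: "s > 0" using v by (simp add: s_def)
  have "(\<integral>\<^sup>+\<omega>. ennreal ((V \<omega>)^4) \<partial>white_noise) = (\<integral>\<^sup>+x. ennreal (normal_density 0 s x) * ennreal (x^4) \<partial>lborel)"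
    by (rule distributed_nn_integral[symmetric, OF gaussian_span_normal[OF V v, folded s_def]]) simp
  also have "\<dots> = (\<integral>\<^sup>+x. ennreal (normal_density 0 s x * (x - 0)^(2 * 2)) \<partial>lborel)"
    by (intro nn_integral_cong) (simp add: ennreal_mult)
  also have "\<dots> = ennreal (fact (2 * 2) / ((2 / s\<^sup>2)^2 * fact 2))"
    using normal_moment_even[OF s, of 0 2] by (intro nn_integral_eq_integral[THEN trans])
      (auto simp: has_bochner_integral_iff)
  also have "fact (2 * 2) / ((2 / s\<^sup>2)^2 * fact 2) = 3 * (s\<^sup>2)\<^sup>2"
    using s by (simp add: fact_numeral power_divide field_simps)
  finally show ?thesis using v by (simp add: s_def)
qed

section \<open>Brownian motions built from white noise\<close>

text \<open>The covariance of Brownian motion, clipped at negative times in order to be positive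
  semidefinite on the whole line: it is the Gram kernel of the indicators of \<open>(0, t]\<close>.\<close>

definition min_kernel :: "real \<Rightarrow> real \<Rightarrow> real" where
  "min_kernel s t = min (max 0 s) (max 0 t)"

lemma square_integrable_indicator_Ioc: "square_integrable lborel (indicator {a<..b::real})"
proof -
  have "(\<lambda>x. (indicator {a<..b} x :: real)\<^sup>2) = indicator {a<..b}"
    by (auto simp: indicator_def)
  moreover have "integrable lborel (indicator {a<..b} :: real \<Rightarrow> real)"
    by (rule integrable_real_indicator) (cases "a \<le> b"; simp)+
  ultimately show ?thesis by (simp add: square_integrable_def)
qed

lemma L2_inner_indicator: "L2_inner lborel (indicator {0<..s}) (indicator {0<..t}) = min_kernel s t"
proof -
  have "(\<lambda>x. indicator {0<..s} x * indicator {0<..t} x :: real) = indicator {0<..min s t}"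
    by (auto simp: indicator_def)
  moreover have "(\<integral>x. indicator {0<..min s t} x \<partial>lborel) = measure lborel ({0<..min s t} \<inter> space lborel)"
    by simp
  moreover have "measure lborel {0<..min s t} = min_kernel s t"
  proof (cases "s \<le> 0 \<or> t \<le> 0")
    case True
    hence "{0<..min s t} = {}" by auto
    moreover have "min_kernel s t = 0" using True by (auto simp: min_kernel_def max_def)
    ultimately show ?thesis by (simp only: measure_empty)
  next
    case False
    thus ?thesis by (simp add: min_kernel_def)
  qed
  ultimately show ?thesis by (simp add: L2_inner_def)
qed

lemma psd_min_kernel: "psd_kernel min_kernel"
  using psd_kernel_L2_inner[of lborel "\<lambda>t. indicator {0<..t}", OF square_integrable_indicator_Ioc]
  by (simp only: L2_inner_indicator)

definition rational_seq :: "nat \<Rightarrow> real" where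
  "rational_seq = from_nat_into \<rat>"

text \<open>The coordinates of the indicator of \<open>(0, t]\<close> in the orthonormal system obtained from the
  indicators of \<open>(0, q]\<close> for rational \<open>q\<close>.\<close>

definition bm_coeff :: "nat \<Rightarrow> real \<Rightarrow> real" where
  "bm_coeff = kernel_coord min_kernel rational_seq"

lemma bm_coeff_sums: "(\<lambda>i. bm_coeff i s * bm_coeff i t) sums min_kernel s t"
proof -
  have "\<exists>n. min_kernel p p - 2 * min_kernel p (rational_seq n) + min_kernel (rational_seq n) (rational_seq n) < e"
    if "e > 0" for p e :: real
  proof -
    have "p < p + e" using that by simp
    from Rats_dense_in_real[OF this] obtain r where r: "r \<in> \<rat>" "p < r" "r < p + e" by blast
    have "range rational_seq = \<rat>"
      unfolding rational_seq_def by (rule range_from_nat_into) (auto simp: countable_rat)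
    then obtain n where "rational_seq n = r" using r(1) by (metis rangeE)
    thus ?thesis using r that by (intro exI[of _ n]) (auto simp: min_kernel_def max_def min_def)
  qed
  thus ?thesis unfolding bm_coeff_def by (intro kernel_expansion psd_min_kernel) auto
qed

text \<open>The slices are disjoint subsequences of the white noise, hence independent white noises, one
  for each Brownian motion.\<close>

definition noise_slice :: "nat \<Rightarrow> (nat \<Rightarrow> real) \<Rightarrow> nat \<Rightarrow> real" where
  "noise_slice l \<omega> i = \<omega> (prod_encode (l, i))"

lemma sets_white_noise: "sets white_noise = sets (Pi\<^sub>M UNIV (\<lambda>_. borel))"
  unfolding white_noise_def by (rule sets_PiM_cong) auto

lemma measurable_noise_slice [measurable]: "noise_slice l \<in> white_noise \<rightarrow>\<^sub>M white_noise"
proof -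
  have "noise_slice l \<in> white_noise \<rightarrow>\<^sub>M Pi\<^sub>M UNIV (\<lambda>_. borel)"
    unfolding noise_slice_def by (rule measurable_PiM_single') auto
  thus ?thesis using measurable_cong_sets[OF refl sets_white_noise] by blast
qed

lemma distr_noise_slice: "distr white_noise white_noise (noise_slice l) = white_noise"
proof -
  have "distr (Pi\<^sub>M UNIV (\<lambda>_. std_normal_distribution)) (Pi\<^sub>M UNIV (\<lambda>_. std_normal_distribution))
      (\<lambda>\<omega>. \<lambda>n\<in>UNIV. \<omega> (prod_encode (l, n))) = Pi\<^sub>M UNIV (\<lambda>_. std_normal_distribution)"
    by (rule distr_PiM_reindex) (auto intro: prob_space_std_normal simp: inj_on_def)
  moreover have "noise_slice l = (\<lambda>\<omega>. \<lambda>n\<in>UNIV. \<omega> (prod_encode (l, n)))"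
    by (auto simp: noise_slice_def fun_eq_iff)
  ultimately show ?thesis by (simp add: white_noise_def)
qed

lemma L2_tendsto_noise_slice:
  assumes "L2_tendsto white_noise V W"
  shows "L2_tendsto white_noise (\<lambda>n \<omega>. V n (noise_slice l \<omega>)) (\<lambda>\<omega>. W (noise_slice l \<omega>))"
proof -
  have s: "square_integrable white_noise (\<lambda>\<omega>. f (noise_slice l \<omega>))" if f: "square_integrable white_noise f" for f
  proof -
    have [measurable]: "f \<in> borel_measurable white_noise" using f by (rule square_integrable_measurable)
    have "integrable (distr white_noise white_noise (noise_slice l)) (\<lambda>x. (f x)\<^sup>2)"
      using f unfolding distr_noise_slice square_integrable_def by simp
    hence "integrable white_noise (\<lambda>\<omega>. (f (noise_slice l \<omega>))\<^sup>2)"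
      by (subst (asm) integrable_distr_eq) simp_all
    thus ?thesis by (simp add: square_integrable_def)
  qed
  have n: "L2_norm white_noise (\<lambda>\<omega>. f (noise_slice l \<omega>)) = L2_norm white_noise f" if f: "square_integrable white_noise f" for f
  proof -
    have [measurable]: "f \<in> borel_measurable white_noise" using f by (rule square_integrable_measurable)
    have "(\<integral>x. (f x)\<^sup>2 \<partial>distr white_noise white_noise (noise_slice l)) = (\<integral>\<omega>. (f (noise_slice l \<omega>))\<^sup>2 \<partial>white_noise)"
      by (rule integral_distr) simp_all
    thus ?thesis by (simp add: L2_norm_def distr_noise_slice)
  qed
  show ?thesis
    unfolding L2_tendsto_def
  proof (intro conjI allI s)
    have "L2_norm white_noise (\<lambda>x. V n (noise_slice l x) - W (noise_slice l x)) = L2_norm white_noise (\<lambda>x. V n x - W x)" for n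
      by (rule n[of "\<lambda>x. V n x - W x"]) (intro square_integrable_diff L2_tendstoD[OF assms])
    thus "(\<lambda>n. L2_norm white_noise (\<lambda>x. V n (noise_slice l x) - W (noise_slice l x))) \<longlonglongrightarrow> 0"
      using L2_tendstoD(3)[OF assms] by simp
  qed (rule L2_tendstoD[OF assms])+
qed

text \<open>Brownian motion at single times: each value is some version of an \<open>L\<^sup>2\<close> limit, with no
  control of the paths.\<close>

definition bm_series :: "real \<Rightarrow> (nat \<Rightarrow> real) \<Rightarrow> real" where
  "bm_series t = (SOME V. L2_tendsto white_noise (\<lambda>n \<omega>. \<Sum>i<n. bm_coeff i t * \<omega> i) V)"

lemma bm_series: "L2_tendsto white_noise (\<lambda>n \<omega>. \<Sum>i<n. bm_coeff i t * \<omega> i) (bm_series t)"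
proof -
  have "\<exists>V. L2_tendsto white_noise (\<lambda>n \<omega>. \<Sum>i<n. bm_coeff i t * \<omega> i) V"
  proof (rule orthogonal_series_converges)
    show "square_integrable white_noise (\<lambda>\<omega>. bm_coeff i t * \<omega> i)" for i
      by (rule square_integrable_cmult[OF white_noise_coord_square_integrable])
    show "L2_inner white_noise (\<lambda>\<omega>. bm_coeff i t * \<omega> i) (\<lambda>\<omega>. bm_coeff j t * \<omega> j) = 0" if "i \<noteq> j" for i j
      using white_noise_coord_orthonormal[of i j] that
      by (simp add: L2_inner_cmult_left L2_inner_commute[of _ _ "\<lambda>\<omega>. bm_coeff j t * \<omega> j"] L2_inner_commute[of _ "\<lambda>\<omega>. \<omega> j"])
    have "(L2_norm white_noise (\<lambda>\<omega>. bm_coeff i t * \<omega> i))\<^sup>2 = bm_coeff i t * bm_coeff i t" for i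
      using white_noise_coord_orthonormal[of i i]
      by (simp add: L2_norm_cmult power_mult_distrib L2_norm_power2) (simp add: power2_eq_square)
    thus "summable (\<lambda>i. (L2_norm white_noise (\<lambda>\<omega>. bm_coeff i t * \<omega> i))\<^sup>2)"
      using bm_coeff_sums[of t t] by (simp add: sums_iff)
  qed
  thus ?thesis unfolding bm_series_def by (rule someI_ex)
qed

lemma bm_series_slice:
  "L2_tendsto white_noise (\<lambda>n \<omega>. \<Sum>i<n. bm_coeff i t * \<omega> (prod_encode (l, i))) (\<lambda>\<omega>. bm_series t (noise_slice l \<omega>))"
  using L2_tendsto_noise_slice[OF bm_series, of t l] by (simp add: noise_slice_def)

lemma gaussian_span_bm_series: "gaussian_span (\<lambda>\<omega>. bm_series t (noise_slice l \<omega>))"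
  by (rule gaussian_span_limit[OF _ bm_series_slice])
    (intro gaussian_span_sum gaussian_span_cmult gaussian_span_coord)

lemma L2_inner_bm_series:
  "L2_inner white_noise (\<lambda>\<omega>. bm_series s (noise_slice l \<omega>)) (\<lambda>\<omega>. bm_series t (noise_slice l' \<omega>))
    = (if l = l' then min_kernel s t else 0)"
proof -
  have e: "L2_inner white_noise (\<lambda>\<omega>. \<Sum>i<n. bm_coeff i s * \<omega> (prod_encode (l, i))) (\<lambda>\<omega>. \<Sum>i<n. bm_coeff i t * \<omega> (prod_encode (l', i)))
      = (if l = l' then \<Sum>i<n. bm_coeff i s * bm_coeff i t else 0)" for n
  proof -
    have q: "square_integrable white_noise (\<lambda>\<omega>. c * \<omega> k)" for c k
      by (rule square_integrable_cmult[OF white_noise_coord_square_integrable])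
    have "L2_inner white_noise (\<lambda>\<omega>. \<Sum>i<n. bm_coeff i s * \<omega> (prod_encode (l, i))) (\<lambda>\<omega>. \<Sum>i<n. bm_coeff i t * \<omega> (prod_encode (l', i)))
      = (\<Sum>i<n. \<Sum>j<n. L2_inner white_noise (\<lambda>\<omega>. bm_coeff i s * \<omega> (prod_encode (l, i))) (\<lambda>\<omega>. bm_coeff j t * \<omega> (prod_encode (l', j))))"
      by (simp add: L2_inner_sum_left L2_inner_sum_right q square_integrable_sum)
    also have "\<dots> = (\<Sum>i<n. \<Sum>j<n. if j = i then (if l = l' then bm_coeff i s * bm_coeff i t else 0) else 0)"
    proof (intro sum.cong refl)
      fix i j
      have "L2_inner white_noise (\<lambda>\<omega>. bm_coeff i s * \<omega> (prod_encode (l, i))) (\<lambda>\<omega>. bm_coeff j t * \<omega> (prod_encode (l', j)))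
        = bm_coeff i s * (bm_coeff j t * L2_inner white_noise (\<lambda>\<omega>. \<omega> (prod_encode (l', j))) (\<lambda>\<omega>. \<omega> (prod_encode (l, i))))"
        by (simp only: L2_inner_cmult_left L2_inner_commute[of _ _ "\<lambda>\<omega>. bm_coeff j t * \<omega> (prod_encode (l', j))"])
      also have "\<dots> = (if j = i then (if l = l' then bm_coeff i s * bm_coeff i t else 0) else 0)"
        unfolding white_noise_coord_orthonormal by auto
      finally show "L2_inner white_noise (\<lambda>\<omega>. bm_coeff i s * \<omega> (prod_encode (l, i))) (\<lambda>\<omega>. bm_coeff j t * \<omega> (prod_encode (l', j))) = \<dots>" .
    qed
    also have "\<dots> = (if l = l' then \<Sum>i<n. bm_coeff i s * bm_coeff i t else 0)" by simp
    finally show ?thesis .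
  qed
  have A: "(\<lambda>n. if l = l' then \<Sum>i<n. bm_coeff i s * bm_coeff i t else 0) \<longlonglongrightarrow>
      L2_inner white_noise (\<lambda>\<omega>. bm_series s (noise_slice l \<omega>)) (\<lambda>\<omega>. bm_series t (noise_slice l' \<omega>))"
    using L2_tendsto_inner[OF bm_series_slice bm_series_slice, of s l t l'] unfolding e .
  have B: "(\<lambda>n. if l = l' then \<Sum>i<n. bm_coeff i s * bm_coeff i t else 0) \<longlonglongrightarrow> (if l = l' then min_kernel s t else 0)"
    using bm_coeff_sums[of s t] by (cases "l = l'") (simp_all add: sums_def)
  show ?thesis by (rule LIMSEQ_unique[OF A B])
qed

definition dyadic_floor :: "nat \<Rightarrow> real \<Rightarrow> real" where
  "dyadic_floor n t = of_int \<lfloor>2 ^ n * t\<rfloor> / 2 ^ n"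

lemma dyadic_floor_bounds: "dyadic_floor n t \<le> t" "t < dyadic_floor n t + 1 / 2 ^ n"
proof -
  have "real_of_int \<lfloor>2 ^ n * t\<rfloor> \<le> 2 ^ n * t" by linarith
  thus "dyadic_floor n t \<le> t" by (simp add: dyadic_floor_def field_simps)
  have "2 ^ n * t < real_of_int \<lfloor>2 ^ n * t\<rfloor> + 1" by linarith
  thus "t < dyadic_floor n t + 1 / 2 ^ n" by (simp add: dyadic_floor_def field_simps)
qed

text \<open>Chaining along the dyadic approximations of a point: two points at distance less than
  \<open>2\<^sup>-\<^sup>n\<close> have equal or adjacent approximations at level \<open>n\<close>, and consecutive approximations
  of one point differ by at most one increment of the finer level.\<close>

lemma dyadic_chaining:
  fixes f :: "real \<Rightarrow> real"
  assumes inc: "\<And>n k. k < N * 2 ^ n \<Longrightarrow> \<bar>f (real (Suc k) / 2 ^ n) - f (real k / 2 ^ n)\<bar> \<le> m n"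
    and m: "summable m"
  shows "\<And>t. 0 \<le> t \<Longrightarrow> t < real N \<Longrightarrow> convergent (\<lambda>n. f (dyadic_floor n t))"
    and "continuous_on {0..<real N} (\<lambda>t. lim (\<lambda>n. f (dyadic_floor n t)))"
proof -
  have idx: "\<exists>k<N * 2 ^ n. \<lfloor>2 ^ n * t\<rfloor> = int k" if "0 \<le> t" "t < real N" for n t
  proof (intro exI conjI)
    have "0 \<le> 2 ^ n * t" using that by simp
    thus e: "\<lfloor>2 ^ n * t\<rfloor> = int (nat \<lfloor>2 ^ n * t\<rfloor>)" by simp
    have "2 ^ n * t < 2 ^ n * real N" using that by simp
    also have "\<dots> = real (N * 2 ^ n)" by simp
    finally have "\<lfloor>2 ^ n * t\<rfloor> < int (N * 2 ^ n)" by (simp only: floor_less_iff of_int_of_nat_eq)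
    thus "nat \<lfloor>2 ^ n * t\<rfloor> < N * 2 ^ n" using e by linarith
  qed
  have m0: "0 \<le> m n" if "N > 0" for n using inc[of 0 n] that by (simp add: order_trans[OF abs_ge_zero])
  have step: "\<bar>f (dyadic_floor (Suc n) t) - f (dyadic_floor n t)\<bar> \<le> m (Suc n)" if t: "0 \<le> t" "t < real N" for n t
  proof -
    obtain k where k: "k < N * 2 ^ n" "\<lfloor>2 ^ n * t\<rfloor> = int k" using idx[OF t] by blast
    have "\<lfloor>2 ^ Suc n * t\<rfloor> = 2 * int k \<or> \<lfloor>2 ^ Suc n * t\<rfloor> = 2 * int k + 1"
    proof -
      have "real k \<le> 2 ^ n * t" "2 ^ n * t < real k + 1" using k(2) by linarith+
      moreover have "2 ^ Suc n * t = 2 * (2 ^ n * t)" by simp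
      ultimately show ?thesis by linarith
    qed
    thus ?thesis
    proof
      assume "\<lfloor>2 ^ Suc n * t\<rfloor> = 2 * int k"
      hence "dyadic_floor (Suc n) t = dyadic_floor n t" using k by (simp add: dyadic_floor_def)
      thus ?thesis using m0[of "Suc n"] k(1) by (cases "N = 0") simp_all
    next
      assume "\<lfloor>2 ^ Suc n * t\<rfloor> = 2 * int k + 1"
      hence "dyadic_floor (Suc n) t = real (Suc (2 * k)) / 2 ^ Suc n" by (simp add: dyadic_floor_def)
      moreover have "dyadic_floor n t = real (2 * k) / 2 ^ Suc n" using k by (simp add: dyadic_floor_def)
      ultimately show ?thesis using inc[of "2 * k" "Suc n"] k(1) by simp
    qed
  qed
  have sm: "summable (\<lambda>n. m (Suc n))" using m by (simp only: summable_Suc_iff)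
  have summ: "summable (\<lambda>n. f (dyadic_floor (Suc n) t) - f (dyadic_floor n t))" if "0 \<le> t" "t < real N" for t
    by (rule summable_comparison_test'[OF sm]) (use step[OF that] in simp)
  show conv: "convergent (\<lambda>n. f (dyadic_floor n t))" if t: "0 \<le> t" "t < real N" for t
  proof -
    have "convergent (\<lambda>n. \<Sum>i<n. f (dyadic_floor (Suc i) t) - f (dyadic_floor i t))"
      using summ[OF t] by (simp add: summable_iff_convergent)
    hence "convergent (\<lambda>n. f (dyadic_floor n t) - f (dyadic_floor 0 t))"
      by (simp only: sum_lessThan_telescope[where f = "\<lambda>n. f (dyadic_floor n t)"])
    from convergent_add[OF this convergent_const[of "f (dyadic_floor 0 t)"]]
    show ?thesis by simp
  qed
  define F where "F t = lim (\<lambda>n. f (dyadic_floor n t))" for t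
  have F: "(\<lambda>n. f (dyadic_floor n t)) \<longlonglongrightarrow> F t" if "0 \<le> t" "t < real N" for t
    using conv[OF that] unfolding F_def convergent_LIMSEQ_iff .
  define R where "R n = (\<Sum>i. m (Suc (i + n)))" for n
  have R: "R \<longlonglongrightarrow> 0" unfolding R_def using suminf_exist_split2[OF sm] by simp
  have tail: "\<bar>F t - f (dyadic_floor n t)\<bar> \<le> R n" if t: "0 \<le> t" "t < real N" for n t
  proof -
    have sn: "summable (\<lambda>i. m (Suc (i + n)))"
      using sm summable_iff_shift[of "\<lambda>i. m (Suc i)" n] by simp
    have N0: "N > 0" using t by (cases "N = 0") simp_all
    have "\<bar>f (dyadic_floor (n + j) t) - f (dyadic_floor n t)\<bar> \<le> R n" for j
    proof -
      have "\<bar>f (dyadic_floor (n + j) t) - f (dyadic_floor n t)\<bar> \<le> (\<Sum>i<j. m (Suc (i + n)))"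
      proof (induction j)
        case (Suc j)
        show ?case using Suc step[OF t, of "n + j"] by (simp add: add.commute)
      qed simp
      also have "\<dots> \<le> R n" unfolding R_def by (rule sum_le_suminf[OF sn]) (use m0[OF N0] in auto)
      finally show ?thesis .
    qed
    moreover have "(\<lambda>j. \<bar>f (dyadic_floor (n + j) t) - f (dyadic_floor n t)\<bar>) \<longlonglongrightarrow> \<bar>F t - f (dyadic_floor n t)\<bar>"
      using LIMSEQ_ignore_initial_segment[OF F[OF t], of n]
      by (intro tendsto_intros) (simp add: add.commute)
    ultimately show ?thesis by (intro LIMSEQ_le_const2) auto
  qed
  have adj: "\<bar>f (dyadic_floor n s) - f (dyadic_floor n t)\<bar> \<le> m n"
    if s: "0 \<le> s" "s < real N" and t: "0 \<le> t" "t < real N" and d: "\<bar>s - t\<bar> < 1 / 2 ^ n" for n s t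
  proof -
    have *: "\<bar>f (dyadic_floor n s) - f (dyadic_floor n t)\<bar> \<le> m n"
      if s: "0 \<le> s" "s < real N" and t: "0 \<le> t" "t < real N" and d: "s \<le> t" "t - s < 1 / 2 ^ n" for s t
    proof -
      obtain k where k: "k < N * 2 ^ n" "\<lfloor>2 ^ n * s\<rfloor> = int k" using idx[OF s] by blast
      have "2 ^ n * s \<le> 2 ^ n * t" using d by simp
      moreover have "2 ^ n * t < 2 ^ n * s + 1" using d by (simp add: field_simps)
      ultimately have "\<lfloor>2 ^ n * t\<rfloor> = int k \<or> \<lfloor>2 ^ n * t\<rfloor> = int k + 1" using k(2) by linarith
      moreover have "N > 0" using t by (cases "N = 0") simp_all
      ultimately show ?thesis
        using inc[OF k(1)] m0[of n] k(2) by (auto simp: dyadic_floor_def abs_minus_commute add.commute)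
    qed
    show ?thesis
    proof (cases "s \<le> t")
      case True thus ?thesis using *[OF s t] d by simp
    next
      case False thus ?thesis using *[OF t s] d by (simp add: abs_minus_commute)
    qed
  qed
  show "continuous_on {0..<real N} (\<lambda>t. lim (\<lambda>n. f (dyadic_floor n t)))"
    unfolding F_def[symmetric] continuous_on_iff
  proof (intro ballI allI impI)
    fix t e :: real assume t: "t \<in> {0..<real N}" and "e > 0"
    have "(\<lambda>n. R n + m n + R n) \<longlonglongrightarrow> 0 + 0 + 0"
      by (intro tendsto_intros R summable_LIMSEQ_zero m)
    hence "eventually (\<lambda>n. R n + m n + R n < e) sequentially"
      using \<open>e > 0\<close> by (intro order_tendstoD(2)[where a = e]) simp_all
    then obtain n where n: "R n + m n + R n < e" by (auto simp: eventually_sequentially)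
    show "\<exists>d>0. \<forall>s\<in>{0..<real N}. dist s t < d \<longrightarrow> dist (F s) (F t) < e"
    proof (intro exI[of _ "1 / 2 ^ n"] conjI ballI impI)
      fix s assume s: "s \<in> {0..<real N}" and d: "dist s t < 1 / 2 ^ n"
      have "\<bar>F s - f (dyadic_floor n s)\<bar> \<le> R n" using tail[of s n] s by simp
      moreover have "\<bar>F t - f (dyadic_floor n t)\<bar> \<le> R n" using tail[of t n] t by simp
      moreover have "\<bar>f (dyadic_floor n s) - f (dyadic_floor n t)\<bar> \<le> m n"
        using adj[of s t n] s t d by (simp add: dist_real_def)
      ultimately show "dist (F s) (F t) < e" using n by (simp add: dist_real_def)
    qed simp
  qed
qed

text \<open>The limit along dyadic approximations of \<open>t\<close> selects the version with continuous paths.\<close>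

definition brownian :: "nat \<Rightarrow> real \<Rightarrow> (nat \<Rightarrow> real) \<Rightarrow> real" where
  "brownian l t \<omega> = lim (\<lambda>n. bm_series (dyadic_floor n t) (noise_slice l \<omega>))"

text \<open>Increments over intervals of length \<open>2\<^sup>-\<^sup>n\<close> have fourth moment \<open>3 \<cdot> 4\<^sup>-\<^sup>n\<close>. Even after
  multiplication by \<open>(3/2)\<^sup>n\<close> the fourth powers of all \<open>N \<cdot> 2\<^sup>n\<close> of them are summable
  over \<open>n\<close> in the mean, so that the increments decay geometrically almost surely.\<close>

lemma bm_series_increments:
  "AE \<omega> in white_noise. \<exists>m. summable m \<and> (\<forall>n k. k < N * 2 ^ n \<longrightarrow>
     \<bar>bm_series (real (Suc k) / 2 ^ n) (noise_slice l \<omega>) - bm_series (real k / 2 ^ n) (noise_slice l \<omega>)\<bar> \<le> m n)"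
proof -
  define D where "D n k \<omega> = bm_series (real (Suc k) / 2 ^ n) (noise_slice l \<omega>) - bm_series (real k / 2 ^ n) (noise_slice l \<omega>)" for n k \<omega>
  have span: "gaussian_span (D n k)" for n k
    unfolding D_def by (intro gaussian_span_diff gaussian_span_bm_series)
  have [measurable]: "D n k \<in> borel_measurable white_noise" for n k
    using span by (rule gaussian_span_measurable)
  have var: "L2_inner white_noise (D n k) (D n k) = 1 / 2 ^ n" for n k
  proof -
    note sq = gaussian_span_square_integrable[OF gaussian_span_bm_series]
    have "L2_inner white_noise (D n k) (D n k) =
      min_kernel (real (Suc k) / 2 ^ n) (real (Suc k) / 2 ^ n) - min_kernel (real k / 2 ^ n) (real (Suc k) / 2 ^ n)
      - (min_kernel (real (Suc k) / 2 ^ n) (real k / 2 ^ n) - min_kernel (real k / 2 ^ n) (real k / 2 ^ n))"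
      unfolding D_def
      by (simp only: L2_inner_diff_left[OF sq sq square_integrable_diff[OF sq sq]] L2_inner_diff_right[OF sq sq sq] L2_inner_bm_series if_True)
        simp
    also have "\<dots> = 1 / 2 ^ n"
    proof -
      have "real (Suc k) / 2 ^ n = real k / 2 ^ n + 1 / 2 ^ n" by (simp add: add_divide_distrib)
      moreover have "0 \<le> real k / 2 ^ n" "0 < 1 / (2 ^ n :: real)" by simp_all
      ultimately show ?thesis by (simp add: min_kernel_def)
    qed
    finally show ?thesis .
  qed
  define Y where "Y \<omega> = (\<Sum>n. ennreal ((3/2) ^ n) * (\<Sum>k<N * 2 ^ n. ennreal ((D n k \<omega>) ^ 4)))" for \<omega>
  have "(\<integral>\<^sup>+\<omega>. Y \<omega> \<partial>white_noise) = (\<Sum>n. ennreal ((3/2) ^ n) * (\<Sum>k<N * 2 ^ n. \<integral>\<^sup>+\<omega>. ennreal ((D n k \<omega>) ^ 4) \<partial>white_noise))"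
    unfolding Y_def by (simp add: nn_integral_suminf nn_integral_cmult nn_integral_sum del: sum_ennreal)
  also have "\<dots> = (\<Sum>n. ennreal (3 * real N * (3/4) ^ n))"
  proof (intro suminf_cong)
    fix n
    have "(\<Sum>k<N * 2 ^ n. \<integral>\<^sup>+\<omega>. ennreal ((D n k \<omega>) ^ 4) \<partial>white_noise) = (\<Sum>k<N * 2 ^ n. ennreal (3 * (1 / 2 ^ n)\<^sup>2))"
      by (simp only: gaussian_span_4th_moment[OF span] var)
    also have "\<dots> = ennreal (\<Sum>k<N * 2 ^ n. 3 * (1 / 2 ^ n)\<^sup>2)" by (rule sum_ennreal) simp
    also have "(\<Sum>k<N * 2 ^ n. 3 * (1 / 2 ^ n)\<^sup>2) = 3 * real N * (1 / 2 ^ n :: real)"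
      by (simp add: power2_eq_square field_simps)
    finally have "ennreal ((3/2) ^ n) * (\<Sum>k<N * 2 ^ n. \<integral>\<^sup>+\<omega>. ennreal ((D n k \<omega>) ^ 4) \<partial>white_noise)
        = ennreal ((3/2) ^ n) * ennreal (3 * real N * (1 / 2 ^ n))" by (simp only:)
    also have "\<dots> = ennreal ((3/2) ^ n * (3 * real N * (1 / 2 ^ n)))"
      by (rule ennreal_mult'[symmetric]) simp
    also have "(3/2) ^ n * (3 * real N * (1 / 2 ^ n)) = 3 * real N * (3/4) ^ n"
      by (simp add: power_divide power_mult_distrib[symmetric] field_simps)
    finally show "ennreal ((3/2) ^ n) * (\<Sum>k<N * 2 ^ n. \<integral>\<^sup>+\<omega>. ennreal ((D n k \<omega>) ^ 4) \<partial>white_noise) = ennreal (3 * real N * (3/4) ^ n)" .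
  qed
  also have "\<dots> < \<infinity>"
  proof -
    have "summable (\<lambda>n. 3 * real N * (3/4) ^ n)"
      by (intro summable_mult summable_geometric) simp
    hence "(\<Sum>n. ennreal (3 * real N * (3/4) ^ n)) = ennreal (\<Sum>n. 3 * real N * (3/4) ^ n)"
      by (intro suminf_ennreal2) simp_all
    thus ?thesis by (simp only: infinity_ennreal_def ennreal_less_top)
  qed
  finally have "(\<integral>\<^sup>+\<omega>. Y \<omega> \<partial>white_noise) \<noteq> \<infinity>" by simp
  hence "AE \<omega> in white_noise. Y \<omega> \<noteq> \<infinity>"
    by (intro nn_integral_noteq_infinite) (simp_all add: Y_def)
  thus ?thesis
  proof eventually_elim
    case (elim \<omega>)
    then obtain C where C: "Y \<omega> = ennreal C" "C \<ge> 0" by (cases "Y \<omega>") auto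
    have b: "(3/2) ^ n * (D n k \<omega>) ^ 4 \<le> C" if k: "k < N * 2 ^ n" for n k
    proof -
      have "ennreal ((3/2) ^ n * (D n k \<omega>) ^ 4) = ennreal ((3/2) ^ n) * ennreal ((D n k \<omega>) ^ 4)"
        by (simp add: ennreal_mult)
      also have "\<dots> \<le> ennreal ((3/2) ^ n) * (\<Sum>k<N * 2 ^ n. ennreal ((D n k \<omega>) ^ 4))"
        using k by (intro mult_left_mono member_le_sum) auto
      also have "\<dots> = (\<Sum>n\<in>{n}. ennreal ((3/2) ^ n) * (\<Sum>k<N * 2 ^ n. ennreal ((D n k \<omega>) ^ 4)))" by simp
      also have "\<dots> \<le> Y \<omega>" unfolding Y_def by (rule sum_le_suminf) auto
      finally show ?thesis using C by simp
    qed
    \<comment> \<open>From \<open>(3/2)\<^sup>n \<bar>D\<bar>\<^sup>4 \<le> C\<close>, the increments of level \<open>n\<close> are bounded by a multiple of \<open>(2/3)\<^sup>n\<^sup>/\<^sup>4\<close>.\<close>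
    define q :: real where "q = root 4 (2/3)"
    have q: "0 \<le> q" "q < 1" "q ^ 4 = 2/3"
      by (simp_all add: q_def)
    define m where "m n = root 4 C * q ^ n" for n
    have "summable m" unfolding m_def using q by (intro summable_mult summable_geometric) simp
    moreover have "\<bar>D n k \<omega>\<bar> \<le> m n" if k: "k < N * 2 ^ n" for n k
    proof (rule power_le_imp_le_base[of _ 3])
      have "\<bar>D n k \<omega>\<bar> ^ 4 = (2/3) ^ n * ((3/2) ^ n * (D n k \<omega>) ^ 4)"
        by (simp add: power_divide power_even_abs)
      also have "\<dots> \<le> (2/3) ^ n * C" using b[OF k] by (intro mult_left_mono) auto
      also have "\<dots> = (q ^ 4) ^ n * (root 4 C) ^ 4"
      proof -
        have "root 4 C ^ 4 = C" using C by simp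
        thus ?thesis by (simp only: q(3))
      qed
      also have "\<dots> = (m n) ^ 4" by (simp add: m_def power_mult_distrib power_mult[symmetric] mult.commute)
      finally show "\<bar>D n k \<omega>\<bar> ^ Suc 3 \<le> m n ^ Suc 3" by (simp add: numeral_eq_Suc)
      show "0 \<le> m n" using q C by (simp add: m_def)
    qed
    ultimately show ?case unfolding D_def by blast
  qed
qed

lemma brownian_paths:
  "AE \<omega> in white_noise. continuous_on {0..} (\<lambda>t. brownian l t \<omega>) \<and>
     (\<forall>t\<ge>0. (\<lambda>n. bm_series (dyadic_floor n t) (noise_slice l \<omega>)) \<longlonglongrightarrow> brownian l t \<omega>)"
proof -
  have "AE \<omega> in white_noise. \<forall>N. \<exists>m. summable m \<and> (\<forall>n k. k < N * 2 ^ n \<longrightarrow>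
     \<bar>bm_series (real (Suc k) / 2 ^ n) (noise_slice l \<omega>) - bm_series (real k / 2 ^ n) (noise_slice l \<omega>)\<bar> \<le> m n)"
    unfolding AE_all_countable by (intro allI bm_series_increments)
  thus ?thesis
  proof eventually_elim
    case (elim \<omega>)
    have cont: "continuous_on {0..<real N} (\<lambda>t. brownian l t \<omega>)"
      and conv: "0 \<le> t \<Longrightarrow> t < real N \<Longrightarrow> convergent (\<lambda>n. bm_series (dyadic_floor n t) (noise_slice l \<omega>))" for N t
    proof -
      obtain m where m: "summable m" "\<And>n k. k < N * 2 ^ n \<Longrightarrow>
         \<bar>bm_series (real (Suc k) / 2 ^ n) (noise_slice l \<omega>) - bm_series (real k / 2 ^ n) (noise_slice l \<omega>)\<bar> \<le> m n"
        using elim by blast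
      show "continuous_on {0..<real N} (\<lambda>t. brownian l t \<omega>)"
        unfolding brownian_def by (rule dyadic_chaining(2)[where m = m]) (use m in auto)
      show "0 \<le> t \<Longrightarrow> t < real N \<Longrightarrow> convergent (\<lambda>n. bm_series (dyadic_floor n t) (noise_slice l \<omega>))"
        by (rule dyadic_chaining(1)[where m = m and N = N and f = "\<lambda>t. bm_series t (noise_slice l \<omega>)"]) (use m in auto)
    qed
    show ?case
    proof (intro conjI allI impI)
      show "continuous_on {0..} (\<lambda>t. brownian l t \<omega>)"
        unfolding continuous_on_eq_continuous_within
      proof
        fix t :: real assume t: "t \<in> {0..}"
        obtain N where N: "t < real N" using reals_Archimedean2 by blast
        have "at t within {0..} = at t within {0..<real N}"
          by (rule at_within_nhd[of t "{..<real N}"]) (use N in auto)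
        moreover have "continuous (at t within {0..<real N}) (\<lambda>t. brownian l t \<omega>)"
          using cont[of N] t N unfolding continuous_on_eq_continuous_within by simp
        ultimately show "continuous (at t within {0..}) (\<lambda>t. brownian l t \<omega>)" by simp
      qed
      fix t :: real assume t: "t \<ge> 0"
      obtain N where N: "t < real N" using reals_Archimedean2 by blast
      show "(\<lambda>n. bm_series (dyadic_floor n t) (noise_slice l \<omega>)) \<longlonglongrightarrow> brownian l t \<omega>"
        using conv[OF t N] unfolding brownian_def convergent_LIMSEQ_iff .
    qed
  qed
qed

lemma measurable_brownian0: "(\<lambda>\<eta>. lim (\<lambda>n. bm_series (dyadic_floor n t) \<eta>)) \<in> borel_measurable white_noise"
proof -
  have [measurable]: "bm_series s \<in> borel_measurable white_noise" for s
    by (rule square_integrable_measurable[OF L2_tendstoD(2)[OF bm_series]])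
  show ?thesis by measurable
qed

lemma measurable_brownian [measurable]: "brownian l t \<in> borel_measurable white_noise"
  unfolding brownian_def[abs_def] by (rule measurable_compose[OF measurable_noise_slice measurable_brownian0])

text \<open>The dyadic approximations converge both almost surely and in \<open>L\<^sup>2\<close>, because the increments
  over intervals of length \<open>2\<^sup>-\<^sup>n\<close> have variance \<open>2\<^sup>-\<^sup>n\<close>.\<close>

lemma brownian_eq_series:
  assumes t: "t \<ge> 0"
  shows "AE \<omega> in white_noise. bm_series t (noise_slice l \<omega>) = brownian l t \<omega>"
proof -
  note sq = gaussian_span_square_integrable[OF gaussian_span_bm_series]
  have "L2_tendsto white_noise (\<lambda>n \<omega>. bm_series (dyadic_floor n t) (noise_slice l \<omega>)) (\<lambda>\<omega>. bm_series t (noise_slice l \<omega>))"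
    unfolding L2_tendsto_def
  proof (intro conjI allI sq)
    have sqle: "(L2_norm white_noise (\<lambda>\<omega>. bm_series (dyadic_floor n t) (noise_slice l \<omega>) - bm_series t (noise_slice l \<omega>)))\<^sup>2 \<le> (1/2) ^ n" for n
    proof -
      have "(L2_norm white_noise (\<lambda>\<omega>. bm_series (dyadic_floor n t) (noise_slice l \<omega>) - bm_series t (noise_slice l \<omega>)))\<^sup>2
        = min_kernel (dyadic_floor n t) (dyadic_floor n t) - min_kernel t (dyadic_floor n t)
          - (min_kernel (dyadic_floor n t) t - min_kernel t t)"
        unfolding L2_norm_power2
        by (simp only: L2_inner_diff_left[OF sq sq square_integrable_diff[OF sq sq]] L2_inner_diff_right[OF sq sq sq] L2_inner_bm_series if_True)
          simp
      also have "\<dots> \<le> (1/2) ^ n" using dyadic_floor_bounds[where n = n and t = t] t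
        by (auto simp: min_kernel_def min_def max_def power_divide)
      finally show ?thesis .
    qed
    have "(\<lambda>n. sqrt ((1/2::real) ^ n)) \<longlonglongrightarrow> sqrt 0"
      by (intro tendsto_real_sqrt LIMSEQ_power_zero) simp
    hence lim: "(\<lambda>n. sqrt ((1/2::real) ^ n)) \<longlonglongrightarrow> 0" by simp
    show "(\<lambda>n. L2_norm white_noise (\<lambda>\<omega>. bm_series (dyadic_floor n t) (noise_slice l \<omega>) - bm_series t (noise_slice l \<omega>))) \<longlonglongrightarrow> 0"
    proof (rule Lim_null_comparison[OF always_eventually[OF allI] lim])
      fix n show "norm (L2_norm white_noise (\<lambda>\<omega>. bm_series (dyadic_floor n t) (noise_slice l \<omega>) - bm_series t (noise_slice l \<omega>))) \<le> sqrt ((1/2) ^ n)"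
        using real_le_rsqrt[OF sqle[of n]] by simp
    qed
  qed
  moreover have "AE \<omega> in white_noise. (\<lambda>n. bm_series (dyadic_floor n t) (noise_slice l \<omega>)) \<longlonglongrightarrow> brownian l t \<omega>"
    using brownian_paths[of l] by eventually_elim (use t in blast)
  ultimately have "AE \<omega> in white_noise. brownian l t \<omega> = bm_series t (noise_slice l \<omega>)"
    by (rule L2_tendsto_AE_unique) (rule measurable_brownian)
  thus ?thesis by eventually_elim simp
qed

lemma gaussian_span_cong_AE:
  assumes V: "gaussian_span V" and e: "AE \<omega> in white_noise. V \<omega> = W \<omega>" and W: "W \<in> borel_measurable white_noise"
  shows "gaussian_span W"
  by (rule gaussian_span_limit[of "\<lambda>_. V"])
    (rule V, rule L2_tendsto_cong_AE[OF L2_tendsto_const[OF gaussian_span_square_integrable[OF V]] e W])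

lemma gaussian_span_brownian: "t \<ge> 0 \<Longrightarrow> gaussian_span (brownian l t)"
  by (rule gaussian_span_cong_AE[OF gaussian_span_bm_series brownian_eq_series measurable_brownian])

lemma L2_inner_brownian:
  assumes "s \<ge> 0" "t \<ge> 0"
  shows "L2_inner white_noise (brownian l s) (brownian l' t) = (if l = l' then min s t else 0)"
proof -
  have "L2_inner white_noise (\<lambda>\<omega>. bm_series s (noise_slice l \<omega>)) (\<lambda>\<omega>. bm_series t (noise_slice l' \<omega>))
      = L2_inner white_noise (brownian l s) (brownian l' t)"
    by (rule L2_inner_cong_AE[OF brownian_eq_series[OF assms(1)] brownian_eq_series[OF assms(2)]])
      (rule gaussian_span_measurable[OF gaussian_span_bm_series] measurable_brownian)+
  hence "L2_inner white_noise (brownian l s) (brownian l' t) = (if l = l' then min_kernel s t else 0)"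
    by (simp only: L2_inner_bm_series)
  moreover have "min_kernel s t = min s t" using assms by (simp add: min_kernel_def)
  ultimately show ?thesis by simp
qed

text \<open>The characteristic function of a combination depends on its variance only, which is a
  function of the inner products.\<close>

lemma equal_in_law_gaussian_span:
  assumes Z: "\<And>e. e \<in> E \<Longrightarrow> gaussian_span (Z e)" and Z': "\<And>e. e \<in> E \<Longrightarrow> gaussian_span (Z' e)"
    and cov: "\<And>e f. e \<in> E \<Longrightarrow> f \<in> E \<Longrightarrow> L2_inner white_noise (Z e) (Z f) = L2_inner white_noise (Z' e) (Z' f)"
  shows "equal_in_law white_noise white_noise E Z Z'"
proof (rule equal_in_law_iexpI[OF prob_space_white_noise prob_space_white_noise])
  fix J c assume J: "finite J" "J \<subseteq> E"
  have "L2_inner white_noise (\<lambda>x. \<Sum>i\<in>J. c i * Z i x) (\<lambda>x. \<Sum>i\<in>J. c i * Z i x)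
      = L2_inner white_noise (\<lambda>x. \<Sum>i\<in>J. c i * Z' i x) (\<lambda>x. \<Sum>i\<in>J. c i * Z' i x)"
  proof (subst (1 2) L2_inner_combination)
    show "(\<Sum>i\<in>J. \<Sum>j\<in>J. c i * c j * L2_inner white_noise (Z i) (Z j)) = (\<Sum>i\<in>J. \<Sum>j\<in>J. c i * c j * L2_inner white_noise (Z' i) (Z' j))"
      by (intro sum.cong refl) (use J cov in auto)
  qed (use J Z Z' in \<open>auto intro!: gaussian_span_square_integrable\<close>)
  moreover have "gaussian_span (\<lambda>x. \<Sum>i\<in>J. c i * Z i x)" "gaussian_span (\<lambda>x. \<Sum>i\<in>J. c i * Z' i x)"
    using J Z Z' by (auto intro!: gaussian_span_sum gaussian_span_cmult)
  ultimately show "(\<integral>x. iexp (\<Sum>i\<in>J. c i * Z i x) \<partial>white_noise) = (\<integral>x. iexp (\<Sum>i\<in>J. c i * Z' i x) \<partial>white_noise)"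
    by (simp only: char_gaussian_span)
qed (use Z Z' in \<open>auto intro!: gaussian_span_measurable\<close>)

text \<open>Orthogonal elements of the Gaussian Hilbert space are jointly distributed like suitably
  scaled coordinates of the white noise, which are independent.\<close>

lemma gaussian_span_orthogonal_indep:
  fixes V :: "nat \<Rightarrow> (nat \<Rightarrow> real) \<Rightarrow> real"
  assumes V: "\<And>i. i \<in> I \<Longrightarrow> gaussian_span (V i)"
    and orth: "\<And>i j. i \<in> I \<Longrightarrow> j \<in> I \<Longrightarrow> i \<noteq> j \<Longrightarrow> L2_inner white_noise (V i) (V j) = 0"
  shows "white_noise.indep_vars (\<lambda>_. borel) V I"
proof (cases "I = {}")
  case True
  thus ?thesis by (simp add: white_noise.indep_vars_def white_noise.indep_sets_def)
next
  case False
  define U where "U i \<omega> = L2_norm white_noise (V i) * \<omega> i" for i and \<omega> :: "nat \<Rightarrow> real"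
  have U: "gaussian_span (U i)" for i unfolding U_def by (intro gaussian_span_cmult gaussian_span_coord)
  have law: "equal_in_law white_noise white_noise I V U"
  proof (rule equal_in_law_gaussian_span[OF V U])
    fix i j assume ij: "i \<in> I" "j \<in> I"
    have "L2_inner white_noise (U i) (U j)
        = L2_norm white_noise (V i) * (L2_norm white_noise (V j) * L2_inner white_noise (\<lambda>\<omega>. \<omega> j) (\<lambda>\<omega>. \<omega> i))"
      unfolding U_def by (simp only: L2_inner_cmult_left L2_inner_commute[of _ _ "\<lambda>\<omega>. L2_norm white_noise (V j) * \<omega> j"])
    thus "L2_inner white_noise (V i) (V j) = L2_inner white_noise (U i) (U j)"
      using orth[OF ij] L2_norm_power2[of white_noise "V i"]
      by (cases "i = j") (simp_all add: white_noise_coord_orthonormal power2_eq_square)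
  qed
  have mV: "V i \<in> borel_measurable white_noise" if "i \<in> I" for i using V[OF that] by (rule gaussian_span_measurable)
  have mU: "U i \<in> borel_measurable white_noise" for i using U by (rule gaussian_span_measurable)
  have "white_noise.indep_vars (\<lambda>_. borel) U I"
    unfolding U_def[abs_def]
    by (rule white_noise.indep_vars_subset[OF white_noise.indep_vars_compose2[OF indep_white_noise_coords,
            where Y = "\<lambda>i x. L2_norm white_noise (V i) * x" and N = "\<lambda>_. borel"]]) simp_all
  hence d: "distr white_noise (Pi\<^sub>M I (\<lambda>_. borel)) (\<lambda>x. \<lambda>i\<in>I. U i x) = Pi\<^sub>M I (\<lambda>i. distr white_noise borel (U i))"
    using white_noise.indep_vars_iff_distr_eq_PiM'[OF False mU] by simp
  have comp: "distr white_noise borel (V i) = distr white_noise borel (U i)" if i: "i \<in> I" for i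
  proof -
    have "distr (distr white_noise (Pi\<^sub>M I (\<lambda>_. borel)) (\<lambda>x. \<lambda>i\<in>I. V i x)) borel (\<lambda>y. y i) = distr white_noise borel (V i)"
      using mV i by (subst distr_distr) (auto simp: comp_def intro!: measurable_restrict)
    moreover have "distr (distr white_noise (Pi\<^sub>M I (\<lambda>_. borel)) (\<lambda>x. \<lambda>i\<in>I. U i x)) borel (\<lambda>y. y i) = distr white_noise borel (U i)"
      using mU i by (subst distr_distr) (auto simp: comp_def intro!: measurable_restrict)
    ultimately show ?thesis using law unfolding equal_in_law_def by simp
  qed
  have "distr white_noise (Pi\<^sub>M I (\<lambda>_. borel)) (\<lambda>x. \<lambda>i\<in>I. V i x) = Pi\<^sub>M I (\<lambda>i. distr white_noise borel (U i))"
    using law d unfolding equal_in_law_def by simp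
  also have "\<dots> = Pi\<^sub>M I (\<lambda>i. distr white_noise borel (V i))"
    by (rule PiM_cong) (simp_all add: comp)
  finally show ?thesis
    by (rule iffD2[OF white_noise.indep_vars_iff_distr_eq_PiM'[OF False], rotated]) (rule mV)
qed

lemma L2_inner_brownian_increments:
  assumes "0 \<le> a" "a \<le> b" "0 \<le> c" "c \<le> d"
  shows "L2_inner white_noise (\<lambda>\<omega>. brownian l b \<omega> - brownian l a \<omega>) (\<lambda>\<omega>. brownian l' d \<omega> - brownian l' c \<omega>)
    = (if l = l' then min b d - min a d - (min b c - min a c) else 0)"
proof -
  have sq: "square_integrable white_noise (brownian l t)" if "t \<ge> 0" for l t
    by (rule gaussian_span_square_integrable[OF gaussian_span_brownian[OF that]])
  have "0 \<le> b" "0 \<le> d" using assms by linarith+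
  thus ?thesis using assms
    by (simp add: L2_inner_diff_left L2_inner_diff_right square_integrable_diff sq L2_inner_brownian)
qed

lemma standard_brownian_motion_brownian: "standard_brownian_motion white_noise (brownian l)"
  unfolding standard_brownian_motion_def
proof (intro conjI allI impI)
  show "brownian l t \<in> borel_measurable white_noise" for t by (rule measurable_brownian)
  show "AE \<omega> in white_noise. brownian l 0 \<omega> = 0"
  proof -
    have "(\<integral>\<^sup>+x. ennreal ((brownian l 0 x)\<^sup>2) \<partial>white_noise) = 0"
      using nn_integral_square[OF gaussian_span_square_integrable[OF gaussian_span_brownian[of 0 l]]]
      by (simp add: L2_norm_power2 L2_inner_brownian)
    hence "AE x in white_noise. ennreal ((brownian l 0 x)\<^sup>2) = 0"
      by (subst (asm) nn_integral_0_iff_AE) simp_all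
    thus ?thesis by eventually_elim simp
  qed
  show "AE \<omega> in white_noise. continuous_on {0..} (\<lambda>t. brownian l t \<omega>)"
    using brownian_paths[of l] by eventually_elim blast
next
  fix s t :: real assume st: "0 \<le> s" "s < t"
  have v: "L2_inner white_noise (\<lambda>\<omega>. brownian l t \<omega> - brownian l s \<omega>) (\<lambda>\<omega>. brownian l t \<omega> - brownian l s \<omega>) = t - s"
    using st by (subst L2_inner_brownian_increments) simp_all
  have "gaussian_span (\<lambda>\<omega>. brownian l t \<omega> - brownian l s \<omega>)"
    by (intro gaussian_span_diff gaussian_span_brownian) (use st in simp_all)
  from gaussian_span_normal[OF this, unfolded v] st
  show "distributed white_noise lborel (\<lambda>\<omega>. brownian l t \<omega> - brownian l s \<omega>) (\<lambda>x. ennreal (normal_density 0 (sqrt (t - s)) x))"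
    by simp
next
  fix n :: nat and \<tau> :: "nat \<Rightarrow> real" assume \<tau>: "0 \<le> \<tau> 0" "mono \<tau>"
  have nn: "0 \<le> \<tau> i" for i using \<tau> monoD[OF \<tau>(2), of 0 i] by simp
  have le: "\<tau> i \<le> \<tau> (Suc i)" for i using monoD[OF \<tau>(2), of i "Suc i"] by simp
  show "white_noise.indep_vars (\<lambda>_. borel) (\<lambda>i \<omega>. brownian l (\<tau> (Suc i)) \<omega> - brownian l (\<tau> i) \<omega>) {..<n}"
  proof (rule gaussian_span_orthogonal_indep)
    show "gaussian_span (\<lambda>\<omega>. brownian l (\<tau> (Suc i)) \<omega> - brownian l (\<tau> i) \<omega>)" for i
      by (intro gaussian_span_diff gaussian_span_brownian nn)
    fix i j :: nat assume "i \<noteq> j"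
    hence "Suc i \<le> j \<or> Suc j \<le> i" by linarith
    hence "\<tau> (Suc i) \<le> \<tau> j \<or> \<tau> (Suc j) \<le> \<tau> i" using monoD[OF \<tau>(2)] by blast
    thus "L2_inner white_noise (\<lambda>\<omega>. brownian l (\<tau> (Suc i)) \<omega> - brownian l (\<tau> i) \<omega>) (\<lambda>\<omega>. brownian l (\<tau> (Suc j)) \<omega> - brownian l (\<tau> j) \<omega>) = 0"
      using le[of i] le[of j] by (subst L2_inner_brownian_increments) (auto simp: nn min_def)
  qed
qed

text \<open>The \<open>l\<close>-th motion is a function of the \<open>l\<close>-th slice, that is, of the block \<open>K l\<close> of coordinates.\<close>

theorem independent_brownian_motions_brownian: "independent_brownian_motions white_noise brownian"
  unfolding independent_brownian_motions_def
proof (intro conjI allI standard_brownian_motion_brownian)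
  define K where "K l = range (\<lambda>i. prod_encode (l, i))" for l :: nat
  have "white_noise.indep_vars (\<lambda>l. Pi\<^sub>M (K l) (\<lambda>_. borel)) (\<lambda>l \<omega>. restrict (\<lambda>i. \<omega> i) (K l)) UNIV"
    by (rule white_noise.indep_vars_restrict[OF indep_white_noise_coords]) (auto simp: K_def disjoint_family_on_def)
  hence "white_noise.indep_vars (\<lambda>_. Pi\<^sub>M {0..} (\<lambda>_. borel))
    (\<lambda>l \<omega>. (\<lambda>x. \<lambda>t\<in>{0..}. lim (\<lambda>n. bm_series (dyadic_floor n t) (\<lambda>i. x (prod_encode (l, i))))) (restrict (\<lambda>i. \<omega> i) (K l))) UNIV"
  proof (rule white_noise.indep_vars_compose2)
    fix l :: nat
    have "(\<lambda>x i. x (prod_encode (l, i))) \<in> Pi\<^sub>M (K l) (\<lambda>_. borel) \<rightarrow>\<^sub>M Pi\<^sub>M UNIV (\<lambda>_. borel :: real measure)"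
      by (rule measurable_PiM_single') (auto simp: K_def intro!: measurable_component_singleton)
    hence "(\<lambda>x i. x (prod_encode (l, i))) \<in> Pi\<^sub>M (K l) (\<lambda>_. borel) \<rightarrow>\<^sub>M white_noise"
      using measurable_cong_sets[OF refl sets_white_noise] by blast
    from measurable_compose[OF this measurable_brownian0]
    show "(\<lambda>x. \<lambda>t\<in>{0..}. lim (\<lambda>n. bm_series (dyadic_floor n t) (\<lambda>i. x (prod_encode (l, i))))) \<in> Pi\<^sub>M (K l) (\<lambda>_. borel) \<rightarrow>\<^sub>M Pi\<^sub>M {0..} (\<lambda>_. borel)"
      by (intro measurable_restrict)
  qed
  moreover have "(\<lambda>i. (restrict (\<lambda>i. \<omega> i) (K l)) (prod_encode (l, i))) = noise_slice l \<omega>" for l and \<omega> :: "nat \<Rightarrow> real"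
    by (auto simp: K_def noise_slice_def)
  ultimately show "white_noise.indep_vars (\<lambda>_. Pi\<^sub>M {0..} (\<lambda>_. borel)) (\<lambda>l \<omega>. \<lambda>t\<in>{0..}. brownian l t \<omega>) UNIV"
    by (simp only: brownian_def)
qed

section \<open>Wiener integrals\<close>

subsection \<open>Density of step functions\<close>

text \<open>The closure of the step functions on \<open>[0, u]\<close> in \<open>L\<^sup>2\<close>.\<close>

definition step_approx :: "real \<Rightarrow> (real \<Rightarrow> real) \<Rightarrow> bool" where
  "step_approx u f \<longleftrightarrow> square_integrable lborel f \<and>
     (\<forall>e>0. \<exists>\<phi>. steps_in u \<phi> \<and> L2_norm lborel (\<lambda>x. step_fun \<phi> x - f x) < e)"

lemma step_fun_Nil [simp]: "step_fun [] = (\<lambda>x. 0)"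
  by (simp add: step_fun_def fun_eq_iff)

lemma step_fun_Cons: "step_fun ((c, a, b) # \<phi>) = (\<lambda>x. c * indicator {a<..b} x + step_fun \<phi> x)"
  by (simp add: step_fun_def fun_eq_iff)

lemma step_fun_append: "step_fun (\<phi> @ \<psi>) x = step_fun \<phi> x + step_fun \<psi> x"
  by (simp add: step_fun_def)

lemma step_fun_scale: "step_fun (map (\<lambda>(c, a, b). (k * c, a, b)) \<phi>) x = k * step_fun \<phi> x"
proof (induction \<phi>)
  case (Cons y \<phi>)
  obtain c a b where "y = (c, a, b)" by (cases y)
  with Cons show ?case by (simp add: step_fun_Cons distrib_left)
qed simp

lemma square_integrable_step_fun: "square_integrable lborel (step_fun \<phi>)"
proof (induction \<phi>)
  case (Cons y \<phi>)
  obtain c a b where "y = (c, a, b)" by (cases y)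
  with Cons show ?case
    by (simp add: step_fun_Cons square_integrable_add square_integrable_cmult square_integrable_indicator_Ioc)
qed simp

lemma step_approx_square_integrable: "step_approx u f \<Longrightarrow> square_integrable lborel f"
  by (simp add: step_approx_def)

lemma step_approx_add:
  assumes "step_approx u f" "step_approx u g" shows "step_approx u (\<lambda>x. f x + g x)"
  unfolding step_approx_def
proof (intro conjI allI impI)
  note sf = step_approx_square_integrable[OF assms(1)]
  note sg = step_approx_square_integrable[OF assms(2)]
  show "square_integrable lborel (\<lambda>x. f x + g x)" by (rule square_integrable_add[OF sf sg])
  fix e :: real assume "e > 0"
  hence e2: "e / 2 > 0" by simp
  obtain \<phi> where \<phi>: "steps_in u \<phi>" "L2_norm lborel (\<lambda>x. step_fun \<phi> x - f x) < e / 2"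
    using assms(1) e2 unfolding step_approx_def by blast
  obtain \<psi> where \<psi>: "steps_in u \<psi>" "L2_norm lborel (\<lambda>x. step_fun \<psi> x - g x) < e / 2"
    using assms(2) e2 unfolding step_approx_def by blast
  have "L2_norm lborel (\<lambda>x. step_fun (\<phi> @ \<psi>) x - (f x + g x))
      = L2_norm lborel (\<lambda>x. (step_fun \<phi> x - f x) + (step_fun \<psi> x - g x))"
    by (simp add: step_fun_append algebra_simps)
  also have "\<dots> \<le> L2_norm lborel (\<lambda>x. step_fun \<phi> x - f x) + L2_norm lborel (\<lambda>x. step_fun \<psi> x - g x)"
    by (intro L2_norm_triangle square_integrable_diff square_integrable_step_fun sf sg)
  also have "\<dots> < e" using \<phi> \<psi> by simp
  finally have "L2_norm lborel (\<lambda>x. step_fun (\<phi> @ \<psi>) x - (f x + g x)) < e" .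
  moreover have "steps_in u (\<phi> @ \<psi>)" using \<phi> \<psi> by (auto simp: steps_in_def)
  ultimately show "\<exists>\<phi>. steps_in u \<phi> \<and> L2_norm lborel (\<lambda>x. step_fun \<phi> x - (f x + g x)) < e" by blast
qed

lemma step_approx_cmult:
  assumes "step_approx u f" shows "step_approx u (\<lambda>x. k * f x)"
  unfolding step_approx_def
proof (intro conjI allI impI)
  show "square_integrable lborel (\<lambda>x. k * f x)"
    by (rule square_integrable_cmult[OF step_approx_square_integrable[OF assms]])
  fix e :: real assume "e > 0"
  hence "e / (\<bar>k\<bar> + 1) > 0" by (simp add: add_nonneg_pos)
  then obtain \<phi> where \<phi>: "steps_in u \<phi>" "L2_norm lborel (\<lambda>x. step_fun \<phi> x - f x) < e / (\<bar>k\<bar> + 1)"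
    using assms unfolding step_approx_def by blast
  let ?\<psi> = "map (\<lambda>(c, a, b). (k * c, a, b)) \<phi>"
  have "L2_norm lborel (\<lambda>x. step_fun ?\<psi> x - k * f x) = L2_norm lborel (\<lambda>x. k * (step_fun \<phi> x - f x))"
    by (simp only: step_fun_scale right_diff_distrib)
  also have "\<dots> \<le> (\<bar>k\<bar> + 1) * L2_norm lborel (\<lambda>x. step_fun \<phi> x - f x)"
    unfolding L2_norm_cmult by (intro mult_right_mono) auto
  also have "\<dots> < e" using \<phi>(2) by (simp add: pos_less_divide_eq add_nonneg_pos mult.commute)
  finally have "L2_norm lborel (\<lambda>x. step_fun ?\<psi> x - k * f x) < e" .
  moreover have "steps_in u ?\<psi>" using \<phi> by (auto simp: steps_in_def)
  ultimately show "\<exists>\<phi>. steps_in u \<phi> \<and> L2_norm lborel (\<lambda>x. step_fun \<phi> x - k * f x) < e" by blast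
qed

lemma step_approx_limit:
  assumes f: "\<And>n. step_approx u (f n)" and lim: "L2_tendsto lborel f g"
  shows "step_approx u g"
  unfolding step_approx_def
proof (intro conjI allI impI)
  note sg = L2_tendstoD(2)[OF lim]
  show "square_integrable lborel g" by (rule sg)
  fix e :: real assume "e > 0"
  hence e2: "e / 2 > 0" by simp
  from order_tendstoD(2)[OF L2_tendstoD(3)[OF lim] e2]
  obtain n where n: "L2_norm lborel (\<lambda>x. f n x - g x) < e / 2" by (auto simp: eventually_sequentially)
  obtain \<phi> where \<phi>: "steps_in u \<phi>" "L2_norm lborel (\<lambda>x. step_fun \<phi> x - f n x) < e / 2"
    using f[of n] e2 unfolding step_approx_def by blast
  have "L2_norm lborel (\<lambda>x. step_fun \<phi> x - g x)
      \<le> L2_norm lborel (\<lambda>x. step_fun \<phi> x - f n x) + L2_norm lborel (\<lambda>x. f n x - g x)"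
    by (intro L2_norm_triangle_diff square_integrable_step_fun step_approx_square_integrable[OF f] sg)
  also have "\<dots> < e" using n \<phi> by simp
  finally show "\<exists>\<phi>. steps_in u \<phi> \<and> L2_norm lborel (\<lambda>x. step_fun \<phi> x - g x) < e" using \<phi> by blast
qed

lemma step_approx_cong_AE:
  assumes "step_approx u f" "AE x in lborel. f x = g x" "g \<in> borel_measurable lborel"
  shows "step_approx u g"
  by (rule step_approx_limit[of u "\<lambda>_. f"])
    (rule assms, rule L2_tendsto_cong_AE[OF L2_tendsto_const[OF step_approx_square_integrable] assms(2,3)], rule assms)

lemma step_approx_step_fun: "steps_in u \<phi> \<Longrightarrow> step_approx u (step_fun \<phi>)"
  unfolding step_approx_def
proof (intro conjI allI impI square_integrable_step_fun)
  fix e :: real assume "steps_in u \<phi>" "e > 0"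
  thus "\<exists>\<psi>. steps_in u \<psi> \<and> L2_norm lborel (\<lambda>x. step_fun \<psi> x - step_fun \<phi> x) < e"
    by (intro exI[of _ \<phi>]) (simp add: L2_norm_def)
qed

lemma step_approx_sum:
  assumes "\<And>i. i \<in> I \<Longrightarrow> step_approx u (f i)" shows "step_approx u (\<lambda>x. \<Sum>i\<in>I. f i x)"
proof -
  have z: "step_approx u (\<lambda>x. 0)" using step_approx_step_fun[of u "[]"] by (simp add: steps_in_def)
  show ?thesis using assms
    by (induction I rule: infinite_finite_induct) (auto intro: step_approx_add z)
qed

lemma step_approx_empty: "step_approx u (indicator {})"
proof -
  have "(indicator {} :: real \<Rightarrow> real) = step_fun []" by (simp add: fun_eq_iff)
  thus ?thesis using step_approx_step_fun[of u "[]"] by (simp add: steps_in_def)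
qed

lemma step_approx_indicator_Icc: "step_approx u (indicator ({a..b} \<inter> {0..u}))"
proof (cases "max a 0 \<le> min b u")
  case True
  have "step_approx u (step_fun [(1, max a 0, min b u)])"
    using True by (intro step_approx_step_fun) (simp add: steps_in_def)
  moreover have "AE x in lborel. step_fun [(1, max a 0, min b u)] x = indicator ({a..b} \<inter> {0..u}) x"
    using AE_lborel_singleton[of "max a 0"]
    by eventually_elim (auto simp: step_fun_Cons indicator_def max_def split: if_splits)
  ultimately show ?thesis by (rule step_approx_cong_AE) auto
next
  case False
  hence "{a..b} \<inter> {0..u} = {}" by auto
  thus ?thesis by (simp only: step_approx_empty)
qed

lemma square_integrable_indicator_Icc: "square_integrable lborel (indicator {a..b::real})"
proof -
  have "(\<lambda>x. (indicator {a..b} x :: real)\<^sup>2) = indicator {a..b}"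
    by (auto simp: indicator_def)
  moreover have "integrable lborel (indicator {a..b} :: real \<Rightarrow> real)"
    by (rule integrable_real_indicator) (cases "a \<le> b"; simp)+
  ultimately show ?thesis by (simp add: square_integrable_def)
qed

lemma step_approx_indicator:
  assumes "A \<in> sets borel"
  shows "step_approx u (indicator (A \<inter> {0..u}))"
  using assms
proof (induction A rule: borel_set_induct)
  case empty
  show ?case by (simp only: Int_empty_left step_approx_empty)
next
  case (interval a b)
  show ?case by (rule step_approx_indicator_Icc)
next
  case (compl A)
  have "step_approx u (\<lambda>x. indicator ({0..u} \<inter> {0..u}) x + (-1) * indicator (A \<inter> {0..u}) x)"
    by (intro step_approx_add step_approx_cmult step_approx_indicator_Icc compl)
  moreover have "(\<lambda>x. indicator ({0..u} \<inter> {0..u}) x + (-1) * indicator (A \<inter> {0..u}) x) = (indicator (- A \<inter> {0..u}) :: real \<Rightarrow> real)"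
    by (auto simp: indicator_def fun_eq_iff)
  ultimately show ?case by simp
next
  case (union f)
  have [measurable]: "f i \<in> sets borel" for i by (rule union)
  have un: "(\<Sum>i<n. indicator (f i \<inter> {0..u}) x) = (indicator ((\<Union>i<n. f i) \<inter> {0..u}) x :: real)" for n x
  proof -
    have "indicator (\<Union>i<n. f i \<inter> {0..u}) x = (\<Sum>i<n. indicator (f i \<inter> {0..u}) x :: real)"
      by (rule indicator_UN_disjoint) (use union(1) in \<open>auto simp: disjoint_family_on_def\<close>)
    moreover have "(\<Union>i<n. f i \<inter> {0..u}) = (\<Union>i<n. f i) \<inter> {0..u}" by blast
    ultimately show ?thesis by simp
  qed
  have "L2_tendsto lborel (\<lambda>n x. \<Sum>i<n. indicator (f i \<inter> {0..u}) x) (indicator ((\<Union>i. f i) \<inter> {0..u}))"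
    unfolding un
  proof (rule L2_tendsto_dominated[where h = "indicator {0..u}"])
    fix x :: real
    show "(\<lambda>n. indicator ((\<Union>i<n. f i) \<inter> {0..u}) x :: real) \<longlonglongrightarrow> indicator ((\<Union>i. f i) \<inter> {0..u}) x"
    proof (cases "x \<in> (\<Union>i. f i)")
      case True
      then obtain k where k: "x \<in> f k" by blast
      show ?thesis
        by (rule tendsto_eventually, rule eventually_sequentiallyI[of "Suc k"])
          (use k in \<open>auto simp: indicator_def Suc_le_eq\<close>)
    next
      case False
      thus ?thesis by (intro tendsto_eventually always_eventually allI) (auto simp: indicator_def)
    qed
  qed (auto simp: square_integrable_indicator_Icc indicator_def)
  thus ?case by (rule step_approx_limit[rotated]) (intro step_approx_sum union)
qed

text \<open>Approximation by simple functions reduces the claim to indicators of Borel sets, for which it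
  follows from the case of intervals.\<close>

lemma step_functions_dense:
  assumes f: "square_integrable lborel f" and supp: "\<And>x. x \<notin> {0..u} \<Longrightarrow> f x = 0"
  shows "step_approx u f"
proof -
  obtain s where s: "\<And>i. simple_function lborel (s i)" "\<And>x. (\<lambda>i. s i x) \<longlonglongrightarrow> f x"
    "\<And>i x. dist (s i x) 0 \<le> 2 * dist (f x) 0"
    using borel_measurable_implies_sequence_metric[OF square_integrable_measurable[OF f], of 0] by auto
  have sm: "s i \<in> borel_measurable lborel" for i by (rule borel_measurable_simple_function[OF s(1)])
  have lim: "L2_tendsto lborel s f"
  proof (rule L2_tendsto_dominated[where h = "\<lambda>x. 2 * \<bar>f x\<bar>"])
    show "\<bar>s n x\<bar> \<le> 2 * \<bar>f x\<bar>" for n x using s(3)[of n x] by (simp add: dist_real_def)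
  qed (use sm s(2) square_integrable_measurable[OF f] in \<open>simp_all add: square_integrable_cmult square_integrable_abs f\<close>)
  have sa: "step_approx u (s i)" for i
  proof -
    have e: "s i x = (\<Sum>y\<in>range (s i). y * indicator (s i -` {y} \<inter> {0..u}) x)" for x
    proof (cases "x \<in> {0..u}")
      case True
      thus ?thesis using simple_function_indicator_representation_banach[OF s(1), of x i]
        by (simp add: indicator_def mult.commute)
    next
      case False
      hence "s i x = 0" using s(3)[of i x] supp by simp
      moreover have "(\<Sum>y\<in>range (s i). y * indicator (s i -` {y} \<inter> {0..u}) x) = 0"
        using False by (intro sum.neutral) (simp add: indicator_def)
      ultimately show ?thesis by simp
    qed
    have "step_approx u (\<lambda>x. \<Sum>y\<in>range (s i). y * indicator (s i -` {y} \<inter> {0..u}) x)"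
    proof (intro step_approx_sum step_approx_cmult step_approx_indicator)
      fix y show "s i -` {y} \<in> sets borel" using measurable_sets[OF sm, of "{y}" i] by simp
    qed
    thus ?thesis by (simp only: e[symmetric])
  qed
  show ?thesis by (rule step_approx_limit[OF sa lim])
qed

subsection \<open>The isometry\<close>

lemma step_integral_Nil [simp]: "step_integral B [] = (\<lambda>\<omega>. 0)"
  by (simp add: step_integral_def fun_eq_iff)

lemma step_integral_Cons:
  "step_integral B ((c, a, b) # \<phi>) = (\<lambda>\<omega>. c * (B b \<omega> - B a \<omega>) + step_integral B \<phi> \<omega>)"
  by (simp add: step_integral_def fun_eq_iff)

lemma steps_in_Cons: "steps_in u ((c, a, b) # \<phi>) \<longleftrightarrow> 0 \<le> a \<and> a \<le> b \<and> b \<le> u \<and> steps_in u \<phi>"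
  by (auto simp: steps_in_def)

lemma gaussian_span_step_integral:
  "steps_in u \<phi> \<Longrightarrow> gaussian_span (step_integral (brownian l) \<phi>)"
proof (induction \<phi>)
  case Nil show ?case by (simp add: gaussian_span_zero)
next
  case (Cons y \<phi>)
  obtain c a b where "y = (c, a, b)" by (cases y)
  with Cons show ?case
    by (auto simp: step_integral_Cons steps_in_Cons
        intro!: gaussian_span_add gaussian_span_cmult gaussian_span_diff gaussian_span_brownian)
qed

lemma L2_inner_indicator_Ioc:
  assumes "0 \<le> a" "a \<le> b" "0 \<le> c" "c \<le> d"
  shows "L2_inner lborel (indicator {a<..b}) (indicator {c<..d}) = min b d - min a d - (min b c - min a c)"
proof -
  have e: "indicator {a<..b} = (\<lambda>x. indicator {0<..b} x - indicator {0<..a} x :: real)" if "0 \<le> a" "a \<le> b" for a b :: real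
    using that by (auto simp: indicator_def fun_eq_iff)
  have "0 \<le> b" "0 \<le> d" using assms by linarith+
  thus ?thesis using assms
    unfolding e[OF assms(1,2)] e[OF assms(3,4)]
    by (simp add: L2_inner_diff_left L2_inner_diff_right square_integrable_diff square_integrable_indicator_Ioc
        L2_inner_indicator min_kernel_def)
qed

text \<open>Both sides are bilinear. For single intervals the inner product on the left is the covariance of
  two increments, and the one on the right is the length of the overlap.\<close>

lemma step_integral_isometry:
  assumes "steps_in u \<phi>" "steps_in v \<psi>"
  shows "L2_inner white_noise (step_integral (brownian l) \<phi>) (step_integral (brownian l') \<psi>)
    = (if l = l' then L2_inner lborel (step_fun \<phi>) (step_fun \<psi>) else 0)"
proof -
  have sqB: "square_integrable white_noise (\<lambda>\<omega>. brownian l b \<omega> - brownian l a \<omega>)" if "0 \<le> a" "a \<le> b" for a b l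
    using that by (intro gaussian_span_square_integrable gaussian_span_diff gaussian_span_brownian) simp_all
  have sqS: "square_integrable white_noise (step_integral (brownian l) \<phi>)" if "steps_in u \<phi>" for u l \<phi>
    using that by (intro gaussian_span_square_integrable gaussian_span_step_integral)
  have single: "L2_inner white_noise (\<lambda>\<omega>. brownian l b \<omega> - brownian l a \<omega>) (step_integral (brownian l') \<psi>)
    = (if l = l' then L2_inner lborel (indicator {a<..b}) (step_fun \<psi>) else 0)"
    if ab: "0 \<le> a" "a \<le> b" and "steps_in v \<psi>" for a b
    using that(3)
  proof (induction \<psi>)
    case Nil
    then show ?case by (simp add: L2_inner_def)
  next
    case (Cons y \<psi>)
    obtain c' a' b' where y: "y = (c', a', b')" by (cases y)
    have s: "0 \<le> a'" "a' \<le> b'" "steps_in v \<psi>" using Cons.prems by (simp_all add: y steps_in_Cons)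
    have "L2_inner white_noise (step_integral (brownian l') (y # \<psi>)) (\<lambda>\<omega>. brownian l b \<omega> - brownian l a \<omega>)
      = c' * L2_inner white_noise (\<lambda>\<omega>. brownian l' b' \<omega> - brownian l' a' \<omega>) (\<lambda>\<omega>. brownian l b \<omega> - brownian l a \<omega>)
        + L2_inner white_noise (step_integral (brownian l') \<psi>) (\<lambda>\<omega>. brownian l b \<omega> - brownian l a \<omega>)"
      unfolding y step_integral_Cons
      by (subst L2_inner_add_left) (simp_all add: L2_inner_cmult_left sqB sqS[OF s(3)] s ab square_integrable_cmult)
    moreover have "L2_inner lborel (step_fun (y # \<psi>)) (indicator {a<..b})
      = c' * L2_inner lborel (indicator {a'<..b'}) (indicator {a<..b}) + L2_inner lborel (step_fun \<psi>) (indicator {a<..b})"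
      unfolding y step_fun_Cons
      by (subst L2_inner_add_left) (simp_all add: L2_inner_cmult_left square_integrable_indicator_Ioc
          square_integrable_step_fun square_integrable_cmult)
    ultimately show ?case
      using Cons.IH[OF s(3)]
      by (simp add: L2_inner_commute[of _ _ "step_integral _ _"] L2_inner_commute[of _ _ "step_fun _"]
        L2_inner_brownian_increments L2_inner_indicator_Ioc s ab)
  qed
  show ?thesis using assms(1)
  proof (induction \<phi>)
    case Nil
    then show ?case by (simp add: L2_inner_def)
  next
    case (Cons y \<phi>)
    obtain c a b where y: "y = (c, a, b)" by (cases y)
    have s: "0 \<le> a" "a \<le> b" "steps_in u \<phi>" using Cons.prems by (simp_all add: y steps_in_Cons)
    have "L2_inner white_noise (step_integral (brownian l) (y # \<phi>)) (step_integral (brownian l') \<psi>)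
      = c * L2_inner white_noise (\<lambda>\<omega>. brownian l b \<omega> - brownian l a \<omega>) (step_integral (brownian l') \<psi>)
        + L2_inner white_noise (step_integral (brownian l) \<phi>) (step_integral (brownian l') \<psi>)"
      unfolding y step_integral_Cons
      by (subst L2_inner_add_left) (simp_all add: L2_inner_cmult_left sqB sqS[OF s(3)] sqS[OF assms(2)] s square_integrable_cmult)
    moreover have "L2_inner lborel (step_fun (y # \<phi>)) (step_fun \<psi>)
      = c * L2_inner lborel (indicator {a<..b}) (step_fun \<psi>) + L2_inner lborel (step_fun \<phi>) (step_fun \<psi>)"
      unfolding y step_fun_Cons
      by (subst L2_inner_add_left) (simp_all add: L2_inner_cmult_left square_integrable_indicator_Ioc
          square_integrable_step_fun square_integrable_cmult)
    ultimately show ?case using Cons.IH[OF s(3)] single[OF s(1,2) assms(2)] by simp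
  qed
qed

lemma step_integral_norm_diff:
  assumes "steps_in u \<phi>" "steps_in v \<psi>"
  shows "L2_norm white_noise (\<lambda>\<omega>. step_integral (brownian l) \<phi> \<omega> - step_integral (brownian l) \<psi> \<omega>)
    = L2_norm lborel (\<lambda>x. step_fun \<phi> x - step_fun \<psi> x)"
proof -
  have "(L2_norm white_noise (\<lambda>\<omega>. step_integral (brownian l) \<phi> \<omega> - step_integral (brownian l) \<psi> \<omega>))\<^sup>2
    = (L2_norm lborel (\<lambda>x. step_fun \<phi> x - step_fun \<psi> x))\<^sup>2"
    using gaussian_span_step_integral[OF assms(1), of l] gaussian_span_step_integral[OF assms(2), of l]
    by (simp add: L2_norm_diff_power2 gaussian_span_square_integrable square_integrable_step_fun
        step_integral_isometry[OF assms] step_integral_isometry[OF assms(1,1)] step_integral_isometry[OF assms(2,2)])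
  thus ?thesis by (simp add: power2_eq_iff_nonneg)
qed

lemma step_fun_outside: "steps_in u \<phi> \<Longrightarrow> x \<notin> {0..u} \<Longrightarrow> step_fun \<phi> x = 0"
proof (induction \<phi>)
  case (Cons y \<phi>)
  obtain c a b where "y = (c, a, b)" by (cases y)
  with Cons show ?case by (auto simp: step_fun_Cons steps_in_Cons indicator_def)
qed simp

text \<open>A step function on \<open>[0, u]\<close> vanishes outside this interval, so that the integrals over \<open>[0, u]\<close> are
  squared distances in \<open>L\<^sup>2\<close> of the line.\<close>

lemma has_wiener_integral_iff:
  "has_wiener_integral white_noise (brownian l) u g I \<longleftrightarrow>
    square_integrable lborel (\<lambda>x. indicator {0..u} x * g x) \<and>
    (\<exists>\<phi>. (\<forall>n. steps_in u (\<phi> n)) \<and> L2_tendsto lborel (\<lambda>n. step_fun (\<phi> n)) (\<lambda>x. indicator {0..u} x * g x)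
       \<and> L2_tendsto white_noise (\<lambda>n. step_integral (brownian l) (\<phi> n)) I)"
  (is "?W \<longleftrightarrow> square_integrable lborel ?g \<and> ?R")
proof -
  have sq: "set_borel_measurable lborel {0..u} g \<and> set_integrable lborel {0..u} (\<lambda>\<eta>. (g \<eta>)\<^sup>2) \<longleftrightarrow> square_integrable lborel ?g"
  proof -
    have "(\<lambda>x. indicator {0..u} x *\<^sub>R (g x)\<^sup>2) = (\<lambda>x. (?g x)\<^sup>2)" by (auto simp: indicator_def fun_eq_iff)
    thus ?thesis by (simp add: set_borel_measurable_def set_integrable_def square_integrable_def)
  qed
  have nn: "(\<integral>\<^sup>+\<eta>\<in>{0..u}. ennreal ((step_fun \<phi> \<eta> - g \<eta>)\<^sup>2) \<partial>lborel) = (\<integral>\<^sup>+\<eta>. ennreal ((step_fun \<phi> \<eta> - ?g \<eta>)\<^sup>2) \<partial>lborel)"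
    if "steps_in u \<phi>" for \<phi>
    by (intro nn_integral_cong) (use step_fun_outside[OF that] in \<open>auto simp: indicator_def\<close>)
  have L: "(\<lambda>n. \<integral>\<^sup>+\<eta>\<in>{0..u}. ennreal ((step_fun (\<phi> n) \<eta> - g \<eta>)\<^sup>2) \<partial>lborel) \<longlonglongrightarrow> 0 \<longleftrightarrow> L2_tendsto lborel (\<lambda>n. step_fun (\<phi> n)) ?g"
    if "\<forall>n. steps_in u (\<phi> n)" "square_integrable lborel ?g" for \<phi>
    using L2_tendsto_iff_nn[of lborel "\<lambda>n. step_fun (\<phi> n)" ?g, OF square_integrable_step_fun
        square_integrable_measurable[OF that(2)]] that(1) by (simp add: nn)
  have R: "I \<in> borel_measurable white_noise \<and> (\<lambda>n. \<integral>\<^sup>+\<omega>. ennreal ((step_integral (brownian l) (\<phi> n) \<omega> - I \<omega>)\<^sup>2) \<partial>white_noise) \<longlonglongrightarrow> 0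
      \<longleftrightarrow> L2_tendsto white_noise (\<lambda>n. step_integral (brownian l) (\<phi> n)) I" if \<phi>: "\<forall>n. steps_in u (\<phi> n)" for \<phi>
  proof -
    have s: "square_integrable white_noise (step_integral (brownian l) (\<phi> n))" for n
      using \<phi> by (intro gaussian_span_square_integrable gaussian_span_step_integral) auto
    show ?thesis
      using L2_tendsto_iff_nn[of white_noise "\<lambda>n. step_integral (brownian l) (\<phi> n)" I, OF s]
        square_integrable_measurable[OF L2_tendstoD(2), of white_noise "\<lambda>n. step_integral (brownian l) (\<phi> n)" I] by blast
  qed
  show ?thesis
    unfolding has_wiener_integral_def using sq L R by blast
qed

text \<open>By the isometry, the integrals of a convergent sequence of step functions form a Cauchy
  sequence.\<close>

lemma wiener_integral_exists:
  assumes g: "square_integrable lborel (\<lambda>x. indicator {0..u} x * g x)"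
  shows "\<exists>I. has_wiener_integral white_noise (brownian l) u g I"
proof -
  let ?g = "\<lambda>x. indicator {0..u} x * g x"
  have "step_approx u ?g" by (rule step_functions_dense[OF g]) simp
  hence "\<forall>n. \<exists>\<phi>. steps_in u \<phi> \<and> L2_norm lborel (\<lambda>x. step_fun \<phi> x - ?g x) < inverse (real (Suc n))"
    unfolding step_approx_def by simp
  then obtain \<phi> where \<phi>: "\<And>n. steps_in u (\<phi> n)" "\<And>n. L2_norm lborel (\<lambda>x. step_fun (\<phi> n) x - ?g x) < inverse (real (Suc n))"
    by metis
  have "(\<lambda>n. L2_norm lborel (\<lambda>x. step_fun (\<phi> n) x - ?g x)) \<longlonglongrightarrow> 0"
    by (rule Lim_null_comparison[OF always_eventually[OF allI] LIMSEQ_inverse_real_of_nat])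
      (simp only: real_norm_def abs_of_nonneg L2_norm_nonneg less_imp_le[OF \<phi>(2)])
  hence lim: "L2_tendsto lborel (\<lambda>n. step_fun (\<phi> n)) ?g"
    using g by (simp add: L2_tendsto_def square_integrable_step_fun)
  have "\<exists>I. L2_tendsto white_noise (\<lambda>n. step_integral (brownian l) (\<phi> n)) I"
  proof (rule L2_complete)
    show "square_integrable white_noise (step_integral (brownian l) (\<phi> n))" for n
      by (rule gaussian_span_square_integrable[OF gaussian_span_step_integral[OF \<phi>(1)]])
    fix e :: real assume "e > 0"
    hence "e / 2 > 0" by simp
    from order_tendstoD(2)[OF L2_tendstoD(3)[OF lim] this]
    obtain N where N: "\<And>n. n \<ge> N \<Longrightarrow> L2_norm lborel (\<lambda>x. step_fun (\<phi> n) x - ?g x) < e / 2"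
      by (auto simp: eventually_sequentially)
    show "\<exists>N. \<forall>m\<ge>N. \<forall>n\<ge>N. L2_norm white_noise (\<lambda>x. step_integral (brownian l) (\<phi> m) x - step_integral (brownian l) (\<phi> n) x) < e"
    proof (intro exI[of _ N] allI impI)
      fix m n assume mn: "m \<ge> N" "n \<ge> N"
      have "L2_norm white_noise (\<lambda>x. step_integral (brownian l) (\<phi> m) x - step_integral (brownian l) (\<phi> n) x)
        = L2_norm lborel (\<lambda>x. step_fun (\<phi> m) x - step_fun (\<phi> n) x)"
        by (rule step_integral_norm_diff[OF \<phi>(1) \<phi>(1)])
      also have "\<dots> \<le> L2_norm lborel (\<lambda>x. step_fun (\<phi> m) x - ?g x) + L2_norm lborel (\<lambda>x. ?g x - step_fun (\<phi> n) x)"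
        by (intro L2_norm_triangle_diff square_integrable_step_fun g)
      also have "\<dots> < e" using N[OF mn(1)] N[OF mn(2)] by (simp add: L2_norm_minus_commute[of lborel ?g])
      finally show "L2_norm white_noise (\<lambda>x. step_integral (brownian l) (\<phi> m) x - step_integral (brownian l) (\<phi> n) x) < e" .
    qed
  qed
  thus ?thesis unfolding has_wiener_integral_iff using g lim \<phi>(1) by blast
qed

lemma gaussian_span_wiener_integral:
  assumes "has_wiener_integral white_noise (brownian l) u g I" shows "gaussian_span I"
proof -
  obtain \<phi> where \<phi>: "\<forall>n. steps_in u (\<phi> n)" "L2_tendsto white_noise (\<lambda>n. step_integral (brownian l) (\<phi> n)) I"
    using assms unfolding has_wiener_integral_iff by blast
  show ?thesis
    by (rule gaussian_span_limit[OF _ \<phi>(2)]) (use \<phi>(1) gaussian_span_step_integral in blast)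
qed

lemma wiener_integral_isometry:
  assumes "has_wiener_integral white_noise (brownian l) u g I" "has_wiener_integral white_noise (brownian l') v h J"
  shows "L2_inner white_noise I J = (if l = l' then (LBINT \<eta>:{0..min u v}. g \<eta> * h \<eta>) else 0)"
proof -
  obtain \<phi> where \<phi>: "\<forall>n. steps_in u (\<phi> n)" "L2_tendsto lborel (\<lambda>n. step_fun (\<phi> n)) (\<lambda>x. indicator {0..u} x * g x)"
    "L2_tendsto white_noise (\<lambda>n. step_integral (brownian l) (\<phi> n)) I"
    using assms(1) unfolding has_wiener_integral_iff by blast
  obtain \<psi> where \<psi>: "\<forall>n. steps_in v (\<psi> n)" "L2_tendsto lborel (\<lambda>n. step_fun (\<psi> n)) (\<lambda>x. indicator {0..v} x * h x)"
    "L2_tendsto white_noise (\<lambda>n. step_integral (brownian l') (\<psi> n)) J"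
    using assms(2) unfolding has_wiener_integral_iff by blast
  have A: "(\<lambda>n. if l = l' then L2_inner lborel (step_fun (\<phi> n)) (step_fun (\<psi> n)) else 0) \<longlonglongrightarrow> L2_inner white_noise I J"
    using L2_tendsto_inner[OF \<phi>(3) \<psi>(3)] step_integral_isometry[of u _ v _ l l'] \<phi>(1) \<psi>(1) by simp
  have "L2_inner lborel (\<lambda>x. indicator {0..u} x * g x) (\<lambda>x. indicator {0..v} x * h x) = (LBINT \<eta>:{0..min u v}. g \<eta> * h \<eta>)"
    unfolding L2_inner_def set_lebesgue_integral_def
    by (intro Bochner_Integration.integral_cong) (auto simp: indicator_def)
  hence B: "(\<lambda>n. if l = l' then L2_inner lborel (step_fun (\<phi> n)) (step_fun (\<psi> n)) else 0)
      \<longlonglongrightarrow> (if l = l' then (LBINT \<eta>:{0..min u v}. g \<eta> * h \<eta>) else 0)"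
    using L2_tendsto_inner[OF \<phi>(2) \<psi>(2)] by (cases "l = l'") simp_all
  show ?thesis by (rule LIMSEQ_unique[OF A B])
qed

lemma wiener_integral_unique:
  assumes I: "has_wiener_integral white_noise (brownian l) u g I" and J: "has_wiener_integral white_noise (brownian l) u g J"
  shows "AE \<omega> in white_noise. I \<omega> = J \<omega>"
proof -
  note s = gaussian_span_square_integrable[OF gaussian_span_wiener_integral[OF I]]
    gaussian_span_square_integrable[OF gaussian_span_wiener_integral[OF J]]
  have "(L2_norm white_noise (\<lambda>\<omega>. I \<omega> - J \<omega>))\<^sup>2 = 0"
    unfolding L2_norm_diff_power2[OF s]
    by (simp add: wiener_integral_isometry[OF I I] wiener_integral_isometry[OF I J] wiener_integral_isometry[OF J J])
  hence "L2_tendsto white_noise (\<lambda>_. I) J"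
    using s by (simp add: L2_tendsto_def)
  from L2_tendsto_unique[OF L2_tendsto_const[OF s(1)] this] show ?thesis .
qed

lemma wiener_integral_const:
  assumes "0 \<le> u"
  shows "has_wiener_integral white_noise (brownian l) u (\<lambda>_. c) (\<lambda>\<omega>. c * brownian l u \<omega>)"
proof -
  have st: "steps_in u [(c, 0, u)]" using assms by (simp add: steps_in_def)
  have g: "square_integrable lborel (\<lambda>x. indicator {0..u} x * c)"
    using square_integrable_cmult[OF square_integrable_indicator_Icc, of c 0 u] by (simp add: mult.commute)
  \<comment> \<open>The half-open step on \<open>(0, u]\<close> misses the endpoint \<open>0\<close>.\<close>
  have "AE x in lborel. step_fun [(c, 0, u)] x = indicator {0..u} x * c"
    using AE_lborel_singleton[of "0::real"] by eventually_elim (auto simp: step_fun_Cons indicator_def)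
  hence 1: "L2_tendsto lborel (\<lambda>n::nat. step_fun [(c, 0, u)]) (\<lambda>x. indicator {0..u} x * c)"
    by (rule L2_tendsto_cong_AE[OF L2_tendsto_const[OF square_integrable_step_fun]])
      (rule square_integrable_measurable[OF g])
  have "AE \<omega> in white_noise. brownian l 0 \<omega> = 0"
    using standard_brownian_motion_brownian[of l] unfolding standard_brownian_motion_def by blast
  hence "AE \<omega> in white_noise. step_integral (brownian l) [(c, 0, u)] \<omega> = c * brownian l u \<omega>"
    by eventually_elim (simp add: step_integral_Cons)
  hence 2: "L2_tendsto white_noise (\<lambda>n::nat. step_integral (brownian l) [(c, 0, u)]) (\<lambda>\<omega>. c * brownian l u \<omega>)"
    by (rule L2_tendsto_cong_AE[OF L2_tendsto_const[OF gaussian_span_square_integrable[OF gaussian_span_step_integral[OF st]]]])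
      measurable
  show ?thesis unfolding has_wiener_integral_iff
    by (intro conjI g exI[of _ "\<lambda>_. [(c, 0, u)]"] allI st 1 2)
qed

subsection \<open>Series of Wiener integrals\<close>

text \<open>For fixed \<open>(u, p)\<close> the summands are orthogonal, and the sum of their variances is the
  integral of \<open>K \<eta> p p\<close> over \<open>[0, u]\<close>.\<close>

lemma wiener_series:
  fixes g :: "nat \<Rightarrow> real \<Rightarrow> 'p \<Rightarrow> real" and K :: "real \<Rightarrow> 'p \<Rightarrow> 'p \<Rightarrow> real"
  assumes meas: "\<And>l p. p \<in> A \<Longrightarrow> (\<lambda>\<eta>. indicator {0..1} \<eta> * g l \<eta> p) \<in> borel_measurable borel"
    and sums: "\<And>\<eta> p q. \<eta> \<in> {0..1} \<Longrightarrow> p \<in> A \<Longrightarrow> q \<in> A \<Longrightarrow> (\<lambda>l. g l \<eta> p * g l \<eta> q) sums K \<eta> p q"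
    and bdd: "\<And>\<eta> p. \<eta> \<in> {0..1} \<Longrightarrow> p \<in> A \<Longrightarrow> K \<eta> p p \<le> C p"
  obtains I :: "nat \<Rightarrow> real \<times> 'p \<Rightarrow> (nat \<Rightarrow> real) \<Rightarrow> real" and Z :: "real \<times> 'p \<Rightarrow> (nat \<Rightarrow> real) \<Rightarrow> real"
  where "\<And>l u p. u \<in> {0..1} \<Longrightarrow> p \<in> A \<Longrightarrow> has_wiener_integral white_noise (brownian l) u (\<lambda>\<eta>. g l \<eta> p) (I l (u, p))"
    and "\<And>u p. u \<in> {0..1} \<Longrightarrow> p \<in> A \<Longrightarrow> L2_tendsto white_noise (\<lambda>n \<omega>. \<Sum>l<n. I l (u, p) \<omega>) (Z (u, p))"
    and "\<And>u p v q. u \<in> {0..1} \<Longrightarrow> p \<in> A \<Longrightarrow> v \<in> {0..1} \<Longrightarrow> q \<in> A \<Longrightarrow>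
       L2_inner white_noise (Z (u, p)) (Z (v, q)) = (LBINT \<eta>:{0..min u v}. K \<eta> p q)"
proof -
  have part: "(\<Sum>l<n. (g l \<eta> p)\<^sup>2) \<le> C p" if "\<eta> \<in> {0..1}" "p \<in> A" for n \<eta> p
  proof -
    have "(\<lambda>l. (g l \<eta> p)\<^sup>2) sums K \<eta> p p" using sums[OF that(1,2,2)] by (simp add: power2_eq_square)
    hence "(\<Sum>l<n. (g l \<eta> p)\<^sup>2) \<le> K \<eta> p p"
      using sum_le_suminf[of "\<lambda>l. (g l \<eta> p)\<^sup>2" "{..<n}"] by (simp add: sums_iff)
    thus ?thesis using bdd[OF that] by linarith
  qed
  have gm: "(\<lambda>x. indicator {0..u} x * g l x p) \<in> borel_measurable borel" if "u \<in> {0..1}" "p \<in> A" for u l p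
  proof -
    have "(\<lambda>x. indicator {0..u} x * (indicator {0..1} x * g l x p)) \<in> borel_measurable borel"
      using meas[OF that(2), of l] by simp
    moreover have "(\<lambda>x. indicator {0..u} x * (indicator {0..1} x * g l x p)) = (\<lambda>x. indicator {0..u} x * g l x p)"
      using that(1) by (auto simp: indicator_def fun_eq_iff)
    ultimately show ?thesis by simp
  qed
  have prodint: "integrable lborel (\<lambda>x. indicator {0..u} x * (g l x p * g l x q))"
    and sq: "square_integrable lborel (\<lambda>x. indicator {0..u} x * g l x p)" if u: "u \<in> {0..1}" and p: "p \<in> A" "q \<in> A" for u l p q
  proof -
    have s: "square_integrable lborel (\<lambda>x. indicator {0..u} x * g l x p)" if p: "p \<in> A" for p
      unfolding square_integrable_def
    proof
      show m: "(\<lambda>x. indicator {0..u} x * g l x p) \<in> borel_measurable lborel" using gm[OF u p] by simp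
      show "integrable lborel (\<lambda>x. (indicator {0..u} x * g l x p)\<^sup>2)"
      proof (rule Bochner_Integration.integrable_bound)
        show "integrable lborel (\<lambda>x. C p * (indicator {0..u} x)\<^sup>2)"
          using square_integrable_indicator_Icc[of 0 u] by (simp add: square_integrable_def)
        show "AE x in lborel. norm ((indicator {0..u} x * g l x p)\<^sup>2) \<le> norm (C p * (indicator {0..u} x)\<^sup>2)"
        proof (rule AE_I2)
          fix x
          show "norm ((indicator {0..u} x * g l x p)\<^sup>2) \<le> norm (C p * (indicator {0..u} x)\<^sup>2)"
          proof (cases "x \<in> {0..u}")
            case True
            hence "x \<in> {0..1}" using u by auto
            have "(g l x p)\<^sup>2 \<le> (\<Sum>k<Suc l. (g k x p)\<^sup>2)" by (rule member_le_sum) auto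
            also have "\<dots> \<le> C p" by (rule part) fact+
            finally show ?thesis using True by simp
          qed simp
        qed
      qed (use m in simp)
    qed
    show "square_integrable lborel (\<lambda>x. indicator {0..u} x * g l x p)" by (rule s[OF p(1)])
    have "(\<lambda>x. (indicator {0..u} x * g l x p) * (indicator {0..u} x * g l x q)) = (\<lambda>x. indicator {0..u} x * (g l x p * g l x q))"
      by (auto simp: indicator_def fun_eq_iff)
    thus "integrable lborel (\<lambda>x. indicator {0..u} x * (g l x p * g l x q))"
      using square_integrable_mult[OF s[OF p(1)] s[OF p(2)]] by simp
  qed
  have "\<exists>I. has_wiener_integral white_noise (brownian l) u (\<lambda>\<eta>. g l \<eta> p) I" if "u \<in> {0..1}" "p \<in> A" for l u p
    by (rule wiener_integral_exists[OF sq[OF that that(2)]])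
  hence "\<forall>l up. \<exists>I. fst up \<in> {0..1} \<and> snd up \<in> A \<longrightarrow> has_wiener_integral white_noise (brownian l) (fst up) (\<lambda>\<eta>. g l \<eta> (snd up)) I"
    by blast
  then obtain I where I': "\<And>l up. fst up \<in> {0..1} \<and> snd up \<in> A \<Longrightarrow> has_wiener_integral white_noise (brownian l) (fst up) (\<lambda>\<eta>. g l \<eta> (snd up)) (I l up)"
    by metis
  have I: "has_wiener_integral white_noise (brownian l) u (\<lambda>\<eta>. g l \<eta> p) (I l (u, p))" if "u \<in> {0..1}" "p \<in> A" for l u p
    using I'[of "(u, p)" l] that by simp
  have sI: "square_integrable white_noise (I l (u, p))" if "u \<in> {0..1}" "p \<in> A" for l u p
    by (rule gaussian_span_square_integrable[OF gaussian_span_wiener_integral[OF I[OF that]]])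
  have "\<exists>Z. L2_tendsto white_noise (\<lambda>n \<omega>. \<Sum>l<n. I l (u, p) \<omega>) Z" if up: "u \<in> {0..1}" "p \<in> A" for u p
  proof (rule orthogonal_series_converges)
    show "square_integrable white_noise (I l (u, p))" for l by (rule sI[OF up])
    show "L2_inner white_noise (I i (u, p)) (I j (u, p)) = 0" if "i \<noteq> j" for i j
      using wiener_integral_isometry[OF I[OF up, of i] I[OF up, of j]] that by simp
    show "summable (\<lambda>l. (L2_norm white_noise (I l (u, p)))\<^sup>2)"
    proof (rule summableI_nonneg_bounded[where x = "C p * u"])
      fix n
      have "(\<Sum>l<n. (L2_norm white_noise (I l (u, p)))\<^sup>2) = (\<Sum>l<n. \<integral>x. indicator {0..u} x * (g l x p * g l x p) \<partial>lborel)"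
        by (simp add: L2_norm_power2 wiener_integral_isometry[OF I[OF up] I[OF up]] set_lebesgue_integral_def)
      also have "\<dots> = (\<integral>x. (\<Sum>l<n. indicator {0..u} x * (g l x p * g l x p)) \<partial>lborel)"
        by (rule Bochner_Integration.integral_sum[symmetric]) (rule prodint[OF up up(2)])
      also have "\<dots> \<le> (\<integral>x. C p * indicator {0..u} x \<partial>lborel)"
      proof (rule integral_mono)
        show "integrable lborel (\<lambda>x. \<Sum>l<n. indicator {0..u} x * (g l x p * g l x p))"
          by (rule Bochner_Integration.integrable_sum) (rule prodint[OF up up(2)])
        show "integrable lborel (\<lambda>x. C p * indicator {0..u} x)"
          using up by (intro integrable_mult_right integrable_real_indicator) auto
        fix x
        show "(\<Sum>l<n. indicator {0..u} x * (g l x p * g l x p)) \<le> C p * indicator {0..u} x"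
          using part[of x p n] up by (cases "x \<in> {0..u}") (auto simp: power2_eq_square)
      qed
      also have "\<dots> = C p * u" using up by simp
      finally show "(\<Sum>l<n. (L2_norm white_noise (I l (u, p)))\<^sup>2) \<le> C p * u" .
    qed simp
  qed
  hence "\<forall>up. \<exists>Z. fst up \<in> {0..1} \<and> snd up \<in> A \<longrightarrow> L2_tendsto white_noise (\<lambda>n \<omega>. \<Sum>l<n. I l up \<omega>) Z"
    by (metis prod.collapse)
  then obtain Z where Z': "\<And>up. fst up \<in> {0..1} \<and> snd up \<in> A \<Longrightarrow> L2_tendsto white_noise (\<lambda>n \<omega>. \<Sum>l<n. I l up \<omega>) (Z up)"
    by metis
  have Z: "L2_tendsto white_noise (\<lambda>n \<omega>. \<Sum>l<n. I l (u, p) \<omega>) (Z (u, p))" if "u \<in> {0..1}" "p \<in> A" for u p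
    using Z'[of "(u, p)"] that by simp
  have inner: "L2_inner white_noise (Z (u, p)) (Z (v, q)) = (LBINT \<eta>:{0..min u v}. K \<eta> p q)"
    if up: "u \<in> {0..1}" "p \<in> A" and vq: "v \<in> {0..1}" "q \<in> A" for u p v q
  proof -
    let ?w = "min u v"
    have w: "?w \<in> {0..1}" using up vq by auto
    have "L2_inner white_noise (\<lambda>\<omega>. \<Sum>l<n. I l (u, p) \<omega>) (\<lambda>\<omega>. \<Sum>l<n. I l (v, q) \<omega>)
      = (\<integral>x. (\<Sum>l<n. indicator {0..?w} x * (g l x p * g l x q)) \<partial>lborel)" for n
    proof -
      have "L2_inner white_noise (\<lambda>\<omega>. \<Sum>l<n. I l (u, p) \<omega>) (\<lambda>\<omega>. \<Sum>l<n. I l (v, q) \<omega>)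
        = (\<Sum>i<n. \<Sum>j<n. L2_inner white_noise (I i (u, p)) (I j (v, q)))"
        by (simp add: L2_inner_sum_left L2_inner_sum_right sI[OF up] sI[OF vq] square_integrable_sum)
      also have "\<dots> = (\<Sum>i<n. \<Sum>j<n. if j = i then (LBINT \<eta>:{0..?w}. g i \<eta> p * g i \<eta> q) else 0)"
        by (intro sum.cong refl) (auto simp: wiener_integral_isometry[OF I[OF up] I[OF vq]])
      also have "\<dots> = (\<Sum>l<n. LBINT \<eta>:{0..?w}. g l \<eta> p * g l \<eta> q)" by simp
      also have "\<dots> = (\<Sum>l<n. \<integral>x. indicator {0..?w} x * (g l x p * g l x q) \<partial>lborel)"
        by (simp add: set_lebesgue_integral_def)
      also have "\<dots> = (\<integral>x. (\<Sum>l<n. indicator {0..?w} x * (g l x p * g l x q)) \<partial>lborel)"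
        by (rule Bochner_Integration.integral_sum[symmetric]) (rule prodint[OF w up(2) vq(2)])
      finally show ?thesis .
    qed
    hence A: "(\<lambda>n. \<integral>x. (\<Sum>l<n. indicator {0..?w} x * (g l x p * g l x q)) \<partial>lborel) \<longlonglongrightarrow> L2_inner white_noise (Z (u, p)) (Z (v, q))"
      using L2_tendsto_inner[OF Z[OF up] Z[OF vq]] by simp
    have B: "(\<lambda>n. \<integral>x. (\<Sum>l<n. indicator {0..?w} x * (g l x p * g l x q)) \<partial>lborel) \<longlonglongrightarrow> (\<integral>x. indicator {0..?w} x * K x p q \<partial>lborel)"
    proof (rule integral_dominated_convergence[where w = "\<lambda>x. (C p + C q) * indicator {0..?w} x"])
      have lim: "(\<lambda>n. \<Sum>l<n. indicator {0..?w} x * (g l x p * g l x q)) \<longlonglongrightarrow> indicator {0..?w} x * K x p q" for x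
      proof (cases "x \<in> {0..?w}")
        case True
        hence "x \<in> {0..1}" using w by auto
        thus ?thesis using sums[OF _ up(2) vq(2)] True by (simp add: sums_def)
      qed simp
      show "AE x in lborel. (\<lambda>n. \<Sum>l<n. indicator {0..?w} x * (g l x p * g l x q)) \<longlonglongrightarrow> indicator {0..?w} x * K x p q"
        using lim by simp
      have m: "(\<lambda>x. \<Sum>l<n. indicator {0..?w} x * (g l x p * g l x q)) \<in> borel_measurable lborel" for n
        using prodint[OF w up(2) vq(2)] by (intro borel_measurable_sum borel_measurable_integrable)
      show "(\<lambda>x. \<Sum>l<n. indicator {0..?w} x * (g l x p * g l x q)) \<in> borel_measurable lborel" for n by (rule m)
      show "(\<lambda>x. indicator {0..?w} x * K x p q) \<in> borel_measurable lborel"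
        by (rule borel_measurable_LIMSEQ_real[OF lim m])
      show "integrable lborel (\<lambda>x. (C p + C q) * indicator {0..?w} x)"
        using w by (intro integrable_mult_right integrable_real_indicator) auto
      show "AE x in lborel. norm (\<Sum>l<n. indicator {0..?w} x * (g l x p * g l x q)) \<le> (C p + C q) * indicator {0..?w} x" for n
      proof (rule AE_I2)
        fix x
        show "norm (\<Sum>l<n. indicator {0..?w} x * (g l x p * g l x q)) \<le> (C p + C q) * indicator {0..?w} x"
        proof (cases "x \<in> {0..?w}")
          case True
          hence x: "x \<in> {0..1}" using w by auto
          have "norm (\<Sum>l<n. g l x p * g l x q) \<le> (\<Sum>l<n. (g l x p)\<^sup>2 + (g l x q)\<^sup>2)"
          proof (rule sum_norm_le)
            fix l
            have "2 * \<bar>g l x p\<bar> * \<bar>g l x q\<bar> \<le> (g l x p)\<^sup>2 + (g l x q)\<^sup>2"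
              using sum_squares_bound[of "\<bar>g l x p\<bar>" "\<bar>g l x q\<bar>"] by simp
            moreover have "0 \<le> \<bar>g l x p\<bar> * \<bar>g l x q\<bar>" by simp
            ultimately show "norm (g l x p * g l x q) \<le> (g l x p)\<^sup>2 + (g l x q)\<^sup>2"
              unfolding real_norm_def abs_mult by linarith
          qed
          also have "\<dots> \<le> C p + C q" using part[OF x up(2), of n] part[OF x vq(2), of n] by (simp add: sum.distrib)
          finally show ?thesis using True by simp
        qed simp
      qed
    qed
    show ?thesis using LIMSEQ_unique[OF A B] by (simp add: set_lebesgue_integral_def)
  qed
  show ?thesis by (rule that[OF I Z inner])
qed

section \<open>Transfer of continuity between processes with the same law\<close>

lemma compact_imp_countable_dense:
  fixes E :: "'e::metric_space set"
  assumes "compact E"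
  shows "\<exists>D\<subseteq>E. countable D \<and> E \<subseteq> closure D"
proof -
  have "\<forall>n. \<exists>k. finite k \<and> k \<subseteq> E \<and> E \<subseteq> (\<Union>x\<in>k. ball x (inverse (real (Suc n))))"
    using seq_compact_imp_totally_bounded[OF compact_imp_seq_compact[OF assms]] by simp
  then obtain k where k: "\<And>n. finite (k n)" "\<And>n. k n \<subseteq> E"
    "\<And>n. E \<subseteq> (\<Union>x\<in>k n. ball x (inverse (real (Suc n))))" by metis
  have "E \<subseteq> closure (\<Union>n. k n)"
  proof
    fix e assume "e \<in> E"
    show "e \<in> closure (\<Union>n. k n)"
      unfolding closure_approachable
    proof (intro allI impI)
      fix \<delta> :: real assume "\<delta> > 0"
      then obtain n where n: "inverse (real (Suc n)) < \<delta>" using reals_Archimedean by blast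
      obtain x where "x \<in> k n" "dist x e < inverse (real (Suc n))" using k(3)[of n] \<open>e \<in> E\<close> by auto
      thus "\<exists>y\<in>\<Union>n. k n. dist y e < \<delta>" using n by (intro bexI[of _ x]) auto
    qed
  qed
  thus ?thesis using k by (intro exI[of _ "\<Union>n. k n"]) (auto intro: countable_finite)
qed

lemma equal_in_law_AE_transfer:
  assumes law: "equal_in_law N P E \<zeta> Z"
    and m: "\<And>e. e \<in> E \<Longrightarrow> \<zeta> e \<in> borel_measurable N" "\<And>e. e \<in> E \<Longrightarrow> Z e \<in> borel_measurable P"
    and Q: "Measurable.pred (Pi\<^sub>M E (\<lambda>_. borel)) Q"
    and ae: "AE \<omega> in N. Q (\<lambda>e\<in>E. \<zeta> e \<omega>)"
  shows "AE \<omega> in P. Q (\<lambda>e\<in>E. Z e \<omega>)"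
proof -
  have Q': "{x \<in> space (Pi\<^sub>M E (\<lambda>_. borel)). Q x} \<in> sets (Pi\<^sub>M E (\<lambda>_. borel))" using Q by measurable
  have "AE x in distr N (Pi\<^sub>M E (\<lambda>_. borel)) (\<lambda>\<omega>. \<lambda>e\<in>E. \<zeta> e \<omega>). Q x"
    using ae by (subst AE_distr_iff) (auto intro!: measurable_restrict m Q')
  hence "AE x in distr P (Pi\<^sub>M E (\<lambda>_. borel)) (\<lambda>\<omega>. \<lambda>e\<in>E. Z e \<omega>). Q x"
    by (subst law[unfolded equal_in_law_def, symmetric])
  thus ?thesis by (subst (asm) AE_distr_iff) (auto intro!: measurable_restrict m Q')
qed

lemma pred_countable_Ball:
  assumes "countable X" "\<And>i. i \<in> X \<Longrightarrow> Measurable.pred M (\<lambda>x. P x i)"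
  shows "Measurable.pred M (\<lambda>x. \<forall>i\<in>X. P x i)"
proof (cases "X = {}")
  case False
  have "(\<Inter>i\<in>X. {x \<in> space M. P x i}) \<in> sets M"
    using assms False by (intro sets.countable_INT') (auto simp: pred_def)
  moreover have "(\<Inter>i\<in>X. {x \<in> space M. P x i}) = {x \<in> space M. \<forall>i\<in>X. P x i}" using False by auto
  ultimately show ?thesis by (simp add: pred_def)
qed simp

text \<open>Uniform continuity on a countable dense subset, and convergence along a sequence, are events
  in the product \<open>\<sigma>\<close>-algebra, in contrast to continuity on \<open>E\<close>. Since they have probability one for
  \<open>\<zeta>\<close>, they have probability one for \<open>Z\<close>; the continuous extension from the dense set is the
  desired version.\<close>

lemma continuous_version:
  fixes E :: "'e::metric_space set"
  assumes E: "compact E" and law: "equal_in_law N P E \<zeta> Z"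
    and m: "\<And>e. e \<in> E \<Longrightarrow> \<zeta> e \<in> borel_measurable N" "\<And>e. e \<in> E \<Longrightarrow> Z e \<in> borel_measurable P"
    and cont: "AE \<omega> in N. continuous_on E (\<lambda>e. \<zeta> e \<omega>)"
  obtains Z' where "\<And>e. e \<in> E \<Longrightarrow> Z' e \<in> borel_measurable P" "\<And>e. e \<in> E \<Longrightarrow> AE \<omega> in P. Z e \<omega> = Z' e \<omega>"
    "AE \<omega> in P. continuous_on E (\<lambda>e. Z' e \<omega>)"
proof -
  obtain D where D: "D \<subseteq> E" "countable D" "E \<subseteq> closure D" using compact_imp_countable_dense[OF E] by blast
  have "\<forall>e\<in>E. \<exists>d. (\<forall>n. d n \<in> D) \<and> d \<longlonglongrightarrow> e" using D(3) unfolding closure_sequential[symmetric] by blast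
  then obtain d where d: "\<And>e n. e \<in> E \<Longrightarrow> d e n \<in> D" "\<And>e. e \<in> E \<Longrightarrow> d e \<longlonglongrightarrow> e" by metis
  \<comment> \<open>With tolerances \<open>1 / (k + 1)\<close> both predicates are countable combinations of events in
    countably many coordinates.\<close>
  define U where "U x \<longleftrightarrow> (\<forall>k::nat. \<exists>m::nat. \<forall>a\<in>D. \<forall>c\<in>D. dist a c < inverse (real (Suc m)) \<longrightarrow> dist (x a) (x c) < inverse (real (Suc k)))"
    for x :: "'e \<Rightarrow> real"
  define V where "V e x \<longleftrightarrow> (\<forall>k::nat. \<exists>m::nat. \<forall>n\<ge>m. dist (x (d e n)) (x e) < inverse (real (Suc k)))"
    for e and x :: "'e \<Rightarrow> real"
  have comp: "(\<lambda>x. x a) \<in> borel_measurable (Pi\<^sub>M E (\<lambda>_. borel :: real measure))" if "a \<in> E" for a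
    by (rule measurable_component_singleton[OF that])
  have predU: "Measurable.pred (Pi\<^sub>M E (\<lambda>_. borel)) U"
    unfolding U_def
  proof (intro pred_intros_countable pred_countable_Ball pred_intros_logic D(2))
    fix k :: nat and a c assume "a \<in> D" "c \<in> D"
    hence ac: "(\<lambda>x. x a) \<in> borel_measurable (Pi\<^sub>M E (\<lambda>_. borel :: real measure))"
        "(\<lambda>x. x c) \<in> borel_measurable (Pi\<^sub>M E (\<lambda>_. borel :: real measure))" using D(1) comp by blast+
    show "Measurable.pred (Pi\<^sub>M E (\<lambda>_. borel)) (\<lambda>x :: 'e \<Rightarrow> real. dist (x a) (x c) < inverse (real (Suc k)))"
      unfolding pred_def by (intro borel_measurable_less borel_measurable_dist ac borel_measurable_const)
  qed simp
  have predV: "Measurable.pred (Pi\<^sub>M E (\<lambda>_. borel)) (V e)" if e: "e \<in> E" for e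
    unfolding V_def
  proof (intro pred_intros_countable pred_intros_logic)
    fix k n :: nat
    have ac: "(\<lambda>x. x (d e n)) \<in> borel_measurable (Pi\<^sub>M E (\<lambda>_. borel :: real measure))"
        "(\<lambda>x. x e) \<in> borel_measurable (Pi\<^sub>M E (\<lambda>_. borel :: real measure))" using D(1) d(1)[OF e] e comp by blast+
    show "Measurable.pred (Pi\<^sub>M E (\<lambda>_. borel)) (\<lambda>x :: 'e \<Rightarrow> real. dist (x (d e n)) (x e) < inverse (real (Suc k)))"
      unfolding pred_def by (intro borel_measurable_less borel_measurable_dist ac borel_measurable_const)
  qed simp
  have U_iff: "U (\<lambda>e\<in>E. f e) \<longleftrightarrow> uniformly_continuous_on D f" for f :: "'e \<Rightarrow> real"
  proof -
    have "U (\<lambda>e\<in>E. f e) \<longleftrightarrow> (\<forall>k::nat. \<exists>m::nat. \<forall>a\<in>D. \<forall>c\<in>D. dist a c < inverse (real (Suc m)) \<longrightarrow> dist (f a) (f c) < inverse (real (Suc k)))"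
      unfolding U_def using D(1) by (intro all_cong1 ex_cong1 ball_cong refl) (simp add: subsetD)
    also have "\<dots> \<longleftrightarrow> uniformly_continuous_on D f"
    proof
      assume L: "\<forall>k::nat. \<exists>m::nat. \<forall>a\<in>D. \<forall>c\<in>D. dist a c < inverse (real (Suc m)) \<longrightarrow> dist (f a) (f c) < inverse (real (Suc k))"
      show "uniformly_continuous_on D f"
        unfolding uniformly_continuous_on_def
      proof (intro allI impI)
        fix \<epsilon> :: real assume "\<epsilon> > 0"
        then obtain k where k: "inverse (real (Suc k)) < \<epsilon>" using reals_Archimedean by blast
        obtain m where m: "\<forall>a\<in>D. \<forall>c\<in>D. dist a c < inverse (real (Suc m)) \<longrightarrow> dist (f a) (f c) < inverse (real (Suc k))" using L by blast
        show "\<exists>\<delta>>0. \<forall>x\<in>D. \<forall>x'\<in>D. dist x' x < \<delta> \<longrightarrow> dist (f x') (f x) < \<epsilon>"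
          using m k by (intro exI[of _ "inverse (real (Suc m))"] conjI ballI impI) (simp, meson less_trans)
      qed
    next
      assume R: "uniformly_continuous_on D f"
      show "\<forall>k::nat. \<exists>m::nat. \<forall>a\<in>D. \<forall>c\<in>D. dist a c < inverse (real (Suc m)) \<longrightarrow> dist (f a) (f c) < inverse (real (Suc k))"
      proof
        fix k :: nat
        have "inverse (real (Suc k)) > 0" by simp
        then obtain \<delta> where \<delta>: "\<delta> > 0" "\<And>x x'. x \<in> D \<Longrightarrow> x' \<in> D \<Longrightarrow> dist x' x < \<delta> \<Longrightarrow> dist (f x') (f x) < inverse (real (Suc k))"
          using R unfolding uniformly_continuous_on_def by meson
        obtain m where "inverse (real (Suc m)) < \<delta>" using reals_Archimedean[OF \<delta>(1)] by blast
        thus "\<exists>m::nat. \<forall>a\<in>D. \<forall>c\<in>D. dist a c < inverse (real (Suc m)) \<longrightarrow> dist (f a) (f c) < inverse (real (Suc k))"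
          using \<delta>(2) by (intro exI[of _ m]) (meson less_trans)
      qed
    qed
    finally show ?thesis .
  qed
  have V_iff: "V e (\<lambda>e\<in>E. f e) \<longleftrightarrow> (\<lambda>n. f (d e n)) \<longlonglongrightarrow> f e" if e: "e \<in> E" for f :: "'e \<Rightarrow> real" and e
  proof -
    have "d e n \<in> E" for n using d(1)[OF e] D(1) by blast
    hence "V e (\<lambda>e\<in>E. f e) \<longleftrightarrow> (\<forall>k::nat. \<exists>m::nat. \<forall>n\<ge>m. dist (f (d e n)) (f e) < inverse (real (Suc k)))"
      unfolding V_def using e by simp
    also have "\<dots> \<longleftrightarrow> (\<lambda>n. f (d e n)) \<longlonglongrightarrow> f e"
      unfolding lim_sequentially
    proof (intro iffI allI impI)
      fix \<epsilon> :: real assume L: "\<forall>k::nat. \<exists>m::nat. \<forall>n\<ge>m. dist (f (d e n)) (f e) < inverse (real (Suc k))" and "\<epsilon> > 0"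
      then obtain k where k: "inverse (real (Suc k)) < \<epsilon>" using reals_Archimedean by blast
      thus "\<exists>no. \<forall>n\<ge>no. dist (f (d e n)) (f e) < \<epsilon>" using L by (meson less_trans)
    next
      fix k :: nat assume "\<forall>r>0. \<exists>no. \<forall>n\<ge>no. dist (f (d e n)) (f e) < r"
      thus "\<exists>m::nat. \<forall>n\<ge>m. dist (f (d e n)) (f e) < inverse (real (Suc k))" by simp
    qed
    finally show ?thesis .
  qed
  have aeU: "AE \<omega> in P. uniformly_continuous_on D (\<lambda>e. Z e \<omega>)"
  proof -
    have "AE \<omega> in N. U (\<lambda>e\<in>E. \<zeta> e \<omega>)"
      using cont
    proof eventually_elim
      case (elim \<omega>)
      show ?case unfolding U_iff
        using compact_uniformly_continuous[OF elim E] D(1) unfolding uniformly_continuous_on_def by (meson subsetD)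
    qed
    from equal_in_law_AE_transfer[OF law m predU this] show ?thesis by (simp only: U_iff)
  qed
  have aeV: "AE \<omega> in P. (\<lambda>n. Z (d e n) \<omega>) \<longlonglongrightarrow> Z e \<omega>" if e: "e \<in> E" for e
  proof -
    have "AE \<omega> in N. V e (\<lambda>e\<in>E. \<zeta> e \<omega>)"
      using cont
    proof eventually_elim
      case (elim \<omega>)
      have "(\<lambda>n. \<zeta> (d e n) \<omega>) \<longlonglongrightarrow> \<zeta> e \<omega>"
        by (rule continuous_on_tendsto_compose[OF elim d(2)[OF e] e]) (intro always_eventually allI subsetD[OF D(1) d(1)[OF e]])
      thus ?case unfolding V_iff[OF e] .
    qed
    from equal_in_law_AE_transfer[OF law m predV[OF e] this] show ?thesis by (simp only: V_iff[OF e])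
  qed
  define Z' where "Z' e \<omega> = lim (\<lambda>n. Z (d e n) \<omega>)" for e \<omega>
  show ?thesis
  proof (rule that)
    fix e assume e: "e \<in> E"
    have "Z (d e n) \<in> borel_measurable P" for n using d(1)[OF e] D(1) m(2) by blast
    thus "Z' e \<in> borel_measurable P" unfolding Z'_def[abs_def] by (intro borel_measurable_lim_metric)
    show "AE \<omega> in P. Z e \<omega> = Z' e \<omega>"
      using aeV[OF e] by eventually_elim (simp add: Z'_def limI)
  next
    show "AE \<omega> in P. continuous_on E (\<lambda>e. Z' e \<omega>)"
      using aeU
    proof eventually_elim
      case (elim \<omega>)
      obtain h where h: "uniformly_continuous_on (closure D) h" "\<And>x. x \<in> D \<Longrightarrow> Z x \<omega> = h x"
        using uniformly_continuous_on_extension_on_closure[OF elim] by metis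
      have ch: "continuous_on (closure D) h" by (rule uniformly_continuous_imp_continuous[OF h(1)])
      have "Z' e \<omega> = h e" if e: "e \<in> E" for e
      proof -
        have "(\<lambda>n. h (d e n)) \<longlonglongrightarrow> h e"
        proof (rule continuous_on_tendsto_compose[OF ch d(2)[OF e]])
          show "e \<in> closure D" using D(3) e by blast
          show "\<forall>\<^sub>F n in sequentially. d e n \<in> closure D"
            using d(1)[OF e] closure_subset[of D] by (intro always_eventually allI) blast
        qed
        thus ?thesis unfolding Z'_def by (simp add: h(2)[OF d(1)[OF e]] limI)
      qed
      moreover have "continuous_on E h" by (rule continuous_on_subset[OF ch D(3)])
      ultimately show ?case by (simp cong: continuous_on_cong)
    qed
  qed
qed

section \<open>Representation of Gaussian processes with a diagonalised covariance density\<close>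

lemma (in prob_space) char_centred_normal:
  assumes V: "normal_rv M V" and mean: "(\<integral>\<omega>. V \<omega> \<partial>M) = 0"
  shows "square_integrable M V"
    and "(\<integral>\<omega>. iexp (V \<omega>) \<partial>M) = complex_of_real (exp (- L2_inner M V V / 2))"
proof -
  have [measurable]: "V \<in> borel_measurable M" using V by (simp add: normal_rv_def)
  obtain \<mu> s where ms: "(s = 0 \<and> (AE \<omega> in M. V \<omega> = \<mu>)) \<or>
            (s > 0 \<and> distributed M lborel V (\<lambda>x. ennreal (normal_density \<mu> s x)))"
    using V unfolding normal_rv_def by blast
  have "square_integrable M V \<and> (\<integral>\<omega>. iexp (V \<omega>) \<partial>M) = complex_of_real (exp (- L2_inner M V V / 2))"
    using ms
  proof
    assume *: "s = 0 \<and> (AE \<omega> in M. V \<omega> = \<mu>)"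
    have "(\<integral>\<omega>. V \<omega> \<partial>M) = (\<integral>\<omega>. \<mu> \<partial>M)" by (rule integral_cong_AE) (use * in auto)
    hence "\<mu> = 0" using mean by (simp add: prob_space)
    hence z: "AE \<omega> in M. 0 = V \<omega>" using * by auto
    have "square_integrable M V"
      by (rule square_integrable_cong_AE[OF square_integrable_zero z]) simp
    moreover have "L2_inner M V V = L2_inner M (\<lambda>_. 0) (\<lambda>_. 0)"
      by (rule L2_inner_cong_AE) (use z in auto)
    moreover have "(\<integral>\<omega>. iexp (V \<omega>) \<partial>M) = (\<integral>\<omega>. 1 \<partial>M)"
    proof (rule integral_cong_AE)
      show "AE \<omega> in M. iexp (V \<omega>) = 1" using z by eventually_elim simp
    qed auto
    ultimately show ?thesis by (simp add: L2_inner_def prob_space)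
  next
    assume *: "s > 0 \<and> distributed M lborel V (\<lambda>x. ennreal (normal_density \<mu> s x))"
    hence s: "s > 0" and d: "distributed M lborel V (\<lambda>x. ennreal (normal_density \<mu> s x))" by blast+
    have \<mu>: "\<mu> = 0" using normal_distributed_expectation[OF s d] mean by simp
    have "variance V = s\<^sup>2" by (rule normal_distributed_variance[OF s d])
    hence var: "L2_inner M V V = s\<^sup>2" using mean by (simp add: L2_inner_def power2_eq_square)
    have "integrable lborel (\<lambda>x. normal_density \<mu> s x * (x - \<mu>)^2)" by (rule integrable_normal_moment[OF s])
    hence "integrable M (\<lambda>\<omega>. (V \<omega>)\<^sup>2)"
      using distributed_integrable[OF d, of "\<lambda>x. x\<^sup>2"] \<mu> by simp
    hence sq: "square_integrable M V" by (simp add: square_integrable_def)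
    have "distributed M lborel (\<lambda>\<omega>. V \<omega> / s) (\<lambda>x. ennreal (normal_density 0 1 x))"
      using normal_standard_normal_convert[OF s, of V \<mu>] d \<mu> by simp
    hence st: "distr M borel (\<lambda>\<omega>. V \<omega> / s) = std_normal_distribution"
      by (subst (asm) distributed_normal_iff_distr) (auto simp: prob_space_axioms)
    have "(\<integral>\<omega>. iexp (V \<omega>) \<partial>M) = (\<integral>\<omega>. iexp (s * (V \<omega> / s)) \<partial>M)" using s by simp
    also have "\<dots> = char (distr M borel (\<lambda>\<omega>. V \<omega> / s)) s"
      unfolding char_def by (subst integral_distr) auto
    also have "\<dots> = complex_of_real (exp (- s\<^sup>2 / 2))" by (simp only: st char_std_normal_distribution)
    finally show ?thesis using sq var by simp
  qed
  thus "square_integrable M V" "(\<integral>\<omega>. iexp (V \<omega>) \<partial>M) = complex_of_real (exp (- L2_inner M V V / 2))"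
    by blast+
qed

lemma (in prob_space) centred_gaussian_process_combination:
  assumes G: "centred_gaussian_process M E Z" and J: "finite J" "J \<subseteq> E"
  shows "\<And>e. e \<in> E \<Longrightarrow> square_integrable M (Z e)"
    and "(\<integral>\<omega>. iexp (\<Sum>e\<in>J. c e * Z e \<omega>) \<partial>M)
      = complex_of_real (exp (- (\<Sum>e\<in>J. \<Sum>f\<in>J. c e * c f * cov M (Z e) (Z f)) / 2))"
proof -
  have mean: "(\<integral>\<omega>. Z e \<omega> \<partial>M) = 0" if "e \<in> E" for e
    using G that unfolding centred_gaussian_process_def by blast
  have nrm: "normal_rv M (\<lambda>\<omega>. \<Sum>e\<in>J. c e * Z e \<omega>)" if "finite J" "J \<subseteq> E" for J c
    using G that unfolding centred_gaussian_process_def by blast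
  show sq: "square_integrable M (Z e)" if "e \<in> E" for e
    using char_centred_normal(1)[of "Z e"] nrm[of "{e}" "\<lambda>_. 1"] mean[OF that] that by simp
  have "(\<integral>\<omega>. (\<Sum>e\<in>J. c e * Z e \<omega>) \<partial>M) = (\<Sum>e\<in>J. c e * (\<integral>\<omega>. Z e \<omega> \<partial>M))"
    by (subst Bochner_Integration.integral_sum) (use J L2_imp_integrable[OF sq] in auto)
  also have "\<dots> = 0" using mean J by (intro sum.neutral) auto
  finally have m0: "(\<integral>\<omega>. (\<Sum>e\<in>J. c e * Z e \<omega>) \<partial>M) = 0" .
  have "L2_inner M (\<lambda>\<omega>. \<Sum>e\<in>J. c e * Z e \<omega>) (\<lambda>\<omega>. \<Sum>e\<in>J. c e * Z e \<omega>)
      = (\<Sum>e\<in>J. \<Sum>f\<in>J. c e * c f * L2_inner M (Z e) (Z f))"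
    by (rule L2_inner_combination) (use sq J in auto)
  also have "\<dots> = (\<Sum>e\<in>J. \<Sum>f\<in>J. c e * c f * cov M (Z e) (Z f))"
    using J mean by (intro sum.cong refl) (auto simp: cov_def L2_inner_def subsetD)
  finally show "(\<integral>\<omega>. iexp (\<Sum>e\<in>J. c e * Z e \<omega>) \<partial>M)
      = complex_of_real (exp (- (\<Sum>e\<in>J. \<Sum>f\<in>J. c e * c f * cov M (Z e) (Z f)) / 2))"
    using char_centred_normal(2)[OF nrm[OF J] m0] by simp
qed

text \<open>The series and \<open>\<zeta>\<close> are centred Gaussian with the same covariance, so they have the same law, and
  the series has a continuous version. This version differs from the series on a null set at each
  index, which changes neither the law nor the mean square limits. The last conclusion holds for all
  versions \<open>I\<close> of the integrals; it allows explicit ones to be inserted.\<close>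

theorem wiener_series_representation:
  fixes \<zeta> :: "real \<times> 's::metric_space \<times> real \<Rightarrow> 'z \<Rightarrow> real"
    and g :: "nat \<Rightarrow> real \<Rightarrow> 's \<Rightarrow> real \<Rightarrow> real" and K :: "real \<Rightarrow> 's \<Rightarrow> real \<Rightarrow> 's \<Rightarrow> real \<Rightarrow> real"
  assumes S: "compact (UNIV :: 's set)" and N: "prob_space N"
    and gauss: "centred_gaussian_process N (index_set b) \<zeta>" and cont: "as_continuous N (index_set b) \<zeta>"
    and cov: "\<forall>(u1, y1, r1)\<in>index_set b. \<forall>(u2, y2, r2)\<in>index_set b.
        cov N (\<zeta> (u1, y1, r1)) (\<zeta> (u2, y2, r2)) = (LBINT \<eta>:{0..min u1 u2}. K \<eta> y1 r1 y2 r2)"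
    and meas: "\<And>l y r. r \<in> {0..b} \<Longrightarrow> (\<lambda>\<eta>. indicator {0..1} \<eta> * g l \<eta> y r) \<in> borel_measurable borel"
    and sums: "\<And>\<eta> y1 r1 y2 r2. \<eta> \<in> {0..1} \<Longrightarrow> r1 \<in> {0..b} \<Longrightarrow> r2 \<in> {0..b} \<Longrightarrow>
       (\<lambda>l. g l \<eta> y1 r1 * g l \<eta> y2 r2) sums K \<eta> y1 r1 y2 r2"
    and bdd: "\<And>\<eta> y r. \<eta> \<in> {0..1} \<Longrightarrow> r \<in> {0..b} \<Longrightarrow> K \<eta> y r y r \<le> C y r"
  obtains Z where "series_of_wiener_integrals white_noise b brownian g Z"
    and "equal_in_law N white_noise (index_set b) \<zeta> Z"
    and "\<And>u y r I. (u, y, r) \<in> index_set b \<Longrightarrow>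
       (\<And>l. has_wiener_integral white_noise (brownian l) u (\<lambda>\<eta>. g l \<eta> y r) (I l)) \<Longrightarrow>
       sums_L2 white_noise I (Z (u, y, r))"
proof -
  let ?P = "white_noise" and ?E = "index_set b :: (real \<times> 's \<times> real) set"
  interpret N: prob_space N by fact
  have idx: "(u, y, r) \<in> ?E \<longleftrightarrow> u \<in> {0..1} \<and> r \<in> {0..b}" for u y r by (simp add: index_set_def)
  obtain I0 :: "nat \<Rightarrow> real \<times> 's \<times> real \<Rightarrow> (nat \<Rightarrow> real) \<Rightarrow> real" and Z0 where
    I0: "\<And>l u p. u \<in> {0..1} \<Longrightarrow> p \<in> UNIV \<times> {0..b} \<Longrightarrow> has_wiener_integral ?P (brownian l) u (\<lambda>\<eta>. (\<lambda>(y, r). g l \<eta> y r) p) (I0 l (u, p))"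
    and lim: "\<And>u p. u \<in> {0..1} \<Longrightarrow> p \<in> UNIV \<times> {0..b} \<Longrightarrow> L2_tendsto ?P (\<lambda>n \<omega>. \<Sum>l<n. I0 l (u, p) \<omega>) (Z0 (u, p))"
    and inner: "\<And>u p v q. u \<in> {0..1} \<Longrightarrow> p \<in> UNIV \<times> {0..b} \<Longrightarrow> v \<in> {0..1} \<Longrightarrow> q \<in> UNIV \<times> {0..b} \<Longrightarrow>
       L2_inner ?P (Z0 (u, p)) (Z0 (v, q)) = (LBINT \<eta>:{0..min u v}. (\<lambda>(y1, r1) (y2, r2). K \<eta> y1 r1 y2 r2) p q)"
  proof (rule wiener_series[of "UNIV \<times> {0..b}" "\<lambda>l \<eta> (y, r). g l \<eta> y r" "\<lambda>\<eta> (y1, r1) (y2, r2). K \<eta> y1 r1 y2 r2" "\<lambda>(y, r). C y r"])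
    show "(\<lambda>\<eta>. indicator {0..1} \<eta> * (case p of (y, r) \<Rightarrow> g l \<eta> y r)) \<in> borel_measurable borel" if "p \<in> UNIV \<times> {0..b}" for l p
      using that meas by (cases p) simp
    show "(\<lambda>l. (case p of (y, r) \<Rightarrow> g l \<eta> y r) * (case q of (y, r) \<Rightarrow> g l \<eta> y r)) sums
        (case p of (y1, r1) \<Rightarrow> \<lambda>(y2, r2). K \<eta> y1 r1 y2 r2) q"
      if "\<eta> \<in> {0..1}" "p \<in> UNIV \<times> {0..b}" "q \<in> UNIV \<times> {0..b}" for \<eta> p q
      using that sums by (cases p; cases q) simp
    show "(case p of (y1, r1) \<Rightarrow> \<lambda>(y2, r2). K \<eta> y1 r1 y2 r2) p \<le> (case p of (y, r) \<Rightarrow> C y r)"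
      if "\<eta> \<in> {0..1}" "p \<in> UNIV \<times> {0..b}" for \<eta> p
      using that bdd by (cases p) simp
  qed (rule that)
  have mem: "fst e \<in> {0..1}" "snd e \<in> UNIV \<times> {0..b}" if "e \<in> ?E" for e
    using that by (auto simp: index_set_def)
  have spI: "gaussian_span (I0 l e)" if "e \<in> ?E" for l e
    using gaussian_span_wiener_integral[OF I0[OF mem[OF that]]] by simp
  have limE: "L2_tendsto ?P (\<lambda>n \<omega>. \<Sum>l<n. I0 l e \<omega>) (Z0 e)" if "e \<in> ?E" for e
    using lim[OF mem[OF that]] by simp
  have spZ: "gaussian_span (Z0 e)" if "e \<in> ?E" for e
    by (rule gaussian_span_limit[OF _ limE[OF that]]) (intro gaussian_span_sum spI that)
  have mZ: "Z0 e \<in> borel_measurable ?P" if "e \<in> ?E" for e using spZ[OF that] by (rule gaussian_span_measurable)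
  have covZ: "L2_inner ?P (Z0 e) (Z0 f) = cov N (\<zeta> e) (\<zeta> f)" if "e \<in> ?E" "f \<in> ?E" for e f
  proof -
    obtain u1 y1 r1 where e: "e = (u1, y1, r1)" by (cases e)
    obtain u2 y2 r2 where f: "f = (u2, y2, r2)" by (cases f)
    have "cov N (\<zeta> e) (\<zeta> f) = (LBINT \<eta>:{0..min u1 u2}. K \<eta> y1 r1 y2 r2)"
      using bspec[OF bspec[OF cov that(1)[unfolded e], unfolded prod.case] that(2)[unfolded f], unfolded prod.case]
      unfolding e f .
    thus ?thesis using that inner[of u1 "(y1, r1)" u2 "(y2, r2)"]
      unfolding e f by (simp add: idx)
  qed
  have m\<zeta>: "\<zeta> e \<in> borel_measurable N" if "e \<in> ?E" for e
    using gauss that unfolding centred_gaussian_process_def by blast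
  have ch: "(\<integral>x. iexp (\<Sum>e\<in>J. c e * \<zeta> e x) \<partial>N) = (\<integral>x. iexp (\<Sum>e\<in>J. c e * Z0 e x) \<partial>?P)"
    if J: "finite J" "J \<subseteq> ?E" for J c
  proof -
    have JE: "e \<in> ?E" if "e \<in> J" for e using J that by blast
    have "(\<integral>x. iexp (\<Sum>e\<in>J. c e * Z0 e x) \<partial>?P)
      = complex_of_real (exp (- L2_inner ?P (\<lambda>x. \<Sum>e\<in>J. c e * Z0 e x) (\<lambda>x. \<Sum>e\<in>J. c e * Z0 e x) / 2))"
      by (intro char_gaussian_span gaussian_span_sum gaussian_span_cmult spZ JE)
    also have "L2_inner ?P (\<lambda>x. \<Sum>e\<in>J. c e * Z0 e x) (\<lambda>x. \<Sum>e\<in>J. c e * Z0 e x)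
      = (\<Sum>e\<in>J. \<Sum>f\<in>J. c e * c f * L2_inner ?P (Z0 e) (Z0 f))"
      by (rule L2_inner_combination) (intro gaussian_span_square_integrable spZ JE)
    also have "\<dots> = (\<Sum>e\<in>J. \<Sum>f\<in>J. c e * c f * cov N (\<zeta> e) (\<zeta> f))"
      by (intro sum.cong refl) (simp add: covZ JE)
    finally show ?thesis by (simp only: N.centred_gaussian_process_combination(2)[OF gauss J])
  qed
  have law0: "equal_in_law N ?P ?E \<zeta> Z0"
    by (rule equal_in_law_iexpI[OF N prob_space_white_noise m\<zeta> mZ ch])
  have cE: "compact ?E"
    unfolding index_set_def by (intro compact_Times compact_Icc S)
  obtain Z where Z: "\<And>e. e \<in> ?E \<Longrightarrow> Z e \<in> borel_measurable ?P" "\<And>e. e \<in> ?E \<Longrightarrow> AE \<omega> in ?P. Z0 e \<omega> = Z e \<omega>"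
    "AE \<omega> in ?P. continuous_on ?E (\<lambda>e. Z e \<omega>)"
    using continuous_version[OF cE law0 m\<zeta> mZ cont[unfolded as_continuous_def]] by blast
  have law: "equal_in_law N ?P ?E \<zeta> Z"
  proof (rule equal_in_law_iexpI[OF N prob_space_white_noise m\<zeta> Z(1)])
    fix J c assume J: "finite J" "J \<subseteq> ?E"
    have "AE \<omega> in ?P. \<forall>e\<in>J. Z0 e \<omega> = Z e \<omega>"
      using J Z(2) by (subst AE_finite_all) auto
    hence ae: "AE \<omega> in ?P. iexp (\<Sum>e\<in>J. c e * Z0 e \<omega>) = iexp (\<Sum>e\<in>J. c e * Z e \<omega>)"
      by eventually_elim simp
    have mm: "(\<lambda>\<omega>. iexp (\<Sum>e\<in>J. c e * W e \<omega>)) \<in> borel_measurable ?P" if "\<And>e. e \<in> ?E \<Longrightarrow> W e \<in> borel_measurable ?P" for W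
    proof -
      have [measurable]: "(\<lambda>\<omega>. \<Sum>e\<in>J. c e * W e \<omega>) \<in> borel_measurable ?P"
        using that J by (intro borel_measurable_sum borel_measurable_times borel_measurable_const) blast
      show ?thesis by measurable
    qed
    have "(\<integral>x. iexp (\<Sum>e\<in>J. c e * Z0 e x) \<partial>?P) = (\<integral>x. iexp (\<Sum>e\<in>J. c e * Z e x) \<partial>?P)"
      by (rule integral_cong_AE[OF mm[OF mZ] mm[OF Z(1)] ae])
    thus "(\<integral>x. iexp (\<Sum>e\<in>J. c e * \<zeta> e x) \<partial>N) = (\<integral>x. iexp (\<Sum>e\<in>J. c e * Z e x) \<partial>?P)"
      by (simp only: ch[OF J])
  qed
  have sumsI: "sums_L2 ?P I (Z (u, y, r))"
    if e: "(u, y, r) \<in> ?E" and I: "\<And>l. has_wiener_integral ?P (brownian l) u (\<lambda>\<eta>. g l \<eta> y r) (I l)" for u y r I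
  proof -
    have I0': "has_wiener_integral ?P (brownian l) u (\<lambda>\<eta>. g l \<eta> y r) (I0 l (u, y, r))" for l
      using I0[OF mem[OF e], of l] by simp
    have sI: "square_integrable ?P (I l)" for l
      by (rule gaussian_span_square_integrable[OF gaussian_span_wiener_integral[OF I]])
    have limZ: "L2_tendsto ?P (\<lambda>n \<omega>. \<Sum>l<n. I0 l (u, y, r) \<omega>) (Z (u, y, r))"
      by (rule L2_tendsto_cong_AE[OF limE[OF e] Z(2)[OF e] Z(1)[OF e]])
    have "L2_norm ?P (\<lambda>\<omega>. (\<Sum>l<n. I0 l (u, y, r) \<omega>) - Z (u, y, r) \<omega>) = L2_norm ?P (\<lambda>\<omega>. (\<Sum>l<n. I l \<omega>) - Z (u, y, r) \<omega>)" for n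
    proof (rule L2_norm_cong_AE)
      have "AE \<omega> in ?P. \<forall>l. I0 l (u, y, r) \<omega> = I l \<omega>"
        unfolding AE_all_countable by (intro allI wiener_integral_unique[OF I0' I])
      thus "AE \<omega> in ?P. (\<Sum>l<n. I0 l (u, y, r) \<omega>) - Z (u, y, r) \<omega> = (\<Sum>l<n. I l \<omega>) - Z (u, y, r) \<omega>"
        by eventually_elim simp
      show "(\<lambda>\<omega>. (\<Sum>l<n. I0 l (u, y, r) \<omega>) - Z (u, y, r) \<omega>) \<in> borel_measurable ?P"
        by (intro borel_measurable_diff square_integrable_measurable[OF L2_tendstoD(1)[OF limZ]] Z(1)[OF e])
      show "(\<lambda>\<omega>. (\<Sum>l<n. I l \<omega>) - Z (u, y, r) \<omega>) \<in> borel_measurable ?P"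
        by (intro borel_measurable_diff borel_measurable_sum square_integrable_measurable[OF sI] Z(1)[OF e])
    qed
    hence "L2_tendsto ?P (\<lambda>n \<omega>. \<Sum>l<n. I l \<omega>) (Z (u, y, r))"
      using limZ unfolding L2_tendsto_def by (auto intro: square_integrable_sum sI)
    hence "(\<lambda>n. \<integral>\<^sup>+\<omega>. ennreal (((\<Sum>l<n. I l \<omega>) - Z (u, y, r) \<omega>)\<^sup>2) \<partial>?P) \<longlonglongrightarrow> 0"
      by (subst (asm) L2_tendsto_iff_nn) (auto intro: square_integrable_sum sI Z(1)[OF e])
    thus ?thesis unfolding sums_L2_def
      using Z(1)[OF e] square_integrable_measurable[OF sI] by blast
  qed
  have ser: "series_of_wiener_integrals ?P b brownian g Z"
    unfolding series_of_wiener_integrals_def as_continuous_def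
  proof (intro conjI Z(3) ballI)
    fix e assume e: "e \<in> ?E"
    obtain u y r where eq: "e = (u, y, r)" by (cases e)
    have "has_wiener_integral ?P (brownian l) u (\<lambda>\<eta>. g l \<eta> y r) (I0 l (u, y, r))" for l
      using I0[OF mem[OF e], of l] by (simp add: eq)
    moreover from this have "sums_L2 ?P (\<lambda>l. I0 l (u, y, r)) (Z (u, y, r))"
      by (rule sumsI[OF e[unfolded eq]])
    ultimately show "case e of (u, y, r) \<Rightarrow> \<exists>I. (\<forall>l. has_wiener_integral ?P (brownian l) u (\<lambda>\<eta>. g l \<eta> y r) (I l)) \<and> sums_L2 ?P I (Z (u, y, r))"
      unfolding eq prod.case by (intro exI[of _ "\<lambda>l. I0 l (u, y, r)"] conjI allI)
  qed
  show ?thesis by (rule that[OF ser law sumsI])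
qed

section \<open>Projections of functionals of an iid sequence\<close>

lemma Doob_Dynkin_real:
  fixes f :: "'a \<Rightarrow> real"
  assumes F: "\<And>A. A \<in> sets F \<Longrightarrow> \<exists>B\<in>sets N. A = g -` B \<inter> space F"
    and f: "f \<in> borel_measurable F"
  obtains \<phi> where "\<phi> \<in> borel_measurable N" "\<And>x. x \<in> space F \<Longrightarrow> f x = \<phi> (g x)"
proof -
  obtain s where s: "\<And>i. simple_function F (s i)" "\<And>x. x \<in> space F \<Longrightarrow> (\<lambda>i. s i x) \<longlonglongrightarrow> f x"
    using borel_measurable_implies_sequence_metric[OF f, of 0] by blast
  have "\<exists>B\<in>sets N. s i -` {y} \<inter> space F = g -` B \<inter> space F" for i y
    by (rule F) (rule simple_functionD(2)[OF s(1)])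
  then obtain B where B: "\<And>i y. B i y \<in> sets N" "\<And>i y. s i -` {y} \<inter> space F = g -` B i y \<inter> space F" by metis
  define \<phi> where "\<phi> i z = (\<Sum>y\<in>s i ` space F. y * indicator (B i y) z)" for i z
  have m: "\<phi> i \<in> borel_measurable N" for i
    unfolding \<phi>_def using B(1) by (intro borel_measurable_sum borel_measurable_times borel_measurable_const borel_measurable_indicator)
  have e: "s i x = \<phi> i (g x)" if x: "x \<in> space F" for i x
  proof -
    have "s i x = (\<Sum>y\<in>s i ` space F. indicator (s i -` {y} \<inter> space F) x *\<^sub>R y)"
      by (rule simple_function_indicator_representation_banach[OF s(1) x])
    also have "\<dots> = \<phi> i (g x)"
      unfolding \<phi>_def B(2) using x by (intro sum.cong refl) (simp add: indicator_def)
    finally show ?thesis .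
  qed
  show ?thesis
  proof (rule that)
    show "(\<lambda>z. lim (\<lambda>i. \<phi> i z)) \<in> borel_measurable N" by (intro borel_measurable_lim_metric m)
    fix x assume "x \<in> space F"
    thus "f x = lim (\<lambda>i. \<phi> i (g x))" using s(2)[of x] e by (simp add: limI)
  qed
qed

locale driving_noise = prob_space M
  for M :: "'w measure" and G :: "'g measure" and \<epsilon> \<epsilon>' :: "int \<Rightarrow> 'w \<Rightarrow> 'g" +
  assumes iid: "iid_with_independent_copy M G \<epsilon> \<epsilon>'"
begin

abbreviation "paths \<equiv> Pi\<^sub>M (UNIV :: int set) (\<lambda>_. G)"
abbreviation "pasts \<equiv> Pi\<^sub>M (UNIV :: nat set) (\<lambda>_. G)"
abbreviation "hist \<equiv> history M G \<epsilon>"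
abbreviation "cexp k \<equiv> real_cond_exp M (hist k)"
abbreviation "ip \<equiv> L2_inner M"

lemma indep_noise: "indep_vars (\<lambda>_. G) \<epsilon> UNIV"
  using iid by (simp add: iid_with_independent_copy_def)

lemma measurable_noise [measurable]: "\<epsilon> t \<in> M \<rightarrow>\<^sub>M G"
  using indep_noise by (simp add: indep_vars_def)

lemma measurable_path: "(\<lambda>\<omega> t. \<epsilon> t \<omega>) \<in> M \<rightarrow>\<^sub>M paths"
  by (rule measurable_PiM_single') (auto simp: measurable_space[OF measurable_noise])

lemma measurable_path': "(\<lambda>\<omega> t. \<epsilon>' t \<omega>) \<in> M \<rightarrow>\<^sub>M paths"
proof -
  have "indep_var paths (\<lambda>\<omega> t. \<epsilon> t \<omega>) paths (\<lambda>\<omega> t. \<epsilon>' t \<omega>)"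
    using iid by (simp add: iid_with_independent_copy_def)
  thus ?thesis by (rule indep_var_rv2)
qed

lemma measurable_past: "past \<epsilon> t \<in> M \<rightarrow>\<^sub>M pasts"
  unfolding past_def[abs_def]
  by (rule measurable_PiM_single') (auto simp: measurable_space[OF measurable_noise])

lemma measurable_coupled_past: "coupled_past \<epsilon> \<epsilon>' m t \<in> M \<rightarrow>\<^sub>M pasts"
proof -
  have c: "\<epsilon>' s \<in> M \<rightarrow>\<^sub>M G" for s
    using measurable_compose[OF measurable_path' measurable_component_singleton[of s]] by simp
  show ?thesis
    unfolding coupled_past_def[abs_def]
  proof (rule measurable_PiM_single')
    show "(\<lambda>\<omega>. if k < m then \<epsilon> (t - int k) \<omega> else \<epsilon>' (t - int k) \<omega>) \<in> M \<rightarrow>\<^sub>M G" for k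
      by (cases "k < m") (simp_all add: c)
  qed (auto simp: measurable_space[OF measurable_noise] measurable_space[OF c])
qed

lemma space_hist: "space (hist k) = space M"
  by (simp add: history_def space_measure_of_conv)

lemma sets_hist: "sets (hist k) = sigma_sets (space M) {\<epsilon> s -` A \<inter> space M | s A. s \<le> k \<and> A \<in> sets G}"
  unfolding history_def by (rule sets_measure_of) auto

lemma subalgebra_hist: "subalgebra M (hist k)"
  unfolding subalgebra_def
proof
  show "sets (hist k) \<subseteq> sets M"
    unfolding sets_hist by (rule sets.sigma_sets_subset) (auto intro: measurable_sets[OF measurable_noise])
qed (rule space_hist)

lemma sfs_hist: "sigma_finite_subalgebra M (hist k)"
  by (rule finite_measure_subalgebra_is_sigma_finite, unfold_locales) (rule subalgebra_hist)

lemma measurable_hist_past: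
  assumes "j \<le> k" shows "past \<epsilon> j \<in> hist k \<rightarrow>\<^sub>M pasts"
  unfolding past_def[abs_def]
proof (rule measurable_PiM_single')
  fix i :: nat
  show "\<epsilon> (j - int i) \<in> hist k \<rightarrow>\<^sub>M G"
  proof (rule measurableI)
    show "\<epsilon> (j - int i) \<omega> \<in> space G" if "\<omega> \<in> space (hist k)" for \<omega>
      using that measurable_space[OF measurable_noise] by (simp add: space_hist)
    fix A assume "A \<in> sets G"
    thus "\<epsilon> (j - int i) -` A \<inter> space (hist k) \<in> sets (hist k)"
      unfolding space_hist sets_hist using assms
      by (intro sigma_sets.Basic CollectI exI[of _ "j - int i"] exI[of _ A]) auto
  qed
qed (auto simp: space_hist measurable_space[OF measurable_noise])

lemma sets_hist_past:
  assumes "A \<in> sets (hist k)"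
  shows "\<exists>B\<in>sets pasts. A = past \<epsilon> k -` B \<inter> space (hist k)"
  using assms unfolding sets_hist space_hist
proof (induction A rule: sigma_sets.induct)
  case (Basic a)
  then obtain s A where a: "a = \<epsilon> s -` A \<inter> space M" "s \<le> k" "A \<in> sets G" by blast
  have "(\<lambda>x. x (nat (k - s))) -` A \<inter> space pasts \<in> sets pasts"
    using a by (intro measurable_sets[OF measurable_component_singleton]) auto
  moreover have "a = past \<epsilon> k -` ((\<lambda>x. x (nat (k - s))) -` A \<inter> space pasts) \<inter> space M"
    using a measurable_space[OF measurable_past] by (auto simp: past_def)
  ultimately show ?case by blast
next
  case Empty
  show ?case by (intro bexI[of _ "{}"]) auto
next
  case (Compl a)
  then obtain B where B: "B \<in> sets pasts" "a = past \<epsilon> k -` B \<inter> space M" by blast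
  show ?case using B measurable_space[OF measurable_past] by (intro bexI[of _ "space pasts - B"]) auto
next
  case (Union a)
  then obtain B where B: "\<And>i. B i \<in> sets pasts" "\<And>i. a i = past \<epsilon> k -` B i \<inter> space M" by metis
  show ?case using B by (intro bexI[of _ "\<Union>i. B i"]) auto
qed

lemma hist_mono:
  fixes f :: "'w \<Rightarrow> real"
  assumes f: "f \<in> borel_measurable (hist j)" and jk: "j \<le> k"
  shows "f \<in> borel_measurable (hist k)"
proof -
  obtain \<phi> where \<phi>: "\<phi> \<in> borel_measurable pasts" "\<And>\<omega>. \<omega> \<in> space (hist j) \<Longrightarrow> f \<omega> = \<phi> (past \<epsilon> j \<omega>)"
    using Doob_Dynkin_real[OF sets_hist_past f] by blast
  have "(\<lambda>\<omega>. \<phi> (past \<epsilon> j \<omega>)) \<in> borel_measurable (hist k)"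
    by (rule measurable_compose[OF measurable_hist_past[OF jk] \<phi>(1)])
  thus ?thesis
    using \<phi>(2) by (subst measurable_cong) (auto simp: space_hist)
qed

subsection \<open>Conditional expectations of bounded variables\<close>

definition bounded_rv :: "('w \<Rightarrow> real) \<Rightarrow> bool" where
  "bounded_rv V \<longleftrightarrow> V \<in> borel_measurable M \<and> (\<exists>C. \<forall>\<omega>\<in>space M. \<bar>V \<omega>\<bar> \<le> C)"

lemma bounded_rv_square_integrable: "bounded_rv V \<Longrightarrow> square_integrable M V"
  unfolding bounded_rv_def using square_integrable_bounded by blast

lemma bounded_rv_integrable: "bounded_rv V \<Longrightarrow> integrable M V"
  by (rule L2_imp_integrable[OF bounded_rv_square_integrable])

lemma bounded_rv_measurable: "bounded_rv V \<Longrightarrow> V \<in> borel_measurable M"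
  by (simp add: bounded_rv_def)

lemma bounded_rv_diff:
  assumes "bounded_rv V" "bounded_rv W" shows "bounded_rv (\<lambda>\<omega>. V \<omega> - W \<omega>)"
proof -
  obtain C D where "\<forall>\<omega>\<in>space M. \<bar>V \<omega>\<bar> \<le> C" "\<forall>\<omega>\<in>space M. \<bar>W \<omega>\<bar> \<le> D"
    using assms unfolding bounded_rv_def by blast
  hence "\<forall>\<omega>\<in>space M. \<bar>V \<omega> - W \<omega>\<bar> \<le> C + D" by (smt (verit))
  thus ?thesis using assms unfolding bounded_rv_def by (intro conjI borel_measurable_diff) blast+
qed

lemma cexp_hist_measurable: "cexp k V \<in> borel_measurable (hist k)"
  by (rule borel_measurable_cond_exp)

lemma cexp_measurable: "cexp k V \<in> borel_measurable M"
  by (rule borel_measurable_cond_exp2)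

lemma cexp_square_integrable:
  assumes V: "bounded_rv V" shows "square_integrable M (cexp k V)"
proof -
  interpret sigma_finite_subalgebra M "hist k" by (rule sfs_hist)
  obtain C where C: "\<forall>\<omega>\<in>space M. \<bar>V \<omega>\<bar> \<le> C" using V unfolding bounded_rv_def by blast
  have "AE \<omega> in M. cexp k V \<omega> \<ge> - C"
    by (rule real_cond_exp_ge_c[OF bounded_rv_integrable[OF V]]) (use C in \<open>auto intro!: AE_I2 simp: abs_le_iff\<close>)
  moreover have "AE \<omega> in M. cexp k V \<omega> \<le> C"
    by (rule real_cond_exp_le_c[OF bounded_rv_integrable[OF V]]) (use C in \<open>auto intro!: AE_I2 simp: abs_le_iff\<close>)
  ultimately have "AE \<omega> in M. \<bar>cexp k V \<omega>\<bar> \<le> C" by eventually_elim simp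
  thus ?thesis by (rule square_integrable_AE_bounded[OF cexp_measurable])
qed

lemma inner_cexp:
  assumes V: "bounded_rv V" and U: "U \<in> borel_measurable (hist k)" "square_integrable M U"
  shows "ip U (cexp k V) = ip U V"
proof -
  interpret sigma_finite_subalgebra M "hist k" by (rule sfs_hist)
  show ?thesis unfolding L2_inner_def
    by (rule real_cond_exp_intg(2)[OF square_integrable_mult[OF U(2) bounded_rv_square_integrable[OF V]] U(1) bounded_rv_measurable[OF V]])
qed

lemma inner_cexp_cexp:
  assumes V: "bounded_rv V" and W: "bounded_rv W" and jk: "j \<le> k"
  shows "ip (cexp k V) (cexp j W) = ip V (cexp j W)"
  using inner_cexp[OF V hist_mono[OF cexp_hist_measurable jk] cexp_square_integrable[OF W]]
  by (simp add: L2_inner_commute)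

lemma inner_cexp_sym:
  assumes "bounded_rv V" "bounded_rv W"
  shows "ip V (cexp k W) = ip (cexp k V) W"
  using inner_cexp_cexp[OF assms order_refl, of k] inner_cexp_cexp[OF assms(2,1) order_refl, of k]
  by (simp add: L2_inner_commute)

lemma cexp_norm_le:
  assumes V: "bounded_rv V" shows "L2_norm M (cexp k V) \<le> L2_norm M V"
proof -
  have "(L2_norm M (cexp k V))\<^sup>2 = ip V (cexp k V)"
    unfolding L2_norm_power2 by (rule inner_cexp_cexp[OF V V order_refl])
  also have "\<dots> \<le> L2_norm M V * L2_norm M (cexp k V)"
    using L2_Cauchy_Schwarz[OF bounded_rv_square_integrable[OF V] cexp_square_integrable[OF V], of k] by linarith
  finally have "L2_norm M (cexp k V) * L2_norm M (cexp k V) \<le> L2_norm M V * L2_norm M (cexp k V)"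
    by (simp add: power2_eq_square)
  thus ?thesis
    using mult_right_le_imp_le[of "L2_norm M (cexp k V)" "L2_norm M (cexp k V)" "L2_norm M V"]
    by (cases "L2_norm M (cexp k V) = 0") (simp_all add: order_neq_le_trans)
qed

lemma cexp_diff:
  assumes "bounded_rv V" "bounded_rv W"
  shows "AE \<omega> in M. cexp k (\<lambda>\<omega>. V \<omega> - W \<omega>) \<omega> = cexp k V \<omega> - cexp k W \<omega>"
proof -
  interpret sigma_finite_subalgebra M "hist k" by (rule sfs_hist)
  show ?thesis by (rule real_cond_exp_diff[OF assms[THEN bounded_rv_integrable]])
qed

lemma proj_measurable: "proj M G \<epsilon> k V \<in> borel_measurable M"
  unfolding proj_def by (intro borel_measurable_diff cexp_measurable)

lemma proj_square_integrable: "bounded_rv V \<Longrightarrow> square_integrable M (proj M G \<epsilon> k V)"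
  unfolding proj_def by (intro square_integrable_diff cexp_square_integrable)

lemma proj_diff:
  assumes "bounded_rv V" "bounded_rv W"
  shows "AE \<omega> in M. proj M G \<epsilon> k (\<lambda>\<omega>. V \<omega> - W \<omega>) \<omega> = proj M G \<epsilon> k V \<omega> - proj M G \<epsilon> k W \<omega>"
  using cexp_diff[OF assms, of k] cexp_diff[OF assms, of "k - 1"]
  by eventually_elim (simp add: proj_def)

lemma proj_norm_le:
  assumes V: "bounded_rv V" shows "L2_norm M (proj M G \<epsilon> k V) \<le> 2 * L2_norm M V"
proof -
  have "L2_norm M (proj M G \<epsilon> k V) \<le> L2_norm M (cexp k V) + L2_norm M (\<lambda>\<omega>. - cexp (k - 1) V \<omega>)"
    using L2_norm_triangle[OF cexp_square_integrable[OF V, of k] square_integrable_cmult[OF cexp_square_integrable[OF V, of "k - 1"], of "-1"]]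
    by (simp add: proj_def)
  thus ?thesis using cexp_norm_le[OF V, of k] cexp_norm_le[OF V, of "k - 1"] by (simp add: L2_norm_uminus)
qed

lemma proj_norm_diff_le:
  assumes "bounded_rv V" "bounded_rv W"
  shows "L2_norm M (\<lambda>\<omega>. proj M G \<epsilon> k V \<omega> - proj M G \<epsilon> k W \<omega>) \<le> 2 * L2_norm M (\<lambda>\<omega>. V \<omega> - W \<omega>)"
proof -
  have "L2_norm M (\<lambda>\<omega>. proj M G \<epsilon> k V \<omega> - proj M G \<epsilon> k W \<omega>) = L2_norm M (proj M G \<epsilon> k (\<lambda>\<omega>. V \<omega> - W \<omega>))"
    by (rule L2_norm_cong_AE[symmetric]) (auto intro!: proj_diff[OF assms] borel_measurable_diff proj_measurable)
  thus ?thesis using proj_norm_le[OF bounded_rv_diff[OF assms]] by simp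
qed

lemma inner_proj:
  assumes V: "bounded_rv V" and W: "bounded_rv W"
  shows "ip (proj M G \<epsilon> k V) (proj M G \<epsilon> k W) = ip V (cexp k W) - ip V (cexp (k - 1) W)"
proof -
  have "ip (proj M G \<epsilon> k V) (proj M G \<epsilon> k W) = ip (cexp k V) (cexp k W) - ip (cexp k V) (cexp (k - 1) W)
     - (ip (cexp (k - 1) V) (cexp k W) - ip (cexp (k - 1) V) (cexp (k - 1) W))"
    unfolding proj_def
    by (simp add: L2_inner_diff_left L2_inner_diff_right cexp_square_integrable V W square_integrable_diff)
  moreover have "ip (cexp k V) (cexp k W) = ip V (cexp k W)"
    "ip (cexp k V) (cexp (k - 1) W) = ip V (cexp (k - 1) W)"
    "ip (cexp (k - 1) V) (cexp (k - 1) W) = ip V (cexp (k - 1) W)"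
    by (rule inner_cexp_cexp[OF V W]; simp)+
  moreover have "ip (cexp (k - 1) V) (cexp k W) = ip V (cexp (k - 1) W)"
    using inner_cexp_cexp[OF W V, of "k - 1" k] inner_cexp_sym[OF V W, of "k - 1"] by (simp add: L2_inner_commute)
  ultimately show ?thesis by simp
qed

subsection \<open>Stationarity\<close>

lemma distr_shifted_path: "distr M paths (\<lambda>\<omega> t. \<epsilon> (t + a) \<omega>) = distr M paths (\<lambda>\<omega> t. \<epsilon> t \<omega>)"
proof -
  have pG: "prob_space (distr M G (\<epsilon> 0))" by (rule prob_space_distr) simp
  have "distr M paths (\<lambda>\<omega>. \<lambda>t\<in>UNIV. \<epsilon> t \<omega>) = Pi\<^sub>M UNIV (\<lambda>t. distr M G (\<epsilon> t))"
    using indep_noise by (subst (asm) indep_vars_iff_distr_eq_PiM) simp_all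
  moreover have "(\<lambda>t. distr M G (\<epsilon> t)) = (\<lambda>_. distr M G (\<epsilon> 0))"
    using iid unfolding iid_with_independent_copy_def by (intro ext) blast
  ultimately have L: "distr M paths (\<lambda>\<omega> t. \<epsilon> t \<omega>) = Pi\<^sub>M UNIV (\<lambda>_. distr M G (\<epsilon> 0))"
    by (simp add: restrict_def)
  have sets: "sets (Pi\<^sub>M UNIV (\<lambda>_::int. distr M G (\<epsilon> 0))) = sets paths" by (rule sets_PiM_cong) auto
  have ms: "(\<lambda>x t. x (t + a)) \<in> paths \<rightarrow>\<^sub>M paths"
    by (rule measurable_PiM_single') (auto simp: space_PiM PiE_iff intro!: measurable_component_singleton)
  have "distr M paths (\<lambda>\<omega> t. \<epsilon> (t + a) \<omega>) = distr (distr M paths (\<lambda>\<omega> t. \<epsilon> t \<omega>)) paths (\<lambda>x t. x (t + a))"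
    by (subst distr_distr[OF ms measurable_path]) (simp add: comp_def)
  also have "\<dots> = distr (Pi\<^sub>M UNIV (\<lambda>_. distr M G (\<epsilon> 0))) (Pi\<^sub>M UNIV (\<lambda>_. distr M G (\<epsilon> 0))) (\<lambda>x. \<lambda>t\<in>UNIV. x (t + a))"
    unfolding L by (rule distr_cong) (simp_all add: sets restrict_def)
  also have "\<dots> = Pi\<^sub>M UNIV (\<lambda>_. distr M G (\<epsilon> 0))"
    by (rule distr_PiM_reindex) (auto simp: pG inj_on_def)
  finally show ?thesis unfolding L .
qed

lemma integral_shift:
  fixes h :: "(int \<Rightarrow> 'g) \<Rightarrow> real"
  assumes h: "h \<in> borel_measurable paths"
  shows "(\<integral>\<omega>. h (\<lambda>t. \<epsilon> (t + a) \<omega>) \<partial>M) = (\<integral>\<omega>. h (\<lambda>t. \<epsilon> t \<omega>) \<partial>M)"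
proof -
  have m: "(\<lambda>\<omega> t. \<epsilon> (t + a) \<omega>) \<in> M \<rightarrow>\<^sub>M paths"
    by (rule measurable_PiM_single') (auto simp: measurable_space[OF measurable_noise])
  show ?thesis
    using integral_distr[OF m h] integral_distr[OF measurable_path h] by (simp add: distr_shifted_path)
qed

definition obs :: "((nat \<Rightarrow> 'g) \<Rightarrow> real) \<Rightarrow> int \<Rightarrow> 'w \<Rightarrow> real" where
  "obs v t \<omega> = v (past \<epsilon> t \<omega>)"

definition past_of :: "int \<Rightarrow> (int \<Rightarrow> 'g) \<Rightarrow> nat \<Rightarrow> 'g" where
  "past_of t x = (\<lambda>k. x (t - int k))"

lemma past_of_path: "past_of t (\<lambda>s. \<epsilon> s \<omega>) = past \<epsilon> t \<omega>" "past_of t (\<lambda>s. \<epsilon> (s + a) \<omega>) = past \<epsilon> (t + a) \<omega>"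
  by (simp_all add: past_of_def past_def algebra_simps)

lemma measurable_past_of: "past_of t \<in> paths \<rightarrow>\<^sub>M pasts"
  unfolding past_of_def[abs_def]
  by (rule measurable_PiM_single') (auto simp: space_PiM PiE_iff intro!: measurable_component_singleton)

lemma obs_integral_shift:
  assumes v: "v \<in> borel_measurable pasts" and w: "w \<in> borel_measurable pasts"
  shows "(\<integral>\<omega>. obs v (s + a) \<omega> * obs w (t + a) \<omega> \<partial>M) = (\<integral>\<omega>. obs v s \<omega> * obs w t \<omega> \<partial>M)"
proof -
  have "(\<lambda>x. v (past_of s x) * w (past_of t x)) \<in> borel_measurable paths"
    by (intro borel_measurable_times measurable_compose[OF measurable_past_of] v w)
  from integral_shift[OF this, of a] show ?thesis by (simp add: past_of_path obs_def)
qed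

lemma obs_bounded_rv:
  assumes "v \<in> borel_measurable pasts" "\<And>x. \<bar>v x\<bar> \<le> C" shows "bounded_rv (obs v t)"
  unfolding bounded_rv_def obs_def[abs_def]
  using assms measurable_compose[OF measurable_past assms(1)] by blast

lemma obs_hist_measurable:
  assumes "v \<in> borel_measurable pasts" "t \<le> k" shows "obs v t \<in> borel_measurable (hist k)"
  unfolding obs_def[abs_def] by (rule measurable_compose[OF measurable_hist_past[OF assms(2)] assms(1)])

text \<open>The conditional expectation of a functional of the noise up to time \<open>t\<close> given the noise up to
  time \<open>k\<close> is a functional of the latter; the same functional serves after a shift of time.\<close>

lemma inner_cexp_shift:
  assumes v: "v \<in> borel_measurable pasts" "\<And>x. \<bar>v x\<bar> \<le> C" and w: "w \<in> borel_measurable pasts" "\<And>x. \<bar>w x\<bar> \<le> C"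
  shows "ip (obs v (s + a)) (cexp (k + a) (obs w (t + a))) = ip (obs v s) (cexp k (obs w t))"
proof -
  have bv: "bounded_rv (obs v t)" and bw: "bounded_rv (obs w t)" for t by (rule obs_bounded_rv[OF v] obs_bounded_rv[OF w])+
  obtain \<phi> where \<phi>: "\<phi> \<in> borel_measurable pasts" "\<And>\<omega>. \<omega> \<in> space (hist k) \<Longrightarrow> cexp k (obs w t) \<omega> = \<phi> (past \<epsilon> k \<omega>)"
    using Doob_Dynkin_real[OF sets_hist_past cexp_hist_measurable] by blast
  have e: "cexp k (obs w t) \<omega> = obs \<phi> k \<omega>" if "\<omega> \<in> space M" for \<omega>
    using \<phi>(2) that by (simp add: space_hist obs_def)
  have m\<phi>: "obs \<phi> k \<in> borel_measurable M" for k
    unfolding obs_def[abs_def] by (rule measurable_compose[OF measurable_past \<phi>(1)])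
  have int0: "integrable M (obs \<phi> k)"
    using Bochner_Integration.integrable_cong[OF refl, of M "obs \<phi> k" "cexp k (obs w t)"] e
      L2_imp_integrable[OF cexp_square_integrable[OF bw]] by simp
  have int: "integrable M (obs \<phi> (k + a))"
  proof -
    have mp: "(\<lambda>x. \<phi> (past_of k x)) \<in> borel_measurable paths" by (rule measurable_compose[OF measurable_past_of \<phi>(1)])
    have "integrable (distr M paths (\<lambda>\<omega> t. \<epsilon> t \<omega>)) (\<lambda>x. \<phi> (past_of k x))"
      using int0 by (subst integrable_distr_eq[OF measurable_path mp]) (simp add: past_of_path obs_def[abs_def])
    hence "integrable (distr M paths (\<lambda>\<omega> t. \<epsilon> (t + a) \<omega>)) (\<lambda>x. \<phi> (past_of k x))" by (simp add: distr_shifted_path)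
    moreover have "(\<lambda>\<omega> t. \<epsilon> (t + a) \<omega>) \<in> M \<rightarrow>\<^sub>M paths"
      by (rule measurable_PiM_single') (auto simp: measurable_space[OF measurable_noise])
    ultimately show ?thesis
      by (subst (asm) integrable_distr_eq[OF _ mp]) (simp_all add: past_of_path obs_def[abs_def])
  qed
  interpret sigma_finite_subalgebra M "hist (k + a)" by (rule sfs_hist)
  have "AE \<omega> in M. cexp (k + a) (obs w (t + a)) \<omega> = obs \<phi> (k + a) \<omega>"
  proof (rule real_cond_exp_charact)
    show "integrable M (obs w (t + a))" by (rule bounded_rv_integrable[OF bw])
    show "integrable M (obs \<phi> (k + a))" by (rule int)
    show "obs \<phi> (k + a) \<in> borel_measurable (hist (k + a))" by (rule obs_hist_measurable[OF \<phi>(1) order_refl])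
    fix A assume "A \<in> sets (hist (k + a))"
    then obtain B where B: "B \<in> sets pasts" "A = past \<epsilon> (k + a) -` B \<inter> space M"
      using sets_hist_past[of A "k + a"] unfolding space_hist by blast
    have iB: "indicator B \<in> borel_measurable pasts" using B(1) by simp
    have set: "(LINT \<omega>:A|M. obs u (s + a) \<omega>) = (\<integral>\<omega>. obs (indicator B) (k + a) \<omega> * obs u (s + a) \<omega> \<partial>M)" for u s
      unfolding set_lebesgue_integral_def B(2)
      by (intro Bochner_Integration.integral_cong) (auto simp: obs_def indicator_def)
    interpret K: sigma_finite_subalgebra M "hist k" by (rule sfs_hist)
    have sB: "square_integrable M (obs (indicator B) k)"
      by (rule bounded_rv_square_integrable[OF obs_bounded_rv[OF iB, of 1]]) (simp add: indicator_def)
    have "(LINT \<omega>:A|M. obs w (t + a) \<omega>) = ip (obs (indicator B) k) (obs w t)"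
      unfolding set L2_inner_def by (rule obs_integral_shift[OF iB w(1)])
    also have "\<dots> = ip (obs (indicator B) k) (cexp k (obs w t))"
      by (rule inner_cexp[OF bw obs_hist_measurable[OF iB order_refl] sB, symmetric])
    also have "\<dots> = (\<integral>\<omega>. obs (indicator B) k \<omega> * obs \<phi> k \<omega> \<partial>M)"
      unfolding L2_inner_def by (rule Bochner_Integration.integral_cong) (simp_all add: e)
    also have "\<dots> = (LINT \<omega>:A|M. obs \<phi> (k + a) \<omega>)"
      unfolding set by (rule obs_integral_shift[OF iB \<phi>(1), symmetric])
    finally show "(LINT \<omega>:A|M. obs w (t + a) \<omega>) = (LINT \<omega>:A|M. obs \<phi> (k + a) \<omega>)" .
  qed
  hence "ip (obs v (s + a)) (cexp (k + a) (obs w (t + a))) = ip (obs v (s + a)) (obs \<phi> (k + a))"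
    by (intro L2_inner_cong_AE) (auto intro: cexp_measurable m\<phi> bounded_rv_measurable[OF bv])
  also have "\<dots> = ip (obs v s) (obs \<phi> k)"
    unfolding L2_inner_def by (rule obs_integral_shift[OF v(1) \<phi>(1)])
  also have "\<dots> = ip (obs v s) (cexp k (obs w t))"
    unfolding L2_inner_def by (rule Bochner_Integration.integral_cong) (simp_all add: e)
  finally show ?thesis .
qed

subsection \<open>The remote past\<close>

text \<open>The coupled variable does not involve the noise up to time \<open>t - m\<close>. Conditionally on \<open>\<epsilon>'\<close>, this
  is the independence of two blocks of \<open>\<epsilon>\<close>.\<close>

lemma cexp_coupled:
  assumes w: "w \<in> borel_measurable pasts" "\<And>x. \<bar>w x\<bar> \<le> C"
  defines "W \<equiv> \<lambda>m t \<omega>. w (coupled_past \<epsilon> \<epsilon>' m t \<omega>)"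
  shows "AE \<omega> in M. cexp (t - int m) (W m t) \<omega> = (\<integral>\<omega>. W m t \<omega> \<partial>M)"
proof -
  define k where "k = t - int m"
  define mix where "mix x x' = (\<lambda>i. if i < m then x (t - int i) else x' (t - int i))" for x x' :: "int \<Rightarrow> 'g"
  have W: "W m t \<omega> = w (mix (\<lambda>s. \<epsilon> s \<omega>) (\<lambda>s. \<epsilon>' s \<omega>))" for \<omega>
    by (simp add: W_def mix_def coupled_past_def cong: if_cong)
  have mW: "W m t \<in> borel_measurable M"
    unfolding W_def by (rule measurable_compose[OF measurable_coupled_past w(1)])
  have bW: "bounded_rv (W m t)" unfolding bounded_rv_def using mW w(2) by (auto simp: W_def)
  have mmix: "(\<lambda>(x, x'). mix x x') \<in> paths \<Otimes>\<^sub>M paths \<rightarrow>\<^sub>M pasts"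
    unfolding mix_def split_beta
  proof (rule measurable_PiM_single')
    fix i :: nat
    show "(\<lambda>p. if i < m then fst p (t - int i) else snd p (t - int i)) \<in> paths \<Otimes>\<^sub>M paths \<rightarrow>\<^sub>M G"
      by (cases "i < m") (simp_all add: measurable_compose[OF measurable_fst measurable_component_singleton]
          measurable_compose[OF measurable_snd measurable_component_singleton])
  qed (auto simp: space_pair_measure space_PiM PiE_iff)
  define L L' where "L = distr M paths (\<lambda>\<omega> t. \<epsilon> t \<omega>)" and "L' = distr M paths (\<lambda>\<omega> t. \<epsilon>' t \<omega>)"
  interpret L: prob_space L unfolding L_def by (rule prob_space_distr[OF measurable_path])
  interpret L': prob_space L' unfolding L'_def by (rule prob_space_distr[OF measurable_path'])
  interpret LL: pair_prob_space L L' ..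
  have joint: "L \<Otimes>\<^sub>M L' = distr M (paths \<Otimes>\<^sub>M paths) (\<lambda>\<omega>. ((\<lambda>s. \<epsilon> s \<omega>), (\<lambda>s. \<epsilon>' s \<omega>)))"
    using iid unfolding iid_with_independent_copy_def indep_var_distribution_eq L_def L'_def by blast
  have mj: "(\<lambda>\<omega>. ((\<lambda>s. \<epsilon> s \<omega>), (\<lambda>s. \<epsilon>' s \<omega>))) \<in> M \<rightarrow>\<^sub>M paths \<Otimes>\<^sub>M paths"
    by (rule measurable_Pair[OF measurable_path measurable_path'])
  have mwm: "(\<lambda>(x, x'). w (mix x x')) \<in> borel_measurable (paths \<Otimes>\<^sub>M paths)"
    using measurable_compose[OF mmix w(1)] by (simp add: split_beta)
  have sLL: "sets (L \<Otimes>\<^sub>M L') = sets (paths \<Otimes>\<^sub>M paths)"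
    by (rule sets_pair_measure_cong) (simp_all add: L_def L'_def)
  \<comment> \<open>Integrating over \<open>\<epsilon>\<close> first keeps \<open>\<epsilon>'\<close> fixed, so that only independence within \<open>\<epsilon>\<close> is left to use.\<close>
  have fubini: "(\<integral>\<omega>. h ((\<lambda>s. \<epsilon> s \<omega>), (\<lambda>s. \<epsilon>' s \<omega>)) \<partial>M) = (\<integral>x'. (\<integral>\<omega>. h ((\<lambda>s. \<epsilon> s \<omega>), x') \<partial>M) \<partial>L')"
    if h: "h \<in> borel_measurable (paths \<Otimes>\<^sub>M paths)" "\<And>p. \<bar>h p\<bar> \<le> C'" for h :: "(int \<Rightarrow> 'g) \<times> (int \<Rightarrow> 'g) \<Rightarrow> real" and C'
  proof -
    have h': "h \<in> borel_measurable (L \<Otimes>\<^sub>M L')" using h(1) measurable_cong_sets[OF sLL refl] by blast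
    have hi: "integrable (L \<Otimes>\<^sub>M L') (case_prod (\<lambda>x x'. h (x, x')))"
      by (rule LL.integrable_const_bound[where B = C']) (use h h' in auto)
    have "(\<integral>\<omega>. h ((\<lambda>s. \<epsilon> s \<omega>), (\<lambda>s. \<epsilon>' s \<omega>)) \<partial>M) = (\<integral>p. h p \<partial>(L \<Otimes>\<^sub>M L'))"
      unfolding joint by (rule integral_distr[OF mj h(1), symmetric])
    also have "\<dots> = (\<integral>x'. (\<integral>x. h (x, x') \<partial>L) \<partial>L')"
      using LL.integral_snd[OF hi] by simp
    also have "\<dots> = (\<integral>x'. (\<integral>\<omega>. h ((\<lambda>s. \<epsilon> s \<omega>), x') \<partial>M) \<partial>L')"
    proof (rule Bochner_Integration.integral_cong[OF refl])
      fix x' assume "x' \<in> space L'"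
      hence "x' \<in> space paths" by (simp add: L'_def)
      hence "(\<lambda>x. h (x, x')) \<in> borel_measurable paths"
        by (intro measurable_compose[OF measurable_Pair2' h(1)])
      thus "(\<integral>x. h (x, x') \<partial>L) = (\<integral>\<omega>. h ((\<lambda>s. \<epsilon> s \<omega>), x') \<partial>M)"
        unfolding L_def by (rule integral_distr[OF measurable_path])
    qed
    finally show ?thesis .
  qed
  interpret sigma_finite_subalgebra M "hist k" by (rule sfs_hist)
  have "AE \<omega> in M. cexp k (W m t) \<omega> = (\<integral>\<omega>. W m t \<omega> \<partial>M)"
  proof (rule real_cond_exp_charact)
    show "integrable M (W m t)" by (rule bounded_rv_integrable[OF bW])
    fix A assume "A \<in> sets (hist k)"
    then obtain B where B: "B \<in> sets pasts" "A = past \<epsilon> k -` B \<inter> space M"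
      using sets_hist_past[of A k] unfolding space_hist by blast
    have iB: "indicator B \<in> borel_measurable pasts" using B(1) by simp
    have mh: "(\<lambda>p. indicator B (past_of k (fst p)) * w (mix (fst p) (snd p))) \<in> borel_measurable (paths \<Otimes>\<^sub>M paths)"
      using mwm by (intro borel_measurable_times measurable_compose[OF measurable_fst measurable_compose[OF measurable_past_of iB]])
        (simp add: split_beta)
    have bh: "\<bar>indicator B (past_of k (fst p)) * w (mix (fst p) (snd p))\<bar> \<le> \<bar>C\<bar>" for p
      using w(2)[of "mix (fst p) (snd p)"] by (auto simp: indicator_def)
    have split: "(\<integral>\<omega>. indicator B (past \<epsilon> k \<omega>) * w (mix (\<lambda>s. \<epsilon> s \<omega>) x') \<partial>M)
      = (\<integral>\<omega>. indicator B (past \<epsilon> k \<omega>) \<partial>M) * (\<integral>\<omega>. w (mix (\<lambda>s. \<epsilon> s \<omega>) x') \<partial>M)" if x': "x' \<in> space paths" for x'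
    proof -
      have ind: "indep_var (Pi\<^sub>M {..k} (\<lambda>_. G)) (\<lambda>\<omega>. restrict (\<lambda>i. \<epsilon> i \<omega>) {..k}) (Pi\<^sub>M {k<..} (\<lambda>_. G)) (\<lambda>\<omega>. restrict (\<lambda>i. \<epsilon> i \<omega>) {k<..})"
        by (rule indep_var_restrict[OF indep_noise]) auto
      have m1: "(\<lambda>x. indicator B (\<lambda>i. x (k - int i)) :: real) \<in> borel_measurable (Pi\<^sub>M {..k} (\<lambda>_. G))"
        by (rule measurable_compose[OF _ iB], rule measurable_PiM_single')
          (auto simp: space_PiM PiE_iff intro!: measurable_component_singleton)
      have m2: "(\<lambda>x. w (mix x x')) \<in> borel_measurable (Pi\<^sub>M {k<..} (\<lambda>_. G))"
      proof (rule measurable_compose[OF _ w(1)], unfold mix_def, rule measurable_PiM_single')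
        fix i :: nat
        show "(\<lambda>x. if i < m then x (t - int i) else x' (t - int i)) \<in> Pi\<^sub>M {k<..} (\<lambda>_. G) \<rightarrow>\<^sub>M G"
          using x' by (cases "i < m") (auto simp: k_def space_PiM PiE_iff intro!: measurable_component_singleton measurable_const)
      qed (use x' in \<open>auto simp: space_PiM PiE_iff k_def\<close>)
      have "indep_var borel ((\<lambda>x. indicator B (\<lambda>i. x (k - int i)) :: real) \<circ> (\<lambda>\<omega>. restrict (\<lambda>i. \<epsilon> i \<omega>) {..k}))
          borel ((\<lambda>x. w (mix x x')) \<circ> (\<lambda>\<omega>. restrict (\<lambda>i. \<epsilon> i \<omega>) {k<..}))"
        by (rule indep_var_compose[OF ind m1 m2])
      moreover have "(\<lambda>x. indicator B (\<lambda>i. x (k - int i)) :: real) \<circ> (\<lambda>\<omega>. restrict (\<lambda>i. \<epsilon> i \<omega>) {..k}) = (\<lambda>\<omega>. indicator B (past \<epsilon> k \<omega>))"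
        by (auto simp: fun_eq_iff past_def)
      moreover have "(\<lambda>x. w (mix x x')) \<circ> (\<lambda>\<omega>. restrict (\<lambda>i. \<epsilon> i \<omega>) {k<..}) = (\<lambda>\<omega>. w (mix (\<lambda>s. \<epsilon> s \<omega>) x'))"
        by (auto simp: fun_eq_iff mix_def k_def intro!: arg_cong[of _ _ w])
      ultimately have iv: "indep_var borel (\<lambda>\<omega>. indicator B (past \<epsilon> k \<omega>) :: real) borel (\<lambda>\<omega>. w (mix (\<lambda>s. \<epsilon> s \<omega>) x'))" by simp
      show ?thesis
      proof (rule indep_var_lebesgue_integral[OF iv])
        show "integrable M (\<lambda>\<omega>. indicator B (past \<epsilon> k \<omega>) :: real)"
          by (rule integrable_const_bound[where B = 1]) (use indep_var_rv1[OF iv] in \<open>auto simp: indicator_def\<close>)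
        show "integrable M (\<lambda>\<omega>. w (mix (\<lambda>s. \<epsilon> s \<omega>) x'))"
          by (rule integrable_const_bound[where B = C]) (use indep_var_rv2[OF iv] w(2) in auto)
      qed
    qed
    have "(LINT \<omega>:A|M. W m t \<omega>) = (\<integral>\<omega>. indicator B (past_of k (fst ((\<lambda>s. \<epsilon> s \<omega>), (\<lambda>s. \<epsilon>' s \<omega>)))) * w (mix (fst ((\<lambda>s. \<epsilon> s \<omega>), (\<lambda>s. \<epsilon>' s \<omega>))) (snd ((\<lambda>s. \<epsilon> s \<omega>), (\<lambda>s. \<epsilon>' s \<omega>)))) \<partial>M)"
      unfolding set_lebesgue_integral_def B(2) W
      by (intro Bochner_Integration.integral_cong) (auto simp: indicator_def past_of_path)
    also have "\<dots> = (\<integral>x'. (\<integral>\<omega>. indicator B (past \<epsilon> k \<omega>) * w (mix (\<lambda>s. \<epsilon> s \<omega>) x') \<partial>M) \<partial>L')"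
      by (subst fubini[OF mh bh]) (simp add: past_of_path)
    also have "\<dots> = (\<integral>x'. (\<integral>\<omega>. indicator B (past \<epsilon> k \<omega>) \<partial>M) * (\<integral>\<omega>. w (mix (\<lambda>s. \<epsilon> s \<omega>) x') \<partial>M) \<partial>L')"
      by (intro Bochner_Integration.integral_cong refl split) (simp add: L'_def)
    also have "\<dots> = (\<integral>\<omega>. indicator B (past \<epsilon> k \<omega>) \<partial>M) * (\<integral>x'. (\<integral>\<omega>. w (mix (\<lambda>s. \<epsilon> s \<omega>) x') \<partial>M) \<partial>L')"
      by simp
    also have "(\<integral>x'. (\<integral>\<omega>. w (mix (\<lambda>s. \<epsilon> s \<omega>) x') \<partial>M) \<partial>L') = (\<integral>\<omega>. W m t \<omega> \<partial>M)"
      using fubini[OF mwm, of C] w(2) unfolding W by (simp add: split_beta)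
    also have "(\<integral>\<omega>. indicator B (past \<epsilon> k \<omega>) \<partial>M) * (\<integral>\<omega>. W m t \<omega> \<partial>M) = (LINT \<omega>:A|M. (\<integral>\<omega>. W m t \<omega> \<partial>M))"
      unfolding set_lebesgue_integral_def B(2)
      by (simp flip: integral_mult_left_zero, intro Bochner_Integration.integral_cong) (auto simp: indicator_def)
    finally show "(LINT \<omega>:A|M. W m t \<omega>) = (LINT \<omega>:A|M. (\<integral>\<omega>. W m t \<omega> \<partial>M))" .
  qed auto
  thus ?thesis by (simp add: k_def)
qed

definition coupling_error :: "((nat \<Rightarrow> 'g) \<Rightarrow> real) \<Rightarrow> int \<Rightarrow> nat \<Rightarrow> real" where
  "coupling_error v t m = L2_norm M (\<lambda>\<omega>. obs v t \<omega> - v (coupled_past \<epsilon> \<epsilon>' m t \<omega>))"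

text \<open>The conditional expectation given the remote past is constant for the coupled variables, and
  these approximate the original ones.\<close>

lemma inner_cexp_remote_past:
  assumes v: "v \<in> borel_measurable pasts" "\<And>x. \<bar>v x\<bar> \<le> C" and w: "w \<in> borel_measurable pasts" "\<And>x. \<bar>w x\<bar> \<le> C"
    and err: "coupling_error w t \<longlonglongrightarrow> 0"
  shows "(\<lambda>m. ip (obs v s) (cexp (t - int m) (obs w t))) \<longlonglongrightarrow> (\<integral>\<omega>. obs v s \<omega> \<partial>M) * (\<integral>\<omega>. obs w t \<omega> \<partial>M)"
proof -
  define Wm where "Wm m \<omega> = w (coupled_past \<epsilon> \<epsilon>' m t \<omega>)" for m \<omega>
  have bv: "bounded_rv (obs v s)" and bw: "bounded_rv (obs w t)" by (rule obs_bounded_rv[OF v] obs_bounded_rv[OF w])+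
  have bW: "bounded_rv (Wm m)" for m
    unfolding bounded_rv_def Wm_def using measurable_compose[OF measurable_coupled_past w(1)] w(2) by auto
  have sv: "square_integrable M (obs v s)" by (rule bounded_rv_square_integrable[OF bv])
  let ?ew = "\<integral>\<omega>. obs w t \<omega> \<partial>M"
  have sc: "square_integrable M (\<lambda>_. c)" for c by (rule square_integrable_bounded[where C = "\<bar>c\<bar>"]) auto
  have "L2_norm M (\<lambda>\<omega>. cexp (t - int m) (obs w t) \<omega> - ?ew) \<le> 2 * coupling_error w t m" for m
  proof -
    have "L2_norm M (\<lambda>\<omega>. cexp (t - int m) (obs w t) \<omega> - ?ew)
      \<le> L2_norm M (\<lambda>\<omega>. cexp (t - int m) (obs w t) \<omega> - cexp (t - int m) (Wm m) \<omega>) + L2_norm M (\<lambda>\<omega>. cexp (t - int m) (Wm m) \<omega> - ?ew)"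
      by (intro L2_norm_triangle_diff cexp_square_integrable bw bW sc)
    also have "L2_norm M (\<lambda>\<omega>. cexp (t - int m) (obs w t) \<omega> - cexp (t - int m) (Wm m) \<omega>)
        = L2_norm M (cexp (t - int m) (\<lambda>\<omega>. obs w t \<omega> - Wm m \<omega>))"
      by (rule L2_norm_cong_AE[symmetric]) (auto intro!: cexp_diff bw bW cexp_measurable borel_measurable_diff)
    also have "\<dots> \<le> coupling_error w t m"
      using cexp_norm_le[OF bounded_rv_diff[OF bw bW]] by (simp add: coupling_error_def Wm_def)
    also have "L2_norm M (\<lambda>\<omega>. cexp (t - int m) (Wm m) \<omega> - ?ew) = L2_norm M (\<lambda>\<omega>. (\<integral>\<omega>. Wm m \<omega> \<partial>M) - ?ew)"
    proof (rule L2_norm_cong_AE)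
      show "AE \<omega> in M. cexp (t - int m) (Wm m) \<omega> - ?ew = (\<integral>\<omega>. Wm m \<omega> \<partial>M) - ?ew"
        using cexp_coupled[OF w, of t m] unfolding Wm_def[symmetric] by eventually_elim simp
    qed (auto intro!: cexp_measurable borel_measurable_diff)
    also have "\<dots> = \<bar>\<integral>\<omega>. Wm m \<omega> - obs w t \<omega> \<partial>M\<bar>"
      using bounded_rv_integrable[OF bW] bounded_rv_integrable[OF bw] by (simp add: L2_norm_def prob_space)
    also have "\<dots> \<le> (\<integral>\<omega>. \<bar>Wm m \<omega> - obs w t \<omega>\<bar> \<partial>M)" by (rule integral_abs_bound)
    also have "\<dots> \<le> L2_norm M (\<lambda>\<omega>. Wm m \<omega> - obs w t \<omega>)"
      by (intro integral_abs_le_L2_norm square_integrable_diff bounded_rv_square_integrable bW bw)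
    also have "\<dots> = coupling_error w t m" by (simp add: coupling_error_def Wm_def L2_norm_minus_commute)
    finally show ?thesis by simp
  qed
  hence "\<forall>m. norm (L2_norm M (\<lambda>\<omega>. cexp (t - int m) (obs w t) \<omega> - ?ew)) \<le> 2 * coupling_error w t m" by simp
  from Lim_null_comparison[OF always_eventually[OF this] tendsto_mult_right_zero[OF err]]
  have "L2_tendsto M (\<lambda>m. cexp (t - int m) (obs w t)) (\<lambda>_. ?ew)"
    by (simp add: L2_tendsto_def cexp_square_integrable bw sc)
  from L2_tendsto_inner[OF L2_tendsto_const[OF sv] this] show ?thesis by (simp add: L2_inner_def)
qed

end

section \<open>The long-run covariance as an inner product\<close>

lemma cov_eq_inner:
  assumes "prob_space M" "square_integrable M V" "square_integrable M W"
  shows "cov M V W = L2_inner M V W - (\<integral>\<omega>. V \<omega> \<partial>M) * (\<integral>\<omega>. W \<omega> \<partial>M)"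
proof -
  interpret prob_space M by fact
  define a b where "a = (\<integral>\<omega>. V \<omega> \<partial>M)" and "b = (\<integral>\<omega>. W \<omega> \<partial>M)"
  have "cov M V W = (\<integral>\<omega>. V \<omega> * W \<omega> - a * W \<omega> - b * V \<omega> + a * b \<partial>M)"
    unfolding cov_def a_def[symmetric] b_def[symmetric] by (simp add: algebra_simps)
  also have "\<dots> = L2_inner M V W - a * b - b * a + a * b"
    using square_integrable_mult[OF assms(2,3)] L2_imp_integrable[OF assms(2)] L2_imp_integrable[OF assms(3)]
    by (simp add: L2_inner_def prob_space a_def b_def)
  finally show ?thesis by (simp add: a_def b_def)
qed

context driving_noise
begin

text \<open>The functionals to which the martingale approximation applies: \<open>a\<close> bounds the projections
  uniformly in time, and the coupling makes the remote past trivial.\<close>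

definition regular :: "((nat \<Rightarrow> 'g) \<Rightarrow> real) \<Rightarrow> (nat \<Rightarrow> real) \<Rightarrow> bool" where
  "regular v a \<longleftrightarrow> v \<in> borel_measurable pasts \<and> (\<forall>x. \<bar>v x\<bar> \<le> 1) \<and> (\<forall>t. coupling_error v t \<longlonglongrightarrow> 0) \<and>
     summable a \<and> (\<forall>t j. L2_norm M (proj M G \<epsilon> (t - int j) (obs v t)) \<le> a j)"

lemma regularD:
  assumes "regular v a"
  shows "v \<in> borel_measurable pasts" "\<And>x. \<bar>v x\<bar> \<le> 1" "\<And>t. coupling_error v t \<longlonglongrightarrow> 0" "summable a"
    "\<And>t j. L2_norm M (proj M G \<epsilon> (t - int j) (obs v t)) \<le> a j" "\<And>j. 0 \<le> a j"
    "\<And>t. bounded_rv (obs v t)"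
proof -
  show r: "v \<in> borel_measurable pasts" "\<And>x. \<bar>v x\<bar> \<le> 1" "\<And>t. coupling_error v t \<longlonglongrightarrow> 0" "summable a"
    "\<And>t j. L2_norm M (proj M G \<epsilon> (t - int j) (obs v t)) \<le> a j"
    using assms by (auto simp: regular_def)
  show "0 \<le> a j" for j using r(5)[of 0 j] by (rule order_trans[OF L2_norm_nonneg])
  show "bounded_rv (obs v t)" for t by (rule obs_bounded_rv[OF r(1,2)])
qed

text \<open>Truncations of the martingale difference \<open>\<Sum>\<^sub>t P\<^sub>1(V\<^sub>t)\<close>, \<open>t \<ge> 1\<close>, whose variance is the long-run
  variance. Time \<open>1\<close> is taken as origin since the continuity of the auxiliary process in
  rescaled time is known for positive times only.\<close>

definition mart :: "((nat \<Rightarrow> 'g) \<Rightarrow> real) \<Rightarrow> nat \<Rightarrow> 'w \<Rightarrow> real" where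
  "mart v n \<omega> = (\<Sum>s<n. proj M G \<epsilon> 1 (obs v (1 + int s)) \<omega>)"

lemma mart_square_integrable: "regular v a \<Longrightarrow> square_integrable M (mart v n)"
  unfolding mart_def[abs_def] by (intro square_integrable_sum proj_square_integrable regularD(7))

lemma proj_obs_norm: "regular v a \<Longrightarrow> L2_norm M (proj M G \<epsilon> 1 (obs v (1 + int s))) \<le> a s"
  using regularD(5)[of v a "1 + int s" s] by simp

lemma mart_norm_diff:
  assumes r: "regular v a" and "m \<le> n"
  shows "L2_norm M (\<lambda>\<omega>. mart v n \<omega> - mart v m \<omega>) \<le> (\<Sum>s=m..<n. a s)"
proof -
  have "(\<lambda>\<omega>. mart v n \<omega> - mart v m \<omega>) = (\<lambda>\<omega>. \<Sum>s=m..<n. proj M G \<epsilon> 1 (obs v (1 + int s)) \<omega>)"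
    unfolding mart_def lessThan_atLeast0 using assms(2) by (intro ext sum_diff_nat_ivl) simp_all
  hence "L2_norm M (\<lambda>\<omega>. mart v n \<omega> - mart v m \<omega>) \<le> (\<Sum>s=m..<n. L2_norm M (proj M G \<epsilon> 1 (obs v (1 + int s))))"
    using L2_norm_sum_le[of "{m..<n}" M "\<lambda>s. proj M G \<epsilon> 1 (obs v (1 + int s))"] proj_square_integrable[OF regularD(7)[OF r]] by simp
  also have "\<dots> \<le> (\<Sum>s=m..<n. a s)" by (intro sum_mono proj_obs_norm[OF r])
  finally show ?thesis .
qed

lemma mart_norm_le:
  assumes r: "regular v a" shows "L2_norm M (mart v n) \<le> suminf a"
proof -
  have "L2_norm M (mart v n) \<le> (\<Sum>s=0..<n. a s)"
  proof -
    have "mart v 0 = (\<lambda>_. 0)" by (simp add: mart_def fun_eq_iff)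
    thus ?thesis using mart_norm_diff[OF r, of 0 n] by simp
  qed
  also have "\<dots> \<le> suminf a" by (rule sum_le_suminf) (use regularD[OF r] in auto)
  finally show ?thesis .
qed

lemma mart_converges:
  assumes r: "regular v a" shows "\<exists>W. L2_tendsto M (mart v) W"
proof (rule L2_complete[OF mart_square_integrable[OF r]])
  fix e :: real assume "e > 0"
  then obtain N where N: "\<And>m n. m \<ge> N \<Longrightarrow> norm (\<Sum>i=m..<n. a i) < e"
    using regularD(4)[OF r] unfolding summable_Cauchy by blast
  have le: "L2_norm M (\<lambda>\<omega>. mart v n \<omega> - mart v m \<omega>) < e" if "N \<le> m" "m \<le> n" for m n
    using mart_norm_diff[OF r that(2)] N[OF that(1), of n] by simp
  show "\<exists>N. \<forall>m\<ge>N. \<forall>n\<ge>N. L2_norm M (\<lambda>x. mart v m x - mart v n x) < e"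
  proof (intro exI[of _ N] allI impI)
    fix m n assume mn: "N \<le> m" "N \<le> n"
    show "L2_norm M (\<lambda>x. mart v m x - mart v n x) < e"
    proof (cases "m \<le> n")
      case True
      thus ?thesis using le[OF mn(1) True] L2_norm_minus_commute[of M "mart v m" "mart v n"] by simp
    next
      case False
      thus ?thesis using le[OF mn(2), of m] by simp
    qed
  qed
qed

definition mart_lim :: "((nat \<Rightarrow> 'g) \<Rightarrow> real) \<Rightarrow> 'w \<Rightarrow> real" where
  "mart_lim v = (SOME W. L2_tendsto M (mart v) W)"

lemma mart_lim: "regular v a \<Longrightarrow> L2_tendsto M (mart v) (mart_lim v)"
  unfolding mart_lim_def by (rule someI_ex[OF mart_converges])

lemma proj_obs_shift:
  assumes v: "regular v a" and w: "regular w c"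
  shows "ip (proj M G \<epsilon> (k + d) (obs v (s + d))) (proj M G \<epsilon> (k + d) (obs w (t + d)))
    = ip (proj M G \<epsilon> k (obs v s)) (proj M G \<epsilon> k (obs w t))"
  using inner_cexp_shift[OF regularD(1,2)[OF v] regularD(1,2)[OF w], of s d k t]
    inner_cexp_shift[OF regularD(1,2)[OF v] regularD(1,2)[OF w], of s d "k - 1" t]
  by (simp add: inner_proj[OF regularD(7)[OF v] regularD(7)[OF w]] algebra_simps)

text \<open>Only the projections at times \<open>\<le> min 0 h\<close> contribute, since one of the two variables is a
  functional of the noise up to this time. The partial sums telescope, and the remainder tends to
  the product of the means.\<close>

lemma cov_obs_sums:
  assumes v: "regular v a" and w: "regular w c"
  shows "(\<lambda>n. ip (proj M G \<epsilon> (min 0 h - int n) (obs v 0)) (proj M G \<epsilon> (min 0 h - int n) (obs w h))) sums cov M (obs v 0) (obs w h)"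
proof -
  define m where "m = min 0 h"
  define \<Gamma> where "\<Gamma> k = ip (obs v 0) (cexp k (obs w h))" for k
  note bv = regularD(7)[OF v] and bw = regularD(7)[OF w]
  have part: "(\<Sum>i<n. ip (proj M G \<epsilon> (m - int i) (obs v 0)) (proj M G \<epsilon> (m - int i) (obs w h))) = \<Gamma> m - \<Gamma> (m - int n)" for n
  proof (induction n)
    case (Suc n)
    have "ip (proj M G \<epsilon> (m - int n) (obs v 0)) (proj M G \<epsilon> (m - int n) (obs w h)) = \<Gamma> (m - int n) - \<Gamma> (m - int n - 1)"
      unfolding \<Gamma>_def by (rule inner_proj[OF bv bw])
    moreover have "m - int n - 1 = m - int (Suc n)" by simp
    ultimately show ?case using Suc by simp
  qed simp
  have "\<Gamma> m = ip (obs v 0) (obs w h)"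
  proof (cases "h \<ge> 0")
    case True
    thus ?thesis unfolding \<Gamma>_def m_def
      by (simp add: inner_cexp[OF bw obs_hist_measurable[OF regularD(1)[OF v]] bounded_rv_square_integrable[OF bv]])
  next
    case False
    hence m: "m = h" by (simp add: m_def)
    have "\<Gamma> h = ip (obs w h) (cexp h (obs v 0))"
      unfolding \<Gamma>_def using inner_cexp_sym[OF bv bw] by (simp add: L2_inner_commute)
    also have "\<dots> = ip (obs w h) (obs v 0)"
      by (rule inner_cexp[OF bv obs_hist_measurable[OF regularD(1)[OF w] order_refl] bounded_rv_square_integrable[OF bw]])
    finally show ?thesis by (simp add: m L2_inner_commute)
  qed
  moreover have "(\<lambda>n. \<Gamma> (m - int n)) \<longlonglongrightarrow> (\<integral>\<omega>. obs v 0 \<omega> \<partial>M) * (\<integral>\<omega>. obs w h \<omega> \<partial>M)"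
  proof -
    have "h - int (n + nat (h - m)) = m - int n" for n by (simp add: m_def)
    thus ?thesis
      using LIMSEQ_ignore_initial_segment[OF inner_cexp_remote_past[OF regularD(1,2)[OF v] regularD(1,2)[OF w] regularD(3)[OF w], of 0 h], of "nat (h - m)"]
      unfolding \<Gamma>_def by (simp only:)
  qed
  ultimately have "(\<lambda>n. \<Gamma> m - \<Gamma> (m - int n)) \<longlonglongrightarrow> ip (obs v 0) (obs w h) - (\<integral>\<omega>. obs v 0 \<omega> \<partial>M) * (\<integral>\<omega>. obs w h \<omega> \<partial>M)"
    by (auto intro: tendsto_diff)
  moreover have "cov M (obs v 0) (obs w h) = ip (obs v 0) (obs w h) - (\<integral>\<omega>. obs v 0 \<omega> \<partial>M) * (\<integral>\<omega>. obs w h \<omega> \<partial>M)"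
    by (rule cov_eq_inner[OF prob_space_axioms bounded_rv_square_integrable[OF bv] bounded_rv_square_integrable[OF bw]])
  ultimately show ?thesis unfolding sums_def part[unfolded m_def] m_def by simp
qed

text \<open>Both sides are the sum over \<open>s, t \<ge> 0\<close> of \<open>\<langle>P\<^sub>1 V\<^sub>1\<^sub>+\<^sub>s, P\<^sub>1 W\<^sub>1\<^sub>+\<^sub>t\<rangle>\<close>: on the left, pairs with the
  same lag \<open>t - s\<close> are collected, and stationarity moves the projections to time \<open>1\<close>.\<close>

lemma long_run_cov_eq_inner:
  assumes v: "regular v a" and w: "regular w c"
  shows "(\<Sum>\<^sub>\<infinity>h::int. cov M (obs v 0) (obs w h)) = ip (mart_lim v) (mart_lim w)"
proof -
  define q where "q = (\<lambda>(s::nat, t::nat). ip (proj M G \<epsilon> 1 (obs v (1 + int s))) (proj M G \<epsilon> 1 (obs w (1 + int t))))"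
  have sq: "square_integrable M (proj M G \<epsilon> 1 (obs v (1 + int s)))" "square_integrable M (proj M G \<epsilon> 1 (obs w (1 + int s)))" for s
    by (rule proj_square_integrable regularD(7)[OF v] regularD(7)[OF w])+
  have a0: "0 \<le> a s" and c0: "0 \<le> c s" for s by (rule regularD(6)[OF v] regularD(6)[OF w])+
  have ac: "(\<lambda>x. norm ((\<lambda>(s, t). a s * c t) x)) summable_on UNIV \<times> UNIV"
    unfolding Infinite_Sum.abs_summable_on_Sigma_iff
  proof (intro conjI ballI)
    have sa: "a summable_on UNIV" and sc: "c summable_on UNIV"
      using regularD(4)[OF v] regularD(4)[OF w] by (simp_all add: summable_on_UNIV_nonneg_real_iff a0 c0)
    show "(\<lambda>t. norm (case (s, t) of (s, t) \<Rightarrow> a s * c t)) summable_on UNIV" for s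
      using summable_on_cmult_right[OF sc, of "a s"] by (simp add: abs_mult a0 c0)
    have "infsum (\<lambda>t. norm (case (s, t) of (s, t) \<Rightarrow> a s * c t)) UNIV = a s * infsum c UNIV" for s
      using infsum_cmult_right[of "a s" c UNIV] sc by (simp add: abs_mult a0 c0)
    thus "(\<lambda>s. norm (infsum (\<lambda>t. norm (case (s, t) of (s, t) \<Rightarrow> a s * c t)) UNIV)) summable_on UNIV"
      using summable_on_cmult_left[OF sa, of "infsum c UNIV"] by (simp add: abs_mult a0 infsum_nonneg c0)
  qed
  have qabs: "(\<lambda>x. norm (q x)) summable_on UNIV \<times> UNIV"
  proof (rule Infinite_Sum.abs_summable_on_comparison_test[OF ac])
    fix x :: "nat \<times> nat"
    obtain s t where x: "x = (s, t)" by (cases x)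
    have "\<bar>q x\<bar> \<le> L2_norm M (proj M G \<epsilon> 1 (obs v (1 + int s))) * L2_norm M (proj M G \<epsilon> 1 (obs w (1 + int t)))"
      unfolding q_def x prod.case by (rule L2_Cauchy_Schwarz[OF sq])
    also have "\<dots> \<le> a s * c t" by (intro mult_mono proj_obs_norm[OF v] proj_obs_norm[OF w] L2_norm_nonneg a0)
    finally show "norm (q x) \<le> norm (case x of (s, t) \<Rightarrow> a s * c t)" by (simp add: x abs_mult a0 c0)
  qed
  hence "q summable_on UNIV \<times> UNIV" by (rule iffD2[OF summable_on_iff_abs_summable_on_real])
  hence qs: "q summable_on UNIV" by simp
  \<comment> \<open>\<open>\<beta>\<close> parametrises the pairs \<open>(s, t)\<close> by their lag \<open>h = t - s\<close> and by \<open>k = min s t\<close>.\<close>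
  define \<beta> where "\<beta> = (\<lambda>(h::int, k::nat). (k + nat (- h), k + nat h))"
  have bij: "bij_betw \<beta> (UNIV \<times> UNIV) UNIV"
    by (rule bij_betw_byWitness[where f' = "\<lambda>(s, t). (int t - int s, min s t)"]) (auto simp: \<beta>_def min_def)
  have fs: "(\<lambda>x. q (\<beta> x)) summable_on UNIV \<times> UNIV"
    using qs summable_on_reindex_bij_betw[OF bij, of q] by simp
  hence fs': "(\<lambda>(h, k). q (\<beta> (h, k))) summable_on UNIV \<times> UNIV" by (simp add: case_prod_unfold)
  have inner_sum: "infsum (\<lambda>k. q (\<beta> (h, k))) UNIV = cov M (obs v 0) (obs w h)" for h
  proof -
    have "(\<lambda>k. q (\<beta> (h, k))) sums cov M (obs v 0) (obs w h)"
    proof -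
      have "q (\<beta> (h, k)) = ip (proj M G \<epsilon> (min 0 h - int k) (obs v 0)) (proj M G \<epsilon> (min 0 h - int k) (obs w h))" for k
        using proj_obs_shift[OF v w, of "min 0 h - int k" "1 - (min 0 h - int k)" 0 h]
        by (cases "h = 0") (simp_all add: q_def \<beta>_def min_def algebra_simps split: if_splits)
      thus ?thesis using cov_obs_sums[OF v w, of h] by simp
    qed
    moreover have "(\<lambda>k. q (\<beta> (h, k))) summable_on UNIV"
    proof -
      have "(\<lambda>x. norm (q (\<beta> x))) summable_on UNIV \<times> UNIV" using fs by (rule iffD1[OF summable_on_iff_abs_summable_on_real])
      hence "(\<lambda>k. norm (q (\<beta> (h, k)))) summable_on UNIV" unfolding Infinite_Sum.abs_summable_on_Sigma_iff by blast
      thus ?thesis by (rule iffD2[OF summable_on_iff_abs_summable_on_real])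
    qed
    ultimately show ?thesis using has_sum_imp_sums[OF has_sum_infsum] sums_unique2 by blast
  qed
  have "(\<Sum>\<^sub>\<infinity>h::int. cov M (obs v 0) (obs w h)) = infsum (\<lambda>h. infsum (\<lambda>k. q (\<beta> (h, k))) UNIV) UNIV"
    by (simp only: inner_sum)
  also have "\<dots> = infsum (\<lambda>(h, k). q (\<beta> (h, k))) (UNIV \<times> UNIV)" by (rule infsum_Sigma'_banach[OF fs'])
  also have "\<dots> = infsum q UNIV"
    using infsum_reindex_bij_betw[OF bij, of q] by (simp add: case_prod_unfold)
  finally have e: "(\<Sum>\<^sub>\<infinity>h::int. cov M (obs v 0) (obs w h)) = infsum q UNIV" .
  have "filterlim (\<lambda>n. {..<n} \<times> {..<n} :: (nat \<times> nat) set) (finite_subsets_at_top UNIV) sequentially"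
    unfolding filterlim_finite_subsets_at_top
  proof (intro allI impI)
    fix X :: "(nat \<times> nat) set" assume X: "finite X \<and> X \<subseteq> UNIV"
    show "\<forall>\<^sub>F n in sequentially. finite ({..<n} \<times> {..<n}) \<and> X \<subseteq> {..<n} \<times> {..<n} \<and> {..<n} \<times> {..<n} \<subseteq> UNIV"
    proof (rule eventually_sequentiallyI[of "Suc (\<Sum>x\<in>X. fst x + snd x)"])
      fix n assume n: "n \<ge> Suc (\<Sum>x\<in>X. fst x + snd x)"
      have "fst x + snd x \<le> (\<Sum>x\<in>X. fst x + snd x)" if "x \<in> X" for x
        using X that by (intro member_le_sum) auto
      hence "fst x < n \<and> snd x < n" if "x \<in> X" for x using n that by fastforce
      thus "finite ({..<n} \<times> {..<n}) \<and> X \<subseteq> {..<n} \<times> {..<n} \<and> {..<n} \<times> {..<n} \<subseteq> UNIV" by (auto simp: mem_Times_iff)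
    qed
  qed
  hence A: "(\<lambda>n. sum q ({..<n} \<times> {..<n})) \<longlonglongrightarrow> infsum q UNIV"
    using has_sum_infsum[OF qs] unfolding has_sum_def by (rule filterlim_compose[rotated])
  have "sum q ({..<n} \<times> {..<n}) = ip (mart v n) (mart w n)" for n
    unfolding mart_def[abs_def] q_def
    by (simp add: sum.cartesian_product[symmetric] L2_inner_sum_left L2_inner_sum_right sq square_integrable_sum)
  hence "(\<lambda>n. ip (mart v n) (mart w n)) \<longlonglongrightarrow> infsum q UNIV" using A by simp
  from LIMSEQ_unique[OF this L2_tendsto_inner[OF mart_lim[OF v] mart_lim[OF w]]] e show ?thesis by simp
qed

lemma mart_lim_norm_le:
  assumes v: "regular v a" shows "ip (mart_lim v) (mart_lim v) \<le> (suminf a)\<^sup>2"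
proof (rule LIMSEQ_le_const2[OF L2_tendsto_inner[OF mart_lim[OF v] mart_lim[OF v]]])
  have "ip (mart v n) (mart v n) \<le> (suminf a)\<^sup>2" for n
    unfolding L2_norm_power2[symmetric] by (rule power_mono[OF mart_norm_le[OF v] L2_norm_nonneg])
  thus "\<exists>N. \<forall>n\<ge>N. ip (mart v n) (mart v n) \<le> (suminf a)\<^sup>2" by blast
qed

lemma mart_norm_diff_functionals:
  assumes v: "regular v a" and w: "regular w c"
  shows "L2_norm M (\<lambda>\<omega>. mart v n \<omega> - mart w n \<omega>) \<le> (\<Sum>s<n. 2 * L2_norm M (\<lambda>\<omega>. obs v (1 + int s) \<omega> - obs w (1 + int s) \<omega>))"
proof -
  have "L2_norm M (\<lambda>\<omega>. mart v n \<omega> - mart w n \<omega>)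
    = L2_norm M (\<lambda>\<omega>. \<Sum>s<n. proj M G \<epsilon> 1 (obs v (1 + int s)) \<omega> - proj M G \<epsilon> 1 (obs w (1 + int s)) \<omega>)"
    by (simp add: mart_def sum_subtractf)
  also have "\<dots> \<le> (\<Sum>s<n. L2_norm M (\<lambda>\<omega>. proj M G \<epsilon> 1 (obs v (1 + int s)) \<omega> - proj M G \<epsilon> 1 (obs w (1 + int s)) \<omega>))"
    by (intro L2_norm_sum_le square_integrable_diff proj_square_integrable regularD(7)[OF v] regularD(7)[OF w]) simp
  also have "\<dots> \<le> (\<Sum>s<n. 2 * L2_norm M (\<lambda>\<omega>. obs v (1 + int s) \<omega> - obs w (1 + int s) \<omega>))"
    by (intro sum_mono proj_norm_diff_le regularD(7)[OF v] regularD(7)[OF w])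
  finally show ?thesis .
qed

end

section \<open>Exponential functionals of the distance\<close>

lemma fyr_bounds: "0 \<le> r \<Longrightarrow> 0 \<le> fyr y r x \<and> fyr y r x \<le> 1"
  by (simp add: fyr_def)

lemma exp_minus_diff_le:
  fixes a b :: real
  assumes "0 \<le> a" "0 \<le> b" shows "\<bar>exp (- a) - exp (- b)\<bar> \<le> \<bar>a - b\<bar>"
proof -
  have *: "exp (- a) - exp (- b) \<le> b - a" if "a \<le> b" "0 \<le> a" for a b :: real
  proof -
    have "1 - (b - a) \<le> exp (- (b - a))" using exp_ge_add_one_self[of "- (b - a)"] by linarith
    hence "exp (- a) * (1 - (b - a)) \<le> exp (- a) * exp (- (b - a))" by (intro mult_left_mono) auto
    also have "\<dots> = exp (- b)" by (simp add: exp_add[symmetric])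
    finally have "exp (- a) - exp (- b) \<le> exp (- a) * (b - a)" by (simp add: algebra_simps)
    also have "\<dots> \<le> 1 * (b - a)" using that by (intro mult_right_mono) auto
    finally show ?thesis by simp
  qed
  show ?thesis
  proof (cases "a \<le> b")
    case True
    thus ?thesis using *[OF True assms(1)] by simp
  next
    case False
    thus ?thesis using *[of b a] assms by simp
  qed
qed

text \<open>As \<open>f\<close> takes values in \<open>[0, 1]\<close>, the square of a difference is bounded by the difference itself,
  to which the Lipschitz bound \<open>r\<close> applies.\<close>

lemma fyr_Lipschitz_square:
  assumes "0 \<le> r"
  shows "(fyr y r x - fyr y r x')\<^sup>2 \<le> max 1 r * min (dist x x') 1"
proof -
  let ?d = "\<bar>fyr y r x - fyr y r x'\<bar>"
  have d1: "?d \<le> 1" using fyr_bounds[OF assms, of y x] fyr_bounds[OF assms, of y x'] by linarith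
  have "?d \<le> \<bar>r * dist x y - r * dist x' y\<bar>"
    unfolding fyr_def using exp_minus_diff_le[of "r * dist x y" "r * dist x' y"] assms by simp
  also have "\<dots> = r * \<bar>dist x y - dist x' y\<bar>" using assms by (simp add: abs_mult flip: right_diff_distrib)
  also have "\<dots> \<le> r * dist x x'" using abs_dist_diff_le[of x y x'] assms by (intro mult_left_mono) (auto simp: dist_commute)
  also have "\<dots> \<le> max 1 r * dist x x'" by (intro mult_right_mono) auto
  finally have d2: "?d \<le> max 1 r * dist x x'" .
  have "?d \<le> max 1 r * min (dist x x') 1"
    using d1 d2 by (auto simp: min_def)
  moreover have "(fyr y r x - fyr y r x')\<^sup>2 \<le> ?d"
    using mult_left_mono[OF d1, of ?d] by (simp add: power2_eq_square flip: abs_mult)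
  ultimately show ?thesis by linarith
qed

lemma fyr_diff_le:
  assumes "0 \<le> r" "r \<le> b" "0 \<le> r'" and B: "\<And>x y :: 's::metric_space. dist x y \<le> B"
  shows "\<bar>fyr y r x - fyr y' r' (x::'s)\<bar> \<le> b * dist y y' + B * \<bar>r - r'\<bar>"
proof -
  have "\<bar>fyr y r x - fyr y' r' x\<bar> \<le> \<bar>r * dist x y - r' * dist x y'\<bar>"
    unfolding fyr_def using exp_minus_diff_le[of "r * dist x y" "r' * dist x y'"] assms by simp
  also have "\<dots> = \<bar>r * (dist x y - dist x y') + (r - r') * dist x y'\<bar>" by (simp add: algebra_simps)
  also have "\<dots> \<le> \<bar>r * (dist x y - dist x y')\<bar> + \<bar>(r - r') * dist x y'\<bar>" by (rule abs_triangle_ineq)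
  also have "\<bar>r * (dist x y - dist x y')\<bar> \<le> b * dist y y'"
    using abs_dist_diff_le[of y x y'] assms by (simp add: abs_mult dist_commute mult_mono)
  also have "\<bar>(r - r') * dist x y'\<bar> \<le> B * \<bar>r - r'\<bar>"
    using B[of x y'] by (simp add: abs_mult mult.commute[of B] mult_left_mono)
  finally show ?thesis by simp
qed

lemma measurable_fyr: "fyr y r \<in> borel_measurable borel"
  unfolding fyr_def[abs_def] by (intro borel_measurable_continuous_onI continuous_intros)

text \<open>The distance is the supremum of \<open>\<bar>d(X, z) - d(X', z)\<bar>\<close> over a countable dense set of points \<open>z\<close>.\<close>

lemma measurable_dist_compact:
  fixes X X' :: "'a \<Rightarrow> 's::metric_space"
  assumes S: "compact (UNIV :: 's set)" and X: "X \<in> M \<rightarrow>\<^sub>M borel" and X': "X' \<in> M \<rightarrow>\<^sub>M borel"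
  shows "(\<lambda>\<omega>. dist (X \<omega>) (X' \<omega>)) \<in> borel_measurable M"
proof -
  obtain D :: "'s set" where D: "countable D" "UNIV \<subseteq> closure D" using compact_imp_countable_dense[OF S] by blast
  have ne: "D \<noteq> {}" using D(2) by auto
  have bd: "\<bar>dist x z - dist x' z\<bar> \<le> dist x x'" for x x' z :: 's
    using abs_dist_diff_le[of x z x'] by (simp add: dist_commute)
  have e: "dist x x' = (SUP z\<in>D. \<bar>dist x z - dist x' z\<bar>)" for x x' :: 's
  proof (rule antisym)
    show "(SUP z\<in>D. \<bar>dist x z - dist x' z\<bar>) \<le> dist x x'" by (rule cSUP_least[OF ne bd])
    show "dist x x' \<le> (SUP z\<in>D. \<bar>dist x z - dist x' z\<bar>)"
    proof (rule field_le_epsilon)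
      fix \<delta> :: real assume "\<delta> > 0"
      hence "\<delta> / 2 > 0" by simp
      then obtain z where z: "z \<in> D" "dist z x' < \<delta> / 2" using D(2) closure_approachable[of x' D] by blast
      have "dist x x' \<le> dist x z + dist x' z" by (rule dist_triangle2)
      hence "dist x x' \<le> \<bar>dist x z - dist x' z\<bar> + \<delta>" using z(2) by (simp add: dist_commute)
      also have "\<bar>dist x z - dist x' z\<bar> \<le> (SUP z\<in>D. \<bar>dist x z - dist x' z\<bar>)"
        using z(1) bd by (intro cSUP_upper bdd_aboveI2) auto
      finally show "dist x x' \<le> (SUP z\<in>D. \<bar>dist x z - dist x' z\<bar>) + \<delta>" by simp
    qed
  qed
  have "(\<lambda>\<omega>. SUP z\<in>D. \<bar>dist (X \<omega>) z - dist (X' \<omega>) z\<bar>) \<in> borel_measurable M"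
  proof (rule borel_measurable_cSUP[OF D(1)])
    fix z :: 's
    have m: "(\<lambda>x. dist x z) \<in> borel_measurable borel" by (intro borel_measurable_continuous_onI continuous_intros)
    show "(\<lambda>\<omega>. \<bar>dist (X \<omega>) z - dist (X' \<omega>) z\<bar>) \<in> borel_measurable M"
      by (intro borel_measurable_abs borel_measurable_diff measurable_compose[OF X m] measurable_compose[OF X' m])
  next
    show "bdd_above ((\<lambda>z. \<bar>dist (X \<omega>) z - dist (X' \<omega>) z\<bar>) ` D)" for \<omega> using bd by (intro bdd_aboveI2) auto
  qed
  moreover have "(\<lambda>\<omega>. dist (X \<omega>) (X' \<omega>)) = (\<lambda>\<omega>. SUP z\<in>D. \<bar>dist (X \<omega>) z - dist (X' \<omega>) z\<bar>)"
    by (rule ext) (rule e)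
  ultimately show ?thesis by presburger
qed

lemma (in prob_space) fyr_L2_dist:
  fixes X X' :: "'a \<Rightarrow> 's::metric_space"
  assumes S: "compact (UNIV :: 's set)" and X: "X \<in> M \<rightarrow>\<^sub>M borel" and X': "X' \<in> M \<rightarrow>\<^sub>M borel" and r: "0 \<le> r"
  shows "L2_norm M (\<lambda>\<omega>. fyr y r (X \<omega>) - fyr y r (X' \<omega>)) \<le> sqrt (max 1 r * (\<integral>\<omega>. min (dist (X \<omega>) (X' \<omega>)) 1 \<partial>M))"
proof -
  note md = measurable_dist_compact[OF S X X']
  have i: "integrable M (\<lambda>\<omega>. min (dist (X \<omega>) (X' \<omega>)) 1)"
    by (rule integrable_const_bound[where B = 1]) (use md in auto)
  have "(\<integral>\<omega>. (fyr y r (X \<omega>) - fyr y r (X' \<omega>))\<^sup>2 \<partial>M) \<le> (\<integral>\<omega>. max 1 r * min (dist (X \<omega>) (X' \<omega>)) 1 \<partial>M)"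
  proof (rule integral_mono)
    show "integrable M (\<lambda>\<omega>. (fyr y r (X \<omega>) - fyr y r (X' \<omega>))\<^sup>2)"
    proof (rule Bochner_Integration.integrable_bound)
      show "integrable M (\<lambda>\<omega>. max 1 r * min (dist (X \<omega>) (X' \<omega>)) 1)" using i by simp
      show "(\<lambda>\<omega>. (fyr y r (X \<omega>) - fyr y r (X' \<omega>))\<^sup>2) \<in> borel_measurable M"
        by (intro borel_measurable_power borel_measurable_diff measurable_compose[OF X measurable_fyr] measurable_compose[OF X' measurable_fyr])
      show "AE \<omega> in M. norm ((fyr y r (X \<omega>) - fyr y r (X' \<omega>))\<^sup>2) \<le> norm (max 1 r * min (dist (X \<omega>) (X' \<omega>)) 1)"
        using fyr_Lipschitz_square[OF r] by (intro AE_I2) (auto intro: order_trans[OF _ abs_ge_self])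
    qed
    show "integrable M (\<lambda>\<omega>. max 1 r * min (dist (X \<omega>) (X' \<omega>)) 1)" using i by simp
  qed (rule fyr_Lipschitz_square[OF r])
  thus ?thesis by (simp add: L2_norm_def)
qed

lemma Lp_norm_2: "Lp_norm M 2 V = L2_norm M V"
proof -
  have "\<bar>x\<bar> powr 2 = x\<^sup>2" for x :: real
    by (cases "x = 0") (simp_all add: powr_numeral)
  thus ?thesis by (simp add: Lp_norm_def L2_norm_def powr_half_sqrt)
qed

context driving_noise
begin

lemma coupling_error_fyr_tendsto_0:
  fixes F' :: "(nat \<Rightarrow> 'g) \<Rightarrow> 's::metric_space"
  assumes S: "compact (UNIV :: 's set)" and F': "F' \<in> pasts \<rightarrow>\<^sub>M borel" and r: "0 \<le> r"
    and X: "X \<in> M \<rightarrow>\<^sub>M borel" "AE \<omega> in M. X \<omega> = F' (past \<epsilon> t \<omega>)"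
    and \<delta>: "(\<lambda>m. \<integral>\<omega>. min (dist (X \<omega>) (F' (coupled_past \<epsilon> \<epsilon>' m t \<omega>))) 1 \<partial>M) \<longlonglongrightarrow> 0"
  shows "coupling_error (\<lambda>x. fyr y r (F' x)) t \<longlonglongrightarrow> 0"
proof -
  have mp: "(\<lambda>\<omega>. F' (past \<epsilon> t \<omega>)) \<in> M \<rightarrow>\<^sub>M borel" by (rule measurable_compose[OF measurable_past F'])
  have mc: "(\<lambda>\<omega>. F' (coupled_past \<epsilon> \<epsilon>' m t \<omega>)) \<in> M \<rightarrow>\<^sub>M borel" for m by (rule measurable_compose[OF measurable_coupled_past F'])
  have "coupling_error (\<lambda>x. fyr y r (F' x)) t m
      = L2_norm M (\<lambda>\<omega>. fyr y r (X \<omega>) - fyr y r (F' (coupled_past \<epsilon> \<epsilon>' m t \<omega>)))" for m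
    unfolding coupling_error_def obs_def
    by (rule L2_norm_cong_AE) (use X(2) in \<open>auto intro!: borel_measurable_diff measurable_compose[OF _ measurable_fyr] mp mc X(1)\<close>)
  hence "norm (coupling_error (\<lambda>x. fyr y r (F' x)) t m)
      \<le> sqrt (max 1 r * (\<integral>\<omega>. min (dist (X \<omega>) (F' (coupled_past \<epsilon> \<epsilon>' m t \<omega>))) 1 \<partial>M))" for m
    using fyr_L2_dist[OF S X(1) mc r, of y m] by simp
  moreover
  have "(\<lambda>m. sqrt (max 1 r * (\<integral>\<omega>. min (dist (X \<omega>) (F' (coupled_past \<epsilon> \<epsilon>' m t \<omega>))) 1 \<partial>M))) \<longlonglongrightarrow> sqrt (max 1 r * 0)"
    by (intro tendsto_intros \<delta>)
  hence "(\<lambda>m. sqrt (max 1 r * (\<integral>\<omega>. min (dist (X \<omega>) (F' (coupled_past \<epsilon> \<epsilon>' m t \<omega>))) 1 \<partial>M))) \<longlonglongrightarrow> 0"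
    by (simp only: mult_zero_right real_sqrt_zero)
  ultimately show ?thesis
    by (rule Lim_null_comparison[OF always_eventually[OF allI]])
qed

text \<open>For fixed lag, the projections of the coupled variables converge to those of the original
  variable as \<open>m \<rightarrow> \<infinity>\<close>, so that the latter inherit the bound.\<close>

lemma regular_fyr:
  fixes F' :: "(nat \<Rightarrow> 'g) \<Rightarrow> 's::metric_space"
  assumes F': "F' \<in> pasts \<rightarrow>\<^sub>M borel" and r: "0 \<le> r"
    and err: "\<And>t. coupling_error (\<lambda>x. fyr y r (F' x)) t \<longlonglongrightarrow> 0"
    and th: "(\<Sum>j. SUP t. theta M G \<epsilon> y r t (\<lambda>m \<omega>. F' (coupled_past \<epsilon> \<epsilon>' m t \<omega>)) j) < \<infinity>"
  shows "regular (\<lambda>x. fyr y r (F' x)) (\<lambda>j. enn2real (SUP t. theta M G \<epsilon> y r t (\<lambda>m \<omega>. F' (coupled_past \<epsilon> \<epsilon>' m t \<omega>)) j))"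
    and "(\<Sum>j. enn2real (SUP t. theta M G \<epsilon> y r t (\<lambda>m \<omega>. F' (coupled_past \<epsilon> \<epsilon>' m t \<omega>)) j))
      = enn2real (\<Sum>j. SUP t. theta M G \<epsilon> y r t (\<lambda>m \<omega>. F' (coupled_past \<epsilon> \<epsilon>' m t \<omega>)) j)"
proof -
  let ?v = "\<lambda>x. fyr y r (F' x)"
  define \<Theta> where "\<Theta> j = (SUP t. theta M G \<epsilon> y r t (\<lambda>m \<omega>. F' (coupled_past \<epsilon> \<epsilon>' m t \<omega>)) j)" for j
  have fin: "\<Theta> j < \<infinity>" for j
  proof -
    have "\<Theta> j = (\<Sum>i\<in>{j}. \<Theta> i)" by simp
    also have "\<dots> \<le> (\<Sum>j. \<Theta> j)" by (rule sum_le_suminf) auto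
    finally show ?thesis using th unfolding \<Theta>_def[symmetric] by (rule le_less_trans)
  qed
  have \<Theta>: "\<Theta> j = ennreal (enn2real (\<Theta> j))" for j using fin[of j] by simp
  have \<Theta>s: "(\<Sum>j. \<Theta> j) = (\<Sum>j. ennreal (enn2real (\<Theta> j)))" by (rule suminf_cong[OF \<Theta>])
  have mv: "?v \<in> borel_measurable pasts" by (rule measurable_compose[OF F' measurable_fyr])
  have bv: "\<bar>?v x\<bar> \<le> 1" for x using fyr_bounds[OF r, of y "F' x"] by simp
  have "(\<Sum>j. ennreal (enn2real (\<Theta> j))) \<noteq> top"
    using th unfolding \<Theta>_def[symmetric] \<Theta>s by simp
  hence sm: "summable (\<lambda>j. enn2real (\<Theta> j))" by (rule summable_suminf_not_top[rotated]) simp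
  have "L2_norm M (proj M G \<epsilon> (t - int j) (obs ?v t)) \<le> enn2real (\<Theta> j)" for t j
  proof (rule field_le_epsilon)
    fix e :: real assume "e > 0"
    hence e2: "e / 2 > 0" by simp
    from order_tendstoD(2)[OF err this, of t]
    obtain N where N: "\<And>m. m \<ge> N \<Longrightarrow> coupling_error ?v t m < e / 2" by (auto simp: eventually_sequentially)
    define m where "m = max N 1"
    define W where "W \<omega> = ?v (coupled_past \<epsilon> \<epsilon>' m t \<omega>)" for \<omega>
    have bW: "bounded_rv W"
      unfolding bounded_rv_def W_def using measurable_compose[OF measurable_coupled_past mv] bv by auto
    have bo: "bounded_rv (obs ?v t)" by (rule obs_bounded_rv[OF mv bv])
    have "ennreal (Lp_norm M 2 (proj M G \<epsilon> (t - int j) W)) \<le> theta M G \<epsilon> y r t (\<lambda>m \<omega>. F' (coupled_past \<epsilon> \<epsilon>' m t \<omega>)) j"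
      unfolding theta_def W_def by (rule SUP_upper) (simp add: m_def)
    also have "\<dots> \<le> \<Theta> j" unfolding \<Theta>_def by (rule SUP_upper) simp
    also have "\<dots> = ennreal (enn2real (\<Theta> j))" by (rule \<Theta>)
    finally have A: "L2_norm M (proj M G \<epsilon> (t - int j) W) \<le> enn2real (\<Theta> j)" by (simp add: Lp_norm_2)
    have "L2_norm M (proj M G \<epsilon> (t - int j) (obs ?v t))
      \<le> L2_norm M (\<lambda>\<omega>. proj M G \<epsilon> (t - int j) (obs ?v t) \<omega> - proj M G \<epsilon> (t - int j) W \<omega>) + L2_norm M (proj M G \<epsilon> (t - int j) W)"
      using L2_norm_triangle[OF square_integrable_diff[OF proj_square_integrable[OF bo, of "t - int j"] proj_square_integrable[OF bW, of "t - int j"]] proj_square_integrable[OF bW, of "t - int j"]]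
      by simp
    also have "L2_norm M (\<lambda>\<omega>. proj M G \<epsilon> (t - int j) (obs ?v t) \<omega> - proj M G \<epsilon> (t - int j) W \<omega>) \<le> 2 * coupling_error ?v t m"
      using proj_norm_diff_le[OF bo bW, of "t - int j"] by (simp add: coupling_error_def W_def)
    also have "2 * coupling_error ?v t m \<le> e" using N[of m] by (simp add: m_def)
    finally show "L2_norm M (proj M G \<epsilon> (t - int j) (obs ?v t)) \<le> enn2real (\<Theta> j) + e" using A by linarith
  qed
  thus "regular ?v (\<lambda>j. enn2real (SUP t. theta M G \<epsilon> y r t (\<lambda>m \<omega>. F' (coupled_past \<epsilon> \<epsilon>' m t \<omega>)) j))"
    unfolding regular_def \<Theta>_def[symmetric] using mv bv err sm by blast
  have "(\<Sum>j. enn2real (\<Theta> j)) = enn2real (\<Sum>j. ennreal (enn2real (\<Theta> j)))"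
  proof -
    have "(\<Sum>j. ennreal (enn2real (\<Theta> j))) = ennreal (\<Sum>j. enn2real (\<Theta> j))"
      by (rule suminf_ennreal2[OF _ sm]) simp
    thus ?thesis using suminf_nonneg[OF sm] by simp
  qed
  thus "(\<Sum>j. enn2real (SUP t. theta M G \<epsilon> y r t (\<lambda>m \<omega>. F' (coupled_past \<epsilon> \<epsilon>' m t \<omega>)) j))
      = enn2real (\<Sum>j. SUP t. theta M G \<epsilon> y r t (\<lambda>m \<omega>. F' (coupled_past \<epsilon> \<epsilon>' m t \<omega>)) j)"
    unfolding \<Theta>_def[symmetric] \<Theta>s .
qed

text \<open>This is the case \<open>r = 0\<close>, to which the projective bounds do not extend.\<close>

lemma regular_const: "regular (\<lambda>x. 1) (\<lambda>j. 0)"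
proof -
  have "L2_norm M (proj M G \<epsilon> k (obs (\<lambda>x. 1) t)) = 0" for k t
  proof -
    have c: "AE \<omega> in M. cexp k (obs (\<lambda>x. 1) t) \<omega> = 1" for k
    proof -
      interpret sigma_finite_subalgebra M "hist k" by (rule sfs_hist)
      have "AE \<omega> in M. cexp k (\<lambda>_. 1) \<omega> = 1" by (rule real_cond_exp_F_meas) auto
      thus ?thesis by (simp add: obs_def[abs_def])
    qed
    have "L2_norm M (proj M G \<epsilon> k (obs (\<lambda>x. 1) t)) = L2_norm M (\<lambda>_. 0)"
    proof (rule L2_norm_cong_AE)
      show "AE \<omega> in M. proj M G \<epsilon> k (obs (\<lambda>x. 1) t) \<omega> = 0"
        using c[of k] c[of "k - 1"] by eventually_elim (simp add: proj_def)
    qed (auto intro: proj_measurable)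
    thus ?thesis by (simp add: L2_norm_def)
  qed
  moreover have "coupling_error (\<lambda>x. 1) t = (\<lambda>m. 0)" for t
    by (simp add: fun_eq_iff coupling_error_def obs_def L2_norm_def)
  ultimately show ?thesis by (simp add: regular_def)
qed

end

section \<open>Diagonalisation of the long-run covariance\<close>

text \<open>The Lipschitz bound is restricted to \<open>t \<ge> 1\<close> because local stationarity concerns the sample times
  of the array only.\<close>

locale auxiliary_process = driving_noise M G \<epsilon> \<epsilon>'
  for M :: "'w measure" and G :: "'g measure" and \<epsilon> \<epsilon>' :: "int \<Rightarrow> 'w \<Rightarrow> 'g" +
  fixes Y :: "real \<Rightarrow> int \<Rightarrow> 'w \<Rightarrow> 's::metric_space" and F' :: "real \<Rightarrow> (nat \<Rightarrow> 'g) \<Rightarrow> 's" and b L :: real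
  assumes compact_S: "compact (UNIV :: 's set)" and b_pos: "b > 0"
    and Y_meas: "\<And>u t. u \<in> {0..1} \<Longrightarrow> Y u t \<in> M \<rightarrow>\<^sub>M borel"
    and F'_meas: "\<And>u. u \<in> {0..1} \<Longrightarrow> F' u \<in> pasts \<rightarrow>\<^sub>M borel"
    and Y_rep: "\<And>u t. u \<in> {0..1} \<Longrightarrow> AE \<omega> in M. Y u t \<omega> = F' u (past \<epsilon> t \<omega>)"
    and Y_Lipschitz: "\<And>u u' t. u \<in> {0..1} \<Longrightarrow> u' \<in> {0..1} \<Longrightarrow> t \<ge> 1 \<Longrightarrow>
       (\<integral>\<omega>. min (dist (Y u t \<omega>) (Y u' t \<omega>)) 1 \<partial>M) \<le> L * \<bar>u - u'\<bar>"
    and coupling: "\<And>u t. u \<in> {0..1} \<Longrightarrow>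
       (\<lambda>m. \<integral>\<omega>. min (dist (Y u t \<omega>) (F' u (coupled_past \<epsilon> \<epsilon>' m t \<omega>))) 1 \<partial>M) \<longlonglongrightarrow> 0"
    and theta_sum: "\<And>y r. r > 0 \<Longrightarrow>
      (SUP u\<in>{0..1}. \<Sum>j. SUP t. theta M G \<epsilon> y r t (\<lambda>m \<omega>. F' u (coupled_past \<epsilon> \<epsilon>' m t \<omega>)) j) < \<infinity>"
begin

definition fn :: "real \<Rightarrow> 's \<times> real \<Rightarrow> (nat \<Rightarrow> 'g) \<Rightarrow> real" where
  "fn u p x = fyr (fst p) (snd p) (F' u x)"

abbreviation "params \<equiv> (UNIV :: 's set) \<times> {0..b}"

definition bound :: "'s \<times> real \<Rightarrow> real" where
  "bound p = enn2real (SUP u\<in>{0..1}. \<Sum>j. SUP t. theta M G \<epsilon> (fst p) (snd p) t (\<lambda>m \<omega>. F' u (coupled_past \<epsilon> \<epsilon>' m t \<omega>)) j)"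

lemma regular_fn:
  assumes u: "u \<in> {0..1}" and p: "p \<in> params"
  shows "\<exists>a. regular (fn u p) a \<and> suminf a \<le> bound p"
proof (cases "snd p = 0")
  case True
  have "fn u p = (\<lambda>x. 1)" by (simp add: fn_def fun_eq_iff fyr_def True)
  thus ?thesis using regular_const by (intro exI[of _ "\<lambda>_. 0"]) (simp add: bound_def)
next
  case False
  define y r where "y = fst p" and "r = snd p"
  have r: "r > 0" using p False by (auto simp: r_def)
  let ?th = "\<lambda>j. SUP t. theta M G \<epsilon> y r t (\<lambda>m \<omega>. F' u (coupled_past \<epsilon> \<epsilon>' m t \<omega>)) j"
  have le: "(\<Sum>j. ?th j) \<le> (SUP u\<in>{0..1}. \<Sum>j. SUP t. theta M G \<epsilon> y r t (\<lambda>m \<omega>. F' u (coupled_past \<epsilon> \<epsilon>' m t \<omega>)) j)"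
    by (rule SUP_upper[OF u])
  have fin: "(\<Sum>j. ?th j) < \<infinity>" by (rule le_less_trans[OF le theta_sum[OF r]])
  have err: "coupling_error (\<lambda>x. fyr y r (F' u x)) t \<longlonglongrightarrow> 0" for t
    by (rule coupling_error_fyr_tendsto_0[OF compact_S F'_meas[OF u] _ Y_meas[OF u] Y_rep[OF u] coupling[OF u]]) (use r in simp)
  have r0: "0 \<le> r" using r by simp
  note reg = regular_fyr[OF F'_meas[OF u] r0 err fin]
  have "fn u p = (\<lambda>x. fyr y r (F' u x))" by (simp add: fn_def fun_eq_iff y_def r_def)
  moreover have "enn2real (\<Sum>j. ?th j) \<le> bound p"
    unfolding bound_def y_def[symmetric] r_def[symmetric]
    by (rule enn2real_mono[OF le]) (use theta_sum[OF r] in simp)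
  ultimately show ?thesis using reg by auto
qed

lemma fn_AE: "u \<in> {0..1} \<Longrightarrow> AE \<omega> in M. fyr y r (Y u t \<omega>) = obs (fn u (y, r)) t \<omega>"
  using Y_rep[of u t] by (auto simp: obs_def fn_def)

lemma long_run_cov_eq:
  assumes u: "u \<in> {0..1}" and p: "(y1, r1) \<in> params" "(y2, r2) \<in> params"
  shows "long_run_cov M Y u y1 r1 y2 r2 = ip (mart_lim (fn u (y1, r1))) (mart_lim (fn u (y2, r2)))"
proof -
  obtain a where a: "regular (fn u (y1, r1)) a" using regular_fn[OF u p(1)] by blast
  obtain c where c: "regular (fn u (y2, r2)) c" using regular_fn[OF u p(2)] by blast
  have m: "(\<lambda>\<omega>. fyr y r (Y u t \<omega>)) \<in> borel_measurable M" for y r t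
    by (rule measurable_compose[OF Y_meas[OF u] measurable_fyr])
  have "cov M (\<lambda>\<omega>. fyr y1 r1 (Y u 0 \<omega>)) (\<lambda>\<omega>. fyr y2 r2 (Y u h \<omega>)) = cov M (obs (fn u (y1, r1)) 0) (obs (fn u (y2, r2)) h)" for h
  proof -
    note A = fn_AE[OF u, of y1 r1 0] and C = fn_AE[OF u, of y2 r2 h]
    note mA = bounded_rv_measurable[OF regularD(7)[OF a]] and mC = bounded_rv_measurable[OF regularD(7)[OF c]]
    have EA: "(\<integral>\<omega>. fyr y1 r1 (Y u 0 \<omega>) \<partial>M) = (\<integral>\<omega>. obs (fn u (y1, r1)) 0 \<omega> \<partial>M)"
      by (rule integral_cong_AE[OF m mA A])
    have EC: "(\<integral>\<omega>. fyr y2 r2 (Y u h \<omega>) \<partial>M) = (\<integral>\<omega>. obs (fn u (y2, r2)) h \<omega> \<partial>M)"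
      by (rule integral_cong_AE[OF m mC C])
    show ?thesis unfolding cov_def EA EC
    proof (rule integral_cong_AE)
      show "AE \<omega> in M. (fyr y1 r1 (Y u 0 \<omega>) - (\<integral>\<omega>. obs (fn u (y1, r1)) 0 \<omega> \<partial>M)) * (fyr y2 r2 (Y u h \<omega>) - (\<integral>\<omega>. obs (fn u (y2, r2)) h \<omega> \<partial>M))
        = (obs (fn u (y1, r1)) 0 \<omega> - (\<integral>\<omega>. obs (fn u (y1, r1)) 0 \<omega> \<partial>M)) * (obs (fn u (y2, r2)) h \<omega> - (\<integral>\<omega>. obs (fn u (y2, r2)) h \<omega> \<partial>M))"
        using A C by eventually_elim simp
    qed (intro borel_measurable_times borel_measurable_diff borel_measurable_const m mA mC)+
  qed
  thus ?thesis unfolding long_run_cov_def by (simp only: long_run_cov_eq_inner[OF a c])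
qed

text \<open>The points of the kernel: the limits \<open>(p, None)\<close>, whose kernel is the long-run covariance, and
  the truncations \<open>(p, Some n)\<close>, which depend continuously on \<open>p\<close> and on the rescaled time.
  Countably many of the latter are dense. The former need not depend continuously on \<open>p\<close>,
  because the projective bounds are not uniform in \<open>p\<close>. The zero vector outside the parameter set
  makes the kernel total.\<close>

definition vec :: "real \<Rightarrow> ('s \<times> real) \<times> nat option \<Rightarrow> 'w \<Rightarrow> real" where
  "vec u x = (if fst x \<in> params then (case snd x of None \<Rightarrow> mart_lim (fn u (fst x)) | Some n \<Rightarrow> mart (fn u (fst x)) n) else (\<lambda>_. 0))"

text \<open>Replacing every limit by its \<open>k\<close>-th truncation makes all entries continuous in rescaled time.\<close>

definition vec_trunc :: "nat \<Rightarrow> real \<Rightarrow> ('s \<times> real) \<times> nat option \<Rightarrow> 'w \<Rightarrow> real" where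
  "vec_trunc k u x = (if fst x \<in> params then mart (fn u (fst x)) (case snd x of None \<Rightarrow> k | Some n \<Rightarrow> n) else (\<lambda>_. 0))"

lemma vec_trunc_tendsto:
  assumes u: "u \<in> {0..1}" shows "L2_tendsto M (\<lambda>k. vec_trunc k u x) (vec u x)"
proof (cases "fst x \<in> params")
  case True
  obtain a where a: "regular (fn u (fst x)) a" using regular_fn[OF u True] by blast
  show ?thesis
  proof (cases "snd x")
    case None
    thus ?thesis using mart_lim[OF a] True by (simp add: vec_def vec_trunc_def)
  next
    case (Some n)
    thus ?thesis using L2_tendsto_const[OF mart_square_integrable[OF a, of n]] True by (simp add: vec_def vec_trunc_def)
  qed
next
  case False
  have "L2_tendsto M (\<lambda>k \<omega>. 0) (\<lambda>\<omega>. 0)" by (rule L2_tendsto_const) simp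
  thus ?thesis using False by (simp only: vec_def vec_trunc_def if_False)
qed

definition kern :: "real \<Rightarrow> ('s \<times> real) \<times> nat option \<Rightarrow> ('s \<times> real) \<times> nat option \<Rightarrow> real" where
  "kern u x z = ip (vec u x) (vec u z)"

lemma vec_square_integrable: "u \<in> {0..1} \<Longrightarrow> square_integrable M (vec u x)"
  by (rule L2_tendstoD(2)[OF vec_trunc_tendsto])

lemma psd_kern: "u \<in> {0..1} \<Longrightarrow> psd_kernel (kern u)"
  unfolding kern_def[abs_def] by (intro psd_kernel_L2_inner vec_square_integrable)

text \<open>A truncation is a finite sum of projections, each of which at most doubles the norm, and in mean
  square the variables \<open>f\<^sub>p(X\<^sub>t(u))\<close> are Hoelder continuous in \<open>u\<close> with exponent \<open>1/2\<close>.\<close>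

lemma mart_fn_continuous:
  assumes p: "p \<in> params" and u: "\<And>i. w i \<in> {0..1}" "u \<in> {0..1}" and lim: "w \<longlonglongrightarrow> u"
  shows "L2_tendsto M (\<lambda>i. mart (fn (w i) p) n) (mart (fn u p) n)"
proof -
  obtain y r where yr: "p = (y, r)" by (cases p)
  have r: "0 \<le> r" using p by (simp add: yr)
  obtain a where a: "regular (fn u p) a" using regular_fn[OF u(2) p] by blast
  have "\<exists>c. regular (fn (w i) p) c" for i using regular_fn[OF u(1) p] by blast
  then obtain c where c: "\<And>i. regular (fn (w i) p) (c i)" by metis
  have bnd: "L2_norm M (\<lambda>\<omega>. obs (fn (w i) p) (1 + int s) \<omega> - obs (fn u p) (1 + int s) \<omega>) \<le> sqrt (max 1 r * (L * \<bar>w i - u\<bar>))" for i s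
  proof -
    have "L2_norm M (\<lambda>\<omega>. obs (fn (w i) p) (1 + int s) \<omega> - obs (fn u p) (1 + int s) \<omega>)
      = L2_norm M (\<lambda>\<omega>. fyr y r (Y (w i) (1 + int s) \<omega>) - fyr y r (Y u (1 + int s) \<omega>))"
    proof (rule L2_norm_cong_AE[symmetric])
      show "AE \<omega> in M. fyr y r (Y (w i) (1 + int s) \<omega>) - fyr y r (Y u (1 + int s) \<omega>)
          = obs (fn (w i) p) (1 + int s) \<omega> - obs (fn u p) (1 + int s) \<omega>"
        using fn_AE[OF u(1)[of i], of y r "1 + int s"] fn_AE[OF u(2), of y r "1 + int s"] unfolding yr by eventually_elim simp
    qed (intro borel_measurable_diff measurable_compose[OF Y_meas measurable_fyr] u bounded_rv_measurable regularD(7)[OF c] regularD(7)[OF a])+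
    also have "\<dots> \<le> sqrt (max 1 r * (\<integral>\<omega>. min (dist (Y (w i) (1 + int s) \<omega>) (Y u (1 + int s) \<omega>)) 1 \<partial>M))"
      by (rule fyr_L2_dist[OF compact_S Y_meas[OF u(1)] Y_meas[OF u(2)] r])
    also have "\<dots> \<le> sqrt (max 1 r * (L * \<bar>w i - u\<bar>))"
      by (intro real_sqrt_le_mono mult_left_mono Y_Lipschitz u) simp_all
    finally show ?thesis .
  qed
  have "norm (L2_norm M (\<lambda>\<omega>. mart (fn (w i) p) n \<omega> - mart (fn u p) n \<omega>)) \<le> (\<Sum>s<n. 2 * sqrt (max 1 r * (L * \<bar>w i - u\<bar>)))" for i
  proof -
    have "L2_norm M (\<lambda>\<omega>. mart (fn (w i) p) n \<omega> - mart (fn u p) n \<omega>)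
        \<le> (\<Sum>s<n. 2 * L2_norm M (\<lambda>\<omega>. obs (fn (w i) p) (1 + int s) \<omega> - obs (fn u p) (1 + int s) \<omega>))"
      by (rule mart_norm_diff_functionals[OF c a])
    also have "\<dots> \<le> (\<Sum>s<n. 2 * sqrt (max 1 r * (L * \<bar>w i - u\<bar>)))"
      by (intro sum_mono mult_left_mono bnd) simp
    finally show ?thesis by simp
  qed
  moreover have "(\<lambda>i. \<Sum>s<n. 2 * sqrt (max 1 r * (L * \<bar>w i - u\<bar>))) \<longlonglongrightarrow> (\<Sum>s<n. 2 * sqrt (max 1 r * (L * \<bar>u - u\<bar>)))"
    by (intro tendsto_intros lim)
  hence "(\<lambda>i. \<Sum>s<n. 2 * sqrt (max 1 r * (L * \<bar>w i - u\<bar>))) \<longlonglongrightarrow> 0" by simp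
  ultimately have "(\<lambda>i. L2_norm M (\<lambda>\<omega>. mart (fn (w i) p) n \<omega> - mart (fn u p) n \<omega>)) \<longlonglongrightarrow> 0"
    by (rule Lim_null_comparison[OF always_eventually[OF allI]])
  thus ?thesis unfolding L2_tendsto_def using mart_square_integrable[OF c] mart_square_integrable[OF a] by blast
qed

lemma measurable_kern: "(\<lambda>u. kern u x z) \<in> borel_measurable (restrict_space borel {0..1})"
proof (rule borel_measurable_LIMSEQ_real)
  fix u assume "u \<in> space (restrict_space borel {0..1::real})"
  hence u: "u \<in> {0..1}" by (simp add: space_restrict_space)
  show "(\<lambda>k. ip (vec_trunc k u x) (vec_trunc k u z)) \<longlonglongrightarrow> kern u x z"
    unfolding kern_def by (rule L2_tendsto_inner[OF vec_trunc_tendsto[OF u] vec_trunc_tendsto[OF u]])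
next
  fix k
  have cont: "L2_tendsto M (\<lambda>i. vec_trunc k (w i) x) (vec_trunc k u x)"
    if "\<And>i. w i \<in> {0..1}" "u \<in> {0..1}" "w \<longlonglongrightarrow> u" for w u x
  proof (cases "fst x \<in> params")
    case True
    thus ?thesis using mart_fn_continuous[OF True that] by (simp only: vec_trunc_def if_True)
  next
    case False
    have "L2_tendsto M (\<lambda>k \<omega>. 0) (\<lambda>\<omega>. 0)" by (rule L2_tendsto_const) simp
    thus ?thesis using False by (simp only: vec_trunc_def if_False)
  qed
  have "continuous_on {0..1} (\<lambda>u. ip (vec_trunc k u x) (vec_trunc k u z))"
    unfolding continuous_on_sequentially comp_def using L2_tendsto_inner[OF cont cont] by blast
  thus "(\<lambda>u. ip (vec_trunc k u x) (vec_trunc k u z)) \<in> borel_measurable (restrict_space borel {0..1})"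
    by (rule borel_measurable_continuous_on_restrict)
qed

text \<open>The limit at \<open>p\<close> is approximated by a truncation at \<open>p\<close>, and this one by the same truncation at a
  nearby point of a countable dense set. The order of truncation depends on \<open>u\<close> and \<open>p\<close>, but the
  sequence contains all orders at all points of the dense set.\<close>

lemma dense_truncations:
  "\<exists>xs :: nat \<Rightarrow> ('s \<times> real) \<times> nat option. \<forall>u\<in>{0..1}. \<forall>p\<in>params. \<forall>e>0.
    \<exists>n. kern u (p, None) (p, None) - 2 * kern u (p, None) (xs n) + kern u (xs n) (xs n) < e"
proof -
  have "compact params" by (rule compact_Times[OF compact_S compact_Icc])
  from compact_imp_countable_dense[OF this] obtain K where K: "K \<subseteq> params" "countable K" "params \<subseteq> closure K" by metis
  have "(undefined, 0) \<in> params" using b_pos by simp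
  hence Kne: "K \<noteq> {}" using K(3) by auto
  define xs where "xs i = (fst (from_nat_into (K \<times> (UNIV :: nat set)) i), Some (snd (from_nat_into (K \<times> (UNIV :: nat set)) i)))" for i
  have xs: "\<exists>i. xs i = (p, Some n)" if pK: "p \<in> K" for p n
  proof -
    have "countable (K \<times> (UNIV :: nat set))" using K(2) by simp
    from from_nat_into_surj[OF this] obtain i where "from_nat_into (K \<times> (UNIV :: nat set)) i = (p, n)" using pK by blast
    thus ?thesis by (intro exI[of _ i]) (simp add: xs_def)
  qed
  have "\<exists>B. \<forall>x\<in>(UNIV :: 's set). \<forall>y\<in>UNIV. dist x y \<le> B"
    using compact_imp_bounded[OF compact_S] by (rule bounded_two_points[THEN iffD1])
  then obtain B where "\<forall>x\<in>(UNIV :: 's set). \<forall>y\<in>UNIV. dist x y \<le> B" ..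
  hence B: "dist x y \<le> B" for x y :: 's by simp
  show ?thesis
  proof (intro exI[of _ xs] ballI allI impI)
    fix u e :: real and p assume u: "u \<in> {0..1}" and p: "p \<in> params" and e: "e > 0"
    define \<delta> where "\<delta> = sqrt e / 2"
    have \<delta>: "\<delta> > 0" using e by (simp add: \<delta>_def)
    obtain a where a: "regular (fn u p) a" using regular_fn[OF u p] by blast
    from order_tendstoD(2)[OF L2_tendstoD(3)[OF mart_lim[OF a]] \<delta>]
    obtain n where n: "L2_norm M (\<lambda>\<omega>. mart (fn u p) n \<omega> - mart_lim (fn u p) \<omega>) < \<delta>" by (auto simp: eventually_sequentially)
    have B0: "0 \<le> B" using B[of undefined undefined] by simp
    \<comment> \<open>The \<open>n\<close>-th truncation is Lipschitz continuous in \<open>p\<close> with constant \<open>2 n (b + B)\<close>.\<close>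
    define \<kappa> where "\<kappa> = \<delta> / (2 * real (Suc n) * (b + B + 1))"
    have den: "0 < 2 * real (Suc n) * (b + B + 1)" using b_pos B0 by (intro mult_pos_pos) simp_all
    have \<kappa>: "\<kappa> > 0" unfolding \<kappa>_def using \<delta> den by (rule divide_pos_pos)
    have "\<forall>e>0. \<exists>q\<in>K. dist q p < e" using subsetD[OF K(3) p] by (rule closure_approachable[THEN iffD1])
    then obtain p' where p': "p' \<in> K" "dist p' p < \<kappa>" using \<kappa> by metis
    have p'A: "p' \<in> params" using p'(1) K(1) by blast
    obtain c where c: "regular (fn u p') c" using regular_fn[OF u p'A] by blast
    have d: "dist (fst p) (fst p') \<le> \<kappa>" "\<bar>snd p - snd p'\<bar> \<le> \<kappa>"
      using dist_fst_le[of p p'] dist_snd_le[of p p'] p'(2) by (auto simp: dist_commute dist_real_def)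
    have od: "L2_norm M (\<lambda>\<omega>. obs (fn u p) t \<omega> - obs (fn u p') t \<omega>) \<le> (b + B) * \<kappa>" for t
    proof -
      have pt: "\<bar>obs (fn u p) t \<omega> - obs (fn u p') t \<omega>\<bar> \<le> (b + B) * \<kappa>" for \<omega>
      proof -
        have "\<bar>obs (fn u p) t \<omega> - obs (fn u p') t \<omega>\<bar> \<le> b * dist (fst p) (fst p') + B * \<bar>snd p - snd p'\<bar>"
          unfolding obs_def fn_def by (rule fyr_diff_le) (use p p'A B in auto)
        also have "\<dots> \<le> b * \<kappa> + B * \<kappa>" using d b_pos B0 by (intro add_mono mult_left_mono) auto
        finally show ?thesis by (simp add: distrib_right)
      qed
      have sq: "square_integrable M (\<lambda>\<omega>. obs (fn u p) t \<omega> - obs (fn u p') t \<omega>)"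
        by (intro square_integrable_diff bounded_rv_square_integrable regularD(7)[OF a] regularD(7)[OF c])
      have "(\<integral>\<omega>. (obs (fn u p) t \<omega> - obs (fn u p') t \<omega>)\<^sup>2 \<partial>M) \<le> (\<integral>\<omega>. ((b + B) * \<kappa>)\<^sup>2 \<partial>M)"
      proof (rule integral_mono)
        show "(obs (fn u p) t \<omega> - obs (fn u p') t \<omega>)\<^sup>2 \<le> ((b + B) * \<kappa>)\<^sup>2" for \<omega>
          using power_mono[OF pt[of \<omega>], of 2] by simp
      qed (use sq in \<open>simp_all add: square_integrable_def\<close>)
      also have "\<dots> = ((b + B) * \<kappa>)\<^sup>2" by (simp add: prob_space)
      finally have "L2_norm M (\<lambda>\<omega>. obs (fn u p) t \<omega> - obs (fn u p') t \<omega>) \<le> sqrt (((b + B) * \<kappa>)\<^sup>2)"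
        unfolding L2_norm_def by (rule real_sqrt_le_mono)
      thus ?thesis using b_pos B0 \<kappa> by simp
    qed
    have "L2_norm M (\<lambda>\<omega>. mart (fn u p) n \<omega> - mart (fn u p') n \<omega>) \<le> (\<Sum>s<n. 2 * L2_norm M (\<lambda>\<omega>. obs (fn u p) (1 + int s) \<omega> - obs (fn u p') (1 + int s) \<omega>))"
      by (rule mart_norm_diff_functionals[OF a c])
    also have "\<dots> \<le> (\<Sum>s<n. 2 * ((b + B) * \<kappa>))" by (intro sum_mono mult_left_mono od) simp
    also have "\<dots> = real n * (2 * ((b + B) * \<kappa>))" by simp
    also have "\<dots> \<le> real (Suc n) * (2 * ((b + B + 1) * \<kappa>))"
      using \<kappa> b_pos B0 by (intro mult_mono) auto
    also have "\<dots> = \<delta>" unfolding \<kappa>_def using den by (simp add: field_simps)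
    finally have D: "L2_norm M (\<lambda>\<omega>. mart (fn u p) n \<omega> - mart (fn u p') n \<omega>) \<le> \<delta>" .
    have "L2_norm M (\<lambda>\<omega>. mart_lim (fn u p) \<omega> - mart (fn u p') n \<omega>)
      \<le> L2_norm M (\<lambda>\<omega>. mart_lim (fn u p) \<omega> - mart (fn u p) n \<omega>) + L2_norm M (\<lambda>\<omega>. mart (fn u p) n \<omega> - mart (fn u p') n \<omega>)"
      by (intro L2_norm_triangle_diff mart_square_integrable[OF a] mart_square_integrable[OF c] L2_tendstoD(2)[OF mart_lim[OF a]])
    also have "\<dots> < sqrt e"
      using n D L2_norm_minus_commute[of M "mart_lim (fn u p)" "mart (fn u p) n"] by (simp add: \<delta>_def)
    finally have lt: "L2_norm M (\<lambda>\<omega>. vec u (p, None) \<omega> - vec u (p', Some n) \<omega>) < sqrt e"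
      using p p'A by (simp add: vec_def)
    obtain i where i: "xs i = (p', Some n)" using xs[OF p'(1)] by blast
    have "kern u (p, None) (p, None) - 2 * kern u (p, None) (xs i) + kern u (xs i) (xs i)
      = (L2_norm M (\<lambda>\<omega>. vec u (p, None) \<omega> - vec u (p', Some n) \<omega>))\<^sup>2"
      unfolding kern_def i by (rule L2_norm_diff_power2[symmetric]) (rule vec_square_integrable[OF u])+
    also have "\<dots> < (sqrt e)\<^sup>2" by (rule power_strict_mono[OF lt]) simp_all
    also have "\<dots> = e" using e by simp
    finally show "\<exists>n. kern u (p, None) (p, None) - 2 * kern u (p, None) (xs n) + kern u (xs n) (xs n) < e" by blast
  qed
qed

theorem long_run_cov_diagonalisation:
  "\<exists>(g :: nat \<Rightarrow> real \<Rightarrow> 's \<Rightarrow> real \<Rightarrow> real) C.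
     (\<forall>l y. \<forall>r\<in>{0..b}. (\<lambda>\<eta>. indicator {0..1} \<eta> * g l \<eta> y r) \<in> borel_measurable borel) \<and>
     (\<forall>\<eta>\<in>{0..1}. \<forall>y1 y2. \<forall>r1\<in>{0..b}. \<forall>r2\<in>{0..b}.
        (\<lambda>l. g l \<eta> y1 r1 * g l \<eta> y2 r2) sums long_run_cov M Y \<eta> y1 r1 y2 r2) \<and>
     (\<forall>\<eta>\<in>{0..1}. \<forall>y. \<forall>r\<in>{0..b}. long_run_cov M Y \<eta> y r y r \<le> C y r)"
proof -
  obtain xs :: "nat \<Rightarrow> ('s \<times> real) \<times> nat option" where "\<forall>u\<in>{0..1}. \<forall>p\<in>params. \<forall>e>0.
    \<exists>n. kern u (p, None) (p, None) - 2 * kern u (p, None) (xs n) + kern u (xs n) (xs n) < e"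
    using dense_truncations ..
  hence xs: "\<And>u p e. u \<in> {0..1} \<Longrightarrow> p \<in> params \<Longrightarrow> e > 0 \<Longrightarrow>
    \<exists>n. kern u (p, None) (p, None) - 2 * kern u (p, None) (xs n) + kern u (xs n) (xs n) < e" by blast
  have kern: "kern u (p, None) (q, None) = long_run_cov M Y u (fst p) (snd p) (fst q) (snd q)"
    if "u \<in> {0..1}" "p \<in> params" "q \<in> params" for u p q
    using long_run_cov_eq[OF that(1), of "fst p" "snd p" "fst q" "snd q"] that(2,3)
    by (simp add: kern_def vec_def)
  show ?thesis
  proof (intro exI[of _ "\<lambda>l \<eta> y r. kernel_coord (kern \<eta>) xs l ((y, r), None)"]
      exI[of _ "\<lambda>y r. (bound (y, r))\<^sup>2"] conjI allI ballI)
    fix l y and r :: real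
    have "(\<lambda>\<eta>. kernel_coord (kern \<eta>) xs l ((y, r), None)) \<in> borel_measurable (restrict_space borel {0..1})"
      by (rule measurable_kernel_coord[OF measurable_kern])
    thus "(\<lambda>\<eta>. indicator {0..1} \<eta> * kernel_coord (kern \<eta>) xs l ((y, r), None)) \<in> borel_measurable borel"
      by (subst (asm) borel_measurable_restrict_space_iff) simp_all
  next
    fix \<eta> y1 r1 y2 r2 assume \<eta>: "\<eta> \<in> {0..1::real}" and r: "r1 \<in> {0..b}" "r2 \<in> {0..b}"
    have p: "(y1, r1) \<in> params" "(y2, r2) \<in> params" using r by simp_all
    show "(\<lambda>l. kernel_coord (kern \<eta>) xs l ((y1, r1), None) * kernel_coord (kern \<eta>) xs l ((y2, r2), None)) sums long_run_cov M Y \<eta> y1 r1 y2 r2"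
      using kernel_expansion[OF psd_kern[OF \<eta>] xs[OF \<eta> p(1)] xs[OF \<eta> p(2)]] kern[OF \<eta> p] by simp
  next
    fix \<eta> y r assume \<eta>: "\<eta> \<in> {0..1::real}" and r: "r \<in> {0..b}"
    have p: "(y, r) \<in> params" using r by simp
    obtain a where a: "regular (fn \<eta> (y, r)) a" "suminf a \<le> bound (y, r)" using regular_fn[OF \<eta> p] by blast
    have "long_run_cov M Y \<eta> y r y r \<le> (suminf a)\<^sup>2"
      using mart_lim_norm_le[OF a(1)] long_run_cov_eq[OF \<eta> p p] by simp
    also have "\<dots> \<le> (bound (y, r))\<^sup>2"
      by (rule power_mono[OF a(2)]) (rule suminf_nonneg[OF regularD(4)[OF a(1)] regularD(6)[OF a(1)]])
    finally show "long_run_cov M Y \<eta> y r y r \<le> (bound (y, r))\<^sup>2" .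
  qed
qed

end

section \<open>Series representation of the limit process\<close>

lemma long_run_cov_stationary:
  assumes st: "under_stationarity M X Y" and ls: "locally_stationary M X Y" and \<eta>: "\<eta> \<in> {0..1}"
  shows "long_run_cov M Y \<eta> y1 r1 y2 r2 = long_run_cov M Y 0 y1 r1 y2 r2"
proof -
  obtain X0 where X0: "\<And>u t. u \<in> {0..1} \<Longrightarrow> AE \<omega> in M. Y u t \<omega> = X0 t \<omega>"
    using st unfolding under_stationarity_def by blast
  have mY: "Y u t \<in> M \<rightarrow>\<^sub>M borel" if "u \<in> {0..1}" for u t
    using ls that unfolding locally_stationary_def stationary_process_def by blast
  have m: "(\<lambda>\<omega>. fyr y r (Y u t \<omega>)) \<in> borel_measurable M" if "u \<in> {0..1}" for y r t u
    by (rule measurable_compose[OF mY[OF that] measurable_fyr])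
  have z: "(0::real) \<in> {0..1}" by simp
  have ae: "AE \<omega> in M. fyr y r (Y \<eta> t \<omega>) = fyr y r (Y 0 t \<omega>)" for y r t
    using X0[OF \<eta>, of t] X0[OF z, of t] by eventually_elim simp
  have E: "(\<integral>\<omega>. fyr y r (Y \<eta> t \<omega>) \<partial>M) = (\<integral>\<omega>. fyr y r (Y 0 t \<omega>) \<partial>M)" for y r t
    by (rule integral_cong_AE[OF m[OF \<eta>] m[OF z] ae])
  have "cov M (\<lambda>\<omega>. fyr y1 r1 (Y \<eta> 0 \<omega>)) (\<lambda>\<omega>. fyr y2 r2 (Y \<eta> h \<omega>)) = cov M (\<lambda>\<omega>. fyr y1 r1 (Y 0 0 \<omega>)) (\<lambda>\<omega>. fyr y2 r2 (Y 0 h \<omega>))" for h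
    unfolding cov_def E
  proof (rule integral_cong_AE)
    show "AE \<omega> in M. (fyr y1 r1 (Y \<eta> 0 \<omega>) - (\<integral>\<omega>. fyr y1 r1 (Y 0 0 \<omega>) \<partial>M)) * (fyr y2 r2 (Y \<eta> h \<omega>) - (\<integral>\<omega>. fyr y2 r2 (Y 0 h \<omega>) \<partial>M))
      = (fyr y1 r1 (Y 0 0 \<omega>) - (\<integral>\<omega>. fyr y1 r1 (Y 0 0 \<omega>) \<partial>M)) * (fyr y2 r2 (Y 0 h \<omega>) - (\<integral>\<omega>. fyr y2 r2 (Y 0 h \<omega>) \<partial>M))"
      using ae[of y1 r1 0] ae[of y2 r2 h] by eventually_elim simp
  qed (intro borel_measurable_times borel_measurable_diff borel_measurable_const m \<eta> z)+
  thus ?thesis by (simp add: long_run_cov_def)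
qed

text \<open>The coupling coefficient is a supremum over all times and rescaled times, bounded by \<open>1\<close>, so that it
  dominates the coupling error of each single variable.\<close>

lemma auxiliary_processI:
  fixes M :: "'w measure" and G :: "'g measure" and Y :: "real \<Rightarrow> int \<Rightarrow> 'w \<Rightarrow> 's::metric_space"
  assumes S: "compact (UNIV :: 's set)" and b: "b > 0" and M: "prob_space M"
    and ls: "locally_stationary M X Y" and iid: "iid_with_independent_copy M G \<epsilon> \<epsilon>'"
    and rep: "has_representations M G \<epsilon> X F Y F'"
    and \<delta>: "delta0_aux M \<epsilon> \<epsilon>' Y F' \<longlonglongrightarrow> 0"
    and th: "\<And>y r. r > 0 \<Longrightarrow>
      (SUP u\<in>{0..1}. \<Sum>j. SUP t. theta M G \<epsilon> y r t (\<lambda>m \<omega>. F' u (coupled_past \<epsilon> \<epsilon>' m t \<omega>)) j) < \<infinity>"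
  shows "\<exists>L. auxiliary_process M G \<epsilon> \<epsilon>' Y F' b L"
proof -
  interpret prob_space M by fact
  interpret driving_noise M G \<epsilon> \<epsilon>' by unfold_locales (rule iid)
  have mY: "Y u t \<in> M \<rightarrow>\<^sub>M borel" if "u \<in> {0..1}" for u t
    using ls that unfolding locally_stationary_def stationary_process_def by blast
  have mF: "F' u \<in> pasts \<rightarrow>\<^sub>M borel" if u: "u \<in> {0..1}" for u
  proof -
    have m: "(\<lambda>(u, x). F' u x) \<in> (restrict_space borel {0..1} \<Otimes>\<^sub>M pasts) \<rightarrow>\<^sub>M borel"
      using rep unfolding has_representations_def by blast
    have "Pair u \<in> pasts \<rightarrow>\<^sub>M restrict_space borel {0..1} \<Otimes>\<^sub>M pasts"
      by (rule measurable_Pair1') (use u in \<open>simp add: space_restrict_space\<close>)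
    from measurable_compose[OF this m] show ?thesis by simp
  qed
  have Yr: "AE \<omega> in M. Y u t \<omega> = F' u (past \<epsilon> t \<omega>)" if "u \<in> {0..1}" for u t
    using rep that unfolding has_representations_def by blast
  obtain L where L: "\<And>T t u v. T \<ge> 1 \<Longrightarrow> t \<in> {1..int T} \<Longrightarrow> u \<in> {0..1} \<Longrightarrow> v \<in> {0..1} \<Longrightarrow>
        (\<integral>\<omega>. min (dist (Y u t \<omega>) (Y v t \<omega>)) 1 \<partial>M) \<le> L * \<bar>u - v\<bar>"
    using ls unfolding locally_stationary_def by metis
  have coup: "(\<lambda>m. \<integral>\<omega>. min (dist (Y u t \<omega>) (F' u (coupled_past \<epsilon> \<epsilon>' m t \<omega>))) 1 \<partial>M) \<longlonglongrightarrow> 0" if u: "u \<in> {0..1}" for u t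
  proof -
    have le1: "(\<integral>\<omega>. min (dist (Y u t \<omega>) (F' u (coupled_past \<epsilon> \<epsilon>' m t \<omega>))) 1 \<partial>M) \<le> 1" if u: "u \<in> {0..1}" for u t m
    proof -
      have "(\<lambda>\<omega>. dist (Y u t \<omega>) (F' u (coupled_past \<epsilon> \<epsilon>' m t \<omega>))) \<in> borel_measurable M"
        by (rule measurable_dist_compact[OF S mY[OF u] measurable_compose[OF measurable_coupled_past mF[OF u]]])
      hence "integrable M (\<lambda>\<omega>. min (dist (Y u t \<omega>) (F' u (coupled_past \<epsilon> \<epsilon>' m t \<omega>))) 1)"
        by (intro integrable_const_bound[where B = 1]) auto
      hence "(\<integral>\<omega>. min (dist (Y u t \<omega>) (F' u (coupled_past \<epsilon> \<epsilon>' m t \<omega>))) 1 \<partial>M) \<le> (\<integral>\<omega>. 1 \<partial>M)"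
        by (intro integral_mono) auto
      thus ?thesis by (simp add: prob_space)
    qed
    have up: "(\<integral>\<omega>. min (dist (Y u t \<omega>) (F' u (coupled_past \<epsilon> \<epsilon>' m t \<omega>))) 1 \<partial>M) \<le> delta0_aux M \<epsilon> \<epsilon>' Y F' m" for m
    proof -
      have "(case (t, u) of (t, u) \<Rightarrow> \<integral>\<omega>. min (dist (Y u t \<omega>) (F' u (coupled_past \<epsilon> \<epsilon>' m t \<omega>))) 1 \<partial>M) \<le> delta0_aux M \<epsilon> \<epsilon>' Y F' m"
        unfolding delta0_aux_def
      proof (rule cSUP_upper)
        show "(t, u) \<in> UNIV \<times> {0..1}" using u by simp
        show "bdd_above ((\<lambda>(t, u). \<integral>\<omega>. min (dist (Y u t \<omega>) (F' u (coupled_past \<epsilon> \<epsilon>' m t \<omega>))) 1 \<partial>M) ` (UNIV \<times> {0..1}))"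
          by (rule bdd_aboveI2[where M = 1]) (use le1 in auto)
      qed
      thus ?thesis by simp
    qed
    have "norm (\<integral>\<omega>. min (dist (Y u t \<omega>) (F' u (coupled_past \<epsilon> \<epsilon>' m t \<omega>))) 1 \<partial>M) \<le> delta0_aux M \<epsilon> \<epsilon>' Y F' m" for m
    proof -
      have "0 \<le> (\<integral>\<omega>. min (dist (Y u t \<omega>) (F' u (coupled_past \<epsilon> \<epsilon>' m t \<omega>))) 1 \<partial>M)"
        by (rule Bochner_Integration.integral_nonneg) simp
      thus ?thesis using up[of m] by simp
    qed
    thus ?thesis by (rule Lim_null_comparison[OF always_eventually[OF allI] \<delta>])
  qed
  have "(\<integral>\<omega>. min (dist (Y u t \<omega>) (Y u' t \<omega>)) 1 \<partial>M) \<le> L * \<bar>u - u'\<bar>" if "u \<in> {0..1}" "u' \<in> {0..1}" "t \<ge> 1" for u u' t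
    using L[of "nat t" t u u'] that by simp
  note Lip = this
  have "auxiliary_process M G \<epsilon> \<epsilon>' Y F' b L"
    by unfold_locales (fact S b mY mF Yr coup th Lip)+
  thus ?thesis by blast
qed

theorem proposition3p11:
  fixes M :: "'w measure" and G :: "'g measure"
    and \<epsilon> \<epsilon>' :: "int \<Rightarrow> 'w \<Rightarrow> 'g"
    and X :: "int \<Rightarrow> nat \<Rightarrow> 'w \<Rightarrow> 's::metric_space"
    and Y :: "real \<Rightarrow> int \<Rightarrow> 'w \<Rightarrow> 's"
    and F :: "int \<Rightarrow> nat \<Rightarrow> (nat \<Rightarrow> 'g) \<Rightarrow> 's"
    and F' :: "real \<Rightarrow> (nat \<Rightarrow> 'g) \<Rightarrow> 's"
    and b :: real
    and N :: "'z measure"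
    and \<zeta> :: "real \<times> 's \<times> real \<Rightarrow> 'z \<Rightarrow> real"
  assumes "compact (UNIV :: 's set)"
    and "b > 0"
    and "prob_space M"
    and "locally_stationary M X Y"
    and "iid_with_independent_copy M G \<epsilon> \<epsilon>'"
    and "has_representations M G \<epsilon> X F Y F'"
    and "delta0_array M \<epsilon> \<epsilon>' X F \<longlonglongrightarrow> 0"
    and "delta0_aux M \<epsilon> \<epsilon>' Y F' \<longlonglongrightarrow> 0"
    and "\<And>y r. r > 0 \<Longrightarrow>
      (SUP T\<in>{1..}. \<Sum>j. SUP t\<in>{1..int T}.
         theta M G \<epsilon> y r t (\<lambda>m \<omega>. F t T (coupled_past \<epsilon> \<epsilon>' m t \<omega>)) j) < \<infinity>"
    and "\<And>y r. r > 0 \<Longrightarrow>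
      (SUP u\<in>{0..1}. \<Sum>j. SUP t.
         theta M G \<epsilon> y r t (\<lambda>m \<omega>. F' u (coupled_past \<epsilon> \<epsilon>' m t \<omega>)) j) < \<infinity>"
    and "(\<exists>\<alpha> p.
            (\<lambda>\<delta>. real (covering_number (index_set b :: (real \<times> 's \<times> real) set) index_dist \<delta>))
              \<in> \<Theta>[at_right 0](\<lambda>\<delta>. \<delta> powr (- \<alpha>)) \<and>
            p > \<alpha> \<and>
            (\<forall>T\<ge>1. \<forall>y. \<forall>r\<in>{0..b}.
               (\<Sum>j. of_nat j * (SUP t\<in>{1..int T}.
                  ennreal (Lp_norm M p (proj M G \<epsilon> (t - int j) (\<lambda>\<omega>. fyr y r (X t T \<omega>)))))) < \<infinity>)) \<or>
         (\<exists>\<alpha><2.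
            (\<lambda>\<delta>. real (covering_number (index_set b :: (real \<times> 's \<times> real) set) index_dist \<delta>))
              \<in> \<Theta>[at_right 0](\<lambda>\<delta>. exp (\<delta> powr (- \<alpha>))) \<and>
            (\<forall>T\<ge>1. \<forall>y. \<forall>r\<in>{0..b}.
               (\<Sum>j. of_nat j * (SUP t\<in>{1..int T}.
                  esssup M (cond_orlicz_norm M (history M G \<epsilon> (t - int j - 1)) (\<lambda>x. exp (x\<^sup>2) - 1)
                    (proj M G \<epsilon> (t - int j) (\<lambda>\<omega>. fyr y r (X t T \<omega>)))))) < \<infinity>))"
    and "prob_space N"
    and "limit_process M Y b N \<zeta>"
  shows "(\<exists>(P :: (nat \<Rightarrow> real) measure) B g Z.
            prob_space P \<and> independent_brownian_motions P B \<and>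
            (\<forall>\<eta>\<in>{0..1}. \<forall>y1 y2. \<forall>r1\<in>{0..b}. \<forall>r2\<in>{0..b}.
               (\<lambda>l. g l \<eta> y1 r1 * g l \<eta> y2 r2) sums long_run_cov M Y \<eta> y1 r1 y2 r2) \<and>
            series_of_wiener_integrals P b B g Z \<and>
            equal_in_law N P (index_set b) \<zeta> Z) \<and>
         (under_stationarity M X Y \<longrightarrow>
           (\<exists>(P :: (nat \<Rightarrow> real) measure) B g Z.
              prob_space P \<and> independent_brownian_motions P B \<and>
              (\<forall>\<eta>\<in>{0..1}. \<forall>y1 y2. \<forall>r1\<in>{0..b}. \<forall>r2\<in>{0..b}.
                 (\<lambda>l. g l y1 r1 * g l y2 r2) sums long_run_cov M Y \<eta> y1 r1 y2 r2) \<and>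
              series_of_wiener_integrals P b B (\<lambda>l \<eta>. g l) Z \<and>
              (\<forall>(u, y, r)\<in>index_set b.
                 sums_L2 P (\<lambda>l \<omega>. g l y r * B l u \<omega>) (Z (u, y, r))) \<and>
              equal_in_law N P (index_set b) \<zeta> Z))"
proof -
  obtain L where "auxiliary_process M G \<epsilon> \<epsilon>' Y F' b L"
    using auxiliary_processI[OF assms(1-6,8,10)] by blast
  then interpret auxiliary_process M G \<epsilon> \<epsilon>' Y F' b L .
  have gauss: "centred_gaussian_process N (index_set b) \<zeta>" and cont: "as_continuous N (index_set b) \<zeta>"
    and covN: "\<forall>(u1, y1, r1)\<in>index_set b. \<forall>(u2, y2, r2)\<in>index_set b.
        cov N (\<zeta> (u1, y1, r1)) (\<zeta> (u2, y2, r2)) = (LBINT \<eta>:{0..min u1 u2}. long_run_cov M Y \<eta> y1 r1 y2 r2)"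
    using assms(13) unfolding limit_process_def by blast+
  obtain g :: "nat \<Rightarrow> real \<Rightarrow> 's \<Rightarrow> real \<Rightarrow> real" and C where
    "\<forall>l y. \<forall>r\<in>{0..b}. (\<lambda>\<eta>. indicator {0..1} \<eta> * g l \<eta> y r) \<in> borel_measurable borel"
    and "\<forall>\<eta>\<in>{0..1}. \<forall>y1 y2. \<forall>r1\<in>{0..b}. \<forall>r2\<in>{0..b}.
       (\<lambda>l. g l \<eta> y1 r1 * g l \<eta> y2 r2) sums long_run_cov M Y \<eta> y1 r1 y2 r2"
    and "\<forall>\<eta>\<in>{0..1}. \<forall>y. \<forall>r\<in>{0..b}. long_run_cov M Y \<eta> y r y r \<le> C y r"
    using long_run_cov_diagonalisation by (elim exE conjE)
  hence meas: "\<And>l y r. r \<in> {0..b} \<Longrightarrow> (\<lambda>\<eta>. indicator {0..1} \<eta> * g l \<eta> y r) \<in> borel_measurable borel"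
    and sums: "\<And>\<eta> y1 r1 y2 r2. \<eta> \<in> {0..1} \<Longrightarrow> r1 \<in> {0..b} \<Longrightarrow> r2 \<in> {0..b} \<Longrightarrow>
       (\<lambda>l. g l \<eta> y1 r1 * g l \<eta> y2 r2) sums long_run_cov M Y \<eta> y1 r1 y2 r2"
    and bdd: "\<And>\<eta> y r. \<eta> \<in> {0..1} \<Longrightarrow> r \<in> {0..b} \<Longrightarrow> long_run_cov M Y \<eta> y r y r \<le> C y r"
    by blast+
  obtain Z where Z: "series_of_wiener_integrals white_noise b brownian g Z"
    "equal_in_law N white_noise (index_set b) \<zeta> Z"
    by (rule wiener_series_representation[OF assms(1) assms(12) gauss cont covN meas sums bdd])
  show ?thesis
  proof (intro conjI impI)
    show "\<exists>(P :: (nat \<Rightarrow> real) measure) B g Z.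
            prob_space P \<and> independent_brownian_motions P B \<and>
            (\<forall>\<eta>\<in>{0..1}. \<forall>y1 y2. \<forall>r1\<in>{0..b}. \<forall>r2\<in>{0..b}.
               (\<lambda>l. g l \<eta> y1 r1 * g l \<eta> y2 r2) sums long_run_cov M Y \<eta> y1 r1 y2 r2) \<and>
            series_of_wiener_integrals P b B g Z \<and>
            equal_in_law N P (index_set b) \<zeta> Z"
      using sums Z prob_space_white_noise independent_brownian_motions_brownian
      by (intro exI[of _ white_noise] exI[of _ brownian] exI[of _ g] exI[of _ Z]) blast
  next
    assume st: "under_stationarity M X Y"
    define h where "h l y r = g l 0 y r" for l y r
    have sums0: "(\<lambda>l. h l y1 r1 * h l y2 r2) sums long_run_cov M Y \<eta> y1 r1 y2 r2"
      if "\<eta> \<in> {0..1}" "r1 \<in> {0..b}" "r2 \<in> {0..b}" for \<eta> y1 r1 y2 r2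
      using sums[of 0 r1 r2 y1 y2] that long_run_cov_stationary[OF st assms(4) that(1)] by (simp add: h_def)
    have meas0: "(\<lambda>\<eta>. indicator {0..1::real} \<eta> * h l y r) \<in> borel_measurable borel" for l y r
      by (intro borel_measurable_times borel_measurable_indicator borel_measurable_const) simp
    obtain W where W: "series_of_wiener_integrals white_noise b brownian (\<lambda>l \<eta>. h l) W"
      "equal_in_law N white_noise (index_set b) \<zeta> W"
      "\<And>u y r I. (u, y, r) \<in> index_set b \<Longrightarrow>
       (\<And>l. has_wiener_integral white_noise (brownian l) u (\<lambda>\<eta>. h l y r) (I l)) \<Longrightarrow>
       sums_L2 white_noise I (W (u, y, r))"
      by (rule wiener_series_representation[where g = "\<lambda>l \<eta>. h l", OF assms(1) assms(12) gauss cont covN meas0 sums0 bdd]) (assumption | (rule that, assumption, assumption, blast))+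
    have "sums_L2 white_noise (\<lambda>l \<omega>. h l y r * brownian l u \<omega>) (W (u, y, r))" if e: "(u, y, r) \<in> index_set b" for u y r
      by (rule W(3)[OF e]) (rule wiener_integral_const, use e in \<open>simp add: index_set_def\<close>)
    hence W3: "\<forall>(u, y, r)\<in>index_set b. sums_L2 white_noise (\<lambda>l \<omega>. h l y r * brownian l u \<omega>) (W (u, y, r))" by auto
    show "\<exists>(P :: (nat \<Rightarrow> real) measure) B g Z.
              prob_space P \<and> independent_brownian_motions P B \<and>
              (\<forall>\<eta>\<in>{0..1}. \<forall>y1 y2. \<forall>r1\<in>{0..b}. \<forall>r2\<in>{0..b}.
                 (\<lambda>l. g l y1 r1 * g l y2 r2) sums long_run_cov M Y \<eta> y1 r1 y2 r2) \<and>
              series_of_wiener_integrals P b B (\<lambda>l \<eta>. g l) Z \<and>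
              (\<forall>(u, y, r)\<in>index_set b.
                 sums_L2 P (\<lambda>l \<omega>. g l y r * B l u \<omega>) (Z (u, y, r))) \<and>
              equal_in_law N P (index_set b) \<zeta> Z"
      using sums0 W(1,2) W3 prob_space_white_noise independent_brownian_motions_brownian
      by (intro exI[of _ white_noise] exI[of _ brownian] exI[of _ h] exI[of _ W] conjI) blast+
  qed
qed

end
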